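(* Let $M=(M_t)_{t\ge 0}$ be any continuous real-valued stochastic process such that $M_0=0$. If there exists a sequence $(a_n)_{n\ge 1}$ of positive real numbers converging to $0$ such that, for every $n \ge 1$, the law of $M$ is invariant by the reflections $\varrho_{T_0}=\varrho_0$ and $\varrho_{T_{a_n}}$ (at times $T_0=0$ and $T_{a_n}$), then $M$ is an Ocone local martingale. Moreover, if $T_{a_1}\circ M$ is almost surely finite, then $M$ is almost surely divergent.
   Context: Let $\mathbb W$ be the set of all continuous functions $w:\mathbb R_+\to\mathbb R$ with $w(0)=0$, with the $\sigma$-field generated by the canonical projections $w\mapsto w(t)$, $t\ge 0$. The law of $M$ is its law as a random variable with values in $\mathbb W$. For $a\in\mathbb R$ and $w\in\mathbb W$, $T_a(w)=\inf\{t\ge 0: w(t)=a\}\in[0,+\infty]$ is the first-passage time of $w$ at level $a$ (with $\inf\emptyset=+\infty$); in particular $T_0=0$. The reflection $\varrho_{T_a}:\mathbb W\to\mathbb W$ is defined by $\varrho_{T_a}(w)(t)=w(t)$ if $t\le T_a(w)$ and $\varrho_{T_a}(w)(t)=2a-w(t)$ if $t\ge T_a(w)$ (so $\varrho_{T_a}(w)=w$ if $T_a(w)=+\infty$); in particular $\varrho_0(w)=-w$. The law of $M$ is invariant by $\varrho_{T_a}$ if $\varrho_{T_a}\circ M$ has the same law as $M$. An Ocone local martingale is a continuous local martingale $M$ with $M_0=0$ (with respect to its natural filtration) which, conditionally on its quadratic variation $\langle M\rangle$, is a Gaussian martingale. Equivalently (Dubins, Émery and Yor), there exists a Brownian motion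 $\beta$, possibly defined on a larger probability space, which is independent of $\langle M\rangle$ and such that $M_t=\beta_{\langle M\rangle_t}$ for every $t$. "$M$ is almost surely divergent" means that almost surely $M_t$ does not converge to a finite limit as $t\to+\infty$. *)

theory Defs
  imports "HOL-Probability.Probability"
begin

section \<open>The path space\<close>

text \<open>
  Paths are indexed by the half-line \<open>{0..}\<close>; following the convention of \<^term>\<open>Pi\<^sub>M\<close> they are
  functions on the reals that are undefined outside \<open>{0..}\<close>. The trace on the set of continuous
  paths of the product \<open>\<sigma>\<close>-algebra is the one generated by the canonical projections.
\<close>

definition path_space :: "(real \<Rightarrow> real) measure" where
  "path_space =
     restrict_space (Pi\<^sub>M {0..} (\<lambda>_. borel)) {w. continuous_on {0..} w \<and> w 0 = 0}"

definition trajectory :: "(real \<Rightarrow> 'w \<Rightarrow> real) \<Rightarrow> 'w \<Rightarrow> real \<Rightarrow> real" where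
  "trajectory X \<omega> = (\<lambda>t\<in>{0..}. X t \<omega>)"

definition continuous_process :: "'w measure \<Rightarrow> (real \<Rightarrow> 'w \<Rightarrow> real) \<Rightarrow> bool" where
  "continuous_process P X \<longleftrightarrow>
     (\<forall>t\<ge>0. X t \<in> borel_measurable P) \<and>
     (\<forall>\<omega>\<in>space P. continuous_on {0..} (\<lambda>t. X t \<omega>))"

definition process_law :: "'w measure \<Rightarrow> (real \<Rightarrow> 'w \<Rightarrow> real) \<Rightarrow> (real \<Rightarrow> real) measure" where
  "process_law P X = distr P path_space (trajectory X)"

definition first_passage :: "real \<Rightarrow> (real \<Rightarrow> real) \<Rightarrow> ennreal" where
  "first_passage a w = (INF t\<in>{t. 0 \<le> t \<and> w t = a}. ennreal t)"

definition reflection :: "real \<Rightarrow> (real \<Rightarrow> real) \<Rightarrow> real \<Rightarrow> real" where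
  "reflection a w =
     (\<lambda>t\<in>{0..}. if ennreal t \<le> first_passage a w then w t else 2 * a - w t)"

definition law_invariant :: "'w measure \<Rightarrow> (real \<Rightarrow> 'w \<Rightarrow> real) \<Rightarrow>
    ((real \<Rightarrow> real) \<Rightarrow> real \<Rightarrow> real) \<Rightarrow> bool" where
  "law_invariant P X \<rho> \<longleftrightarrow>
     distr P path_space (\<lambda>\<omega>. \<rho> (trajectory X \<omega>)) = process_law P X"


section \<open>Local martingales and quadratic variation\<close>

definition natural_filtration ::
    "'w measure \<Rightarrow> (real \<Rightarrow> 'w \<Rightarrow> real) \<Rightarrow> real \<Rightarrow> 'w measure" where
  "natural_filtration P X t =
     vimage_algebra (space P) (\<lambda>\<omega>. \<lambda>s\<in>{0..t}. X s \<omega>) (Pi\<^sub>M {0..t} (\<lambda>_. borel))"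

definition augmented ::
    "'w measure \<Rightarrow> (real \<Rightarrow> 'w measure) \<Rightarrow> real \<Rightarrow> 'w measure" where
  "augmented P F t = sigma (space P) (sets (F t) \<union> null_sets P)"

definition adapted :: "(real \<Rightarrow> 'w measure) \<Rightarrow> (real \<Rightarrow> 'w \<Rightarrow> real) \<Rightarrow> bool" where
  "adapted F X \<longleftrightarrow> (\<forall>t\<ge>0. X t \<in> borel_measurable (F t))"

definition martingale ::
    "'w measure \<Rightarrow> (real \<Rightarrow> 'w measure) \<Rightarrow> (real \<Rightarrow> 'w \<Rightarrow> real) \<Rightarrow> bool" where
  "martingale P F X \<longleftrightarrow>
     filtration (space P) F \<and> (\<forall>t\<ge>0. subalgebra P (F t)) \<and>
     adapted F X \<and> (\<forall>t\<ge>0. integrable P (X t)) \<and>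
     (\<forall>s t. 0 \<le> s \<and> s \<le> t \<longrightarrow> (AE \<omega> in P. real_cond_exp P (F s) (X t) \<omega> = X s \<omega>))"

text \<open>
  Stopping times have values in \<open>[0, \<infinity>]\<close>, so the filtration is reindexed by \<^typ>\<open>ennreal\<close>.
  That \<open>enn2real \<top> = 0\<close> is harmless here, because the event \<open>\<tau> \<le> \<top>\<close> is the whole space.
\<close>

definition extended_stopping_time ::
    "(real \<Rightarrow> 'w measure) \<Rightarrow> ('w \<Rightarrow> ennreal) \<Rightarrow> bool" where
  "extended_stopping_time F \<tau> \<longleftrightarrow> stopping_time (\<lambda>t. F (enn2real t)) \<tau>"

definition stopped ::
    "(real \<Rightarrow> 'w \<Rightarrow> real) \<Rightarrow> ('w \<Rightarrow> ennreal) \<Rightarrow> real \<Rightarrow> 'w \<Rightarrow> real" where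
  "stopped X \<tau> t \<omega> = X (enn2real (min (ennreal t) (\<tau> \<omega>))) \<omega>"

definition local_martingale ::
    "'w measure \<Rightarrow> (real \<Rightarrow> 'w measure) \<Rightarrow> (real \<Rightarrow> 'w \<Rightarrow> real) \<Rightarrow> bool" where
  "local_martingale P F X \<longleftrightarrow>
     adapted F X \<and>
     (\<exists>\<tau> :: nat \<Rightarrow> 'w \<Rightarrow> ennreal.
        (\<forall>n. extended_stopping_time F (\<tau> n)) \<and>
        (AE \<omega> in P. incseq (\<lambda>n. \<tau> n \<omega>) \<and> (\<lambda>n. \<tau> n \<omega>) \<longlonglongrightarrow> \<top>) \<and>
        (\<forall>n. martingale P F (\<lambda>t \<omega>. stopped X (\<tau> n) t \<omega> - X 0 \<omega>)))"

text \<open>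
  The null sets are added to the filtration so that a version with all paths continuous and
  nondecreasing can be adapted; \<open>A\<close> is then unique up to indistinguishability.
\<close>

definition quadratic_variation ::
    "'w measure \<Rightarrow> (real \<Rightarrow> 'w \<Rightarrow> real) \<Rightarrow> (real \<Rightarrow> 'w \<Rightarrow> real) \<Rightarrow> bool" where
  "quadratic_variation P M A \<longleftrightarrow>
     continuous_process P A \<and>
     (\<forall>\<omega>\<in>space P. A 0 \<omega> = 0 \<and> mono_on {0..} (\<lambda>t. A t \<omega>)) \<and>
     adapted (augmented P (natural_filtration P M)) A \<and>
     local_martingale P (augmented P (natural_filtration P M)) (\<lambda>t \<omega>. (M t \<omega>)\<^sup>2 - A t \<omega>)"


section \<open>Ocone local martingales\<close>

text \<open>Constants count as (degenerate) Gaussian variables.\<close>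

definition gaussian_variable :: "'w measure \<Rightarrow> ('w \<Rightarrow> real) \<Rightarrow> bool" where
  "gaussian_variable N Y \<longleftrightarrow>
     Y \<in> borel_measurable N \<and>
     ((\<exists>m. AE \<omega> in N. Y \<omega> = m) \<or>
      (\<exists>m \<sigma>. 0 < \<sigma> \<and> distributed N lborel Y (normal_density m \<sigma>)))"

definition gaussian_process :: "'w measure \<Rightarrow> (real \<Rightarrow> 'w \<Rightarrow> real) \<Rightarrow> bool" where
  "gaussian_process N X \<longleftrightarrow>
     (\<forall>S c. finite S \<and> S \<subseteq> {0..} \<longrightarrow> gaussian_variable N (\<lambda>\<omega>. \<Sum>t\<in>S. c t * X t \<omega>))"

definition gaussian_martingale :: "'w measure \<Rightarrow> (real \<Rightarrow> 'w \<Rightarrow> real) \<Rightarrow> bool" where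
  "gaussian_martingale N X \<longleftrightarrow>
     gaussian_process N X \<and> martingale N (natural_filtration N X) X"

text \<open>\<open>K\<close> is a regular conditional law of the process \<open>X\<close> given (the \<open>\<sigma>\<close>-algebra generated by)
  the process \<open>A\<close>.\<close>

definition regular_conditional_law ::
    "'w measure \<Rightarrow> (real \<Rightarrow> 'w \<Rightarrow> real) \<Rightarrow> (real \<Rightarrow> 'w \<Rightarrow> real) \<Rightarrow>
     ('w \<Rightarrow> (real \<Rightarrow> real) measure) \<Rightarrow> bool" where
  "regular_conditional_law P X A K \<longleftrightarrow>
     (let G = vimage_algebra (space P) (trajectory A) path_space in
        K \<in> G \<rightarrow>\<^sub>M prob_algebra path_space \<and>
        (\<forall>B\<in>sets path_space. \<forall>C\<in>sets G.
           emeasure P {\<omega>\<in>C. trajectory X \<omega> \<in> B} = (\<integral>\<^sup>+\<omega>\<in>C. emeasure (K \<omega>) B \<partial>P)))"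

text \<open>
  Since the quadratic variation is unique up to indistinguishability, it does not matter which
  version \<open>A\<close> is conditioned upon. The canonical process on \<^const>\<open>path_space\<close> is
  \<open>\<lambda>t w. w t\<close>.
\<close>

definition ocone_local_martingale :: "'w measure \<Rightarrow> (real \<Rightarrow> 'w \<Rightarrow> real) \<Rightarrow> bool" where
  "ocone_local_martingale P M \<longleftrightarrow>
     continuous_process P M \<and>
     (\<forall>\<omega>\<in>space P. M 0 \<omega> = 0) \<and>
     local_martingale P (natural_filtration P M) M \<and>
     (\<exists>A K. quadratic_variation P M A \<and>
            regular_conditional_law P M A K \<and>
            (AE \<omega> in P. gaussian_martingale (K \<omega>) (\<lambda>t w. w t)))"

end

theory Submission
  imports Defs
begin

text \<open>
  Call a nonanticipating time \<open>T\<close> good if reflection at \<open>T\<close> preserves the law of the path. Given two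
  levels \<open>l < r\<close> whose hitting times, on both sides, are good, wait until the path leaves \<open>(-l, l)\<close>:
  from there the distances \<open>2 l\<close> and \<open>r - l\<close> are good again. Iterating gives a random grid of good
  times whose space mesh is at most \<open>l + r\<close>; it can be continued forever unless the two distances
  meet, which fails for some pair of levels taken from any three. As the levels tend to \<open>0\<close> these grids
  approximate every nonanticipating time, so every such time is good.

  Let \<open>R n k\<close> be the successive times at which the path has moved by \<open>2\<^sup>-\<^sup>n\<close>. Reflecting at a point of
  this grid flips the later increments but does not move the grid. Hence, given the grids, the
  increments are independent fair signs; the number of grid points up to time \<open>t\<close>, times \<open>4\<^sup>-\<^sup>n\<close>,
  converges to a quadratic variation that no reflection at a grid point changes; and in the limit of the
  products of cosines the path is, given its quadratic variation, a centered Gaussian process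
  with independent increments. The same flips give optional stopping and the martingale property of the
  square minus the quadratic variation. A convergent path visits only finitely many points of
  a grid. Flipping increments compares, up to a factor, the event that the grid ends at a given point with the
  event that it does so after an oscillation near \<open>0\<close>, which almost sure first passage excludes.
\<close>

section \<open>Paths, nonanticipating times and reflections\<close>

text \<open>No moment of the process is assumed. Every estimate is therefore made for transforms
  with bounded coefficients, and first and second moments are recovered afterwards by
  differentiating characteristic functions at \<open>0\<close>. The obstacle in producing good times
  is arithmetical. Up to sign, the smaller of the two distances is doubled modulo their constant
  sum, so the construction breaks down exactly when the ratio of one level to the sum of both is a
  dyadic rational. A computation modulo \<open>4\<close> shows that this cannot happen for all three
  pairs among three distinct levels. The powers of \<open>2\<close> in the dyadic grids make every
  coarse point a point of all finer grids. A reflection at a point of level \<open>n\<close> thus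
  fixes all grids of level at least \<open>n\<close>, and a limit along the levels is fixed by all
  these reflections. This is why the quadratic variation is built as a limit of counts. Reflecting
  at two consecutive points flips a single increment. The one identity \<open>char_identity\<close>
  drawn from this yields the conditional Gaussian law, the conditional martingale property and the
  moments behind the square minus the quadratic variation.\<close>

abbreviation W :: "(real \<Rightarrow> real) set" where "W \<equiv> space path_space"

lemma mem_W: "w \<in> W \<longleftrightarrow> continuous_on {0..} w \<and> w 0 = 0 \<and> w \<in> extensional {0..}"
  by (auto simp: path_space_def space_restrict_space space_PiM PiE_def)

lemma W_cont: "w \<in> W \<Longrightarrow> continuous_on {0..} w"
  and W_zero: "w \<in> W \<Longrightarrow> w 0 = 0"
  by (auto simp: mem_W)

lemma W_eqI: "w \<in> W \<Longrightarrow> w' \<in> W \<Longrightarrow> (\<And>t. 0 \<le> t \<Longrightarrow> w t = w' t) \<Longrightarrow> w = w'"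
  by (auto simp: mem_W intro!: extensionalityI)

lemma eval_measurable [measurable]: "(\<lambda>w. w t) \<in> borel_measurable path_space"
proof (cases "0 \<le> t")
  case True
  then show ?thesis
    unfolding path_space_def by (intro measurable_restrict_space1 measurable_component_singleton) auto
next
  case False
  \<comment> \<open>Paths are extensional, so at a negative time all of them take the value
    \<open>undefined\<close>.\<close>
  have "(\<lambda>w::real\<Rightarrow>real. undefined::real) \<in> borel_measurable path_space" by simp
  moreover have "(\<lambda>w. undefined::real) \<in> borel_measurable path_space \<longleftrightarrow> (\<lambda>w. w t) \<in> borel_measurable path_space"
    by (rule measurable_cong) (use False in \<open>auto simp: mem_W extensional_def\<close>)
  ultimately show ?thesis by blast
qed

lemma measurable_path_spaceI:
  assumes "\<And>x. x \<in> space N \<Longrightarrow> f x \<in> W"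
    and "\<And>t. 0 \<le> t \<Longrightarrow> (\<lambda>x. f x t) \<in> borel_measurable N"
  shows "f \<in> N \<rightarrow>\<^sub>M path_space"
  unfolding path_space_def
proof (rule measurable_restrict_space2)
  show "f \<in> space N \<rightarrow> {w. continuous_on {0..} w \<and> w 0 = 0}"
    using assms(1) by (auto simp: mem_W)
  show "f \<in> N \<rightarrow>\<^sub>M Pi\<^sub>M {0..} (\<lambda>_. borel)"
    using assms by (intro measurable_PiM_single') (auto simp: mem_W PiE_def)
qed

lemma eval_measurable_compose:
  assumes f [measurable]: "f \<in> N \<rightarrow>\<^sub>M path_space"
  shows "(\<lambda>x. f x t) \<in> borel_measurable N"
  using measurable_compose[OF f eval_measurable] .

section \<open>Evaluation at random times\<close>

text \<open>Turns evaluation of a continuous path at a real time into a limit of evaluations at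
  countably many times. Rounding up keeps the approximations of a nonnegative time on the half-line
  and never before that time.\<close>

lemma tendsto_rational_approx:
  fixes x :: real
  shows "(\<lambda>n. real_of_int \<lceil>real (Suc n) * x\<rceil> / real (Suc n)) \<longlonglongrightarrow> x"
proof (rule tendsto_sandwich)
  show "\<forall>\<^sub>F n in sequentially. x \<le> real_of_int \<lceil>real (Suc n) * x\<rceil> / real (Suc n)"
    by (intro always_eventually allI) (simp only: pos_le_divide_eq of_nat_0_less_iff zero_less_Suc mult.commute[of x] le_of_int_ceiling)
  show "\<forall>\<^sub>F n in sequentially. real_of_int \<lceil>real (Suc n) * x\<rceil> / real (Suc n) \<le> x + 1 / real (Suc n)"
  proof (intro always_eventually allI)
    fix n
    have "real_of_int \<lceil>real (Suc n) * x\<rceil> \<le> real (Suc n) * x + 1" by linarith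
    then have "real_of_int \<lceil>real (Suc n) * x\<rceil> / real (Suc n) \<le> (real (Suc n) * x + 1) / real (Suc n)"
      by (intro divide_right_mono) auto
    then show "real_of_int \<lceil>real (Suc n) * x\<rceil> / real (Suc n) \<le> x + 1 / real (Suc n)"
      by (simp add: add_divide_distrib)
  qed
  have "(\<lambda>n. x + 1 / real (Suc n)) \<longlonglongrightarrow> x + 0"
    using LIMSEQ_inverse_real_of_nat by (intro tendsto_intros) (simp add: inverse_eq_divide)
  then show "(\<lambda>n. x + 1 / real (Suc n)) \<longlonglongrightarrow> x" by simp
qed auto

text \<open>A time rounded to multiples of \<open>1 / Suc n\<close> takes countably many values, so
  evaluation there is measurable by a countable case distinction; continuity of the path passes to
  the limit. Negative times are split off because paths are \<open>undefined\<close> there.\<close>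

lemma eval_random_time:
  assumes f [measurable]: "f \<in> N \<rightarrow>\<^sub>M path_space" and T [measurable]: "\<tau> \<in> borel_measurable N"
  shows "(\<lambda>x. f x (\<tau> x)) \<in> borel_measurable N"
proof -
  have pos: "(\<lambda>x. f x (max 0 (\<tau> x))) \<in> borel_measurable N"
  proof (rule borel_measurable_LIMSEQ_real)
    fix x assume x: "x \<in> space N"
    let ?q = "\<lambda>n. real_of_int \<lceil>real (Suc n) * max 0 (\<tau> x)\<rceil> / real (Suc n)"
    have "continuous_on {0..} (f x)" using measurable_space[OF f x] by (rule W_cont)
    moreover have "\<forall>\<^sub>F n in sequentially. ?q n \<in> {0..}"
      by (intro always_eventually allI) (simp add: divide_nonneg_pos ceiling_mono[of 0, simplified])
    ultimately show "(\<lambda>n. f x (?q n)) \<longlonglongrightarrow> f x (max 0 (\<tau> x))"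
      using tendsto_rational_approx[of "max 0 (\<tau> x)"]
      by (intro continuous_on_tendsto_compose[where f="f x" and s="{0..}"]) auto
  next
    fix n
    show "(\<lambda>x. f x (real_of_int \<lceil>real (Suc n) * max 0 (\<tau> x)\<rceil> / real (Suc n))) \<in> borel_measurable N"
    proof (rule measurable_compose_countable[where f="\<lambda>i x. f x (real_of_int i / real (Suc n))"])
      fix i :: int
      show "(\<lambda>x. f x (real_of_int i / real (Suc n))) \<in> borel_measurable N"
        by (rule eval_measurable_compose[OF f])
    qed measurable
  qed
  have "(\<lambda>x. if \<tau> x < 0 then undefined else f x (max 0 (\<tau> x))) \<in> borel_measurable N"
    using pos by measurable
  moreover have "f x (\<tau> x) = (if \<tau> x < 0 then undefined else f x (max 0 (\<tau> x)))" if "x \<in> space N" for x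
    using measurable_space[OF f that] by (auto simp: mem_W extensional_def)
  ultimately show ?thesis by (subst measurable_cong)
qed

lemma eval_self_measurable:
  "\<tau> \<in> borel_measurable path_space \<Longrightarrow> (\<lambda>w. w (\<tau> w)) \<in> borel_measurable path_space"
  by (rule eval_random_time[of "\<lambda>w. w" path_space \<tau>, OF measurable_ident_sets[OF refl]])

section \<open>Stopping and reflecting paths\<close>

text \<open>The real form of the minimum of \<open>t\<close> and a possibly infinite
  \<open>T\<close>. Stopped paths are evaluated here and not at \<open>enn2real T\<close>, which
  would be \<open>0\<close> for infinite \<open>T\<close>.\<close>

definition cut :: "real \<Rightarrow> ennreal \<Rightarrow> real" where
  "cut t T = enn2real (min (ennreal t) T)"

lemma cut_eq: "0 \<le> t \<Longrightarrow> ennreal t \<le> T \<Longrightarrow> cut t T = t"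
  unfolding cut_def by (simp only: min.absorb1 enn2real_ennreal)

lemma cut_eq2: "T \<le> ennreal t \<Longrightarrow> cut t T = enn2real T"
  unfolding cut_def by (simp only: min.absorb2)

lemma cut_nonneg [simp]: "0 \<le> cut t T"
  unfolding cut_def by (rule enn2real_nonneg)

lemma ennreal_cut: "0 \<le> t \<Longrightarrow> ennreal (cut t T) = min (ennreal t) T"
  unfolding cut_def by (rule ennreal_enn2real) (metis ennreal_less_top min.cobounded1 order.strict_trans1)

lemma cut_le: "0 \<le> t \<Longrightarrow> cut t T \<le> t"
  using ennreal_cut[of t T] by (metis cut_nonneg ennreal_le_iff min.cobounded1)

lemma cut_top [simp]: "0 \<le> t \<Longrightarrow> cut t \<top> = t"
  by (simp add: cut_eq)

lemma cut_real: "0 \<le> t \<Longrightarrow> 0 \<le> s \<Longrightarrow> cut t (ennreal s) = min t s"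
  unfolding cut_def by (auto simp: min_def)

lemma cut_measurable [measurable (raw)]:
  "\<tau> \<in> borel_measurable N \<Longrightarrow> T \<in> borel_measurable N \<Longrightarrow> (\<lambda>x. cut (\<tau> x) (T x)) \<in> borel_measurable N"
  unfolding cut_def
  by (intro borel_measurable_enn2real borel_measurable_min measurable_compose[OF _ measurable_ennreal])

lemma continuous_on_cut: "continuous_on {0..} (\<lambda>t. cut t T)"
proof (cases T)
  case (real s)
  then have "continuous_on {0..} (\<lambda>t. min t s)" by (intro continuous_intros)
  then show ?thesis using real by (subst continuous_on_cong[OF refl]) (auto simp: cut_real)
next
  case top
  have "continuous_on {0..} (\<lambda>t::real. t)" by (intro continuous_intros)
  then show ?thesis using top by (subst continuous_on_cong[OF refl]) auto
qed

lemma continuous_on_path_cut: "w \<in> W \<Longrightarrow> continuous_on {0..} (\<lambda>t. w (cut t T))"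
  by (rule continuous_on_compose2[OF W_cont continuous_on_cut]) auto

text \<open>One formula for both cases: before \<open>T\<close> the first term is
  \<open>2 * w t\<close>, after \<open>T\<close> it is twice the value at \<open>T\<close>. An
  infinite \<open>T\<close> leaves the path alone without a case distinction.\<close>

definition reflect :: "((real \<Rightarrow> real) \<Rightarrow> ennreal) \<Rightarrow> (real \<Rightarrow> real) \<Rightarrow> real \<Rightarrow> real" where
  "reflect T w = (\<lambda>t\<in>{0..}. 2 * w (cut t (T w)) - w t)"

lemma reflect_in_W: "w \<in> W \<Longrightarrow> reflect T w \<in> W"
  unfolding mem_W[of "reflect T w"]
proof (intro conjI)
  assume w: "w \<in> W"
  have "continuous_on {0..} (\<lambda>t. 2 * w (cut t (T w)) - w t)"
    using w by (intro continuous_intros continuous_on_path_cut W_cont)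
  then show "continuous_on {0..} (reflect T w)"
    by (subst continuous_on_cong[OF refl]) (auto simp: reflect_def)
  have "cut 0 (T w) = 0" using cut_le[of 0 "T w"] cut_nonneg[of 0 "T w"] by linarith
  then show "reflect T w 0 = 0" using w by (simp add: reflect_def W_zero)
qed (auto simp: reflect_def)

lemma reflect_measurable [measurable]:
  assumes [measurable]: "T \<in> borel_measurable path_space"
  shows "reflect T \<in> path_space \<rightarrow>\<^sub>M path_space"
proof (rule measurable_path_spaceI)
  fix t :: real assume "0 \<le> t"
  have "(\<lambda>w. w (cut t (T w))) \<in> borel_measurable path_space"
    by (rule eval_self_measurable) measurable
  then have "(\<lambda>w. 2 * w (cut t (T w)) - w t) \<in> borel_measurable path_space"
    by (intro borel_measurable_diff borel_measurable_times borel_measurable_const eval_measurable)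
  moreover have "(\<lambda>x. reflect T x t) = (\<lambda>w. 2 * w (cut t (T w)) - w t)"
    using \<open>0 \<le> t\<close> by (auto simp: reflect_def fun_eq_iff)
  ultimately show "(\<lambda>x. reflect T x t) \<in> borel_measurable path_space" by (simp only:)
qed (rule reflect_in_W)

lemma reflect_before: "0 \<le> t \<Longrightarrow> ennreal t \<le> T w \<Longrightarrow> reflect T w t = w t"
  by (simp add: reflect_def cut_eq)

lemma reflect_after: "0 \<le> t \<Longrightarrow> T w \<le> ennreal t \<Longrightarrow> reflect T w t = 2 * w (enn2real (T w)) - w t"
  by (simp add: reflect_def cut_eq2)

section \<open>Nonanticipating times\<close>

definition agree :: "ennreal \<Rightarrow> (real \<Rightarrow> real) \<Rightarrow> (real \<Rightarrow> real) \<Rightarrow> bool" where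
  "agree T w w' \<longleftrightarrow> (\<forall>t\<ge>0. ennreal t \<le> T \<longrightarrow> w' t = w t)"

text \<open>A pathwise substitute for measurability with respect to the past of \<open>T\<close>.
  Pointwise constructions preserve it without any reference to a \<sigma>-algebra; measurability is
  carried separately.\<close>

definition nonant :: "((real \<Rightarrow> real) \<Rightarrow> ennreal) \<Rightarrow> ((real \<Rightarrow> real) \<Rightarrow> 'b) \<Rightarrow> bool" where
  "nonant T f \<longleftrightarrow> (\<forall>w\<in>W. \<forall>w'\<in>W. agree (T w) w w' \<longrightarrow> f w' = f w)"

text \<open>By Galmarino's test these are the stopping times of the canonical filtration.\<close>

definition adm :: "((real \<Rightarrow> real) \<Rightarrow> ennreal) \<Rightarrow> bool" where
  "adm T \<longleftrightarrow> T \<in> borel_measurable path_space \<and> nonant T T"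

lemma adm_measurable [measurable_dest]: "adm T \<Longrightarrow> T \<in> borel_measurable path_space"
  and adm_nonant: "adm T \<Longrightarrow> nonant T T"
  by (auto simp: adm_def)

lemma agree_mono: "agree T w w' \<Longrightarrow> S \<le> T \<Longrightarrow> agree S w w'"
  by (auto simp: agree_def)

lemma agree_sym: "agree T w w' \<Longrightarrow> agree T w' w"
  by (auto simp: agree_def)

lemma nonantD: "nonant T f \<Longrightarrow> w \<in> W \<Longrightarrow> w' \<in> W \<Longrightarrow> agree (T w) w w' \<Longrightarrow> f w' = f w"
  by (auto simp: nonant_def)

lemma nonantI: "(\<And>w w'. w \<in> W \<Longrightarrow> w' \<in> W \<Longrightarrow> agree (T w) w w' \<Longrightarrow> f w' = f w) \<Longrightarrow> nonant T f"
  by (auto simp: nonant_def)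

lemma nonant_mono: "nonant S f \<Longrightarrow> (\<And>w. w \<in> W \<Longrightarrow> S w \<le> T w) \<Longrightarrow> nonant T f"
  unfolding nonant_def using agree_mono by blast

lemma agree_reflect: "agree (T w) w (reflect T w)"
  by (auto simp: agree_def reflect_before)

lemma nonant_reflect: "nonant T f \<Longrightarrow> w \<in> W \<Longrightarrow> f (reflect T w) = f w"
  by (rule nonantD[of T f w "reflect T w"]) (simp_all add: reflect_in_W agree_reflect)

lemma adm_reflect: "adm T \<Longrightarrow> w \<in> W \<Longrightarrow> T (reflect T w) = T w"
  by (simp add: adm_nonant nonant_reflect)

lemma nonant_const: "nonant T (\<lambda>_. c)" by (simp add: nonant_def)

lemma nonant_comp: "nonant T f \<Longrightarrow> nonant T (\<lambda>w. h (f w))"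
  by (simp add: nonant_def)

lemma nonant_eval: "nonant S T \<Longrightarrow> (\<And>w. w \<in> W \<Longrightarrow> T w \<le> S w) \<Longrightarrow> nonant S (\<lambda>w. w (enn2real (T w)))"
proof (rule nonantI)
  fix w w' assume *: "nonant S T" "\<And>w. w \<in> W \<Longrightarrow> T w \<le> S w" "w \<in> W" "w' \<in> W" "agree (S w) w w'"
  then have T: "T w' = T w" by (auto dest: nonantD)
  show "w' (enn2real (T w')) = w (enn2real (T w))"
  proof (cases "T w")
    case (real r)
    then have "ennreal r \<le> S w" using *(2,3) by fastforce
    then have "w' r = w r" using *(5) real by (simp add: agree_def)
    then show ?thesis using T real by simp
  next
    \<comment> \<open>An infinite time is turned by \<open>enn2real\<close> into \<open>0\<close>,
      where all paths vanish.\<close>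
    case top
    then show ?thesis using * T W_zero[of w] W_zero[of w'] by auto
  qed
qed

lemma adm_const: "adm (\<lambda>_. T)"
  by (simp add: adm_def nonant_const)

text \<open>The order of two nonanticipating times is decided at the smaller one. Whichever comes
  first on \<open>w\<close> keeps its value on \<open>w'\<close>; if the other came earlier on
  \<open>w'\<close>, reading the agreement backwards would give it that earlier value on
  \<open>w\<close> as well. The equality of the minima makes the hypothesis symmetric in the two
  paths, so that one implication suffices.\<close>

lemma adm_min_nonant:
  assumes "adm T" "adm V"
  shows "nonant (\<lambda>w. min (T w) (V w)) (\<lambda>w. T w \<le> V w)" (is ?A)
    and "nonant (\<lambda>w. min (T w) (V w)) (\<lambda>w. T w < V w)" (is ?B)
proof -
  have key: "(T w' < V w' \<longrightarrow> T w < V w) \<and> (T w' \<le> V w' \<longrightarrow> T w \<le> V w)"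
    if w: "w \<in> W" "w' \<in> W" "agree (min (T w) (V w)) w w'" and a: "adm T" "adm V" for w w' T V
  proof (cases "T w \<le> V w")
    case True
    then have "T w' = T w" using w a by (auto simp: adm_def min_def dest: nonantD)
    then show ?thesis
      using True w a agree_sym[OF w(3)] nonantD[OF adm_nonant[OF a(2)] w(1,2)]
      by (metis min.absorb1 order_le_less)
  next
    case False
    then have V: "V w' = V w" using w a by (auto simp: adm_def min_def dest: nonantD)
    have "\<not> T w' \<le> V w'"
    proof
      assume "T w' \<le> V w'"
      then have "agree (T w') w' w" using False w(3) V
        by (intro agree_sym[OF agree_mono[OF w(3)]]) (auto simp: min_def)
      then have "T w = T w'" using w a by (auto simp: adm_def dest: nonantD)
      then show False using False V \<open>T w' \<le> V w'\<close> by simp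
    qed
    then show ?thesis by auto
  qed
  have eq: "min (T w') (V w') = min (T w) (V w)"
    if w: "w \<in> W" "w' \<in> W" "agree (min (T w) (V w)) w w'" for w w'
  proof (cases "T w \<le> V w")
    case True
    then have T: "T w' = T w" using w assms by (auto simp: adm_def min_def dest: nonantD)
    have "\<not> V w' < T w'"
    proof
      assume "V w' < T w'"
      then have "agree (V w') w' w" using True w(3) T
        by (intro agree_sym[OF agree_mono[OF w(3)]]) (auto simp: min_def)
      then have "V w = V w'" using w assms by (auto simp: adm_def dest: nonantD)
      then show False using True T \<open>V w' < T w'\<close> by simp
    qed
    then show ?thesis using T True by (auto simp: min_def)
  next
    case False
    then have V: "V w' = V w" using w assms by (auto simp: adm_def min_def dest: nonantD)
    have "\<not> T w' < V w'"
    proof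
      assume "T w' < V w'"
      then have "agree (T w') w' w" using False w(3) V
        by (intro agree_sym[OF agree_mono[OF w(3)]]) (auto simp: min_def)
      then have "T w = T w'" using w assms by (auto simp: adm_def dest: nonantD)
      then show False using False V \<open>T w' < V w'\<close> by simp
    qed
    then show ?thesis using V False by (auto simp: min_def)
  qed
  have sym: "agree (min (T w') (V w')) w' w" if "w \<in> W" "w' \<in> W" "agree (min (T w) (V w)) w w'" for w w'
    using eq[OF that] agree_sym[OF that(3)] by simp
  show ?A ?B
    using key[OF _ _ _ assms] sym by (blast intro!: nonantI)+
qed

lemma adm_min: "adm T \<Longrightarrow> adm V \<Longrightarrow> adm (\<lambda>w. min (T w) (V w))"
  unfolding adm_def[of "\<lambda>w. min (T w) (V w)"]
proof (intro conjI nonantI)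
  fix w w' assume a: "adm T" "adm V" and w: "w \<in> W" "w' \<in> W" "agree (min (T w) (V w)) w w'"
  have "(T w' \<le> V w') = (T w \<le> V w)" using adm_min_nonant(1)[OF a] w by (rule nonantD)
  then show "min (T w') (V w') = min (T w) (V w)"
    using a w by (auto simp: adm_def min_def dest: nonantD split: if_splits)
qed (simp add: adm_def borel_measurable_min)

text \<open>The choice between the two times has to be known before either of them occurs, hence the
  minimum in the hypothesis on \<open>E\<close>.\<close>

lemma adm_mix:
  assumes a: "adm T" "adm V" and E: "nonant (\<lambda>w. min (T w) (V w)) E" "Measurable.pred path_space E"
  shows "adm (\<lambda>w. if E w then T w else V w)"
  unfolding adm_def
proof (intro conjI nonantI)
  fix w w' assume w: "w \<in> W" "w' \<in> W" "agree (if E w then T w else V w) w w'"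
  have "E w' = E w" by (rule nonantD[OF E(1) w(1,2)]) (rule agree_mono[OF w(3)], auto)
  then show "(if E w' then T w' else V w') = (if E w then T w else V w)"
    using a w by (auto simp: adm_def dest: nonantD split: if_splits)
qed (use a E(2) in \<open>simp add: adm_def measurable_If\<close>)

text \<open>A reflected path at time \<open>t\<close> depends only on the values at \<open>t\<close>
  and at \<open>cut t (U w)\<close>. Agreement of two paths up to a time not before \<open>U\<close>
  therefore carries over to their reflections.\<close>

lemma adm_comp_reflect:
  assumes a: "adm T" "adm U" and le: "\<And>w. w \<in> W \<Longrightarrow> U w \<le> T w"
  shows "adm (\<lambda>w. T (reflect U w))"
  unfolding adm_def
proof (intro conjI nonantI)
  fix w w' assume w: "w \<in> W" "w' \<in> W" "agree (T (reflect U w)) w w'"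
  have Ule: "U w \<le> T (reflect U w)" using le[OF reflect_in_W[OF w(1), of U]] adm_reflect[OF a(2) w(1)] by simp
  have U: "U w' = U w"
    by (rule nonantD[OF adm_nonant[OF a(2)] w(1,2)]) (rule agree_mono[OF w(3) Ule])
  have "agree (T (reflect U w)) (reflect U w) (reflect U w')"
    unfolding agree_def
  proof (intro allI impI)
    fix t :: real assume t: "0 \<le> t" "ennreal t \<le> T (reflect U w)"
    have "ennreal (cut t (U w)) \<le> T (reflect U w)" using t by (simp add: ennreal_cut min.coboundedI1)
    then have "w' (cut t (U w)) = w (cut t (U w))" "w' t = w t" using w(3) t by (auto simp: agree_def)
    then show "reflect U w' t = reflect U w t" using t U by (simp add: reflect_def)
  qed
  then show "T (reflect U w') = T (reflect U w)"
    using nonantD[OF adm_nonant[OF a(1)]] w reflect_in_W by blast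
next
  show "(\<lambda>w. T (reflect U w)) \<in> borel_measurable path_space"
    using a by (intro measurable_compose[OF reflect_measurable]) (auto simp: adm_def)
qed

section \<open>Hitting times\<close>

text \<open>Displacements are measured from the position at \<open>S\<close>, so that hitting times
  can be chained. If \<open>S w\<close> is infinite no time competes and the infimum is
  \<open>\<top>\<close>.\<close>

definition hit :: "((real \<Rightarrow> real) \<Rightarrow> ennreal) \<Rightarrow> real \<Rightarrow> (real \<Rightarrow> real) \<Rightarrow> ennreal" where
  "hit S c w = (INF t\<in>{t. 0 \<le> t \<and> S w \<le> ennreal t \<and> w t - w (enn2real (S w)) = c}. ennreal t)"

lemma hit_le: "0 \<le> t \<Longrightarrow> S w \<le> ennreal t \<Longrightarrow> w t - w (enn2real (S w)) = c \<Longrightarrow> hit S c w \<le> ennreal t"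
  unfolding hit_def by (rule INF_lower) simp

lemma hit_ge: "S w \<le> hit S c w"
  unfolding hit_def by (rule INF_greatest) simp

text \<open>By continuity the set of competing times is closed, so a finite infimum is
  attained.\<close>

lemma hit_cases:
  assumes w: "w \<in> W"
  obtains (top) "hit S c w = \<top>" "\<And>t. 0 \<le> t \<Longrightarrow> S w \<le> ennreal t \<Longrightarrow> w t - w (enn2real (S w)) \<noteq> c"
  | (real) t where "0 \<le> t" "hit S c w = ennreal t" "S w \<le> ennreal t" "w t - w (enn2real (S w)) = c"
proof -
  let ?X = "{t. 0 \<le> t \<and> S w \<le> ennreal t \<and> w t - w (enn2real (S w)) = c}"
  show thesis
  proof (cases "?X = {}")
    case True
    then have "hit S c w = \<top>" unfolding hit_def by (simp only: image_empty Inf_empty)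
    then show thesis using True by (intro top) auto
  next
    case False
    then obtain t1 where t1: "t1 \<in> ?X" by auto
    then have fin: "S w < \<top>" using ennreal_less_top by (metis (mono_tags, lifting) mem_Collect_eq order.strict_trans1)
    then obtain s where s: "S w = ennreal s" "0 \<le> s" by (cases "S w") auto
    have X: "?X = {t \<in> {s..}. w t = c + w s}" using s by (auto simp: ennreal_le_iff2)
    have "closed {t \<in> {s..}. w t = c + w s}"
      using s(2) by (intro continuous_closed_preimage_constant continuous_on_subset[OF W_cont[OF w]]) auto
    then have cl: "closed ?X" using X by simp
    have bdd: "bdd_below ?X" by (rule bdd_belowI[of _ 0]) auto
    define t where "t = Inf ?X"
    have t: "t \<in> ?X" unfolding t_def by (rule closed_contains_Inf[OF False bdd cl])
    have "hit S c w = ennreal t"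
    proof (rule antisym)
      show "hit S c w \<le> ennreal t" using t by (intro hit_le) auto
      show "ennreal t \<le> hit S c w" unfolding hit_def
        by (rule INF_greatest) (rule ennreal_leI, unfold t_def, rule cInf_lower[OF _ bdd])
    qed
    then show thesis using t by (intro real[of t]) auto
  qed
qed

lemma hit_finite:
  assumes "w \<in> W" "hit S c w = ennreal t" "0 \<le> t"
  shows "S w \<le> ennreal t" "w t - w (enn2real (S w)) = c"
  using hit_cases[OF assms(1), of S c] assms by (metis ennreal_inj ennreal_neq_top)+

lemma hit_IVT:
  assumes w: "w \<in> W" and "0 \<le> t" "S w \<le> ennreal t" and c: "0 < c"
    and x: "c \<le> \<bar>w t - w (enn2real (S w))\<bar>"
  shows "hit S c w \<le> ennreal t \<or> hit S (-c) w \<le> ennreal t"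
proof -
  obtain s where s: "S w = ennreal s" "0 \<le> s" "s \<le> t"
    using assms(2,3) by (cases "S w") (auto simp: ennreal_le_iff2 top_unique)
  have cont: "continuous_on {s..t} (\<lambda>r. w r - w s)"
    by (intro continuous_intros continuous_on_subset[OF W_cont[OF w]]) (use s in auto)
  show ?thesis
  proof (cases "c \<le> w t - w s")
    case True
    then obtain r where "s \<le> r" "r \<le> t" "w r - w s = c"
      using IVT'[of "\<lambda>r. w r - w s" s c t] cont s c by auto
    then have "hit S c w \<le> ennreal r" using s by (intro hit_le) (auto intro: ennreal_leI)
    then show ?thesis using \<open>r \<le> t\<close> by (meson ennreal_leI order_trans)
  next
    case False
    then have "w t - w s \<le> - c" using x s by (auto simp: abs_if split: if_splits)
    then obtain r where "s \<le> r" "r \<le> t" "w r - w s = - c"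
      using IVT2'[of "\<lambda>r. w r - w s" t "-c" s] cont s c by auto
    then have "hit S (-c) w \<le> ennreal r" using s by (intro hit_le) (auto intro: ennreal_leI)
    then show ?thesis using \<open>r \<le> t\<close> by (meson ennreal_leI order_trans)
  qed
qed

text \<open>A description by countably many evaluations, from which measurability follows. Since
  \<open>c \<noteq> 0\<close>, a hit lies strictly after \<open>S\<close> and rationals fit in just
  before it. Conversely, near-hits at rationals in a compact interval accumulate at a hit.\<close>

lemma hit_eq_rational:
  assumes w: "w \<in> W" and c: "c \<noteq> 0" and a: "0 \<le> a"
  shows "hit S c w \<le> ennreal a \<longleftrightarrow>
    (\<forall>m::nat. \<exists>q::rat. 0 \<le> real_of_rat q \<and> real_of_rat q \<le> a \<and> S w \<le> ennreal (real_of_rat q) \<and>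
       \<bar>w (real_of_rat q) - w (enn2real (S w)) - c\<bar> < 1 / real (Suc m))" (is "?L \<longleftrightarrow> ?R")
proof
  assume L: ?L
  show ?R
  proof
    fix m
    obtain t where t: "0 \<le> t" "hit S c w = ennreal t" "S w \<le> ennreal t" "w t - w (enn2real (S w)) = c"
      using hit_cases[OF w, of S c] L by (metis ennreal_neq_top top_unique)
    have "t \<le> a" using L t a by (simp add: ennreal_le_iff)
    obtain s where s: "S w = ennreal s" "0 \<le> s" "s \<le> t" using t by (cases "S w") (auto simp: top_unique)
    have "s \<noteq> t" using t c s by auto
    then have "s < t" using s by simp
    have "continuous_on {0..} w" using w by (rule W_cont)
    then obtain d where d: "d > 0" "\<And>x. x \<in> {0..} \<Longrightarrow> dist x t < d \<Longrightarrow> dist (w x) (w t) < 1 / real (Suc m)"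
      unfolding continuous_on_iff using t(1) by (metis atLeast_iff of_nat_0_less_iff zero_less_Suc zero_less_divide_1_iff)
    obtain q where q: "max s (t - d) < real_of_rat q" "real_of_rat q < t"
      using of_rat_dense[of "max s (t - d)" t] \<open>s < t\<close> d by auto
    have "dist (w (real_of_rat q)) (w t) < 1 / real (Suc m)" using q s(2) by (intro d(2)) (auto simp: dist_real_def simp del: zero_le_of_rat_iff)
    moreover have "w (real_of_rat q) - w (enn2real (S w)) - c = w (real_of_rat q) - w t" using t by simp
    ultimately have "\<bar>w (real_of_rat q) - w (enn2real (S w)) - c\<bar> < 1 / real (Suc m)"
      by (simp only: dist_real_def)
    then show "\<exists>q::rat. 0 \<le> real_of_rat q \<and> real_of_rat q \<le> a \<and> S w \<le> ennreal (real_of_rat q) \<and>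
       \<bar>w (real_of_rat q) - w (enn2real (S w)) - c\<bar> < 1 / real (Suc m)"
      using q s \<open>t \<le> a\<close> by (intro exI[of _ q]) (auto intro: ennreal_leI simp del: zero_le_of_rat_iff)
  qed
next
  assume ?R
  then obtain q :: "nat \<Rightarrow> rat" where q: "\<And>m. 0 \<le> real_of_rat (q m)" "\<And>m. real_of_rat (q m) \<le> a"
      "\<And>m. S w \<le> ennreal (real_of_rat (q m))"
      "\<And>m. \<bar>w (real_of_rat (q m)) - w (enn2real (S w)) - c\<bar> < 1 / real (Suc m)"
    by metis
  have "S w < \<top>" using q(3)[of 0] by (metis ennreal_less_top order.strict_trans1)
  then obtain s where s: "S w = ennreal s" "0 \<le> s" by (cases "S w") auto
  let ?x = "\<lambda>m. real_of_rat (q m)"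
  have "compact {s..a}" by simp
  moreover have "\<forall>m. ?x m \<in> {s..a}" using q s by (auto simp: ennreal_le_iff)
  ultimately obtain t r where t: "t \<in> {s..a}" "strict_mono r" "(?x \<circ> r) \<longlonglongrightarrow> t"
    unfolding compact_def by metis
  have "(\<lambda>m. w ((?x \<circ> r) m)) \<longlonglongrightarrow> w t"
    by (rule continuous_on_tendsto_compose[OF W_cont[OF w] t(3)]) (use t(1) q(1) s in auto)
  then have l1: "(\<lambda>m. w ((?x \<circ> r) m) - w s - c) \<longlonglongrightarrow> w t - w s - c" by (intro tendsto_intros)
  have "(\<lambda>m. (1 / real (Suc m))) \<longlonglongrightarrow> 0"
    using LIMSEQ_inverse_real_of_nat by (simp add: inverse_eq_divide)
  then have z: "((\<lambda>m. 1 / real (Suc m)) \<circ> r) \<longlonglongrightarrow> 0" using t(2) by (rule LIMSEQ_subseq_LIMSEQ)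
  have l2: "(\<lambda>m. w ((?x \<circ> r) m) - w s - c) \<longlonglongrightarrow> 0"
    by (rule Lim_null_comparison[OF _ z])
      (use q(4) s in \<open>auto intro!: always_eventually less_imp_le simp del: of_nat_Suc\<close>)
  have "w t - w s = c" using LIMSEQ_unique[OF l1 l2] by simp
  then have "hit S c w \<le> ennreal t" using t s by (intro hit_le) (auto intro: ennreal_leI)
  then show ?L using t by (auto intro: order_trans ennreal_leI)
qed

lemma hit_measurable:
  assumes S: "S \<in> borel_measurable path_space" and c: "c \<noteq> 0"
  shows "hit S c \<in> borel_measurable path_space"
proof (rule borel_measurableI_le)
  fix y :: ennreal
  show "{w \<in> W. hit S c w \<le> y} \<in> sets path_space"
  proof (cases y)
    case (real a)
    have e: "(\<lambda>w. w (enn2real (S w))) \<in> borel_measurable path_space"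
      by (intro eval_self_measurable borel_measurable_enn2real S)
    have 1: "Measurable.pred path_space (\<lambda>w. S w \<le> ennreal x)" for x
      using S by simp
    have 2: "Measurable.pred path_space (\<lambda>w. \<bar>w x - w (enn2real (S w)) - c\<bar> < z)" for x z
    proof -
      have "(\<lambda>w. \<bar>w x - w (enn2real (S w)) - c\<bar>) \<in> borel_measurable path_space"
        by (intro borel_measurable_abs borel_measurable_diff eval_measurable e borel_measurable_const)
      then show ?thesis unfolding pred_def by (rule borel_measurable_less) simp
    qed
    have 3: "{w \<in> W. hit S c w \<le> y} = {w \<in> W. \<forall>m::nat. \<exists>q::rat. 0 \<le> real_of_rat q \<and> real_of_rat q \<le> a \<and> S w \<le> ennreal (real_of_rat q) \<and>
       \<bar>w (real_of_rat q) - w (enn2real (S w)) - c\<bar> < 1 / real (Suc m)}"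
      using hit_eq_rational[OF _ c, of _ a S] real by auto
    have "Measurable.pred path_space (\<lambda>w. \<forall>m::nat. \<exists>q::rat. 0 \<le> real_of_rat q \<and> real_of_rat q \<le> a \<and> S w \<le> ennreal (real_of_rat q) \<and>
       \<bar>w (real_of_rat q) - w (enn2real (S w)) - c\<bar> < 1 / real (Suc m))"
      by (intro pred_intros_countable pred_intros_logic 1 2) simp_all
    then show ?thesis unfolding 3 pred_def .
  next
    case top
    then show ?thesis by simp
  qed
qed

lemma adm_hit:
  assumes S: "adm S" and c: "c \<noteq> 0"
  shows "adm (hit S c)"
  unfolding adm_def
proof (intro conjI nonantI hit_measurable c)
  show "S \<in> borel_measurable path_space" using S by (simp add: adm_def)
  have le: "hit S c w' \<le> hit S c w"
    if w: "w \<in> W" "w' \<in> W" "agree (hit S c w) w w'" for w w'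
  proof -
    have Sw: "S w' = S w"
      by (rule nonantD[OF adm_nonant[OF S] w(1,2) agree_mono[OF w(3) hit_ge]])
    show ?thesis
    proof (rule hit_cases[OF w(1), of S c])
      fix t assume t: "0 \<le> t" "hit S c w = ennreal t" "S w \<le> ennreal t" "w t - w (enn2real (S w)) = c"
      obtain s where s: "S w = ennreal s" "0 \<le> s" "s \<le> t" using t by (cases "S w") (auto simp: top_unique)
      have "w' t = w t" "w' s = w s" using w(3) t s by (auto simp: agree_def)
      then show ?thesis unfolding t(2) using t s Sw by (intro hit_le) auto
    qed simp
  qed
  fix w w' assume w: "w \<in> W" "w' \<in> W" "agree (hit S c w) w w'"
  \<comment> \<open>The inequality with the two paths exchanged; the agreement reaches far enough
    because the hit on \<open>w'\<close> is not later than the one on \<open>w\<close>.\<close>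
  have "hit S c w \<le> hit S c w'"
    using le[OF w(2,1) agree_sym[OF agree_mono[OF w(3) le[OF w]]]] .
  then show "hit S c w' = hit S c w" using le[OF w] by simp
qed

lemma reflection_eq_reflect:
  assumes w: "w \<in> W"
  shows "reflection a w = reflect (hit (\<lambda>_. 0) a) w"
proof -
  have fp: "first_passage a w = hit (\<lambda>_. 0) a w"
    using W_zero[OF w] by (simp add: first_passage_def hit_def)
  show ?thesis
  proof
    fix t
    show "reflection a w t = reflect (hit (\<lambda>_. 0) a) w t"
    proof (cases "0 \<le> t")
      case t: True
      show ?thesis
      proof (cases "ennreal t \<le> hit (\<lambda>_. 0) a w")
        case True
        then show ?thesis using t by (simp add: reflection_def reflect_before fp)
      next
        case False
        then obtain r where r: "0 \<le> r" "hit (\<lambda>_. 0) a w = ennreal r"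
          by (cases "hit (\<lambda>_. 0) a w") auto
        then have "w r = a" using hit_finite(2)[OF w r(2,1)] W_zero[OF w] by simp
        then show ?thesis using t False r by (simp add: reflection_def fp reflect_after)
      qed
    qed (simp add: reflection_def reflect_def)
  qed
qed

lemma hit_0_0: "w \<in> W \<Longrightarrow> hit (\<lambda>_. 0) 0 w = 0"
  using hit_le[of 0 "\<lambda>_. 0" w 0] by (simp add: W_zero)

section \<open>Every nonanticipating time is good\<close>

locale path_law = prob_space \<mu> for \<mu> :: "(real \<Rightarrow> real) measure" +
  assumes sets_law [measurable_cong, simp]: "sets \<mu> = sets path_space"
begin

lemma space_law [simp]: "space \<mu> = W"
  by (rule sets_eq_imp_space_eq) simp

definition preserving :: "((real \<Rightarrow> real) \<Rightarrow> real \<Rightarrow> real) \<Rightarrow> bool" where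
  "preserving f \<longleftrightarrow> f \<in> path_space \<rightarrow>\<^sub>M path_space \<and> distr \<mu> path_space f = \<mu>"

definition good :: "((real \<Rightarrow> real) \<Rightarrow> ennreal) \<Rightarrow> bool" where
  "good T \<longleftrightarrow> adm T \<and> preserving (reflect T)"

lemma preserving_measurable: "preserving f \<Longrightarrow> f \<in> \<mu> \<rightarrow>\<^sub>M path_space"
  using measurable_cong_sets[OF sets_law refl, of path_space] by (auto simp: preserving_def)

lemma preservingI:
  assumes "f \<in> path_space \<rightarrow>\<^sub>M path_space"
    and "\<And>B. B \<in> sets path_space \<Longrightarrow> emeasure \<mu> (f -` B \<inter> W) = emeasure \<mu> B"
  shows "preserving f"
  unfolding preserving_def
proof (intro conjI measure_eqI)
  have f: "f \<in> \<mu> \<rightarrow>\<^sub>M path_space" using assms(1) measurable_cong_sets[OF sets_law refl] by auto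
  show "emeasure (distr \<mu> path_space f) A = emeasure \<mu> A" if "A \<in> sets (distr \<mu> path_space f)" for A
    using that by (subst emeasure_distr[OF f]) (auto simp: assms(2))
qed (use assms in auto)

lemma preserving_emeasure:
  "preserving f \<Longrightarrow> B \<in> sets path_space \<Longrightarrow> emeasure \<mu> (f -` B \<inter> W) = emeasure \<mu> B"
  using emeasure_distr[OF preserving_measurable, of f B] by (simp add: preserving_def)

lemma preserving_comp: "preserving f \<Longrightarrow> preserving g \<Longrightarrow> preserving (\<lambda>w. f (g w))"
proof -
  assume a: "preserving f" "preserving g"
  have "distr \<mu> path_space (\<lambda>w. f (g w)) = distr (distr \<mu> path_space g) path_space f"
    using a by (subst distr_distr) (auto simp: comp_def preserving_measurable preserving_def)
  then show ?thesis using a unfolding preserving_def by (auto intro: measurable_compose)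
qed

lemma preserving_integral:
  fixes g :: "_ \<Rightarrow> 'b :: {banach, second_countable_topology}"
  assumes "preserving f" "g \<in> borel_measurable path_space"
  shows "(\<integral>w. g (f w) \<partial>\<mu>) = (\<integral>w. g w \<partial>\<mu>)"
  using integral_distr[OF preserving_measurable[OF assms(1)] assms(2)] assms(1) by (simp add: preserving_def)

text \<open>Both maps send the event and its complement into themselves, so on each of the two
  pieces the chosen map preserves the restricted law.\<close>

lemma preserving_If:
  assumes f: "preserving f" and g: "preserving g" and E: "Measurable.pred path_space E"
    and inv: "\<And>w. w \<in> W \<Longrightarrow> E (f w) = E w" "\<And>w. w \<in> W \<Longrightarrow> E (g w) = E w"
  shows "preserving (\<lambda>w. if E w then f w else g w)"
proof (rule preservingI)
  have fm: "f \<in> path_space \<rightarrow>\<^sub>M path_space" and gm: "g \<in> path_space \<rightarrow>\<^sub>M path_space"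
    using f g by (auto simp: preserving_def)
  show "(\<lambda>w. if E w then f w else g w) \<in> path_space \<rightarrow>\<^sub>M path_space"
    by (rule measurable_If[OF fm gm]) (use E in \<open>simp add: pred_def\<close>)
  fix B assume B [measurable]: "B \<in> sets path_space"
  have E' [measurable]: "{w \<in> W. E w} \<in> sets path_space" using E by (simp add: pred_def)
  let ?E = "{w \<in> W. E w}"
  have BW: "B \<subseteq> W" using B by (rule sets.sets_into_space)
  have eq: "(\<lambda>w. if E w then f w else g w) -` B \<inter> W = (f -` (B \<inter> ?E) \<inter> W) \<union> (g -` (B - ?E) \<inter> W)"
    using inv BW by (auto split: if_splits)
  have sf: "f -` (B \<inter> ?E) \<inter> W \<in> sets path_space" "g -` (B - ?E) \<inter> W \<in> sets path_space"
    using measurable_sets[OF fm, of "B \<inter> ?E"] measurable_sets[OF gm, of "B - ?E"] B E' by auto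
  have dj: "(f -` (B \<inter> ?E) \<inter> W) \<inter> (g -` (B - ?E) \<inter> W) = {}"
    using inv measurable_space[OF gm] by auto
  have "emeasure \<mu> ((\<lambda>w. if E w then f w else g w) -` B \<inter> W)
     = emeasure \<mu> (f -` (B \<inter> ?E) \<inter> W) + emeasure \<mu> (g -` (B - ?E) \<inter> W)"
    unfolding eq using sf dj by (intro plus_emeasure[symmetric]) auto
  also have "\<dots> = emeasure \<mu> (B \<inter> ?E) + emeasure \<mu> (B - ?E)"
    by (simp only: preserving_emeasure[OF f sets.Int[OF B E']] preserving_emeasure[OF g sets.Diff[OF B E']])
  also have "\<dots> = emeasure \<mu> B"
    by (subst plus_emeasure) (auto intro!: arg_cong[where f="emeasure \<mu>"])
  finally show "emeasure \<mu> ((\<lambda>w. if E w then f w else g w) -` B \<inter> W) = emeasure \<mu> B" .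
qed

lemma good_adm: "good T \<Longrightarrow> adm T"
  and good_preserving: "good T \<Longrightarrow> preserving (reflect T)"
  by (auto simp: good_def)

text \<open>The choice \<open>E\<close> is made by the time of the earlier reflection, so neither
  reflection alters it and the gluing of law-preserving maps applies.\<close>

lemma good_mix:
  assumes g: "good T" "good V" and E: "nonant (\<lambda>w. min (T w) (V w)) E" "Measurable.pred path_space E"
  shows "good (\<lambda>w. if E w then T w else V w)"
proof -
  have ET: "nonant T E" "nonant V E" using E(1) by (auto intro: nonant_mono)
  have eq: "reflect (\<lambda>w. if E w then T w else V w) = (\<lambda>w. if E w then reflect T w else reflect V w)"
    by (auto simp: fun_eq_iff reflect_def)
  have "preserving (\<lambda>w. if E w then reflect T w else reflect V w)"
    using g E ET by (intro preserving_If) (auto simp: good_def nonant_reflect)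
  then show ?thesis using adm_mix[OF _ _ E] g by (simp add: good_def eq)
qed

lemma pred_le_adm: "adm T \<Longrightarrow> adm V \<Longrightarrow> Measurable.pred path_space (\<lambda>w. T w \<le> V w)"
  and pred_less_adm: "adm T \<Longrightarrow> adm V \<Longrightarrow> Measurable.pred path_space (\<lambda>w. T w < V w)"
  by (simp_all add: adm_def pred_def borel_measurable_le borel_measurable_less)

lemma good_min: "good T \<Longrightarrow> good V \<Longrightarrow> good (\<lambda>w. min (T w) (V w))"
  unfolding min_def by (intro good_mix) (simp_all add: adm_min_nonant pred_le_adm good_adm)

lemma good_max: "good T \<Longrightarrow> good V \<Longrightarrow> good (\<lambda>w. max (T w) (V w))"
  unfolding max_def by (intro good_mix) (simp_all add: min.commute adm_min_nonant pred_le_adm good_adm)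

text \<open>Reflection at \<open>U\<close> is an involution, and conjugating the reflection at
  \<open>T\<close> by it gives the reflection at the composed time. The three nested cuts collapse
  because \<open>U\<close> precedes \<open>T\<close>.\<close>

lemma good_comp_reflect:
  assumes g: "good T" "good U" and le: "\<And>w. w \<in> W \<Longrightarrow> U w \<le> T w"
  shows "good (\<lambda>w. T (reflect U w))"
proof -
  have a: "adm T" "adm U" using g by (auto simp: good_def)
  have eq: "reflect (\<lambda>w. T (reflect U w)) w = reflect U (reflect T (reflect U w))" if w: "w \<in> W" for w
  proof (rule W_eqI)
    fix t :: real assume t: "0 \<le> t"
    let ?w1 = "reflect U w" let ?T = "T ?w1" let ?w2 = "reflect T ?w1"
    have w1: "?w1 \<in> W" and w2: "?w2 \<in> W" using w by (auto intro: reflect_in_W)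
    have U1: "U ?w1 = U w" using a(2) w by (rule adm_reflect)
    have UT: "U w \<le> ?T" using le[OF w1] U1 by simp
    have "U ?w2 = U ?w1"
      by (rule nonant_reflect[OF nonant_mono[OF adm_nonant[OF a(2)] le] w1])
    then have U2: "U ?w2 = U w" using U1 by simp
    have cc: "cut (cut t ?T) (U w) = cut t (U w)"
    proof -
      have "min (min (ennreal t) ?T) (U w) = min (ennreal t) (U w)"
        using UT by (metis min.absorb2 min.assoc)
      then show ?thesis using t unfolding cut_def[of "cut t ?T"] by (simp add: ennreal_cut) (simp add: cut_def)
    qed
    have cc2: "cut (cut t (U w)) ?T = cut t (U w)"
      using t UT by (intro cut_eq) (auto simp: ennreal_cut intro: min.coboundedI2)
    have cc3: "cut (cut t (U w)) (U w) = cut t (U w)"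
      using t by (intro cut_eq) (auto simp: ennreal_cut)
    have r1: "?w1 s = 2 * w (cut s (U w)) - w s" if "0 \<le> s" for s
      using that by (simp add: reflect_def)
    have r2: "?w2 s = 2 * ?w1 (cut s ?T) - ?w1 s" if "0 \<le> s" for s
      using that by (simp add: reflect_def)
    have "reflect U ?w2 t = 2 * ?w2 (cut t (U w)) - ?w2 t" using t U2 by (simp add: reflect_def)
    also have "\<dots> = 2 * w (cut t ?T) - w t"
      using t by (simp add: r2 r1 cc cc2 cc3)
    finally show "reflect (\<lambda>w. T (reflect U w)) w t = reflect U ?w2 t"
      using t by (simp add: reflect_def)
  qed (auto intro: reflect_in_W w)
  have "preserving (\<lambda>w. reflect U (reflect T (reflect U w)))"
    using preserving_comp[of "reflect U" "\<lambda>w. reflect T (reflect U w)"] preserving_comp[of "reflect T" "reflect U"] g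
    by (simp add: good_def)
  moreover have "distr \<mu> path_space (reflect (\<lambda>w. T (reflect U w)))
    = distr \<mu> path_space (\<lambda>w. reflect U (reflect T (reflect U w)))"
    by (intro distr_cong refl) (simp add: eq)
  moreover have "adm (\<lambda>w. T (reflect U w))" using a le by (rule adm_comp_reflect)
  ultimately show ?thesis
    unfolding good_def preserving_def by (auto simp: adm_def reflect_measurable)
qed

lemma reflect_top: "w \<in> W \<Longrightarrow> T w = \<top> \<Longrightarrow> reflect T w = w"
  by (intro W_eqI reflect_in_W) (auto simp: reflect_def)

lemma good_top: "good (\<lambda>_. \<top>)"
proof -
  have "distr \<mu> path_space (reflect (\<lambda>_. \<top>)) = distr \<mu> \<mu> (\<lambda>w. w)"
    by (intro distr_cong) (auto simp: reflect_top)
  then show ?thesis unfolding good_def preserving_def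
    by (auto simp: adm_const intro!: reflect_measurable)
qed

text \<open>Pointwise convergence gives convergence of the integrals of bounded continuous functions
  of finitely many coordinates. These determine the probabilities of the finite-dimensional lower
  orthants, an intersection-stable family that generates the \<sigma>-algebra.\<close>

lemma preserving_limit:
  assumes f: "\<And>n. preserving (f n)" and g: "g \<in> path_space \<rightarrow>\<^sub>M path_space"
    and lim: "\<And>w t. w \<in> W \<Longrightarrow> 0 \<le> t \<Longrightarrow> (\<lambda>n. f n w t) \<longlonglongrightarrow> g w t"
  shows "preserving g"
proof -
  define G :: "(real \<Rightarrow> real) set set" where
    "G = {{w\<in>W. \<forall>t\<in>I. w t \<le> c t} | I c. finite I \<and> I \<subseteq> {0..}}"
  have gm: "g \<in> \<mu> \<rightarrow>\<^sub>M path_space" using g measurable_cong_sets[OF sets_law refl] by auto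
  interpret D: prob_space "distr \<mu> path_space g" by (rule prob_space_distr[OF gm])
  have G_sets: "G \<subseteq> sets path_space"
  proof
    fix B assume "B \<in> G"
    then obtain I c where B: "B = {w\<in>W. \<forall>t\<in>I. w t \<le> c t}" "finite I" by (auto simp: G_def)
    have "Measurable.pred path_space (\<lambda>w. \<forall>t\<in>I. w t \<le> c t)"
    proof (rule pred_intros_finite(3)[OF B(2)])
      fix t show "Measurable.pred path_space (\<lambda>w. w t \<le> c t)"
        unfolding pred_def by (rule borel_measurable_le[OF eval_measurable]) simp
    qed
    then show "B \<in> sets path_space" by (simp add: B pred_def)
  qed
  have gen: "sets path_space = sigma_sets W G"
  proof (rule antisym)
    show "sigma_sets W G \<subseteq> sets path_space" using G_sets by (rule sets.sigma_sets_subset)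
    have sp: "G \<subseteq> Pow W" using G_sets sets.sets_into_space by blast
    have sp1: "space (sigma W G) = W" by (rule space_measure_of[OF sp])
    have sp2: "sets (sigma W G) = sigma_sets W G" by (rule sets_measure_of[OF sp])
    have id: "(\<lambda>w. w) \<in> sigma W G \<rightarrow>\<^sub>M path_space"
    proof (rule measurable_path_spaceI)
      fix t :: real assume t: "0 \<le> t"
      show "(\<lambda>w. w t) \<in> borel_measurable (sigma W G)"
      proof (rule borel_measurableI_le)
        fix y
        have "{w\<in>W. w t \<le> y} = {w\<in>W. \<forall>s\<in>{t}. w s \<le> y}" by auto
        then have "{w\<in>W. w t \<le> y} \<in> G" unfolding G_def using t
          by (intro CollectI exI[of _ "{t}"] exI[of _ "\<lambda>_. y"]) auto
        then show "{x \<in> space (sigma W G). x t \<le> y} \<in> sets (sigma W G)"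
          unfolding sp1 sp2 by (rule sigma_sets.Basic)
      qed
    qed (simp only: sp1)
    have "B \<in> sigma_sets W G" if "B \<in> sets path_space" for B
    proof -
      have "(\<lambda>w. w) -` B \<inter> space (sigma W G) \<in> sets (sigma W G)"
        using id that by (rule measurable_sets)
      moreover have "(\<lambda>w. w) -` B \<inter> space (sigma W G) = B"
        using sets.sets_into_space[OF that] unfolding sp1 by auto
      ultimately show ?thesis by (simp only: sp2)
    qed
    then show "sets path_space \<subseteq> sigma_sets W G" by auto
  qed
  have eqG: "emeasure (distr \<mu> path_space g) B = emeasure \<mu> B" if B: "B \<in> G" for B
  proof -
    obtain I c where I: "B = {w\<in>W. \<forall>t\<in>I. w t \<le> c t}" "finite I" "I \<subseteq> {0..}" using B by (auto simp: G_def)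
    \<comment> \<open>A continuous piecewise linear function, \<open>1\<close> on the negative
      half-line and \<open>0\<close> from \<open>1 / k\<close> on; it decreases to the indicator of
      the closed half-line.\<close>
    define \<phi> :: "nat \<Rightarrow> real \<Rightarrow> real" where "\<phi> k x = max 0 (min 1 (1 - real k * x))" for k x
    define F where "F k w = (\<Prod>t\<in>I. \<phi> k (w t - c t))" for k and w :: "real \<Rightarrow> real"
    have \<phi>_cont: "continuous_on UNIV (\<phi> k)" for k unfolding \<phi>_def by (intro continuous_intros)
    have \<phi>01: "0 \<le> \<phi> k x" "\<phi> k x \<le> 1" for k x by (auto simp: \<phi>_def)
    have F01: "0 \<le> F k w" "F k w \<le> 1" for k w
      unfolding F_def by (auto intro!: prod_nonneg prod_le_1 \<phi>01)
    have Fm: "F k \<in> borel_measurable path_space" for k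
      unfolding F_def
    proof (rule borel_measurable_prod)
      fix t
      have "(\<lambda>w. w t - c t) \<in> borel_measurable path_space"
        by (intro borel_measurable_diff eval_measurable borel_measurable_const)
      then show "(\<lambda>w. \<phi> k (w t - c t)) \<in> borel_measurable path_space"
        by (rule measurable_compose[OF _ borel_measurable_continuous_onI[OF \<phi>_cont]])
    qed
    have meas: "h \<in> path_space \<rightarrow>\<^sub>M path_space \<Longrightarrow> (\<lambda>w. F k (h w)) \<in> borel_measurable \<mu>" for h k
      using measurable_compose[OF _ Fm] measurable_cong_sets[OF sets_law refl] by blast
    have step1: "(\<integral>w. F k (g w) \<partial>\<mu>) = (\<integral>w. F k w \<partial>\<mu>)" for k
    proof -
      have "(\<lambda>n. \<integral>w. F k (f n w) \<partial>\<mu>) \<longlonglongrightarrow> (\<integral>w. F k (g w) \<partial>\<mu>)"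
      proof (rule integral_dominated_convergence[where w="\<lambda>_. 1"])
        show "AE w in \<mu>. (\<lambda>n. F k (f n w)) \<longlonglongrightarrow> F k (g w)"
        proof (rule AE_I2)
          fix w assume "w \<in> space \<mu>"
          then have w: "w \<in> W" by simp
          have "(\<lambda>n. \<phi> k (f n w t - c t)) \<longlonglongrightarrow> \<phi> k (g w t - c t)" if "t \<in> I" for t
            by (rule continuous_on_tendsto_compose[OF \<phi>_cont])
              (use lim[OF w] that I in \<open>auto intro!: tendsto_intros\<close>)
          then show "(\<lambda>n. F k (f n w)) \<longlonglongrightarrow> F k (g w)" unfolding F_def by (rule tendsto_prod)
        qed
      qed (use f g in \<open>auto intro!: meas simp: F01 preserving_def\<close>)
      moreover have "(\<integral>w. F k (f n w) \<partial>\<mu>) = (\<integral>w. F k w \<partial>\<mu>)" for n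
        using f Fm by (rule preserving_integral)
      ultimately show ?thesis by (simp add: LIMSEQ_const_iff)
    qed
    have conv: "(\<lambda>k. \<integral>w. F k (h w) \<partial>\<mu>) \<longlonglongrightarrow> (\<integral>w. indicator B (h w) \<partial>\<mu>)"
      if h: "h \<in> path_space \<rightarrow>\<^sub>M path_space" for h
    proof (rule integral_dominated_convergence[where w="\<lambda>_. 1"])
      show "AE w in \<mu>. (\<lambda>k. F k (h w)) \<longlonglongrightarrow> indicator B (h w)"
      proof (rule AE_I2)
        fix w assume "w \<in> space \<mu>"
        then have hw: "h w \<in> W" using h by (auto dest: measurable_space)
        have *: "(\<lambda>k. \<phi> k x) \<longlonglongrightarrow> (if x \<le> 0 then 1 else 0)" for x
        proof (cases "x \<le> 0")
          case True
          have "\<phi> k x = 1" for k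
            unfolding \<phi>_def using mult_nonneg_nonpos[of "real k" x] True by (simp add: max_def min_def)
          then show ?thesis using True by simp
        next
          case False
          then obtain k0 :: nat where "1 < real k0 * x" using reals_Archimedean3 by (metis not_le)
          have "\<phi> k x = 0" if "k \<ge> k0" for k
          proof -
            have "real k0 * x \<le> real k * x" using that False by (intro mult_right_mono) auto
            then have "1 - real k * x \<le> 0" using \<open>1 < real k0 * x\<close> by linarith
            then show ?thesis unfolding \<phi>_def by (simp only: min.coboundedI2 max.absorb1)
          qed
          then have "(\<lambda>k. \<phi> k x) \<longlonglongrightarrow> 0"
            by (intro tendsto_eventually) (auto simp: eventually_sequentially)
          then show ?thesis using False by simp
        qed
        have "(\<lambda>k. F k (h w)) \<longlonglongrightarrow> (\<Prod>t\<in>I. if h w t - c t \<le> 0 then 1 else 0)"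
          unfolding F_def by (rule tendsto_prod) (rule *)
        moreover have "(\<Prod>t\<in>I. if h w t - c t \<le> 0 then 1 else 0::real) = indicator B (h w)"
        proof (cases "\<forall>t\<in>I. h w t \<le> c t")
          case True
          then show ?thesis using hw by (simp add: I(1))
        next
          case False
          then have "(\<Prod>t\<in>I. if h w t - c t \<le> 0 then 1 else 0::real) = 0"
            using I(2) by (intro prod_zero) auto
          then show ?thesis using False by (auto simp: I(1))
        qed
        ultimately show "(\<lambda>k. F k (h w)) \<longlonglongrightarrow> indicator B (h w)" by simp
      qed
      have "(\<lambda>w. indicator B w :: real) \<in> borel_measurable path_space" using B G_sets by auto
      from measurable_compose[OF h this] show "(\<lambda>w. indicator B (h w) :: real) \<in> borel_measurable \<mu>"
        using measurable_cong_sets[OF sets_law refl] by blast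
    qed (use h in \<open>auto intro!: meas simp: F01\<close>)
    have "(\<integral>w. indicator B (g w) \<partial>\<mu>) = (\<integral>w. indicator B w \<partial>\<mu> :: real)"
      using conv[OF g] conv[of "\<lambda>w. w"] step1 by (simp add: LIMSEQ_unique)
    moreover have BS: "B \<in> sets path_space" using B G_sets by auto
    moreover have "(\<integral>w. indicator B (g w) \<partial>\<mu>) = (\<integral>w. indicator B w \<partial>distr \<mu> path_space g :: real)"
      using BS by (subst integral_distr[OF gm]) auto
    ultimately have "measure (distr \<mu> path_space g) B = measure \<mu> B"
      using sets.Int_space_eq2[OF BS] by simp
    then show ?thesis using BS by (simp add: D.emeasure_eq_measure emeasure_eq_measure)
  qed
  have "distr \<mu> path_space g = \<mu>"
  proof (rule measure_eqI_generator_eq[where E=G and \<Omega>=W and A="\<lambda>_. W"])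
    show "Int_stable G"
    proof (rule Int_stableI)
      fix a b assume "a \<in> G" "b \<in> G"
      then obtain I c J d where I: "a = {w\<in>W. \<forall>t\<in>I. w t \<le> c t}" "finite I" "I \<subseteq> {0..}"
        and J: "b = {w\<in>W. \<forall>t\<in>J. w t \<le> d t}" "finite J" "J \<subseteq> {0..}" by (auto simp: G_def)
      let ?e = "\<lambda>t. if t \<in> I \<and> t \<in> J then min (c t) (d t) else if t \<in> I then c t else d t"
      have "a \<inter> b = {w\<in>W. \<forall>t\<in>I \<union> J. w t \<le> ?e t}" unfolding I J by auto
      then show "a \<inter> b \<in> G" unfolding G_def using I J by (intro CollectI exI[of _ "I \<union> J"] exI[of _ ?e]) auto
    qed
    have "W = {w\<in>W. \<forall>t\<in>{}. w t \<le> (0::real)}" by simp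
    then have "W \<in> G" unfolding G_def by (intro CollectI exI[of _ "{}"] exI[of _ "\<lambda>_. 0"]) auto
    then show "range (\<lambda>_. W) \<subseteq> G" by auto
    show "G \<subseteq> Pow W" by (auto simp: G_def)
    show "emeasure (distr \<mu> path_space g) W \<noteq> \<infinity>" for i :: nat
      by (metis D.emeasure_finite infinity_ennreal_def)
  qed (auto simp: gen eqG)
  then show ?thesis using g by (simp add: preserving_def)
qed

end

lemma adm_cong: "adm T \<Longrightarrow> (\<And>w. w \<in> W \<Longrightarrow> T' w = T w) \<Longrightarrow> adm T'"
  unfolding adm_def nonant_def using measurable_cong[of path_space T' T borel] by metis

lemma (in path_law) good_cong:
  assumes T: "good T" and eq: "\<And>w. w \<in> W \<Longrightarrow> T' w = T w"
  shows "good T'"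
proof -
  have "distr \<mu> path_space (reflect T') = distr \<mu> path_space (reflect T)"
    by (intro distr_cong refl) (simp add: reflect_def eq)
  then show ?thesis
    using adm_cong[OF good_adm[OF T] eq] T
    unfolding good_def preserving_def by (auto simp: adm_def reflect_measurable)
qed

lemma hit_reflect:
  assumes "adm S" "w \<in> W"
  shows "hit S c (reflect S w) = hit S (- c) w"
proof -
  have S: "S (reflect S w) = S w" using assms by (rule adm_reflect)
  have "{t. 0 \<le> t \<and> S w \<le> ennreal t \<and> reflect S w t - reflect S w (enn2real (S w)) = c}
      = {t. 0 \<le> t \<and> S w \<le> ennreal t \<and> w t - w (enn2real (S w)) = - c}"
  proof (intro Collect_cong conj_cong refl)
    fix t :: real assume t: "0 \<le> t" "S w \<le> ennreal t"
    then obtain s where s: "S w = ennreal s" "0 \<le> s" by (cases "S w") (auto simp: top_unique)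
    have "reflect S w t = 2 * w s - w t" using t s by (simp add: reflect_after)
    moreover have "reflect S w s = w s" using s by (simp add: reflect_before)
    ultimately show "(reflect S w t - reflect S w (enn2real (S w)) = c) = (w t - w (enn2real (S w)) = - c)"
      using s by auto
  qed
  then show ?thesis unfolding hit_def S by simp
qed

text \<open>Changes the base point: the level \<open>c + e\<close> seen from \<open>S\<close> is the
  level \<open>e\<close> seen from the hit of \<open>c\<close>. The last hypothesis rules out that
  \<open>c + e\<close> is visited before \<open>c\<close>.\<close>

lemma hit_shift:
  assumes w: "w \<in> W" and S': "S' w = hit S c w" and le: "S' w \<le> hit S (c + e) w"
  shows "hit S' e w = hit S (c + e) w"
proof (cases "S' w = \<top>")
  case True
  then have "hit S' e w = \<top>" using hit_ge[of S' w e] by (simp add: top_unique)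
  then show ?thesis using True le by (simp add: top_unique)
next
  case False
  then obtain s' where s': "S' w = ennreal s'" "0 \<le> s'" by (cases "S' w") auto
  have ws: "w s' - w (enn2real (S w)) = c" using hit_finite(2)[OF w _ s'(2)] S' s' by metis
  have "{t. 0 \<le> t \<and> S' w \<le> ennreal t \<and> w t - w (enn2real (S' w)) = e}
      = {t. 0 \<le> t \<and> S w \<le> ennreal t \<and> w t - w (enn2real (S w)) = c + e}" (is "?A = ?B")
  proof (rule Collect_cong, rule conj_cong[OF refl])
    fix t :: real assume t: "0 \<le> t"
    have 1: "S w \<le> S' w" using S' hit_ge by metis
    show "S' w \<le> ennreal t \<and> w t - w (enn2real (S' w)) = e
       \<longleftrightarrow> (S w \<le> ennreal t \<and> w t - w (enn2real (S w)) = c + e)" (is "?P = ?Q")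
    proof
      assume ?P then show ?Q using 1 s' ws by (auto intro: order_trans)
    next
      assume Q: ?Q
      then have "hit S (c + e) w \<le> ennreal t" using t by (intro hit_le) auto
      then show ?P using le s' ws Q by (auto intro: order_trans)
    qed
  qed
  then show ?thesis unfolding hit_def by (simp only:)
qed

context path_law
begin

text \<open>\<open>Y\<close> is the hit of one side, the side being chosen by an event known at
  \<open>S\<close>. Reflection at \<open>S\<close> exchanges the sides, so the conjugated time hits
  the opposite one, and selecting between the two along \<open>E\<close> isolates each side.\<close>

lemma good_hit_mirror:
  assumes S: "good S" and Y: "good Y" and le: "\<And>w. w \<in> W \<Longrightarrow> S w \<le> Y w"
    and E: "nonant S E" "Measurable.pred path_space E"
    and eq: "\<And>w. w \<in> W \<Longrightarrow> Y w = (if E w then hit S c w else hit S (- c) w)"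
  shows "good (hit S c)" "good (hit S (- c))"
proof -
  let ?Y' = "\<lambda>w. Y (reflect S w)"
  have Y': "good ?Y'" using Y S le by (rule good_comp_reflect)
  have Y'eq: "?Y' w = (if E w then hit S (- c) w else hit S c w)" if "w \<in> W" for w
    using that eq[OF reflect_in_W[OF that]] hit_reflect[OF good_adm[OF S] that] nonant_reflect[OF E(1) that]
    by simp
  have le': "S w \<le> min (Y w) (?Y' w)" "S w \<le> min (?Y' w) (Y w)" if "w \<in> W" for w
    using le[OF that] le[OF reflect_in_W[OF that]] adm_reflect[OF good_adm[OF S] that] by (metis min.bounded_iff)+
  have "good (\<lambda>w. if E w then Y w else ?Y' w)"
    using le' by (intro good_mix Y Y' E(2) nonant_mono[OF E(1)])
  then show "good (hit S c)" by (rule good_cong) (simp add: eq Y'eq)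
  have "good (\<lambda>w. if E w then ?Y' w else Y w)"
    using le' by (intro good_mix Y Y' E(2) nonant_mono[OF E(1)])
  then show "good (hit S (- c))" by (rule good_cong) (simp add: eq Y'eq)
qed

text \<open>From a good time at which the levels at distance \<open>l\<close> and \<open>r\<close> are good, the
  distances become \<open>2 l\<close> and \<open>r - l\<close> once the path has moved by \<open>\<plusminus>l\<close>: after a move to
  \<open>+l\<close>, the level \<open>-l\<close> is at distance \<open>2 l\<close> and the level \<open>+r\<close> at distance \<open>r - l\<close>.\<close>

lemma good_hit_step:
  assumes P: "good (hit S l)" "good (hit S (- l))" "good (hit S r)" "good (hit S (- r))"
    and S: "adm S" and lr: "0 < l" "l < r"
  defines "S' \<equiv> \<lambda>w. min (hit S l w) (hit S (- l) w)"
  shows "good S'" "good (hit S' (2 * l))" "good (hit S' (- (2 * l)))"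
    "good (hit S' (r - l))" "good (hit S' (- (r - l)))"
proof -
  have a: "adm (hit S l)" "adm (hit S (- l))" using P by (auto simp: good_def)
  show S': "good S'" unfolding S'_def by (intro good_min P)
  let ?E = "\<lambda>w. hit S (- l) w < hit S l w"
  have E: "nonant S' ?E" unfolding S'_def min.commute[of "hit S l _"] by (intro adm_min_nonant a)
  have Em: "Measurable.pred path_space ?E" by (intro pred_less_adm a)
  \<comment> \<open>A level at distance at least \<open>l\<close> cannot be reached before the path
    has left the interval around its position at \<open>S\<close>.\<close>
  have lo: "S' w \<le> hit S c w" if "w \<in> W" "l \<le> \<bar>c\<bar>" for w c
  proof (rule hit_cases[OF that(1), of S c])
    fix t assume t: "0 \<le> t" "hit S c w = ennreal t" "S w \<le> ennreal t" "w t - w (enn2real (S w)) = c"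
    then show ?thesis using hit_IVT[OF that(1), of t S l] lr that(2) by (auto simp: S'_def min_le_iff_disj)
  qed simp
  \<comment> \<open>Once the path has left on one side, the later of the two hits is the crossing of
    the whole interval, upwards if the exit was at \<open>- l\<close> and downwards
    otherwise.\<close>
  have Y1: "max (hit S l w) (hit S (- l) w) = (if ?E w then hit S' (2 * l) w else hit S' (- (2 * l)) w)"
    if w: "w \<in> W" for w
  proof (cases "?E w")
    case True
    then have "S' w = hit S (- l) w" unfolding S'_def by (intro min.absorb2 less_imp_le)
    then have "hit S' (2 * l) w = hit S (- l + 2 * l) w"
      using lo[OF w, of l] lr by (intro hit_shift w) auto
    moreover have "max (hit S l w) (hit S (- l) w) = hit S l w"
      using True by (intro max.absorb1 less_imp_le)
    ultimately show ?thesis using True by simp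
  next
    case False
    then have "S' w = hit S l w" unfolding S'_def by (intro min.absorb1) (simp only: not_less)
    then have "hit S' (- (2 * l)) w = hit S (l + - (2 * l)) w"
      using lo[OF w, of "- l"] lr by (intro hit_shift w) auto
    moreover have "max (hit S l w) (hit S (- l) w) = hit S (- l) w"
      using False by (intro max.absorb2) (simp add: not_less)
    ultimately show ?thesis using False by simp
  qed
  show "good (hit S' (2 * l))" "good (hit S' (- (2 * l)))"
    by (rule good_hit_mirror[OF S' good_max[OF P(1,2)] _ E Em Y1]; simp add: S'_def min.coboundedI1 max.coboundedI1)+
  \<comment> \<open>The outer level on the side of the exit: from the exit point it lies at distance
    \<open>r - l\<close> in the same direction.\<close>
  let ?Y = "\<lambda>w. if ?E w then hit S (- r) w else hit S r w"
  have le2: "S' w \<le> hit S (- r) w" "S' w \<le> hit S r w" if "w \<in> W" for w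
    using lo[OF that] lr by auto
  have Y: "good ?Y" using le2 by (intro good_mix P Em nonant_mono[OF E]) auto
  have Y2: "?Y w = (if ?E w then hit S' (- (r - l)) w else hit S' (- (- (r - l))) w)"
    if w: "w \<in> W" for w
  proof (cases "?E w")
    case True
    then have "S' w = hit S (- l) w" unfolding S'_def by (intro min.absorb2 less_imp_le)
    then have "hit S' (- (r - l)) w = hit S (- l + - (r - l)) w"
      using le2[OF w] by (intro hit_shift w) auto
    then show ?thesis using True by simp
  next
    case False
    then have "S' w = hit S l w" unfolding S'_def by (intro min.absorb1) (simp only: not_less)
    then have "hit S' (r - l) w = hit S (l + (r - l)) w"
      using le2[OF w] by (intro hit_shift w) auto
    then show ?thesis using False by simp
  qed
  have le3: "S' w \<le> ?Y w" if "w \<in> W" for w using le2[OF that] by simp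
  show "good (hit S' (- (r - l)))" by (rule good_hit_mirror(1)[OF S' Y le3 E Em Y2])
  have "good (hit S' (- (- (r - l))))" by (rule good_hit_mirror(2)[OF S' Y le3 E Em Y2])
  then show "good (hit S' (r - l))" by simp
qed

end

section \<open>Grids of hitting times\<close>

text \<open>The step may depend on the index: the grids of good times have varying distances, while
  the dyadic grids used later have a constant one.\<close>

primrec grid :: "(nat \<Rightarrow> real) \<Rightarrow> nat \<Rightarrow> (real \<Rightarrow> real) \<Rightarrow> ennreal" where
  "grid d 0 = (\<lambda>_. 0)"
| "grid d (Suc j) = (\<lambda>w. min (hit (grid d j) (d j) w) (hit (grid d j) (- d j) w))"

lemma grid_mono_Suc: "grid d j w \<le> grid d (Suc j) w"
  by (simp add: hit_ge)

lemma grid_mono: "i \<le> j \<Longrightarrow> grid d i w \<le> grid d j w"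
  by (rule lift_Suc_mono_le[of "\<lambda>j. grid d j w", OF grid_mono_Suc])

lemma adm_grid: "(\<And>j. d j \<noteq> 0) \<Longrightarrow> adm (grid d j)"
  by (induction j) (auto intro!: adm_const adm_min adm_hit)

lemma grid_Suc_finite:
  assumes w: "w \<in> W" and d: "0 < d j" and t: "0 \<le> t" "grid d (Suc j) w = ennreal t"
  obtains s where "0 \<le> s" "s < t" "grid d j w = ennreal s" "\<bar>w t - w s\<bar> = d j"
proof -
  consider "hit (grid d j) (d j) w = ennreal t" | "hit (grid d j) (- d j) w = ennreal t"
    using t(2) by (auto simp: min_def split: if_splits)
  then have *: "grid d j w \<le> ennreal t \<and> \<bar>w t - w (enn2real (grid d j w))\<bar> = d j"
  proof cases
    case 1
    then show ?thesis using hit_finite[OF w 1 t(1)] d by auto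
  next
    case 2
    then show ?thesis using hit_finite[OF w 2 t(1)] d by auto
  qed
  then obtain s where s: "0 \<le> s" "grid d j w = ennreal s"
    by (cases "grid d j w") (auto simp: top_unique)
  then have "s \<noteq> t" "s \<le> t" using * d t(1) by auto
  then show thesis using that[of s] s * by auto
qed

lemma grid_before:
  assumes w: "w \<in> W" and d: "0 < d j" and t: "0 \<le> t" "grid d j w \<le> ennreal t"
    and lt: "ennreal t < grid d (Suc j) w"
  shows "\<bar>w t - w (enn2real (grid d j w))\<bar> < d j"
proof (rule ccontr)
  assume "\<not> ?thesis"
  then have "hit (grid d j) (d j) w \<le> ennreal t \<or> hit (grid d j) (- d j) w \<le> ennreal t"
    using w d t by (intro hit_IVT) auto
  then show False using lt by auto
qed

lemma grid_osc:
  assumes w: "w \<in> W" and d: "0 < d j" and t: "0 \<le> t" "grid d j w \<le> ennreal t"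
    and le: "ennreal t \<le> grid d (Suc j) w"
  shows "\<bar>w t - w (enn2real (grid d j w))\<bar> \<le> d j"
proof (cases "ennreal t = grid d (Suc j) w")
  case True
  then obtain s where "grid d j w = ennreal s" "0 \<le> s" "\<bar>w t - w s\<bar> = d j"
    using grid_Suc_finite[of w d j t, OF w d t(1)] by metis
  then show ?thesis by simp
next
  case False
  then have "ennreal t < grid d (Suc j) w" by (rule le_neq_trans[OF le])
  then show ?thesis by (rule less_imp_le[OF grid_before[OF w d t]])
qed

text \<open>If the grid points stayed bounded they would converge, and by continuity so would the
  path along them; but infinitely many of its steps have size at least
  \<open>\<delta>\<close>.\<close>

lemma grid_unbounded:
  assumes w: "w \<in> W" and d: "\<And>j. 0 < d j" and \<delta>: "0 < \<delta>" "\<And>j. \<exists>i\<ge>j. \<delta> \<le> d i"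
  shows "\<exists>j. ennreal t < grid d j w"
proof (rule ccontr)
  assume "\<not> ?thesis"
  then have le: "\<And>j. grid d j w \<le> ennreal t" by (auto simp: not_less)
  define s where "s j = enn2real (grid d j w)" for j
  have s: "grid d j w = ennreal (s j)" "0 \<le> s j" for j
    using le[of j] by (auto simp: s_def ennreal_enn2real_if top_unique)
  have "incseq s"
    using grid_mono[of _ _ d w] s by (intro incseq_SucI) (metis ennreal_le_iff le_Suc_eq order_refl)
  have t0: "0 \<le> t \<or> grid d 0 w = 0" by simp
  have "s j \<le> max t 0" for j
    using le[of j] s[of j] by (cases "0 \<le> t") (auto simp: ennreal_neg)
  then obtain l where l: "s \<longlonglongrightarrow> l" using incseq_convergent[OF \<open>incseq s\<close>] by metis
  have "l \<ge> 0" using LIMSEQ_le_const[OF l] s by blast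
  have "(\<lambda>j. w (s j)) \<longlonglongrightarrow> w l"
    using \<open>l \<ge> 0\<close> s by (intro continuous_on_tendsto_compose[OF W_cont[OF w] l]) auto
  then have c: "Cauchy (\<lambda>j. w (s j))" by (rule LIMSEQ_imp_Cauchy)
  then obtain N where N: "\<And>m n. m \<ge> N \<Longrightarrow> n \<ge> N \<Longrightarrow> dist (w (s m)) (w (s n)) < \<delta>"
    using \<delta>(1) unfolding Cauchy_def by blast
  obtain i where i: "i \<ge> N" "\<delta> \<le> d i" using \<delta>(2) by blast
  obtain s' where s': "0 \<le> s'" "grid d i w = ennreal s'" "\<bar>w (s (Suc i)) - w s'\<bar> = d i"
    using grid_Suc_finite[of w d i "s (Suc i)", OF w d s(2) s(1)] by metis
  then have "s' = s i" using s[of i] by simp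
  then show False using N[of "Suc i" i] i s' by (auto simp: dist_real_def)
qed

context path_law
begin

text \<open>Every nonanticipating time is a limit of good times: the first point of a grid after it.\<close>

lemma good_of_grids:
  assumes grids: "\<And>\<epsilon>. 0 < \<epsilon> \<Longrightarrow> \<exists>d \<delta>. (\<forall>j. good (grid d j)) \<and> (\<forall>j. 0 < d j \<and> d j \<le> \<epsilon>) \<and> 0 < \<delta> \<and> (\<forall>j. \<exists>i\<ge>j. \<delta> \<le> d i)"
    and T: "adm T"
  shows "good T"
proof -
  define \<epsilon> where "\<epsilon> n = 1 / real (Suc n)" for n
  have \<epsilon>pos: "0 < \<epsilon> n" for n by (simp add: \<epsilon>_def)
  obtain d \<delta> where d: "\<And>n j. good (grid (d n) j)" "\<And>n j. 0 < d n j" "\<And>n j. d n j \<le> \<epsilon> n"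
    and \<delta>: "\<And>n::nat. 0 < \<delta> n" "\<And>n j. \<exists>i\<ge>j. \<delta> n \<le> d n i"
    using grids[OF \<epsilon>pos] by metis
  note unb = grid_unbounded[where d="d n" and \<delta>="\<delta> n" for n, OF _ d(2) \<delta>]
  \<comment> \<open>Grid points before \<open>T\<close> are sent to infinity, so that the infimum
    over \<open>j\<close> is the first grid point not before \<open>T\<close>.\<close>
  define V where "V n j w = (if T w \<le> grid (d n) j w then grid (d n) j w else \<top>)" for n j w
  define M where "M n J w = Min ((\<lambda>j. V n j w) ` {..J})" for n J w
  define T' where "T' n w = (INF j. V n j w)" for n w
  have agrid: "adm (grid (d n) j)" for n j using d(1) by (rule good_adm)
  have V: "good (V n j)" for n j
    unfolding V_def
    using adm_min_nonant(1)[OF T agrid[of n j]]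
    by (intro good_mix d(1) good_top pred_le_adm T agrid) (auto intro: nonant_mono)
  have M: "good (M n J)" for n J
  proof (induction J)
    case 0
    then show ?case using V[of n 0] by (simp add: M_def[abs_def])
  next
    case (Suc J)
    have "M n (Suc J) w = min (M n J w) (V n (Suc J) w)" for w
      unfolding M_def atMost_Suc by (simp add: min.commute)
    then show ?case using good_min[OF Suc V[of n "Suc J"]] by (simp add: fun_eq_iff[symmetric])
  qed
  have T'm: "T' n \<in> borel_measurable path_space" for n
    unfolding T'_def using good_adm[OF V] by (intro borel_measurable_INF) (auto simp: adm_def)
  have pT': "preserving (reflect (T' n))" for n
  \<comment> \<open>On a bounded time interval only finitely many grid points occur, hence the
    finite minima eventually give the same reflected path as the infimum.\<close>
  proof (rule preserving_limit[where f="\<lambda>J. reflect (M n J)"])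
    fix w t assume w: "w \<in> W" and t: "0 \<le> (t::real)"
    obtain J where J: "ennreal t < grid (d n) J w" using unb[OF w] by blast
    have "min (ennreal t) (M n K w) = min (ennreal t) (T' n w)" if K: "K \<ge> J" for K
    proof (rule antisym)
      have "T' n w \<le> M n K w" unfolding M_def T'_def by (auto intro: INF_lower)
      then show "min (ennreal t) (T' n w) \<le> min (ennreal t) (M n K w)" by (intro min.mono) auto
      have "min (ennreal t) (M n K w) \<le> V n j w" for j
      proof (cases "j \<le> K")
        case True
        then have "M n K w \<le> V n j w" unfolding M_def by (intro Min_le) auto
        then show ?thesis by (simp add: min.coboundedI2)
      next
        case False
        then have "ennreal t < grid (d n) j w" using J K grid_mono[of J j "d n" w] by (auto intro: less_le_trans)
        then show ?thesis by (auto simp: V_def min.coboundedI1)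
      qed
      then show "min (ennreal t) (M n K w) \<le> min (ennreal t) (T' n w)"
        by (auto simp: T'_def intro: INF_greatest)
    qed
    then have "reflect (M n K) w t = reflect (T' n) w t" if "K \<ge> J" for K
      using that by (simp add: reflect_def cut_def)
    then show "(\<lambda>K. reflect (M n K) w t) \<longlonglongrightarrow> reflect (T' n) w t"
      by (intro tendsto_eventually) (auto simp: eventually_sequentially)
  qed (use M T'm in \<open>auto simp: good_def intro: reflect_measurable\<close>)
  have lim: "(\<lambda>n. reflect (T' n) w t) \<longlonglongrightarrow> reflect T w t" if w: "w \<in> W" and t: "0 \<le> t" for w t
  proof -
    have TT': "T w \<le> T' n w" for n
      unfolding T'_def by (rule INF_greatest) (simp add: V_def)
    have bd: "\<bar>reflect (T' n) w t - reflect T w t\<bar> \<le> 4 * \<epsilon> n" for n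
    proof (cases "ennreal t \<le> T w")
      case True
      then have "reflect (T' n) w t = reflect T w t"
        using t TT'[of n] by (simp add: reflect_before order_trans)
      then show ?thesis using \<epsilon>pos[of n] by simp
    next
      case False
      then obtain s where s: "0 \<le> s" "T w = ennreal s" "s < t"
        by (cases "T w") (auto simp: not_le ennreal_less_iff)
      obtain J where "ennreal s < grid (d n) J w" using unb[OF w] by blast
      then have ex: "\<exists>j. T w \<le> grid (d n) j w" using s by (auto intro: less_imp_le)
      define j where "j = (LEAST j. T w \<le> grid (d n) j w)"
      have j: "T w \<le> grid (d n) j w" unfolding j_def using ex by (rule LeastI_ex)
      have jl: "grid (d n) i w < T w" if "i < j" for i
        using not_less_Least that unfolding j_def by fastforce
      have T'j: "T' n w = grid (d n) j w"
      proof (rule antisym)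
        have "T' n w \<le> V n j w" unfolding T'_def by (rule INF_lower) simp
        then show "T' n w \<le> grid (d n) j w" using j by (simp add: V_def)
        have "grid (d n) j w \<le> V n i w" for i
          using jl[of i] grid_mono[of j i "d n" w] by (cases "i < j") (auto simp: V_def)
        then show "grid (d n) j w \<le> T' n w" unfolding T'_def by (intro INF_greatest)
      qed
      \<comment> \<open>Both times lie between the same two consecutive grid points, so each value
        is within \<open>\<epsilon> n\<close> of the value at the earlier one. The reflection
        formula doubles this to \<open>4 * \<epsilon> n\<close>.\<close>
      have diff: "\<bar>w (cut t (T' n w)) - w s\<bar> \<le> 2 * \<epsilon> n"
      proof (cases j)
        case 0
        then have "T' n w = 0" "s = 0" using T'j j s by auto
        then show ?thesis using t \<epsilon>pos[of n] by (simp add: cut_eq2)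
      next
        case (Suc i)
        let ?c = "w (enn2real (grid (d n) i w))"
        have 1: "\<bar>w s - ?c\<bar> \<le> d n i"
          using jl[of i] j s Suc by (intro grid_osc w d(2)) auto
        have st: "ennreal s \<le> ennreal t" using s t by (auto intro: ennreal_leI)
        have 2: "\<bar>w (cut t (T' n w)) - ?c\<bar> \<le> d n i"
        proof (rule grid_osc[OF w d(2) cut_nonneg])
          show "ennreal (cut t (T' n w)) \<le> grid (d n) (Suc i) w"
            unfolding ennreal_cut[OF t] T'j Suc by (rule min.cobounded2)
          show "grid (d n) i w \<le> ennreal (cut t (T' n w))"
            unfolding ennreal_cut[OF t] using jl[of i] Suc s(2) st TT'[of n]
            by (metis less_imp_le lessI min.boundedI order_trans)
        qed
        show ?thesis using 1 2 d(3)[of n i] by linarith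
      qed
      have "cut t (T w) = s" using s t by (simp add: cut_real)
      then show ?thesis using diff t by (simp add: reflect_def)
    qed
    have "(\<lambda>n. 4 * \<epsilon> n) \<longlonglongrightarrow> 4 * 0"
      unfolding \<epsilon>_def using LIMSEQ_inverse_real_of_nat by (intro tendsto_mult_left) (simp add: inverse_eq_divide)
    then have z: "(\<lambda>n. 4 * \<epsilon> n) \<longlonglongrightarrow> 0" by simp
    have "(\<lambda>n. reflect (T' n) w t - reflect T w t) \<longlonglongrightarrow> 0"
      by (rule Lim_null_comparison[OF _ z]) (use bd in auto)
    then show ?thesis by (rule LIM_zero_cancel)
  qed
  have "preserving (reflect T)"
    by (rule preserving_limit[OF pT' _ lim]) (use T in \<open>auto simp: adm_def intro: reflect_measurable\<close>)
  then show ?thesis using T by (simp add: good_def)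
qed

end

declare grid.simps(2) [simp del]

section \<open>Arithmetic of the two distances\<close>

text \<open>The rule of \<open>good_hit_step\<close> applied to an unordered pair. The sum of the
  two distances never changes, and modulo this sum the rule is doubling up to sign.\<close>

primrec dists :: "real \<Rightarrow> real \<Rightarrow> nat \<Rightarrow> real \<times> real" where
  "dists a b 0 = (a, b)"
| "dists a b (Suc j) = (case dists a b j of (x, y) \<Rightarrow> (2 * min x y, max x y - min x y))"

text \<open>When the two distances meet, the next pair would contain the distance \<open>0\<close>
  and no further grid point could be formed.\<close>

definition degenerate :: "real \<Rightarrow> real \<Rightarrow> bool" where
  "degenerate a b \<longleftrightarrow> (\<exists>j. fst (dists a b j) = snd (dists a b j))"

lemma dists_sum: "fst (dists a b j) + snd (dists a b j) = a + b"
  by (induction j) (auto simp: split_beta)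

lemma dists_pos:
  assumes "\<not> degenerate a b" "0 < a" "0 < b"
  shows "0 < fst (dists a b j)" "0 < snd (dists a b j)"
proof (induction j)
  case (Suc j)
  have "fst (dists a b j) \<noteq> snd (dists a b j)" using assms(1) by (auto simp: degenerate_def)
  then show "0 < fst (dists a b (Suc j))" "0 < snd (dists a b (Suc j))"
    using Suc by (auto simp: split_beta min_def max_def)
qed (use assms in auto)

text \<open>The two distances are opposite to each other modulo \<open>a + b\<close>, so doubling
  the smaller one is doubling the first one up to sign.\<close>

lemma dists_mod: "\<exists>(k::int) (\<sigma>::int). \<sigma> \<in> {1, -1} \<and> fst (dists a b j) = of_int \<sigma> * 2 ^ j * a + of_int k * (a + b)"
proof (induction j)
  case 0
  then show ?case by (intro exI[of _ 0] exI[of _ 1]) auto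
next
  case (Suc j)
  then obtain k \<sigma> :: int where k: "\<sigma> \<in> {1, -1}" "fst (dists a b j) = of_int \<sigma> * 2 ^ j * a + of_int k * (a + b)" by blast
  have y: "snd (dists a b j) = (a + b) - fst (dists a b j)" using dists_sum[of a b j] by simp
  show ?case
  proof (cases "fst (dists a b j) \<le> snd (dists a b j)")
    case True
    then have "fst (dists a b (Suc j)) = of_int \<sigma> * 2 ^ Suc j * a + of_int (2 * k) * (a + b)"
      using k by (simp add: split_beta algebra_simps)
    then show ?thesis using k by blast
  next
    case False
    then have "fst (dists a b (Suc j)) = 2 * ((a + b) - fst (dists a b j))" using y by (simp add: split_beta)
    also have "\<dots> = of_int (- \<sigma>) * 2 ^ Suc j * a + of_int (2 - 2 * k) * (a + b)"
      unfolding k by (simp add: algebra_simps)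
    finally have "fst (dists a b (Suc j)) = of_int (- \<sigma>) * 2 ^ Suc j * a + of_int (2 - 2 * k) * (a + b)" .
    moreover have "- \<sigma> \<in> {1, -1}" using k(1) by auto
    ultimately show ?thesis by blast
  qed
qed

text \<open>When the distances meet, both equal \<open>(a + b) / 2\<close>, so
  \<open>2 ^ Suc j * a\<close> is an odd multiple \<open>m\<close> of \<open>a + b\<close>. Take
  \<open>p = m\<close> and \<open>q = 2 ^ Suc j - m\<close>. As \<open>a \<noteq> b\<close>, the
  meeting does not occur at index \<open>0\<close>, and \<open>p + q\<close> is divisible by
  \<open>4\<close>.\<close>

lemma degenerate_ratio:
  assumes "degenerate a b" "0 < a" "0 < b" "a \<noteq> b"
  shows "\<exists>p q :: int. odd p \<and> 4 dvd p + q \<and> a * of_int q = b * of_int p"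
proof -
  obtain j where j: "fst (dists a b j) = snd (dists a b j)" using assms(1) by (auto simp: degenerate_def)
  obtain k \<sigma> :: int where k: "\<sigma> \<in> {1, -1}" "fst (dists a b j) = of_int \<sigma> * 2 ^ j * a + of_int k * (a + b)"
    using dists_mod by blast
  define m where "m = \<sigma> * (1 - 2 * k)"
  have odd: "odd m" using k(1) by (auto simp: m_def)
  have "2 * (of_int \<sigma> * 2 ^ j * a + of_int k * (a + b)) = a + b"
    using j dists_sum[of a b j] unfolding k(2)[symmetric] by linarith
  then have "of_int \<sigma> * (2 * 2 ^ j * a) = of_int (1 - 2 * k) * (a + b)" by (simp add: algebra_simps)
  then have "of_int \<sigma> * (of_int \<sigma> * (2 * 2 ^ j * a)) = of_int \<sigma> * (of_int (1 - 2 * k) * (a + b))" by simp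
  moreover have "of_int \<sigma> * (of_int \<sigma> * (2 * 2 ^ j * a)) = 2 ^ Suc j * a" using k(1) by auto
  ultimately have eq: "2 ^ Suc j * a = of_int m * (a + b)" by (simp add: m_def)
  have j0: "j \<noteq> 0" using j assms(4) by (cases j) auto
  then have "(4::int) dvd 2 ^ Suc j" using le_imp_power_dvd[of 2 "Suc j" "2::int"] by simp
  then have "4 dvd m + (2 ^ Suc j - m)" by simp
  moreover have "a * of_int (2 ^ Suc j - m) = b * of_int m" using eq by (simp add: algebra_simps)
  ultimately show ?thesis using odd by blast
qed

text \<open>Multiplying the three ratios gives \<open>q * q' * p'' = p * p' * q''\<close>. Modulo
  \<open>4\<close> each \<open>q\<close> is the opposite of its \<open>p\<close>, so the two sides
  are a product of three odd numbers and its negative; twice an odd number would be divisible by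
  \<open>4\<close>.\<close>

lemma not_all_degenerate:
  assumes "0 < a" "0 < b" "0 < c" "a \<noteq> b" "b \<noteq> c" "a \<noteq> c"
  shows "\<not> (degenerate a b \<and> degenerate b c \<and> degenerate a c)"
proof
  assume "degenerate a b \<and> degenerate b c \<and> degenerate a c"
  then obtain p q p' q' p'' q'' :: int where
    1: "odd p" "4 dvd p + q" "a * of_int q = b * of_int p" and
    2: "odd p'" "4 dvd p' + q'" "b * of_int q' = c * of_int p'" and
    3: "odd p''" "4 dvd p'' + q''" "a * of_int q'' = c * of_int p''"
    using degenerate_ratio assms by metis
  have "a * of_int (q * q' * p'') = (a * of_int q) * of_int q' * of_int p''" by simp
  also have "\<dots> = (b * of_int q') * of_int p * of_int p''" unfolding 1 by simp
  also have "\<dots> = (c * of_int p'') * of_int p * of_int p'" unfolding 2 by simp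
  also have "\<dots> = a * of_int (p * p' * q'')" using 3(3) by (simp add: algebra_simps)
  finally have "of_int (q * q' * p'') = (of_int (p * p' * q'') :: real)" using assms(1) by simp
  then have eq: "q * q' * p'' = p * p' * q''" by (simp only: of_int_eq_iff)
  obtain x y z where x: "p + q = 4 * x" "p' + q' = 4 * y" "p'' + q'' = 4 * z" using 1 2 3 by (auto elim!: dvdE)
  then have q: "q = 4 * x - p" "q' = 4 * y - p'" "q'' = 4 * z - p''" by auto
  have "2 * (p * p' * p'') = 4 * (p * p' * z - (4 * x * y - x * p' - y * p) * p'')"
    using eq unfolding q by (simp add: algebra_simps)
  then have "p * p' * p'' = 2 * (p * p' * z - (4 * x * y - x * p' - y * p) * p'')" by simp
  then have "even (p * p' * p'')" by (metis dvd_triv_left)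
  then show False using 1 2 3 by simp
qed

context path_law
begin

lemma good_grid_dists:
  assumes P: "good (hit (\<lambda>_. 0) a)" "good (hit (\<lambda>_. 0) b)" and 0: "good (\<lambda>_. 0)"
    and ab: "0 < a" "0 < b" "\<not> degenerate a b"
  defines "d \<equiv> \<lambda>j. min (fst (dists a b j)) (snd (dists a b j))"
  shows "good (grid d j)"
proof -
  let ?x = "\<lambda>j. fst (dists a b j)" and ?y = "\<lambda>j. snd (dists a b j)"
  \<comment> \<open>Goodness of the time \<open>0\<close> supplies the negative levels by
    symmetry.\<close>
  have neg: "good (hit (\<lambda>_. 0) (- c))" if "good (hit (\<lambda>_. 0) c)" for c
  proof -
    have "good (\<lambda>w. hit (\<lambda>_. 0) c (reflect (\<lambda>_. 0) w))" using that 0 by (rule good_comp_reflect) simp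
    then show ?thesis by (rule good_cong) (simp add: hit_reflect adm_const)
  qed
  have pos: "0 < ?x j" "0 < ?y j" for j using dists_pos ab by auto
  have ne: "?x j \<noteq> ?y j" for j using ab(3) by (auto simp: degenerate_def)
  \<comment> \<open>The induction also carries the four hitting times at the current distances,
    since these are what produces the next grid point.\<close>
  have "good (grid d j) \<and> good (hit (grid d j) (?x j)) \<and> good (hit (grid d j) (- ?x j))
      \<and> good (hit (grid d j) (?y j)) \<and> good (hit (grid d j) (- ?y j))"
  proof (induction j)
    case 0
    then show ?case using P neg \<open>good (\<lambda>_. 0)\<close> by simp
  next
    case (Suc j)
    show ?case
    proof (cases "?x j < ?y j")
      case True
      have e: "d j = ?x j" "?x (Suc j) = 2 * ?x j" "?y (Suc j) = ?y j - ?x j"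
        using True by (auto simp: d_def split_beta)
      show ?thesis unfolding grid.simps e
        using good_hit_step[of "grid d j" "?x j" "?y j"] Suc True pos by (auto simp: good_adm)
    next
      case False
      then have lt: "?y j < ?x j" using ne[of j] by simp
      have e: "d j = ?y j" "?x (Suc j) = 2 * ?y j" "?y (Suc j) = ?x j - ?y j"
        using lt by (auto simp: d_def split_beta)
      show ?thesis unfolding grid.simps e
        using good_hit_step[of "grid d j" "?y j" "?x j"] Suc lt pos by (auto simp: good_adm)
    qed
  qed
  then show ?thesis by simp
qed

text \<open>While the smaller distance is below a quarter of the sum, its double is still the
  smaller one. It would then double forever, which the constant sum forbids.\<close>

lemma dists_min_large:
  assumes ab: "0 < a" "0 < b" "\<not> degenerate a b"
  defines "d \<equiv> \<lambda>j. min (fst (dists a b j)) (snd (dists a b j))"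
  shows "\<exists>i\<ge>j. (a + b) / 4 \<le> d i"
proof (rule ccontr)
  assume "\<not> ?thesis"
  then have lt: "\<And>i. i \<ge> j \<Longrightarrow> d i < (a + b) / 4" by (meson not_le)
  have dbl: "d (Suc i) = 2 * d i" if "i \<ge> j" for i
  proof -
    have s: "fst (dists a b i) + snd (dists a b i) = a + b" by (rule dists_sum)
    have "d i < (a + b) / 4" using lt that by simp
    then show ?thesis using s unfolding d_def by (auto simp: split_beta min_def max_def split: if_splits)
  qed
  have "d (j + i) = 2 ^ i * d j" for i by (induction i) (auto simp: dbl)
  moreover have "0 < d j" using dists_pos[OF ab(3,1,2)] by (simp add: d_def)
  moreover obtain i where "(a + b) / 4 / d j < 2 ^ i" using real_arch_pow[of 2] by auto
  ultimately have "(a + b) / 4 < d (j + i)" by (simp add: pos_divide_less_eq)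
  then show False using lt[of "j + i"] by simp
qed

theorem all_adm_good:
  fixes a :: "nat \<Rightarrow> real"
  assumes a: "\<And>n. n \<ge> 1 \<Longrightarrow> a n > 0" "a \<longlonglongrightarrow> 0"
    and g: "\<And>n. n \<ge> 1 \<Longrightarrow> good (hit (\<lambda>_. 0) (a n))" "good (\<lambda>_. 0)"
    and T: "adm T"
  shows "good T"
proof (rule good_of_grids[OF _ T])
  fix \<epsilon> :: real assume \<epsilon>: "0 < \<epsilon>"
  have small: "\<exists>n\<ge>1. a n < e" if e: "0 < e" for e
  proof -
    obtain N where "\<And>n. n \<ge> N \<Longrightarrow> norm (a n - 0) < e" using LIMSEQ_D[OF a(2) e] by blast
    then have "norm (a (max N 1) - 0) < e" by simp
    then show ?thesis by (intro exI[of _ "max N 1"]) auto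
  qed
  \<comment> \<open>Three distinct levels below \<open>\<epsilon>\<close> are picked, so that at
    least one pair of them is not degenerate.\<close>
  obtain n1 where n1: "n1 \<ge> 1" "a n1 < \<epsilon>" using small \<epsilon> by blast
  obtain n2 where n2: "n2 \<ge> 1" "a n2 < a n1" using small a(1) n1 by blast
  obtain n3 where n3: "n3 \<ge> 1" "a n3 < a n2" using small a(1) n2 by blast
  have "\<not> (degenerate (a n1) (a n2) \<and> degenerate (a n2) (a n3) \<and> degenerate (a n1) (a n3))"
    using n1 n2 n3 a(1) by (intro not_all_degenerate) auto
  then obtain n m where nm: "n \<ge> 1" "m \<ge> 1" "\<not> degenerate (a n) (a m)" "a n < \<epsilon>" "a m < \<epsilon>"
    using n1 n2 n3 by force
  let ?d = "\<lambda>j. min (fst (dists (a n) (a m) j)) (snd (dists (a n) (a m) j))"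
  have "0 < ?d j \<and> ?d j \<le> \<epsilon>" for j
    using dists_pos[OF nm(3), of j] a(1) nm dists_sum[of "a n" "a m" j] by (auto simp: min_def)
  moreover have "good (grid ?d j)" for j
    using nm g a(1) by (intro good_grid_dists) auto
  moreover have "0 < (a n + a m) / 4" using a(1)[OF nm(1)] a(1)[OF nm(2)] by simp
  moreover have "\<forall>j. \<exists>i\<ge>j. (a n + a m) / 4 \<le> ?d i" using dists_min_large nm a(1) by blast
  ultimately show "\<exists>d \<delta>. (\<forall>j. good (grid d j)) \<and> (\<forall>j. 0 < d j \<and> d j \<le> \<epsilon>) \<and> 0 < \<delta> \<and> (\<forall>j. \<exists>i\<ge>j. \<delta> \<le> d i)"
    by blast
qed

end

section \<open>Dyadic grids and the quadratic variation\<close>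

definition step :: "nat \<Rightarrow> real" where "step n = 1 / 2 ^ n"

lemma step_pos [simp]: "0 < step n" "step n \<noteq> 0" "0 \<le> step n"
  by (simp_all add: step_def)

lemma step_Suc: "step n = 2 * step (Suc n)"
  by (simp add: step_def)

abbreviation R :: "nat \<Rightarrow> nat \<Rightarrow> (real \<Rightarrow> real) \<Rightarrow> ennreal" where
  "R n \<equiv> grid (\<lambda>_. step n)"

lemma adm_R: "adm (R n k)"
  by (rule adm_grid) simp

lemma R_measurable [measurable]: "R n k \<in> borel_measurable path_space"
  using adm_R by (simp add: adm_def)

lemma R_unbounded: "w \<in> W \<Longrightarrow> \<exists>k. ennreal t < R n k w"
  by (rule grid_unbounded[where \<delta>="step n"]) auto

lemma R_Suc_finite:
  assumes w: "w \<in> W" and t: "0 \<le> t" "R n (Suc k) w = ennreal t"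
  obtains s where "0 \<le> s" "s < t" "R n k w = ennreal s" "\<bar>w t - w s\<bar> = step n"
  by (rule grid_Suc_finite[of w "\<lambda>_. step n" k t, OF w _ t]) auto

lemma R_finite_pred: "w \<in> W \<Longrightarrow> R n (Suc k) w < \<top> \<Longrightarrow> R n k w < \<top>"
  using grid_mono_Suc[of "\<lambda>_. step n" k w] by (rule le_less_trans)

lemma R_strict:
  assumes w: "w \<in> W" and "R n k w < \<top>"
  shows "R n k w < R n (Suc k) w"
proof (cases "R n (Suc k) w")
  case (real t)
  then obtain s where "0 \<le> s" "s < t" "R n k w = ennreal s"
    using R_Suc_finite[OF w real(1,2)] by metis
  then show ?thesis using real by (simp add: ennreal_lessI)
qed (use assms in auto)

lemma R_osc:
  assumes "w \<in> W" "0 \<le> t" "R n k w \<le> ennreal t" "ennreal t \<le> R n (Suc k) w"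
  shows "\<bar>w t - w (enn2real (R n k w))\<bar> \<le> step n"
  using assms by (intro grid_osc) auto

lemma R_before:
  assumes "w \<in> W" "0 \<le> t" "R n k w \<le> ennreal t" "ennreal t < R n (Suc k) w"
  shows "\<bar>w t - w (enn2real (R n k w))\<bar> < step n"
  using assms by (intro grid_before[where d="\<lambda>_. step n", simplified]) auto

section \<open>Counting grid points\<close>

text \<open>The index of the last grid point not after a finite \<open>T\<close>. For infinite
  \<open>T\<close> no index satisfies the condition and the value is unspecified.\<close>

definition cnt :: "nat \<Rightarrow> ennreal \<Rightarrow> (real \<Rightarrow> real) \<Rightarrow> nat" where
  "cnt n T w = (LEAST k. T < R n (Suc k) w)"

lemma cnt_bounds:
  assumes w: "w \<in> W" and T: "T < \<top>"
  shows "R n (cnt n T w) w \<le> T" "T < R n (Suc (cnt n T w)) w"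
proof -
  obtain t where t: "T = ennreal t" using T by (cases T) auto
  obtain k where "ennreal t < R n k w" using R_unbounded[OF w] by blast
  then have "T < R n (Suc k) w" using t grid_mono_Suc[of "\<lambda>_. step n" k w] by (metis less_le_trans)
  then show 1: "T < R n (Suc (cnt n T w)) w" unfolding cnt_def by (rule LeastI)
  show "R n (cnt n T w) w \<le> T"
  proof (cases "cnt n T w")
    case (Suc j)
    then have "\<not> T < R n (Suc j) w" unfolding cnt_def using not_less_Least lessI by metis
    then show ?thesis using Suc by simp
  qed simp
qed

lemma R_less_imp: "R n i w < R n j w \<Longrightarrow> i < j"
  using grid_mono[of j i "\<lambda>_. step n" w] by (meson not_le)

lemma cnt_eq: "w \<in> W \<Longrightarrow> R n k w \<le> T \<Longrightarrow> T < R n (Suc k) w \<Longrightarrow> cnt n T w = k"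
proof -
  assume a: "w \<in> W" "R n k w \<le> T" "T < R n (Suc k) w"
  have T: "T < \<top>" using a(3) by (rule less_le_trans) simp
  have "R n k w < R n (Suc (cnt n T w)) w" "R n (cnt n T w) w < R n (Suc k) w"
    using a cnt_bounds[OF a(1) T, of n] by (auto intro: le_less_trans)
  then have "k < Suc (cnt n T w)" "cnt n T w < Suc k" by (auto dest: R_less_imp)
  then show ?thesis by simp
qed

lemma cnt_R: "w \<in> W \<Longrightarrow> R n k w < \<top> \<Longrightarrow> cnt n (R n k w) w = k"
  by (rule cnt_eq) (auto simp: R_strict)

lemma cnt_mono:
  assumes "w \<in> W" "T \<le> T'" "T' < \<top>"
  shows "cnt n T w \<le> cnt n T' w"
proof -
  have T: "T < \<top>" using assms by (metis le_less_trans)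
  have "R n (cnt n T w) w < R n (Suc (cnt n T' w)) w"
    using cnt_bounds[OF assms(1) T, of n] cnt_bounds[OF assms(1,3), of n] assms(2)
    by (meson le_less_trans order_trans)
  then show ?thesis using R_less_imp less_Suc_eq_le by blast
qed

lemma le_cnt_iff: "w \<in> W \<Longrightarrow> T < \<top> \<Longrightarrow> k \<le> cnt n T w \<longleftrightarrow> R n k w \<le> T"
proof
  assume a: "w \<in> W" "T < \<top>"
  show "k \<le> cnt n T w \<Longrightarrow> R n k w \<le> T"
    using grid_mono[of k "cnt n T w" "\<lambda>_. step n" w] cnt_bounds(1)[OF a, of n] by (metis order_trans)
  assume "R n k w \<le> T"
  then show "k \<le> cnt n T w"
    using cnt_mono[OF a(1) _ a(2), of "R n k w"] cnt_R[OF a(1), of n k] a(2) by (metis le_less_trans)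
qed

lemma cnt_measurable:
  assumes T: "T \<in> borel_measurable path_space"
  shows "(\<lambda>w. cnt n (T w) w) \<in> path_space \<rightarrow>\<^sub>M count_space UNIV"
  unfolding cnt_def
proof (rule measurable_Least)
  fix k show "Measurable.pred path_space (\<lambda>w. T w < R n (Suc k) w)"
    unfolding pred_def by (rule borel_measurable_less[OF T R_measurable])
qed

lemma cnt_nonant:
  assumes T: "adm T"
  shows "nonant T (\<lambda>w. cnt n (T w) w)"
proof -
  have "nonant T (\<lambda>w. T w < R n (Suc k) w)" for k
    using adm_min_nonant(2)[OF T adm_R[of n "Suc k"]] by (rule nonant_mono) simp
  then show ?thesis unfolding cnt_def nonant_def by presburger
qed

definition val :: "nat \<Rightarrow> nat \<Rightarrow> (real \<Rightarrow> real) \<Rightarrow> real" where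
  "val n k w = w (enn2real (R n k w))"

text \<open>At an infinite grid point \<open>val\<close> takes the default \<open>w 0 = 0\<close>,
  which is not a position reached by a step; the increment is set to \<open>0\<close> there.\<close>

definition incr :: "nat \<Rightarrow> nat \<Rightarrow> (real \<Rightarrow> real) \<Rightarrow> real" where
  "incr n k w = (if R n (Suc k) w < \<top> then val n (Suc k) w - val n k w else 0)"

lemma val_measurable [measurable]: "val n k \<in> borel_measurable path_space"
  unfolding val_def by (rule eval_self_measurable) measurable

lemma incr_measurable [measurable]: "incr n k \<in> borel_measurable path_space"
  unfolding incr_def by measurable

lemma val_0: "w \<in> W \<Longrightarrow> val n 0 w = 0"
  by (simp add: val_def W_zero)

lemma incr_abs:
  assumes w: "w \<in> W" and "R n (Suc k) w < \<top>"
  shows "\<bar>val n (Suc k) w - val n k w\<bar> = step n"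
proof -
  obtain t where t: "0 \<le> t" "R n (Suc k) w = ennreal t" using assms(2) by (cases "R n (Suc k) w") auto
  then obtain s where "0 \<le> s" "R n k w = ennreal s" "\<bar>w t - w s\<bar> = step n"
    using R_Suc_finite[OF w t] by metis
  then show ?thesis using t by (simp add: val_def)
qed

lemma incr_sq: "w \<in> W \<Longrightarrow> (incr n k w)\<^sup>2 = (if R n (Suc k) w < \<top> then (step n)\<^sup>2 else 0)"
  using incr_abs[of w n k] by (simp add: incr_def) (metis power2_abs)

lemma val_lattice:
  assumes w: "w \<in> W"
  shows "R n k w < \<top> \<Longrightarrow> \<exists>z::int. val n k w = of_int z * step n"
proof (induction k)
  case 0
  show ?case using val_0[OF w, of n] by (intro exI[of _ 0]) simp
next
  case (Suc k)
  then obtain z :: int where z: "val n k w = of_int z * step n"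
    using R_finite_pred[OF w] by blast
  have "val n (Suc k) w - val n k w = step n \<or> val n (Suc k) w - val n k w = - step n"
    using incr_abs[OF w Suc.prems] by (auto simp: abs_if split: if_splits)
  then have "val n (Suc k) w = of_int (z + 1) * step n \<or> val n (Suc k) w = of_int (z - 1) * step n"
    using z by (auto simp: algebra_simps)
  then show ?case by blast
qed

lemma lattice_strict_le:
  fixes z :: int and x s :: real
  assumes "x = of_int z * s" "\<bar>x\<bar> < 2 * s" "0 < s"
  shows "\<bar>x\<bar> \<le> s"
proof -
  have "of_int \<bar>z\<bar> * s < 2 * s" using assms by (simp add: abs_mult)
  then have "of_int \<bar>z\<bar> < (2::real)" using assms(3) by simp
  then have "\<bar>z\<bar> \<le> 1" by linarith
  then have "of_int \<bar>z\<bar> \<le> (1::real)" by linarith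
  then show ?thesis using assms mult_right_mono[of "of_int \<bar>z\<bar>" 1 s] by (simp add: abs_mult)
qed

section \<open>Comparison of consecutive grids\<close>

text \<open>The offset of a fine grid point from the most recent coarse one; this is the part of the
  fine walk that the coarse walk has not yet recorded.\<close>

definition dev :: "nat \<Rightarrow> nat \<Rightarrow> (real \<Rightarrow> real) \<Rightarrow> real" where
  "dev n i w = val (Suc n) i w - val n (cnt n (R (Suc n) i w) w) w"

text \<open>Before the next coarse point the offset is smaller than two fine steps, and it is an
  integer multiple of a fine step.\<close>

lemma dev_abs:
  assumes w: "w \<in> W" and fin: "R (Suc n) i w < \<top>"
  shows "\<bar>dev n i w\<bar> \<le> step (Suc n)"
proof -
  let ?k = "cnt n (R (Suc n) i w) w"
  obtain t where t: "0 \<le> t" "R (Suc n) i w = ennreal t" using fin by (cases "R (Suc n) i w") auto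
  have kt: "R n ?k w \<le> ennreal t" "ennreal t < R n (Suc ?k) w"
    using cnt_bounds[OF w fin, of n] t by auto
  have "\<bar>w t - w (enn2real (R n ?k w))\<bar> < step n" by (rule R_before[OF w t(1) kt])
  then have lt: "\<bar>dev n i w\<bar> < 2 * step (Suc n)" using t by (simp add: dev_def val_def step_Suc[of n])
  have "R n ?k w < \<top>" using kt(1) by (rule le_less_trans) simp
  then obtain z :: int where z: "val n ?k w = of_int z * step n" using val_lattice[OF w] by blast
  obtain y :: int where y: "val (Suc n) i w = of_int y * step (Suc n)" using val_lattice[OF w fin] by blast
  have "dev n i w = of_int (y - 2 * z) * step (Suc n)"
    using y z by (simp add: dev_def step_Suc[of n] algebra_simps)
  then show ?thesis using lt by (rule lattice_strict_le) simp
qed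

text \<open>At a coarse point strictly inside a fine step the path would be less than one fine step
  from the fine value, which is itself at most one fine step from the coarse value. Together this
  falls short of a coarse step.\<close>

lemma fine_le_coarse:
  assumes w: "w \<in> W" and fin: "R (Suc n) (Suc i) w < \<top>"
  shows "R (Suc n) (Suc i) w \<le> R n (Suc (cnt n (R (Suc n) i w) w)) w"
proof (rule ccontr)
  let ?k = "cnt n (R (Suc n) i w) w"
  assume "\<not> ?thesis"
  then have lt: "R n (Suc ?k) w < R (Suc n) (Suc i) w" by simp
  then have "R n (Suc ?k) w < \<top>" using fin by (rule less_trans)
  then obtain t where t: "0 \<le> t" "R n (Suc ?k) w = ennreal t" by (cases "R n (Suc ?k) w") auto
  have fi: "R (Suc n) i w < \<top>" using R_finite_pred[OF w fin] .
  have "R (Suc n) i w \<le> ennreal t" using cnt_bounds(2)[OF w fi, of n] t by simp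
  then have "\<bar>w t - val (Suc n) i w\<bar> < step (Suc n)"
    using R_before[OF w t(1)] lt t unfolding val_def by simp
  moreover have "\<bar>w t - val n ?k w\<bar> = step n"
    using incr_abs[OF w, of n ?k] t by (simp add: val_def)
  ultimately show False using dev_abs[OF w fi] step_Suc[of n] by (simp add: dev_def)
qed

text \<open>Expand the square of \<open>dev\<close> plus the increment. Either this sum is the new
  offset, or a coarse point has been reached and the square \<open>(step n)\<^sup>2\<close> passes
  from the offset to the count.\<close>

lemma dev_Suc:
  assumes w: "w \<in> W" and fin: "R (Suc n) (Suc i) w < \<top>"
  shows "real (cnt n (R (Suc n) (Suc i) w) w) * (step n)\<^sup>2 + (dev n (Suc i) w)\<^sup>2
    = real (cnt n (R (Suc n) i w) w) * (step n)\<^sup>2 + (dev n i w)\<^sup>2 + 2 * dev n i w * incr (Suc n) i w + (step (Suc n))\<^sup>2"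
proof -
  let ?k = "cnt n (R (Suc n) i w) w"
  have fi: "R (Suc n) i w < \<top>" using R_finite_pred[OF w fin] .
  have le: "R (Suc n) (Suc i) w \<le> R n (Suc ?k) w" by (rule fine_le_coarse[OF w fin])
  have inc: "incr (Suc n) i w = val (Suc n) (Suc i) w - val (Suc n) i w" using fin by (simp add: incr_def)
  have incsq: "(incr (Suc n) i w)\<^sup>2 = (step (Suc n))\<^sup>2" using incr_sq[OF w] fin by simp
  have sq: "(dev n i w + incr (Suc n) i w)\<^sup>2 = (dev n i w)\<^sup>2 + 2 * dev n i w * incr (Suc n) i w + (step (Suc n))\<^sup>2"
    using incsq by (simp add: power2_sum)
  have s: "dev n i w + incr (Suc n) i w = val (Suc n) (Suc i) w - val n ?k w" by (simp add: dev_def inc)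
  show ?thesis
  proof (cases "R (Suc n) (Suc i) w = R n (Suc ?k) w")
    case True
    then have c: "cnt n (R (Suc n) (Suc i) w) w = Suc ?k" using cnt_R[OF w] fin by simp
    then have "dev n (Suc i) w = 0" using True by (simp add: dev_def val_def)
    moreover have "(dev n i w + incr (Suc n) i w)\<^sup>2 = (step n)\<^sup>2"
      unfolding s using True incr_abs[OF w, of n ?k] fin by (metis power2_abs val_def)
    ultimately show ?thesis using sq c by (simp add: algebra_simps)
  next
    case False
    have "R n ?k w \<le> R (Suc n) (Suc i) w"
      using cnt_bounds(1)[OF w fi, of n] grid_mono_Suc[of "\<lambda>_. step (Suc n)" i w] by (rule order_trans)
    moreover have "R (Suc n) (Suc i) w < R n (Suc ?k) w" by (rule le_neq_trans[OF le False])
    ultimately have c: "cnt n (R (Suc n) (Suc i) w) w = ?k" by (rule cnt_eq[OF w])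
    then have "dev n (Suc i) w = dev n i w + incr (Suc n) i w" using s by (simp add: dev_def)
    then show ?thesis using sq c by simp
  qed
qed

text \<open>The difference between the two approximations of the quadratic variation is a discrete
  stochastic integral, up to the square of the offset. This makes it accessible to a maximal
  inequality.\<close>

lemma dev_sum:
  assumes w: "w \<in> W"
  shows "R (Suc n) i w < \<top> \<Longrightarrow> real (cnt n (R (Suc n) i w) w) * (step n)\<^sup>2 + (dev n i w)\<^sup>2 - real i * (step (Suc n))\<^sup>2
    = 2 * (\<Sum>j<i. dev n j w * incr (Suc n) j w)"
proof (induction i)
  case 0
  have "cnt n 0 w = 0" using cnt_R[OF w, of n 0] by simp
  then show ?case using val_0[OF w] by (simp add: dev_def)
next
  case (Suc i)
  show ?case using dev_Suc[OF w Suc.prems] Suc.IH[OF R_finite_pred[OF w Suc.prems]]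
    by (simp add: algebra_simps)
qed

lemma dev_measurable [measurable]: "dev n i \<in> borel_measurable path_space"
proof -
  have "(\<lambda>w. val n (cnt n (R (Suc n) i w) w) w) \<in> borel_measurable path_space"
    by (rule measurable_compose_countable[where f="\<lambda>k w. val n k w", OF val_measurable cnt_measurable[OF R_measurable]])
  then have "(\<lambda>w. val (Suc n) i w - val n (cnt n (R (Suc n) i w) w) w) \<in> borel_measurable path_space"
    by (intro borel_measurable_diff val_measurable)
  then show ?thesis by (simp add: dev_def[abs_def])
qed

lemma val_nonant: "k \<le> i \<Longrightarrow> nonant (R n i) (val n k)"
  unfolding val_def[abs_def]
  by (rule nonant_eval) (auto intro: grid_mono nonant_mono[OF adm_nonant[OF adm_R]])

lemma dev_nonant: "nonant (R (Suc n) i) (\<lambda>w. if R (Suc n) i w < \<top> then dev n i w else 0)"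
proof (rule nonantI)
  fix w w' assume w: "w \<in> W" "w' \<in> W" "agree (R (Suc n) i w) w w'"
  let ?T = "R (Suc n) i"
  have T: "?T w' = ?T w" by (rule nonantD[OF adm_nonant[OF adm_R] w])
  show "(if ?T w' < \<top> then dev n i w' else 0) = (if ?T w < \<top> then dev n i w else 0)"
  proof (cases "?T w < \<top>")
    case True
    have c: "cnt n (?T w') w' = cnt n (?T w) w" by (rule nonantD[OF cnt_nonant[OF adm_R] w])
    let ?k = "cnt n (?T w) w"
    have "R n ?k w \<le> ?T w" using cnt_bounds(1)[OF w(1) True] .
    then have a: "agree (R n ?k w) w w'" by (rule agree_mono[OF w(3)])
    have "val n ?k w' = val n ?k w" by (rule nonantD[OF val_nonant[OF order_refl] w(1,2) a])
    moreover have "val (Suc n) i w' = val (Suc n) i w" by (rule nonantD[OF val_nonant[OF order_refl] w])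
    ultimately show ?thesis using True T c by (simp add: dev_def)
  qed (simp add: T)
qed

text \<open>Consider the first fine point not before the given coarse point. By
  \<open>fine_le_coarse\<close> it does not overshoot the next coarse point after its predecessor,
  and that point is not later than the given one.\<close>

lemma R_nested:
  assumes w: "w \<in> W" and fin: "R n k w < \<top>"
  shows "\<exists>j. R (Suc n) j w = R n k w"
proof (cases k)
  case 0
  then show ?thesis by (intro exI[of _ 0]) simp
next
  case (Suc m)
  have "0 < R n k w"
    using R_strict[OF w R_finite_pred[OF w], of n m] fin Suc by (auto intro: le_less_trans[rotated])
  define i where "i = (LEAST i. R n k w \<le> R (Suc n) i w)"
  obtain t where "R n k w = ennreal t" using fin by (cases "R n k w") auto
  then have "\<exists>i. R n k w \<le> R (Suc n) i w" using R_unbounded[OF w, of t "Suc n"] less_imp_le by metis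
  then have i: "R n k w \<le> R (Suc n) i w" unfolding i_def by (rule LeastI_ex)
  have "i \<noteq> 0"
  proof
    assume "i = 0"
    then have "R n k w \<le> 0" using i by simp
    then show False using \<open>0 < R n k w\<close> by simp
  qed
  then obtain l where l: "i = Suc l" by (cases i) auto
  have lt: "R (Suc n) l w < R n k w" using not_less_Least[of l "\<lambda>i. R n k w \<le> R (Suc n) i w"] l
    unfolding i_def[symmetric] by simp
  then have lf: "R (Suc n) l w < \<top>" using fin by (rule less_trans)
  let ?c = "cnt n (R (Suc n) l w) w"
  have "R n ?c w < R n k w" using cnt_bounds(1)[OF w lf] lt by (rule le_less_trans)
  then have "Suc ?c \<le> k" using R_less_imp Suc_leI by blast
  then have ck: "R n (Suc ?c) w \<le> R n k w" by (rule grid_mono)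
  have "R (Suc n) i w \<le> R n k w"
  proof (cases "R (Suc n) i w < \<top>")
    case True
    then show ?thesis using fine_le_coarse[OF w, of n l] l ck by (metis order_trans)
  next
    \<comment> \<open>Without a further fine point the path would stay within one fine step of the
      last fine value, too close to reach a coarse point.\<close>
    case False
    obtain t where t: "0 \<le> t" "R n (Suc ?c) w = ennreal t"
      using ck fin by (cases "R n (Suc ?c) w") (auto simp: top_unique)
    have "ennreal t < R (Suc n) (Suc l) w" using False l by (metis ennreal_less_top top.not_eq_extremum)
    moreover have "R (Suc n) l w \<le> ennreal t" using cnt_bounds(2)[OF w lf, of n] t by simp
    ultimately have "\<bar>w t - val (Suc n) l w\<bar> < step (Suc n)"
      using R_before[OF w t(1)] unfolding val_def by blast
    moreover have "\<bar>w t - val n ?c w\<bar> = step n"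
      using incr_abs[OF w, of n ?c] t by (simp add: val_def)
    ultimately have False using dev_abs[OF w lf] step_Suc[of n] by (simp add: dev_def)
    then show ?thesis ..
  qed
  then show ?thesis using i by (intro exI[of _ i]) simp
qed

lemma R_nested_le:
  assumes w: "w \<in> W" and fin: "R n k w < \<top>"
  shows "n \<le> m \<Longrightarrow> \<exists>j. R m j w = R n k w"
proof (induction m rule: dec_induct)
  case (step m)
  then show ?case using R_nested[OF w, of m] fin by metis
qed auto

section \<open>Invariance of the grids under reflection\<close>

lemma hit_reflect_after:
  assumes w: "w \<in> W" and S: "S (reflect T w) = S w" and TS: "T w \<le> S w"
  shows "hit S c (reflect T w) = hit S (- c) w"
proof -
  have "{t. 0 \<le> t \<and> S w \<le> ennreal t \<and> reflect T w t - reflect T w (enn2real (S w)) = c}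
      = {t. 0 \<le> t \<and> S w \<le> ennreal t \<and> w t - w (enn2real (S w)) = - c}"
  proof (intro Collect_cong conj_cong refl)
    fix t :: real assume t: "0 \<le> t" "S w \<le> ennreal t"
    then obtain s where s: "S w = ennreal s" "0 \<le> s" by (cases "S w") (auto simp: top_unique)
    have "reflect T w t = 2 * w (enn2real (T w)) - w t" using t TS by (intro reflect_after) auto
    moreover have "reflect T w s = 2 * w (enn2real (T w)) - w s" using s TS by (intro reflect_after) auto
    ultimately show "(reflect T w t - reflect T w (enn2real (S w)) = c) = (w t - w (enn2real (S w)) = - c)"
      using s by auto
  qed
  then show ?thesis unfolding hit_def S by simp
qed

text \<open>Up to \<open>T\<close> the path is unchanged, and afterwards its displacements change
  sign, to which the two-sided grid is blind. That \<open>T\<close> is a grid point ensures that no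
  step contains it in its interior.\<close>

lemma R_reflect:
  assumes w: "w \<in> W" and T: "T w = \<top> \<or> (\<exists>k. R m k w = T w)"
  shows "R m j (reflect T w) = R m j w"
proof (cases "T w = \<top>")
  case True
  then have "reflect T w = w" using w by (intro W_eqI reflect_in_W) (auto simp: reflect_def)
  then show ?thesis by simp
next
  case False
  then obtain k where k: "R m k w = T w" using T by auto
  have le: "R m i (reflect T w) = R m i w" if "i \<le> k" for i
  proof (rule nonantD[OF adm_nonant[OF adm_R] w reflect_in_W[OF w]])
    show "agree (R m i w) w (reflect T w)"
      by (rule agree_mono[OF agree_reflect]) (use grid_mono[OF that, of "\<lambda>_. step m" w] k in simp)
  qed
  have ge: "R m (k + i) (reflect T w) = R m (k + i) w" for i
  proof (induction i)
    case (Suc i)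
    have "T w \<le> R m (k + i) w" using k grid_mono[of k "k + i" "\<lambda>_. step m" w] by simp
    then have "hit (R m (k + i)) c (reflect T w) = hit (R m (k + i)) (- c) w" for c
      by (intro hit_reflect_after[where S="R m (k + i)" and T=T] w Suc)
    then show ?case by (simp add: grid.simps(2) min.commute)
  qed (use le in simp)
  show ?thesis
  proof (cases "j \<le> k")
    case False
    then show ?thesis using ge[of "j - k"] by simp
  qed (rule le)
qed

text \<open>A point of a coarse grid is a point of every finer grid, so the reflection there fixes
  all the finer grids at once.\<close>

lemma R_reflect_R: "w \<in> W \<Longrightarrow> n \<le> m \<Longrightarrow> R m j (reflect (R n k) w) = R m j w"
proof (rule R_reflect[where T="R n k"])
  assume "w \<in> W" "n \<le> m"
  then show "R n k w = \<top> \<or> (\<exists>l. R m l w = R n k w)"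
    using R_nested_le[of w n k m] by (cases "R n k w = \<top>") (auto simp: less_top)
qed

lemma val_reflect:
  assumes w: "w \<in> W" and fin: "R n i w < \<top>"
  shows "val n i (reflect (R n k) w) = (if i \<le> k then val n i w else 2 * val n k w - val n i w)"
proof -
  obtain t where t: "0 \<le> t" "R n i w = ennreal t" using fin by (cases "R n i w") auto
  have "val n i (reflect (R n k) w) = reflect (R n k) w t"
    using R_reflect_R[OF w order_refl] t by (simp add: val_def)
  moreover have "i \<le> k \<Longrightarrow> ennreal t \<le> R n k w" using t grid_mono by metis
  moreover have "\<not> i \<le> k \<Longrightarrow> R n k w \<le> ennreal t" using t grid_mono[of k i] by (metis nat_le_linear)
  ultimately show ?thesis using t by (auto simp: reflect_before reflect_after val_def)
qed

lemma incr_reflect: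
  assumes w: "w \<in> W"
  shows "incr n i (reflect (R n k) w) = (if i < k then incr n i w else - incr n i w)"
proof (cases "R n (Suc i) w < \<top>")
  case True
  show ?thesis
    using True R_finite_pred[OF w True] R_reflect_R[OF w order_refl, of n "Suc i" k]
    by (auto simp: incr_def val_reflect[OF w])
qed (simp add: incr_def R_reflect_R[OF w])

text \<open>The error made in passing from one grid to the next has variance of order \<open>4\<^sup>-\<^sup>n\<close>, so any ratio
  strictly between \<open>1/2\<close> and \<open>1\<close> gives a summable sequence of probabilities and of errors.\<close>

definition eta :: "nat \<Rightarrow> real" where "eta n = (2 / 3) ^ n"

lemma eta: "0 < eta n" "eta n \<le> 1" "eta (Suc n) = 2 / 3 * eta n"
  by (simp_all add: eta_def power_le_one)

lemma nine_eta: "(\<lambda>n. 9 * eta n) \<longlonglongrightarrow> 0"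
  unfolding eta_def using tendsto_mult_left[OF LIMSEQ_power_zero[of "2/3::real"], of 9] by simp

section \<open>The limit of the counts\<close>

definition Q :: "nat \<Rightarrow> ennreal \<Rightarrow> (real \<Rightarrow> real) \<Rightarrow> real" where
  "Q n T w = real (cnt n T w) * (step n)\<^sup>2"

text \<open>Pathwise conditions that force the counts to converge. The first compares two
  consecutive levels during \<open>L * 4 ^ Suc n\<close> fine steps, that is, up to an accumulated
  value \<open>L\<close>. The second bounds the counts along some levels only, which is enough to
  start the comparison.\<close>

definition tame :: "(real \<Rightarrow> real) \<Rightarrow> bool" where
  "tame w \<longleftrightarrow>
    (\<forall>L::nat. \<exists>n0. \<forall>n\<ge>n0. \<forall>j \<le> L * 4 ^ Suc n. R (Suc n) j w < \<top> \<longrightarrow>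
       \<bar>Q n (R (Suc n) j w) w - real j * (step (Suc n))\<^sup>2\<bar> \<le> 3 * eta n) \<and>
    (\<forall>m::nat. \<exists>q::nat. \<forall>n0. \<exists>n\<ge>n0. Q n (ennreal (real m)) w \<le> real q)"

text \<open>The value \<open>0\<close> on exceptional paths makes continuity and monotonicity hold
  for every path, as required of a quadratic variation.\<close>

definition qv :: "real \<Rightarrow> (real \<Rightarrow> real) \<Rightarrow> real" where
  "qv t w = (if tame w then lim (\<lambda>n. Q n (ennreal t) w) else 0)"

lemma Q_mono: "w \<in> W \<Longrightarrow> T \<le> T' \<Longrightarrow> T' < \<top> \<Longrightarrow> Q n T w \<le> Q n T' w"
  unfolding Q_def by (intro mult_right_mono) (simp_all add: cnt_mono)

lemma step_sq: "(step n)\<^sup>2 = 1 / 4 ^ n"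
proof -
  have "(2::real) ^ n * 2 ^ n = (2 * 2) ^ n" by (rule power_mult_distrib[symmetric])
  then show ?thesis by (simp add: step_def power2_eq_square)
qed

text \<open>As the grids are nested, the coarse count can change only at fine grid points.\<close>

lemma Q_coarse:
  assumes w: "w \<in> W" and T: "T < \<top>"
  shows "Q n T w = Q n (R (Suc n) (cnt (Suc n) T w) w) w"
proof -
  let ?j = "cnt (Suc n) T w"
  have j: "R (Suc n) ?j w \<le> T" by (rule cnt_bounds(1)[OF w T])
  have jf: "R (Suc n) ?j w < \<top>" using j T by (rule le_less_trans)
  let ?k = "cnt n T w"
  have k: "R n ?k w \<le> T" by (rule cnt_bounds(1)[OF w T])
  then have "R n ?k w < \<top>" using T by (rule le_less_trans)
  then obtain i where i: "R (Suc n) i w = R n ?k w" using R_nested[OF w] by blast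
  then have "i \<le> ?j" using le_cnt_iff[OF w T, of i "Suc n"] k by simp
  then have "R n ?k w \<le> R (Suc n) ?j w" using i grid_mono by metis
  then have "?k \<le> cnt n (R (Suc n) ?j w) w" using le_cnt_iff[OF w jf] by blast
  moreover have "cnt n (R (Suc n) ?j w) w \<le> ?k" by (rule cnt_mono[OF w j T])
  ultimately show ?thesis by (simp add: Q_def)
qed

text \<open>A bootstrap from one level with a bounded count. As long as the counts are bounded the
  comparison of consecutive levels applies, and the geometric sum of its errors keeps them
  bounded.\<close>

lemma tame_uniform:
  assumes w: "w \<in> W" and tm: "tame w"
  shows "\<exists>n1. \<forall>n\<ge>n1. \<forall>t. 0 \<le> t \<and> t \<le> real m \<longrightarrow> \<bar>Q n (ennreal t) w - Q (Suc n) (ennreal t) w\<bar> \<le> 3 * eta n"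
proof -
  obtain q :: nat where q: "\<And>n0. \<exists>n\<ge>n0. Q n (ennreal (real m)) w \<le> real q"
    using tm unfolding tame_def by blast
  \<comment> \<open>Room of \<open>9\<close> for the accumulated errors, \<open>3\<close> for a
    single comparison and \<open>1\<close> to make the final inequality strict.\<close>
  define L where "L = q + 13"
  obtain n0 where n0: "\<And>n j. n \<ge> n0 \<Longrightarrow> j \<le> L * 4 ^ Suc n \<Longrightarrow> R (Suc n) j w < \<top> \<Longrightarrow>
       \<bar>Q n (R (Suc n) j w) w - real j * (step (Suc n))\<^sup>2\<bar> \<le> 3 * eta n"
    using tm unfolding tame_def by blast
  obtain n1 where n1: "n1 \<ge> n0" "Q n1 (ennreal (real m)) w \<le> real q" using q by blast
  let ?\<eta> = eta let ?m = "ennreal (real m)"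
  have \<eta>1: "?\<eta> n \<le> 1" "0 < ?\<eta> n" for n by (simp_all add: eta)
  have diff: "\<bar>Q n T w - Q (Suc n) T w\<bar> \<le> 3 * ?\<eta> n"
    if n: "n \<ge> n0" and T: "T < \<top>" and L: "Q (Suc n) T w \<le> real L" for n T
  proof -
    let ?j = "cnt (Suc n) T w"
    have "real ?j / 4 ^ Suc n \<le> real L" using L by (simp add: Q_def step_sq)
    then have "real ?j \<le> real (L * 4 ^ Suc n)" by (simp add: pos_divide_le_eq)
    then have "?j \<le> L * 4 ^ Suc n" by (simp only: of_nat_le_iff)
    moreover have "R (Suc n) ?j w < \<top>" using cnt_bounds(1)[OF w T] T by (rule le_less_trans)
    ultimately have "\<bar>Q n (R (Suc n) ?j w) w - real ?j * (step (Suc n))\<^sup>2\<bar> \<le> 3 * ?\<eta> n" using n0 n by blast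
    then show ?thesis unfolding Q_coarse[OF w T, symmetric] by (simp only: Q_def[of "Suc n"])
  qed
  have next_le: "Q (Suc n) ?m w \<le> real L" if n: "n \<ge> n0" and Qn: "Q n ?m w \<le> real q + 9" for n
  proof (rule ccontr)
    assume "\<not> ?thesis"
    then have "real L < real (cnt (Suc n) ?m w) / 4 ^ Suc n" by (simp add: Q_def step_sq)
    then have "real (L * 4 ^ Suc n) < real (cnt (Suc n) ?m w)" by (simp add: pos_less_divide_eq)
    then have "L * 4 ^ Suc n \<le> cnt (Suc n) ?m w" by (simp only: of_nat_less_iff less_imp_le)
    then have le: "R (Suc n) (L * 4 ^ Suc n) w \<le> ?m" using le_cnt_iff[OF w, of ?m] by simp
    then have fin: "R (Suc n) (L * 4 ^ Suc n) w < \<top>" by (rule le_less_trans) simp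
    have "\<bar>Q n (R (Suc n) (L * 4 ^ Suc n) w) w - real (L * 4 ^ Suc n) * (step (Suc n))\<^sup>2\<bar> \<le> 3 * ?\<eta> n"
      using n0[OF n order_refl fin] .
    moreover have "real (L * 4 ^ Suc n) * (step (Suc n))\<^sup>2 = real L" by (simp add: step_sq)
    ultimately have "real L - 3 \<le> Q n (R (Suc n) (L * 4 ^ Suc n) w) w" using \<eta>1[of n] by linarith
    also have "\<dots> \<le> Q n ?m w" by (rule Q_mono[OF w le]) simp
    finally show False using Qn by (simp add: L_def)
  qed
  \<comment> \<open>The errors \<open>3 * eta n\<close> have ratio \<open>2/3\<close>, hence their
    sum telescopes as a difference of the values \<open>9 * eta n\<close>.\<close>
  have nine: "real q + (9 * ?\<eta> n1 - 9 * ?\<eta> n) \<le> real q + 9" for n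
  proof -
    show ?thesis using \<eta>1[of n1] \<eta>1[of n] by linarith
  qed
  have "Q n ?m w \<le> real q + (9 * ?\<eta> n1 - 9 * ?\<eta> n)" if "n \<ge> n1" for n
    using that
  proof (induction n rule: dec_induct)
    case base
    then show ?case using n1 by simp
  next
    case (step n)
    have "Q n ?m w \<le> real q + 9" using step.IH nine[of n] by (rule order_trans)
    then have "Q (Suc n) ?m w \<le> real L" using next_le step.hyps n1 by simp
    then have "\<bar>Q n ?m w - Q (Suc n) ?m w\<bar> \<le> 3 * ?\<eta> n" using diff step.hyps n1 by simp
    moreover have "?\<eta> (Suc n) = 2/3 * ?\<eta> n" by (rule eta(3))
    ultimately show ?case using step.IH by (simp add: algebra_simps)
  qed
  then have "Q n ?m w \<le> real q + 9" if "n \<ge> n1" for n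
    using nine[of n] that by (blast intro: order_trans)
  then have L: "Q (Suc n) ?m w \<le> real L" if "n \<ge> n1" for n using that next_le n1 by simp
  show ?thesis
  proof (intro exI[of _ n1] allI impI)
    fix n t assume n: "n \<ge> n1" and t: "0 \<le> t \<and> t \<le> real m"
    have "Q (Suc n) (ennreal t) w \<le> Q (Suc n) ?m w" using t by (intro Q_mono w) (auto intro: ennreal_leI)
    then show "\<bar>Q n (ennreal t) w - Q (Suc n) (ennreal t) w\<bar> \<le> 3 * ?\<eta> n"
      using L[OF n] n n1 by (intro diff) auto
  qed
qed

text \<open>The bound is the tail of the geometric series of the errors
  \<open>3 * eta n\<close>.\<close>

lemma qv_uniform:
  assumes w: "w \<in> W" and tm: "tame w"
  shows "\<exists>n1. \<forall>n\<ge>n1. \<forall>t. 0 \<le> t \<and> t \<le> real m \<longrightarrow> \<bar>Q n (ennreal t) w - qv t w\<bar> \<le> 9 * eta n"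
proof -
  let ?\<eta> = eta
  obtain n1 where n1: "\<And>n t. n \<ge> n1 \<Longrightarrow> 0 \<le> t \<Longrightarrow> t \<le> real m \<Longrightarrow> \<bar>Q n (ennreal t) w - Q (Suc n) (ennreal t) w\<bar> \<le> 3 * ?\<eta> n"
    using tame_uniform[OF w tm, of m] by blast
  have far: "\<bar>Q n (ennreal t) w - Q k (ennreal t) w\<bar> \<le> 9 * ?\<eta> n - 9 * ?\<eta> k"
    if "n1 \<le> n" "n \<le> k" "0 \<le> t" "t \<le> real m" for n k t
    using that(2)
  proof (induction k rule: dec_induct)
    case (step k)
    have "\<bar>Q k (ennreal t) w - Q (Suc k) (ennreal t) w\<bar> \<le> 3 * ?\<eta> k" using n1 step that by simp
    moreover have "?\<eta> (Suc k) = 2/3 * ?\<eta> k" by (rule eta(3))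
    ultimately show ?case using step.IH by linarith
  qed simp
  note z = nine_eta
  show ?thesis
  proof (intro exI[of _ n1] allI impI)
    fix n t assume n: "n \<ge> n1" and t: "0 \<le> t \<and> t \<le> real m"
    have far': "\<bar>Q k (ennreal t) w - Q l (ennreal t) w\<bar> \<le> 9 * ?\<eta> k" if "n1 \<le> k" "k \<le> l" for k l
      using far[of k l t] t that eta(1)[of l] by (smt (verit))
    have "Cauchy (\<lambda>n. Q n (ennreal t) w)"
    proof (rule CauchyI)
      fix e :: real assume "0 < e"
      then obtain M where M: "\<And>n. n \<ge> M \<Longrightarrow> norm (9 * ?\<eta> n - 0) < e" using LIMSEQ_D[OF z] by blast
      have c: "\<bar>Q k (ennreal t) w - Q l (ennreal t) w\<bar> < e" if "k \<ge> max M n1" "l \<ge> k" for k l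
        using far'[of k l] M[of k] that by simp
      show "\<exists>M. \<forall>m\<ge>M. \<forall>n\<ge>M. norm (Q m (ennreal t) w - Q n (ennreal t) w) < e"
        using c by (intro exI[of _ "max M n1"] allI impI) (metis abs_minus_commute nle_le real_norm_def)
    qed
    then have lim: "(\<lambda>n. Q n (ennreal t) w) \<longlonglongrightarrow> qv t w"
      using tm by (simp add: qv_def Cauchy_convergent_iff convergent_LIMSEQ_iff)
    have "(\<lambda>k. \<bar>Q n (ennreal t) w - Q k (ennreal t) w\<bar>) \<longlonglongrightarrow> \<bar>Q n (ennreal t) w - qv t w\<bar>"
      by (intro tendsto_intros lim)
    then show "\<bar>Q n (ennreal t) w - qv t w\<bar> \<le> 9 * ?\<eta> n"
      by (rule LIMSEQ_le_const2) (use far'[OF n] in blast)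
  qed
qed

lemma Q_tendsto_qv:
  assumes w: "w \<in> W" and tm: "tame w" and t: "0 \<le> t"
  shows "(\<lambda>n. Q n (ennreal t) w) \<longlonglongrightarrow> qv t w"
proof -
  obtain m :: nat where "t \<le> real m" using real_arch_simple by blast
  then obtain n1 where "\<forall>n\<ge>n1. \<bar>Q n (ennreal t) w - qv t w\<bar> \<le> 9 * eta n"
    using qv_uniform[OF w tm, of m] t by blast
  then have "(\<lambda>n. Q n (ennreal t) w - qv t w) \<longlonglongrightarrow> 0"
    by (intro Lim_null_comparison[OF _ nine_eta]) (auto simp: eventually_sequentially)
  then show ?thesis by (rule LIM_zero_cancel)
qed

lemma qv_0: "w \<in> W \<Longrightarrow> qv 0 w = 0"
proof (cases "tame w")
  case True
  assume w: "w \<in> W"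
  have "cnt n 0 w = 0" for n using cnt_R[OF w, of n 0] by simp
  then have "(\<lambda>n. Q n (ennreal 0) w) = (\<lambda>_. 0)" by (simp add: Q_def)
  then show ?thesis using Q_tendsto_qv[OF w True, of 0] by (simp add: LIMSEQ_const_iff)
qed (simp add: qv_def)

lemma qv_mono:
  assumes w: "w \<in> W" and st: "0 \<le> s" "s \<le> t"
  shows "qv s w \<le> qv t w"
proof (cases "tame w")
  case True
  show ?thesis
    using st by (intro LIMSEQ_le[OF Q_tendsto_qv[OF w True] Q_tendsto_qv[OF w True]])
      (auto intro!: exI[of _ 0] Q_mono[OF w] ennreal_leI)
qed (simp add: qv_def)

lemma qv_nonneg: "w \<in> W \<Longrightarrow> 0 \<le> t \<Longrightarrow> 0 \<le> qv t w"
  using qv_mono[of w 0 t] by (simp add: qv_0)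

text \<open>Grid points are strictly increasing as long as they are finite, so near any time the
  count jumps at most once, and by one.\<close>

lemma cnt_locally:
  assumes w: "w \<in> W" and t: "0 \<le> t"
  shows "\<exists>d>0. \<forall>s\<ge>0. \<bar>s - t\<bar> < d \<longrightarrow> \<bar>real (cnt n (ennreal s) w) - real (cnt n (ennreal t) w)\<bar> \<le> 1"
proof -
  let ?k = "cnt n (ennreal t) w"
  have k: "R n ?k w \<le> ennreal t" "ennreal t < R n (Suc ?k) w" using cnt_bounds[OF w, of "ennreal t" n] by auto
  obtain u where u: "t < u" "ennreal u \<le> R n (Suc ?k) w"
  proof (cases "R n (Suc ?k) w")
    case (real u)
    then show ?thesis using k t by (intro that[of u]) (auto simp: ennreal_less_iff)
  next
    case top
    then show ?thesis by (intro that[of "t + 1"]) auto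
  qed
  obtain l where l: "l < t" "\<And>s. 0 \<le> s \<Longrightarrow> l < s \<Longrightarrow> ?k \<le> Suc (cnt n (ennreal s) w)"
  proof (cases ?k)
    case 0
    then show ?thesis by (intro that[of "t - 1"]) auto
  next
    case (Suc j)
    have fin: "R n (Suc j) w < \<top>" using k(1) Suc by (metis ennreal_less_top le_less_trans)
    have "R n j w < R n (Suc j) w" using R_strict[OF w R_finite_pred[OF w fin]] .
    then have "R n j w < ennreal t" using k(1) Suc by (metis less_le_trans)
    then obtain r where r: "0 \<le> r" "R n j w = ennreal r" "r < t"
      using t by (cases "R n j w") (auto simp: ennreal_less_iff)
    show ?thesis
    proof (rule that[OF r(3)])
      fix s assume "0 \<le> s" "r < s"
      then have "R n j w \<le> ennreal s" using r by (auto intro: ennreal_leI)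
      then have "j \<le> cnt n (ennreal s) w" using le_cnt_iff[OF w, of "ennreal s"] by simp
      then show "?k \<le> Suc (cnt n (ennreal s) w)" using Suc by simp
    qed
  qed
  have up: "cnt n (ennreal s) w \<le> ?k" if "0 \<le> s" "s < u" for s
  proof (rule ccontr)
    assume "\<not> ?thesis"
    then have "R n (Suc ?k) w \<le> ennreal s" using le_cnt_iff[OF w, of "ennreal s" "Suc ?k" n] by simp
    then have "ennreal u \<le> ennreal s" using u by (metis order_trans)
    then show False using that by (simp add: ennreal_le_iff)
  qed
  show ?thesis
  proof (intro exI[of _ "min (u - t) (t - l)"] conjI allI impI)
    fix s assume s: "0 \<le> s" "\<bar>s - t\<bar> < min (u - t) (t - l)"
    show "\<bar>real (cnt n (ennreal s) w) - real ?k\<bar> \<le> 1"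
    proof -
      have "s < u" "l < s" using s by (auto simp: abs_less_iff)
      then have "cnt n (ennreal s) w \<le> ?k" "?k \<le> Suc (cnt n (ennreal s) w)" using up l(2) s by auto
      then show ?thesis by linarith
    qed
  qed (use u l in auto)
qed

text \<open>On bounded intervals the limit is uniform, and the approximations jump by
  \<open>(1/4) ^ n\<close> only.\<close>

lemma qv_continuous:
  assumes w: "w \<in> W"
  shows "continuous_on {0..} (\<lambda>t. qv t w)"
proof (cases "tame w")
  case True
  show ?thesis
    unfolding continuous_on_iff
  proof (intro ballI allI impI)
    fix t e :: real assume t: "t \<in> {0..}" and e: "0 < e"
    obtain m :: nat where m: "t + 1 \<le> real m" using real_arch_simple by blast
    obtain n1 where n1: "\<And>n s. n \<ge> n1 \<Longrightarrow> 0 \<le> s \<Longrightarrow> s \<le> real m \<Longrightarrow> \<bar>Q n (ennreal s) w - qv s w\<bar> \<le> 9 * eta n"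
      using qv_uniform[OF w True, of m] by blast
    have "(\<lambda>n. (1/4::real) ^ n) \<longlonglongrightarrow> 0" by (rule LIMSEQ_power_zero) simp
    then have "(\<lambda>n. 9 * eta n + 9 * eta n + (1/4) ^ n) \<longlonglongrightarrow> 0 + 0 + 0"
      by (intro tendsto_add nine_eta)
    then have lim: "(\<lambda>n. 9 * eta n + 9 * eta n + (1/4) ^ n) \<longlonglongrightarrow> 0" by simp
    obtain M where M: "\<And>n. n \<ge> M \<Longrightarrow> norm (9 * eta n + 9 * eta n + (1/4) ^ n - 0) < e"
      using LIMSEQ_D[OF lim e] by blast
    define n where "n = max M n1"
    have small: "9 * eta n + 9 * eta n + (1/4) ^ n < e" using M[of n] by (simp add: n_def abs_less_iff)
    obtain d where d: "d > 0" "\<And>s. 0 \<le> s \<Longrightarrow> \<bar>s - t\<bar> < d \<Longrightarrow> \<bar>real (cnt n (ennreal s) w) - real (cnt n (ennreal t) w)\<bar> \<le> 1"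
      using cnt_locally[OF w, of t n] t by auto
    show "\<exists>d>0. \<forall>s\<in>{0..}. dist s t < d \<longrightarrow> dist (qv s w) (qv t w) < e"
    proof (intro exI[of _ "min d 1"] conjI ballI impI)
      fix s assume s: "s \<in> {0..}" "dist s t < min d 1"
      have "\<bar>Q n (ennreal s) w - Q n (ennreal t) w\<bar> = \<bar>real (cnt n (ennreal s) w) - real (cnt n (ennreal t) w)\<bar> * (step n)\<^sup>2"
        by (simp add: Q_def abs_mult left_diff_distrib[symmetric])
      also have "\<dots> \<le> 1 * (step n)\<^sup>2"
        using d(2)[of s] s by (intro mult_right_mono) (auto simp: dist_real_def)
      also have "\<dots> = (1/4) ^ n" by (simp add: step_sq power_one_over)
      finally have "\<bar>Q n (ennreal s) w - Q n (ennreal t) w\<bar> \<le> (1/4) ^ n" .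
      moreover have "\<bar>Q n (ennreal s) w - qv s w\<bar> \<le> 9 * eta n"
        using s m t by (intro n1) (auto simp: n_def dist_real_def)
      moreover have "\<bar>Q n (ennreal t) w - qv t w\<bar> \<le> 9 * eta n"
        using m t by (intro n1) (auto simp: n_def)
      ultimately show "dist (qv s w) (qv t w) < e" using small unfolding dist_real_def by linarith
    qed (use d in auto)
  qed
qed (simp add: qv_def)

lemma Q_measurable:
  "T \<in> borel_measurable path_space \<Longrightarrow> (\<lambda>w. Q n (T w) w) \<in> borel_measurable path_space"
  unfolding Q_def
  by (intro borel_measurable_times borel_measurable_const measurable_compose[OF cnt_measurable]) auto

lemma Q_nonant: "nonant (\<lambda>_. T) (\<lambda>w. Q n T w)"
  unfolding Q_def[abs_def] by (rule nonant_comp[OF cnt_nonant[OF adm_const]])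

lemma tame_measurable: "Measurable.pred path_space tame"
proof -
  have R: "Measurable.pred path_space (\<lambda>w. R (Suc n) j w < \<top>)" for n j
    unfolding pred_def by (rule borel_measurable_less[OF R_measurable]) simp
  have 1: "Measurable.pred path_space (\<lambda>w. \<bar>Q n (R (Suc n) j w) w - real j * (step (Suc n))\<^sup>2\<bar> \<le> 3 * eta n)" for n j
    unfolding pred_def by (rule borel_measurable_le) (intro borel_measurable_abs borel_measurable_diff Q_measurable R_measurable borel_measurable_const)+
  have 2: "Measurable.pred path_space (\<lambda>w. Q n (ennreal (real m)) w \<le> real q)" for n m q
    unfolding pred_def by (rule borel_measurable_le) (intro Q_measurable borel_measurable_const)+
  have "Measurable.pred path_space (\<lambda>w. \<forall>j\<in>{..L * 4 ^ Suc n}. R (Suc n) j w < \<top> \<longrightarrow>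
       \<bar>Q n (R (Suc n) j w) w - real j * (step (Suc n))\<^sup>2\<bar> \<le> 3 * eta n)" for L n
    by (rule pred_intros_finite(3)) (simp, intro pred_intros_logic R 1)
  then have 3: "Measurable.pred path_space (\<lambda>w. \<forall>j \<le> L * 4 ^ Suc n. R (Suc n) j w < \<top> \<longrightarrow>
       \<bar>Q n (R (Suc n) j w) w - real j * (step (Suc n))\<^sup>2\<bar> \<le> 3 * eta n)" for L n
    by (simp only: atMost_iff Ball_def)
  have "Measurable.pred path_space (\<lambda>w.
    (\<forall>L::nat. \<exists>n0::nat. \<forall>n::nat. n \<ge> n0 \<longrightarrow> (\<forall>j \<le> L * 4 ^ Suc n. R (Suc n) j w < \<top> \<longrightarrow>
       \<bar>Q n (R (Suc n) j w) w - real j * (step (Suc n))\<^sup>2\<bar> \<le> 3 * eta n)) \<and>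
    (\<forall>m::nat. \<exists>q::nat. \<forall>n0::nat. \<exists>n::nat. n \<ge> n0 \<and> Q n (ennreal (real m)) w \<le> real q))"
    by (intro pred_intros_logic(3) pred_intros_countable pred_intros_imp' pred_intros_conj1' 3 2)
  then show ?thesis by (simp only: tame_def[abs_def])
qed

lemma qv_measurable: "qv t \<in> borel_measurable path_space"
proof -
  have "(\<lambda>w. if tame w then lim (\<lambda>n. Q n (ennreal t) w) else 0) \<in> borel_measurable path_space"
    by (rule measurable_If[OF _ _ tame_measurable[unfolded pred_def]])
      (intro borel_measurable_lim_metric Q_measurable borel_measurable_const)+
  then show ?thesis by (simp only: qv_def[abs_def])
qed

text \<open>Convergence and the limit depend only on the grids of high level. Reflections at level
  \<open>n\<close> fix just those, although they may move coarser grids.\<close>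

lemma
  assumes eq: "\<And>m j. n \<le> m \<Longrightarrow> R m j w' = R m j w"
  shows tame_tail: "tame w' = tame w" and qv_tail: "qv t w' = qv t w"
    and Q_tail: "n \<le> m \<Longrightarrow> Q m T w' = Q m T w"
proof -
  have Q: "Q m T w' = Q m T w" if "n \<le> m" for m T
    using eq[OF that] by (simp add: Q_def cnt_def)
  then show "n \<le> m \<Longrightarrow> Q m T w' = Q m T w" by simp
  have Q2: "Q m (R (Suc m) j w') w' = Q m (R (Suc m) j w) w" if "n \<le> m" for m j
    using eq[of "Suc m" j] Q[OF that] that by simp
  \<comment> \<open>The thresholds in both conditions may be taken beyond \<open>n\<close>, where
    the two paths have equal grids.\<close>
  have half: "(\<forall>L::nat. \<exists>n0. \<forall>m\<ge>n0. \<forall>j \<le> L * 4 ^ Suc m. R (Suc m) j v < \<top> \<longrightarrow>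
       \<bar>Q m (R (Suc m) j v) v - real j * (step (Suc m))\<^sup>2\<bar> \<le> 3 * eta m) \<longleftrightarrow>
    (\<forall>L::nat. \<exists>n0\<ge>n. \<forall>m\<ge>n0. \<forall>j \<le> L * 4 ^ Suc m. R (Suc m) j v < \<top> \<longrightarrow>
       \<bar>Q m (R (Suc m) j v) v - real j * (step (Suc m))\<^sup>2\<bar> \<le> 3 * eta m)" for v
    by (meson nle_le order_trans)
  have half2: "(\<forall>n0. \<exists>k\<ge>n0. Q k T v \<le> real q) \<longleftrightarrow> (\<forall>n0\<ge>n. \<exists>k\<ge>n0. Q k T v \<le> real q)" for T v and q :: nat
    by (meson nle_le order_trans)
  show t: "tame w' = tame w"
    unfolding tame_def half half2 using Q Q2 eq[of "Suc _"]
    by (intro arg_cong2[where f="(\<and>)"] all_cong1 ex_cong1 conj_cong imp_cong refl) auto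
  have "lim (\<lambda>m. Q m (ennreal t) w') = lim (\<lambda>m. Q m (ennreal t) w)"
    unfolding lim_def
    by (intro arg_cong[where f=The] ext tendsto_cong) (use Q in \<open>auto simp: eventually_sequentially\<close>)
  then show "qv t w' = qv t w" by (simp add: qv_def t)
qed

lemma
  assumes w: "w \<in> W"
  shows qv_reflect: "qv t (reflect (R n k) w) = qv t w"
    and tame_reflect: "tame (reflect (R n k) w) = tame w"
  using R_reflect_R[OF w] by (auto intro!: qv_tail[of n] tame_tail[of n])

section \<open>Discrete stochastic integrals along a grid\<close>

locale reflection_law = path_law +
  assumes reflect_preserving: "adm T \<Longrightarrow> preserving (reflect T)"
begin

lemma law_measurable: "f \<in> path_space \<rightarrow>\<^sub>M N \<Longrightarrow> f \<in> \<mu> \<rightarrow>\<^sub>M N"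
  using measurable_cong_sets[OF sets_law refl] by blast

lemma bounded_integrable:
  fixes f :: "_ \<Rightarrow> 'b :: {banach, second_countable_topology}"
  assumes "f \<in> borel_measurable path_space" "\<And>w. w \<in> W \<Longrightarrow> norm (f w) \<le> B"
  shows "integrable \<mu> f"
  using assms by (intro integrable_const_bound[where B=B] law_measurable) auto

lemma square_integrable:
  fixes f :: "_ \<Rightarrow> real"
  assumes "f \<in> borel_measurable path_space" "\<And>w. w \<in> W \<Longrightarrow> \<bar>f w\<bar> \<le> B"
  shows "integrable \<mu> (\<lambda>w. (f w)\<^sup>2)"
proof (rule bounded_integrable)
  show "(\<lambda>w. (f w)\<^sup>2) \<in> borel_measurable path_space" by (intro borel_measurable_power assms)
  fix w assume "w \<in> W"
  from power_mono[OF assms(2)[OF this], of 2] show "norm ((f w)\<^sup>2) \<le> B\<^sup>2" by simp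
qed

text \<open>Replaces conditioning on the past: instead of a conditional mean of zero, one exhibits a
  law-preserving map that changes the sign.\<close>

lemma integral_antisym:
  fixes f :: "_ \<Rightarrow> real"
  assumes p: "preserving \<psi>" and f: "f \<in> borel_measurable path_space"
    and anti: "\<And>w. w \<in> W \<Longrightarrow> f (\<psi> w) = - f w"
  shows "(\<integral>w. f w \<partial>\<mu>) = 0"
proof -
  have "(\<integral>w. f w \<partial>\<mu>) = (\<integral>w. f (\<psi> w) \<partial>\<mu>)" using preserving_integral[OF p f] by simp
  also have "\<dots> = (\<integral>w. - f w \<partial>\<mu>)" by (rule Bochner_Integration.integral_cong) (simp_all add: anti)
  also have "\<dots> = - (\<integral>w. f w \<partial>\<mu>)" by (rule integral_minus)
  finally show ?thesis by simp
qed

lemma incr_nonant: "i < k \<Longrightarrow> nonant (R n k) (incr n i)"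
proof -
  assume i: "i < k"
  have le: "R n (Suc i) w \<le> R n k w" for w using i by (intro grid_mono) simp
  have "nonant (R n k) (R n (Suc i))" by (rule nonant_mono[OF adm_nonant[OF adm_R] le])
  moreover have "nonant (R n k) (val n (Suc i))" "nonant (R n k) (val n i)"
    using i by (auto intro: val_nonant)
  ultimately show ?thesis unfolding incr_def nonant_def by simp
qed

lemma incr_bound: "w \<in> W \<Longrightarrow> \<bar>incr n k w\<bar> \<le> step n"
  using incr_abs[of w n k] by (simp add: incr_def)

definition transform :: "nat \<Rightarrow> (nat \<Rightarrow> (real \<Rightarrow> real) \<Rightarrow> real) \<Rightarrow> nat \<Rightarrow> (real \<Rightarrow> real) \<Rightarrow> real" where
  "transform n c J w = (\<Sum>i<J. c i w * incr n i w)"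

context
  fixes n :: nat and c :: "nat \<Rightarrow> (real \<Rightarrow> real) \<Rightarrow> real" and B :: real
  assumes c: "\<And>i. c i \<in> borel_measurable path_space" "\<And>i. nonant (R n i) (c i)"
    and B: "\<And>i w. w \<in> W \<Longrightarrow> \<bar>c i w\<bar> \<le> B"
begin

lemma transform_measurable: "transform n c J \<in> borel_measurable path_space"
  unfolding transform_def[abs_def]
  by (intro borel_measurable_sum borel_measurable_times c(1) incr_measurable)

lemma transform_nonant: "J \<le> k \<Longrightarrow> nonant (R n k) (transform n c J)"
proof -
  assume J: "J \<le> k"
  have "nonant (R n k) (c i)" if "i < J" for i
    using nonant_mono[OF c(2)[of i], of "R n k"] that J grid_mono[of i k] by simp
  moreover have "nonant (R n k) (incr n i)" if "i < J" for i using incr_nonant that J by simp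
  ultimately show ?thesis unfolding transform_def nonant_def by (auto intro!: sum.cong)
qed

lemma B_nonneg: "w \<in> W \<Longrightarrow> 0 \<le> B"
  using B[of w 0] by linarith

lemma term_bound: "w \<in> W \<Longrightarrow> \<bar>c i w * incr n i w\<bar> \<le> B * step n"
  unfolding abs_mult by (intro mult_mono B incr_bound B_nonneg) auto

lemma transform_bound: "w \<in> W \<Longrightarrow> \<bar>transform n c J w\<bar> \<le> real J * (B * step n)"
proof -
  assume w: "w \<in> W"
  have "\<bar>transform n c J w\<bar> \<le> (\<Sum>i<J. \<bar>c i w * incr n i w\<bar>)" unfolding transform_def by (rule sum_abs)
  also have "\<dots> \<le> (\<Sum>i<J. B * step n)" by (intro sum_mono term_bound w)
  finally show ?thesis by simp
qed

text \<open>Orthogonality of the increments. Reflection at \<open>R n J\<close> fixes the transform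
  of length \<open>J\<close> and the next coefficient but flips the next increment, so the cross
  term has mean zero.\<close>

lemma transform_square:
  "(\<integral>w. (transform n c J w)\<^sup>2 \<partial>\<mu>) = (\<Sum>i<J. \<integral>w. (c i w * incr n i w)\<^sup>2 \<partial>\<mu>)"
proof (induction J)
  case (Suc J)
  let ?S = "transform n c J" and ?x = "\<lambda>w. c J w * incr n J w"
  have m: "?S \<in> borel_measurable path_space" "?x \<in> borel_measurable path_space"
    by (auto intro!: transform_measurable c(1) borel_measurable_times)
  have b: "\<bar>?S w\<bar> \<le> real J * (B * step n)" "\<bar>?x w\<bar> \<le> B * step n" if "w \<in> W" for w
    using transform_bound term_bound that by auto
  have i1: "integrable \<mu> (\<lambda>w. (?S w)\<^sup>2)"
    by (rule square_integrable[OF m(1) b(1)])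
  have i2: "integrable \<mu> (\<lambda>w. (?x w)\<^sup>2)"
    by (rule square_integrable[OF m(2) b(2)])
  have i3: "integrable \<mu> (\<lambda>w. ?S w * ?x w)"
  proof (rule bounded_integrable[where B="(real J * (B * step n)) * (B * step n)"])
    show "(\<lambda>w. ?S w * ?x w) \<in> borel_measurable path_space" by (intro borel_measurable_times m)
    fix w assume w: "w \<in> W"
    show "norm (?S w * ?x w) \<le> (real J * (B * step n)) * (B * step n)"
      unfolding real_norm_def abs_mult[of "transform n c J w"] using b[OF w] B_nonneg[OF w] by (intro mult_mono) auto
  qed
  have z: "(\<integral>w. ?S w * ?x w \<partial>\<mu>) = 0"
  proof (rule integral_antisym[OF reflect_preserving[OF adm_R[of n J]]])
    fix w assume w: "w \<in> W"
    have "?S (reflect (R n J) w) = ?S w" "c J (reflect (R n J) w) = c J w"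
      using nonant_reflect[OF transform_nonant[OF order_refl] w] nonant_reflect[OF c(2) w] by auto
    then show "?S (reflect (R n J) w) * ?x (reflect (R n J) w) = - (?S w * ?x w)"
      by (simp add: incr_reflect[OF w])
  qed (intro borel_measurable_times m)
  have "(\<integral>w. (transform n c (Suc J) w)\<^sup>2 \<partial>\<mu>) = (\<integral>w. (?S w)\<^sup>2 + (2 * (?S w * ?x w) + (?x w)\<^sup>2) \<partial>\<mu>)"
    by (simp add: transform_def power2_sum algebra_simps)
  also have "\<dots> = (\<integral>w. (?S w)\<^sup>2 \<partial>\<mu>) + (2 * (\<integral>w. ?S w * ?x w \<partial>\<mu>) + (\<integral>w. (?x w)\<^sup>2 \<partial>\<mu>))"
    using i1 i2 i3 by (simp only: Bochner_Integration.integral_add Bochner_Integration.integrable_add integrable_mult_right integral_mult_right_zero)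
  finally show ?case using Suc z by simp
qed (simp add: transform_def)

lemma transform_square_le:
  "(\<integral>w. (transform n c J w)\<^sup>2 \<partial>\<mu>) \<le> real J * (B * step n)\<^sup>2"
proof -
  have "(\<integral>w. (c i w * incr n i w)\<^sup>2 \<partial>\<mu>) \<le> (B * step n)\<^sup>2" for i
  proof (rule integral_le_const)
    have "(c i w * incr n i w)\<^sup>2 \<le> (B * step n)\<^sup>2" if "w \<in> W" for w
      using power_mono[OF term_bound[OF that, of i], of 2] by simp
    moreover have "(\<lambda>w. (c i w * incr n i w)\<^sup>2) \<in> borel_measurable path_space"
      by (intro borel_measurable_power borel_measurable_times c(1) incr_measurable)
    ultimately show "integrable \<mu> (\<lambda>w. (c i w * incr n i w)\<^sup>2)" "AE w in \<mu>. (c i w * incr n i w)\<^sup>2 \<le> (B * step n)\<^sup>2"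
      by (auto intro!: bounded_integrable)
  qed
  then have "(\<Sum>i<J. \<integral>w. (c i w * incr n i w)\<^sup>2 \<partial>\<mu>) \<le> (\<Sum>i<J. (B * step n)\<^sup>2)" by (intro sum_mono)
  then show ?thesis unfolding transform_square by simp
qed

end

text \<open>Stopping the transform when it leaves \<open>(-\<lambda>, \<lambda>)\<close> turns Chebyshev's inequality into a maximal one.\<close>

lemma transform_maximal:
  assumes c: "\<And>i. c i \<in> borel_measurable path_space" "\<And>i. nonant (R n i) (c i)"
    and B: "\<And>i w. w \<in> W \<Longrightarrow> \<bar>c i w\<bar> \<le> B" and l: "0 < l"
  shows "measure \<mu> {w\<in>W. \<exists>j\<le>J. l \<le> \<bar>transform n c j w\<bar>} \<le> real J * (B * step n)\<^sup>2 / l\<^sup>2"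
proof -
  define d where "d i w = (if \<forall>j\<in>{..i}. \<bar>transform n c j w\<bar> < l then c i w else 0)" for i w
  have tm: "transform n c j \<in> borel_measurable path_space" for j
    by (rule transform_measurable[OF c B])
  have pm: "Measurable.pred path_space (\<lambda>w. \<forall>j\<in>{..i}. \<bar>transform n c j w\<bar> < l)" for i
    by (rule pred_intros_finite(3)) (simp, unfold pred_def, rule borel_measurable_less, intro borel_measurable_abs tm, simp)
  have d: "d i \<in> borel_measurable path_space" for i
    unfolding d_def[abs_def] by (rule measurable_If[OF c(1) _ pm[unfolded pred_def]]) simp
  have dn: "nonant (R n i) (d i)" for i
  proof -
    have tn: "nonant (R n i) (transform n c j)" if "j \<le> i" for j by (rule transform_nonant[OF c B that])
    show ?thesis
    proof (rule nonantI)
      fix w w' assume w: "w \<in> W" "w' \<in> W" "agree (R n i w) w w'"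
      have "transform n c j w' = transform n c j w" if "j \<le> i" for j by (rule nonantD[OF tn[OF that] w])
      then have "(\<forall>j\<in>{..i}. \<bar>transform n c j w'\<bar> < l) = (\<forall>j\<in>{..i}. \<bar>transform n c j w\<bar> < l)" by simp
      moreover have "c i w' = c i w" by (rule nonantD[OF c(2) w])
      ultimately show "d i w' = d i w" unfolding d_def by (simp only:)
    qed
  qed
  have dB: "\<bar>d i w\<bar> \<le> B" if "w \<in> W" for i w
    using B[OF that, of i] B_nonneg[OF c B that] by (simp add: d_def)
  let ?E = "{w\<in>W. \<exists>j\<le>J. l \<le> \<bar>transform n c j w\<bar>}" and ?Y = "transform n d J"
  have sub: "?E \<subseteq> {w \<in> space \<mu>. l\<^sup>2 \<le> (?Y w)\<^sup>2}"
  proof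
    fix w assume "w \<in> ?E"
    then have w: "w \<in> W" and ex: "\<exists>j. j \<le> J \<and> l \<le> \<bar>transform n c j w\<bar>" by auto
    define k where "k = (LEAST j. j \<le> J \<and> l \<le> \<bar>transform n c j w\<bar>)"
    have k: "k \<le> J" "l \<le> \<bar>transform n c k w\<bar>" using LeastI_ex[OF ex] by (auto simp: k_def)
    have lt: "\<bar>transform n c j w\<bar> < l" if "j < k" for j
      using not_less_Least[of j "\<lambda>j. j \<le> J \<and> l \<le> \<bar>transform n c j w\<bar>"] that k(1) by (auto simp: k_def)
    have "?Y w = (\<Sum>i<k. d i w * incr n i w)"
      unfolding transform_def
    proof (rule sum.mono_neutral_right)
      show "\<forall>i\<in>{..<J} - {..<k}. d i w * incr n i w = 0"
      proof
        fix i assume "i \<in> {..<J} - {..<k}"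
        then have "k \<le> i" by auto
        then have "\<not> (\<forall>j\<in>{..i}. \<bar>transform n c j w\<bar> < l)" using k(2) by (metis atMost_iff leD)
        then have "d i w = 0" unfolding d_def by (simp only: if_False)
        then show "d i w * incr n i w = 0" by simp
      qed
    qed (use k in auto)
    also have "\<dots> = transform n c k w" unfolding transform_def
      by (intro sum.cong refl) (auto simp: d_def lt)
    finally have "l \<le> \<bar>?Y w\<bar>" using k by simp
    then have "l\<^sup>2 \<le> \<bar>?Y w\<bar>\<^sup>2" using l by (intro power_mono) auto
    then show "w \<in> {w \<in> space \<mu>. l\<^sup>2 \<le> (?Y w)\<^sup>2}" using w by simp
  qed
  have Ym: "?Y \<in> borel_measurable path_space" by (rule transform_measurable[OF d dn dB])
  have "integrable \<mu> (\<lambda>w. (?Y w)\<^sup>2)"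
  proof (rule bounded_integrable)
    show "(\<lambda>w. (?Y w)\<^sup>2) \<in> borel_measurable path_space" by (intro borel_measurable_power Ym)
    fix w assume "w \<in> W"
    from power_mono[OF transform_bound[OF d dn dB this, of J], of 2]
    show "norm ((?Y w)\<^sup>2) \<le> (real J * (B * step n))\<^sup>2" by simp
  qed
  moreover have m: "{w \<in> space \<mu>. l\<^sup>2 \<le> (?Y w)\<^sup>2} \<in> sets \<mu>"
    using law_measurable[OF Ym] by measurable
  ultimately have "measure \<mu> {w \<in> space \<mu>. l\<^sup>2 \<le> (?Y w)\<^sup>2} \<le> (\<integral>w. (?Y w)\<^sup>2 \<partial>\<mu>) / l\<^sup>2"
    using l by (intro integral_Markov_inequality_measure[where A="space \<mu>"]) auto
  also have "\<dots> \<le> real J * (B * step n)\<^sup>2 / l\<^sup>2"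
    by (intro divide_right_mono transform_square_le[OF d dn dB]) auto
  finally show ?thesis using finite_measure_mono[OF sub m] by linarith
qed

text \<open>By \<open>dev_sum\<close> the error is a transform whose coefficients are bounded by one
  fine step. The maximal inequality makes the exceptional probabilities summable, and Borel-Cantelli
  applies.\<close>

lemma AE_fine_coarse:
  "AE w in \<mu>. \<forall>L::nat. \<exists>n0. \<forall>n\<ge>n0. \<forall>j \<le> L * 4 ^ Suc n. R (Suc n) j w < \<top> \<longrightarrow>
       \<bar>Q n (R (Suc n) j w) w - real j * (step (Suc n))\<^sup>2\<bar> \<le> 3 * eta n"
proof -
  define c where "c n i w = (if R (Suc n) i w < \<top> then dev n i w else 0)" for n i w
  have c: "c n i \<in> borel_measurable path_space" "nonant (R (Suc n) i) (c n i)" for n i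
  proof -
    have "{w \<in> W. R (Suc n) i w < \<top>} \<in> sets path_space" by (rule borel_measurable_less[OF R_measurable]) simp
    then show "c n i \<in> borel_measurable path_space" unfolding c_def[abs_def]
      by (intro measurable_If dev_measurable) auto
    show "nonant (R (Suc n) i) (c n i)" unfolding c_def[abs_def] by (rule dev_nonant)
  qed
  have cB: "\<bar>c n i w\<bar> \<le> step (Suc n)" if "w \<in> W" for n i w
    using dev_abs[OF that, of n i] by (simp add: c_def)
  let ?X = "\<lambda>n. transform (Suc n) (c n)"
  define E where "E L n = {w\<in>W. \<exists>j\<le>L * 4 ^ Suc n. eta n \<le> \<bar>?X n j w\<bar>}" for L n
  have Em: "E L n \<in> sets \<mu>" for L n
  proof -
    have "Measurable.pred path_space (\<lambda>w. \<exists>j\<in>{..L * 4 ^ Suc n}. eta n \<le> \<bar>?X n j w\<bar>)"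
      by (rule pred_intros_finite(4)) (simp, unfold pred_def, rule borel_measurable_le, simp, intro borel_measurable_abs transform_measurable[OF c cB])
    moreover have "E L n = {w\<in>W. \<exists>j\<in>{..L * 4 ^ Suc n}. eta n \<le> \<bar>?X n j w\<bar>}" by (auto simp: E_def)
    ultimately show ?thesis by (simp only: pred_def sets_law)
  qed
  \<comment> \<open>There are \<open>L * 4 ^ Suc n\<close> terms, each of variance at most the
    fourth power of a fine step; dividing by the square of \<open>eta n\<close> leaves the ratio
    \<open>9/16\<close>.\<close>
  have bound: "measure \<mu> (E L n) \<le> real L / 4 * (9 / 16) ^ n" for L n
  proof -
    have s: "(step (Suc n) * step (Suc n))\<^sup>2 = (1 / 4 ^ Suc n)\<^sup>2"
      by (simp only: power2_eq_square[symmetric] step_sq)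
    have "measure \<mu> (E L n) \<le> real (L * 4 ^ Suc n) * (step (Suc n) * step (Suc n))\<^sup>2 / (eta n)\<^sup>2"
      unfolding E_def by (rule transform_maximal[OF c cB eta(1)])
    also have "\<dots> = real L * (1 / 4 ^ Suc n) / (eta n)\<^sup>2"
      unfolding s by (simp add: power2_eq_square)
    also have "\<dots> = real L / 4 * ((1 / 4) ^ n / ((2/3)\<^sup>2) ^ n)"
      unfolding eta_def by (simp add: power_mult[symmetric] mult.commute[of 2] power_one_over)
    also have "(1 / 4) ^ n / ((2/3)\<^sup>2) ^ n = (9 / 16 :: real) ^ n"
      unfolding power_divide[symmetric] by (simp add: power2_eq_square)
    finally show ?thesis .
  qed
  have AE: "AE w in \<mu>. \<forall>\<^sub>F n in sequentially. w \<in> space \<mu> - E L n" for L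
  proof (rule borel_cantelli_AE1)
    have "summable (\<lambda>n. real L / 4 * (9 / 16) ^ n)" by (intro summable_mult summable_geometric) simp
    then have "summable (\<lambda>n. measure \<mu> (E L n))"
      by (rule summable_comparison_test'[where N=0]) (use bound in auto)
    then show "summable (\<lambda>n. measure \<mu> (E L n))" .
    show "emeasure \<mu> (E L n) < \<infinity>" for n
      using emeasure_finite[of "E L n"] unfolding infinity_ennreal_def by (rule top.not_eq_extremum[THEN iffD1])
  qed (use Em in auto)
  then have "AE w in \<mu>. \<forall>L. \<forall>\<^sub>F n in sequentially. w \<in> space \<mu> - E L n"
    by (simp add: AE_all_countable)
  then show ?thesis
  proof (rule AE_mp, intro AE_I2 impI allI)
    fix w L assume "w \<in> space \<mu>" and ev: "\<forall>L. \<forall>\<^sub>F n in sequentially. w \<in> space \<mu> - E L n"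
    then have w: "w \<in> W" by simp
    from ev obtain n0 where n0: "\<And>n. n \<ge> n0 \<Longrightarrow> w \<notin> E L n" unfolding eventually_sequentially by blast
    show "\<exists>n0. \<forall>n\<ge>n0. \<forall>j \<le> L * 4 ^ Suc n. R (Suc n) j w < \<top> \<longrightarrow>
       \<bar>Q n (R (Suc n) j w) w - real j * (step (Suc n))\<^sup>2\<bar> \<le> 3 * eta n"
    proof (intro exI[of _ n0] allI impI)
      fix n j assume n: "n \<ge> n0" and j: "j \<le> L * 4 ^ Suc n" and fin: "R (Suc n) j w < \<top>"
      have lt: "\<bar>?X n j w\<bar> < eta n" using n0[OF n] w j unfolding E_def mem_Collect_eq by (meson not_le)
      have "R (Suc n) i w < \<top>" if "i < j" for i
        using grid_mono[of i j "\<lambda>_. step (Suc n)" w] that fin by (auto intro: le_less_trans)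
      then have "?X n j w = (\<Sum>i<j. dev n i w * incr (Suc n) i w)"
        unfolding transform_def c_def by (intro sum.cong) auto
      then have eq: "Q n (R (Suc n) j w) w - real j * (step (Suc n))\<^sup>2 = 2 * ?X n j w - (dev n j w)\<^sup>2"
        using dev_sum[OF w fin] by (simp add: Q_def)
      have "(dev n j w)\<^sup>2 \<le> (step (Suc n))\<^sup>2"
        using power_mono[OF dev_abs[OF w fin], of 2] by simp
      also have "\<dots> \<le> eta n"
      proof -
        have "(1 / 4 :: real) ^ n \<le> (2 / 3) ^ n" by (rule power_mono) auto
        moreover have "(step (Suc n))\<^sup>2 = 1/4 * (1/4) ^ n" by (simp add: step_sq power_one_over)
        moreover have "0 \<le> (1/4 :: real) ^ n" by simp
        ultimately show ?thesis unfolding eta_def by linarith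
      qed
      finally have "(dev n j w)\<^sup>2 \<le> eta n" .
      moreover have "0 \<le> (dev n j w)\<^sup>2" by simp
      \<comment> \<open>Two units of \<open>eta n\<close> come from twice the transform and the
        third from the squared offset.\<close>
      ultimately show "\<bar>Q n (R (Suc n) j w) w - real j * (step (Suc n))\<^sup>2\<bar> \<le> 3 * eta n"
        unfolding eq using lt by linarith
    qed
  qed
qed

text \<open>The walk on the grid, stopped once it leaves \<open>[- C, C]\<close>, is bounded by
  \<open>C + 1\<close>. Its second moment is the expected sum of the squared increments taken so
  far, so these expectations are bounded uniformly in the level and Fatou makes their lower limit
  finite. A given path is bounded on a bounded interval, where for large \<open>C\<close> no
  stopping occurs.\<close>

lemma AE_count_bounded:
  "AE w in \<mu>. \<forall>m::nat. \<exists>q::nat. \<forall>n0. \<exists>n\<ge>n0. Q n (ennreal (real m)) w \<le> real q"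
proof -
  define c where "c C n i w = (if \<forall>j\<in>{..i}. \<bar>val n j w\<bar> \<le> real C then 1 else 0 :: real)" for C n i :: nat and w
  have pm: "Measurable.pred path_space (\<lambda>w. \<forall>j\<in>{..i}. \<bar>val n j w\<bar> \<le> real C)" for n i C
    by (rule pred_intros_finite(3)) (simp, unfold pred_def, rule borel_measurable_le, intro borel_measurable_abs val_measurable, simp)
  have c: "c C n i \<in> borel_measurable path_space" "nonant (R n i) (c C n i)" for C n i
  proof -
    show "c C n i \<in> borel_measurable path_space" unfolding c_def[abs_def]
      by (rule measurable_If[OF _ _ pm[unfolded pred_def]]) simp_all
    have "nonant (R n i) (val n j)" if "j \<le> i" for j by (rule val_nonant[OF that])
    then have "nonant (R n i) (\<lambda>w. \<forall>j\<in>{..i}. \<bar>val n j w\<bar> \<le> real C)"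
      unfolding nonant_def by (metis atMost_iff)
    then show "nonant (R n i) (c C n i)" unfolding c_def[abs_def] by (rule nonant_comp)
  qed
  have cB: "\<bar>c C n i w\<bar> \<le> 1" for C n i w by (simp add: c_def)
  note tr_measurable = transform_measurable[where n=n and c="c C n" and B=1 for C n, OF c cB]
    and tr_bound = term_bound[where n=n and c="c C n" and B=1 for C n, OF c cB]
    and tr_square = transform_square[where n=n and c="c C n" and B=1 for C n, OF c cB]
  have key: "\<bar>transform n (c C n) J w\<bar> \<le> real C + 1" if w: "w \<in> W" for n C J w
  proof -
    \<comment> \<open>The transform always equals one of the positions of the walk: the current one
      as long as neither stopping nor the end of the grid has occurred.\<close>
    have "\<exists>j\<le>J. transform n (c C n) J w = val n j w \<and> \<bar>val n j w\<bar> \<le> real C + 1 \<and>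
        ((\<forall>i\<le>J. \<bar>val n i w\<bar> \<le> real C) \<and> R n J w < \<top> \<longrightarrow> j = J)"
    proof (induction J)
      case 0
      show ?case using val_0[OF w, of n] by (simp add: transform_def)
    next
      case (Suc J)
      then obtain j where j: "j \<le> J" "transform n (c C n) J w = val n j w" "\<bar>val n j w\<bar> \<le> real C + 1"
        "(\<forall>i\<le>J. \<bar>val n i w\<bar> \<le> real C) \<and> R n J w < \<top> \<longrightarrow> j = J" by blast
      have S: "transform n (c C n) (Suc J) w = val n j w + c C n J w * incr n J w"
        using j(2) by (simp add: transform_def)
      show ?case
      proof (cases "(\<forall>i\<le>J. \<bar>val n i w\<bar> \<le> real C) \<and> R n (Suc J) w < \<top>")
        case True
        then have "j = J" using j(4) R_finite_pred[OF w] by blast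
        moreover have "c C n J w = 1" using True by (simp add: c_def)
        moreover have "incr n J w = val n (Suc J) w - val n J w" using True by (simp add: incr_def)
        moreover have "\<bar>val n (Suc J) w - val n J w\<bar> = step n" using incr_abs[OF w] True by blast
        moreover have "step n \<le> 1" by (simp add: step_def)
        moreover have "\<bar>val n J w\<bar> \<le> real C" using True by blast
        ultimately show ?thesis using S by (intro exI[of _ "Suc J"]) auto
      next
        case False
        then have "c C n J w = 0 \<or> incr n J w = 0" by (auto simp: c_def incr_def)
        then have "c C n J w * incr n J w = 0" by simp
        then show ?thesis using S j False by (intro exI[of _ j]) auto
      qed
    qed
    then show ?thesis by auto
  qed
  define f where "f C n w = (\<Sum>i. ennreal ((c C n i w * incr n i w)\<^sup>2))" for C n w
  have tmeas: "(\<lambda>w. (c C n i w * incr n i w)\<^sup>2) \<in> borel_measurable path_space" for C n i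
    by (intro borel_measurable_power borel_measurable_times c(1) incr_measurable)
  have fm: "f C n \<in> borel_measurable \<mu>" for C n
    unfolding f_def[abs_def]
    by (intro borel_measurable_suminf_order measurable_compose[OF law_measurable[OF tmeas] measurable_ennreal])
  have fint: "(\<integral>\<^sup>+w. f C n w \<partial>\<mu>) \<le> ennreal ((real C + 1)\<^sup>2)" for C n
  proof -
    have "(\<integral>\<^sup>+w. f C n w \<partial>\<mu>) = (\<Sum>i. \<integral>\<^sup>+w. ennreal ((c C n i w * incr n i w)\<^sup>2) \<partial>\<mu>)"
      unfolding f_def
      by (intro nn_integral_suminf measurable_compose[OF law_measurable[OF tmeas] measurable_ennreal])
    also have "\<dots> = (\<Sum>i. ennreal (\<integral>w. (c C n i w * incr n i w)\<^sup>2 \<partial>\<mu>))"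
    proof (intro suminf_cong nn_integral_eq_integral)
      fix i
      have "(c C n i w * incr n i w)\<^sup>2 \<le> (1 * step n)\<^sup>2" if "w \<in> W" for w
        using power_mono[OF tr_bound[OF that, of C n i], of 2] by simp
      then show "integrable \<mu> (\<lambda>w. (c C n i w * incr n i w)\<^sup>2)"
        by (intro bounded_integrable[OF tmeas, where B="(1 * step n)\<^sup>2"]) auto
    qed auto
    also have "\<dots> \<le> ennreal ((real C + 1)\<^sup>2)"
      unfolding suminf_eq_SUP
    proof (rule SUP_least)
      fix J
      have "(\<Sum>i<J. ennreal (\<integral>w. (c C n i w * incr n i w)\<^sup>2 \<partial>\<mu>)) = ennreal (\<integral>w. (transform n (c C n) J w)\<^sup>2 \<partial>\<mu>)"
        unfolding tr_square by (rule sum_ennreal) simp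
      also have "\<dots> \<le> ennreal ((real C + 1)\<^sup>2)"
      proof (intro ennreal_leI integral_le_const)
        have "(transform n (c C n) J w)\<^sup>2 \<le> (real C + 1)\<^sup>2" if "w \<in> W" for w
          using power_mono[OF key[OF that, of n C J], of 2] by simp
        then show "integrable \<mu> (\<lambda>w. (transform n (c C n) J w)\<^sup>2)" "AE w in \<mu>. (transform n (c C n) J w)\<^sup>2 \<le> (real C + 1)\<^sup>2"
          by (auto intro!: bounded_integrable[where B="(real C + 1)\<^sup>2"] borel_measurable_power tr_measurable)
      qed
      finally show "(\<Sum>i<J. ennreal (\<integral>w. (c C n i w * incr n i w)\<^sup>2 \<partial>\<mu>)) \<le> ennreal ((real C + 1)\<^sup>2)" .
    qed
    finally show ?thesis .
  qed
  have "AE w in \<mu>. liminf (\<lambda>n. f C n w) \<noteq> \<infinity>" for C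
  proof (rule nn_integral_PInf_AE)
    show "(\<lambda>w. liminf (\<lambda>n. f C n w)) \<in> borel_measurable \<mu>" using fm by measurable
    have "(\<integral>\<^sup>+w. liminf (\<lambda>n. f C n w) \<partial>\<mu>) \<le> liminf (\<lambda>n. \<integral>\<^sup>+w. f C n w \<partial>\<mu>)"
      using fm by (rule nn_integral_liminf)
    also have "\<dots> \<le> liminf (\<lambda>n. ennreal ((real C + 1)\<^sup>2))"
      by (intro Liminf_mono always_eventually allI fint)
    also have "\<dots> = ennreal ((real C + 1)\<^sup>2)" by (intro Liminf_const) simp
    finally show "(\<integral>\<^sup>+w. liminf (\<lambda>n. f C n w) \<partial>\<mu>) \<noteq> \<infinity>" by (auto simp: top_unique)
  qed
  then have "AE w in \<mu>. \<forall>C. liminf (\<lambda>n. f C n w) \<noteq> \<infinity>" by (simp add: AE_all_countable)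
  then show ?thesis
  proof (rule AE_mp, intro AE_I2 impI allI)
    fix w m assume "w \<in> space \<mu>" and fin: "\<forall>C. liminf (\<lambda>n. f C n w) \<noteq> \<infinity>"
    then have w: "w \<in> W" by simp
    have "compact (w ` {0..real m})"
      by (intro compact_continuous_image continuous_on_subset[OF W_cont[OF w]]) auto
    then obtain b where b: "\<And>t. 0 \<le> t \<Longrightarrow> t \<le> real m \<Longrightarrow> \<bar>w t\<bar> \<le> b"
      using compact_imp_bounded bounded_iff by (metis (no_types, lifting) atLeastAtMost_iff imageI real_norm_def)
    obtain C :: nat where C: "b \<le> real C" using real_arch_simple by blast
    have le: "ennreal (Q n (ennreal (real m)) w) \<le> f C n w" for n
    proof -
      let ?N = "cnt n (ennreal (real m)) w"
      have N: "R n ?N w \<le> ennreal (real m)" by (rule cnt_bounds(1)[OF w]) simp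
      have Ri: "R n i w \<le> ennreal (real m)" if "i \<le> ?N" for i
        using grid_mono[OF that, of "\<lambda>_. step n" w] N by (rule order_trans)
      have v: "\<bar>val n i w\<bar> \<le> real C" if i: "i \<le> ?N" for i
      proof -
        obtain s where s: "0 \<le> s" "R n i w = ennreal s"
          using Ri[OF i] by (cases "R n i w") (auto simp: top_unique)
        then have "s \<le> real m" using Ri[OF i] by (simp only: ennreal_le_iff of_nat_0_le_iff)
        then show ?thesis using b[of s] s C by (simp add: val_def)
      qed
      have "ennreal (Q n (ennreal (real m)) w) = (\<Sum>i<?N. ennreal ((step n)\<^sup>2))"
        by (simp add: Q_def ennreal_mult ennreal_of_nat_eq_real_of_nat)
      also have "\<dots> = (\<Sum>i<?N. ennreal ((c C n i w * incr n i w)\<^sup>2))"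
      proof (intro sum.cong refl)
        fix i assume i: "i \<in> {..<?N}"
        have "c C n i w = 1" using v i by (auto simp: c_def)
        moreover have "R n (Suc i) w < \<top>" using Ri[of "Suc i"] i by (auto intro: le_less_trans)
        ultimately show "ennreal ((step n)\<^sup>2) = ennreal ((c C n i w * incr n i w)\<^sup>2)"
          using incr_sq[OF w, of n i] by simp
      qed
      also have "\<dots> \<le> f C n w" unfolding f_def by (rule sum_le_suminf) auto
      finally show ?thesis .
    qed
    obtain q where q: "0 \<le> q" "liminf (\<lambda>n. f C n w) = ennreal q" using fin by (cases "liminf (\<lambda>n. f C n w)") auto
    obtain q' :: nat where q': "q < real q'" using reals_Archimedean2 by blast
    have "liminf (\<lambda>n. f C n w) < ennreal (real q')" using q q' by (simp add: ennreal_lessI)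
    then have "\<not> (\<forall>\<^sub>F n in sequentially. ennreal (real q') \<le> f C n w)"
      using Liminf_bounded by (metis leD)
    then have ex: "\<forall>n0. \<exists>n\<ge>n0. f C n w < ennreal (real q')"
      unfolding eventually_sequentially by (meson not_le)
    have "\<forall>n0. \<exists>n\<ge>n0. Q n (ennreal (real m)) w \<le> real q'"
    proof
      fix n0
      obtain n where n: "n \<ge> n0" "f C n w < ennreal (real q')" using ex by blast
      have "ennreal (Q n (ennreal (real m)) w) \<le> ennreal (real q')" using le[of n] n(2) by (meson le_less_trans less_imp_le)
      then show "\<exists>n\<ge>n0. Q n (ennreal (real m)) w \<le> real q'" using n by (auto simp: ennreal_le_iff)
    qed
    then show "\<exists>q::nat. \<forall>n0. \<exists>n\<ge>n0. Q n (ennreal (real m)) w \<le> real q" by blast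
  qed
qed

lemma AE_tame: "AE w in \<mu>. tame w"
  using AE_fine_coarse AE_count_bounded unfolding tame_def by (rule AE_conjI)

end

lemma cut_cut: "0 \<le> v \<Longrightarrow> cut (cut v A) B = cut v (min A B)"
  unfolding cut_def[of "cut v A"] by (simp add: ennreal_cut) (simp add: cut_def min.assoc)

section \<open>Decomposition of a path into pieces\<close>

text \<open>The displacement during that part of a grid step which lies before \<open>v\<close>.
  Working with pieces allows fixed times that are not on the grid.\<close>

definition piece :: "nat \<Rightarrow> nat \<Rightarrow> real \<Rightarrow> (real \<Rightarrow> real) \<Rightarrow> real" where
  "piece n k v w = w (cut v (R n (Suc k) w)) - w (cut v (R n k w))"

lemma piece_measurable:
  "\<tau> \<in> borel_measurable path_space \<Longrightarrow> (\<lambda>w. piece n k (\<tau> w) w) \<in> borel_measurable path_space"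
  unfolding piece_def by (intro borel_measurable_diff eval_self_measurable cut_measurable R_measurable)

lemma reflect_at_cut:
  assumes w: "w \<in> W" and v: "0 \<le> v"
  shows "reflect (R n j) w (cut v (R n i w)) = (if i \<le> j then w (cut v (R n i w)) else 2 * w (cut v (R n j w)) - w (cut v (R n i w)))"
proof -
  have "reflect (R n j) w (cut v (R n i w)) = 2 * w (cut v (min (R n i w) (R n j w))) - w (cut v (R n i w))"
    by (simp add: reflect_def cut_cut v)
  moreover have "i \<le> j \<Longrightarrow> min (R n i w) (R n j w) = R n i w" by (intro min.absorb1 grid_mono)
  moreover have "\<not> i \<le> j \<Longrightarrow> min (R n i w) (R n j w) = R n j w" by (intro min.absorb2 grid_mono) simp
  ultimately show ?thesis by simp
qed

text \<open>All pieces from index \<open>j\<close> on change sign. Reflecting at \<open>j\<close>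
  and then at \<open>Suc j\<close> therefore flips the piece of index \<open>j\<close>
  alone.\<close>

lemma piece_reflect:
  assumes w: "w \<in> W" and v: "0 \<le> v"
  shows "piece n k v (reflect (R n j) w) = (if k < j then piece n k v w else - piece n k v w)"
  unfolding piece_def R_reflect_R[OF w order_refl] reflect_at_cut[OF w v]
  by (cases "k = j") (auto simp: not_less_eq_eq)

lemma piece_late:
  assumes "0 \<le> v" "ennreal v \<le> R n k w"
  shows "piece n k v w = 0"
proof -
  have "ennreal v \<le> R n (Suc k) w" using assms(2) grid_mono_Suc by (rule order_trans)
  then show ?thesis using assms by (simp add: piece_def cut_eq)
qed

lemma piece_early: "R n (Suc k) w \<le> ennreal v \<Longrightarrow> piece n k v w = val n (Suc k) w - val n k w"
  using grid_mono_Suc[of "\<lambda>_. step n" k w] by (simp add: piece_def cut_eq2 val_def order_trans[of "R n k w"])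

lemma piece_abs:
  assumes w: "w \<in> W" and v: "0 \<le> v"
  shows "\<bar>piece n k v w\<bar> \<le> step n"
proof (cases "ennreal v \<le> R n k w")
  case False
  then have Rk: "R n k w \<le> ennreal v" by simp
  have "\<bar>w (cut v (R n (Suc k) w)) - w (enn2real (R n k w))\<bar> \<le> step n"
  proof (rule R_osc[OF w cut_nonneg])
    show "R n k w \<le> ennreal (cut v (R n (Suc k) w))"
      using Rk by (simp add: ennreal_cut[OF v] grid_mono_Suc)
    show "ennreal (cut v (R n (Suc k) w)) \<le> R n (Suc k) w"
      by (simp add: ennreal_cut[OF v])
  qed
  then show ?thesis using Rk by (simp add: piece_def cut_eq2)
qed (simp add: piece_late v)

lemma sum_piece:
  assumes w: "w \<in> W" and v: "0 \<le> v"
  shows "(\<Sum>k<K. piece n k v w) = w (cut v (R n K w))"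
proof -
  have "(\<Sum>k<K. piece n k v w) = w (cut v (R n K w)) - w (cut v (R n 0 w))"
    unfolding piece_def by (rule sum_lessThan_telescope)
  moreover have "cut v (R n 0 w) = 0" using v by (simp add: cut_eq2)
  ultimately show ?thesis using W_zero[OF w] by simp
qed

text \<open>Steps completed by \<open>u\<close> contribute equally at both times, and steps begun
  after \<open>u\<close> contribute nothing at \<open>u\<close>. Only the step containing
  \<open>u\<close> is miscounted, by at most two pieces.\<close>

lemma pieces_after:
  assumes w: "w \<in> W" and uv: "0 \<le> u" "u \<le> v"
  shows "\<forall>\<^sub>F K in sequentially.
    \<bar>(\<Sum>k<K. if ennreal u \<le> R n k w then piece n k v w else 0) - (w v - w u)\<bar> \<le> 2 * step n"
proof -
  let ?N = "cnt n (ennreal u) w"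
  obtain K0 where K0: "ennreal v < R n K0 w" using R_unbounded[OF w] by blast
  have "\<bar>(\<Sum>k<K. if ennreal u \<le> R n k w then piece n k v w else 0) - (w v - w u)\<bar> \<le> 2 * step n" if K: "K \<ge> K0" for K
  proof -
    have vK: "ennreal v < R n K w" using K0 grid_mono[OF K] by (rule less_le_trans)
    have uK: "ennreal u < R n K w" using vK uv by (meson ennreal_leI le_less_trans)
    have "w v - w u = (\<Sum>k<K. piece n k v w) - (\<Sum>k<K. piece n k u w)"
      using vK uK uv by (simp add: sum_piece[OF w] cut_eq)
    then have "(\<Sum>k<K. if ennreal u \<le> R n k w then piece n k v w else 0) - (w v - w u)
      = (\<Sum>k<K. piece n k u w - (if ennreal u \<le> R n k w then 0 else piece n k v w))"
      unfolding sum_subtractf[symmetric] by (simp add: sum_subtractf[symmetric]) (intro sum.cong, auto)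
    moreover have "\<bar>\<dots>\<bar> \<le> (\<Sum>k<K. if k = ?N then 2 * step n else 0)"
    proof (rule order_trans[OF sum_abs sum_mono])
      fix k
      consider "k < ?N" | "k = ?N" | "?N < k" by linarith
      then show "\<bar>piece n k u w - (if ennreal u \<le> R n k w then 0 else piece n k v w)\<bar> \<le> (if k = ?N then 2 * step n else 0)"
      proof cases
        case 1
        have "R n (Suc k) w \<le> R n ?N w" using 1 by (intro grid_mono) simp
        also have "\<dots> \<le> ennreal u" by (rule cnt_bounds(1)[OF w]) simp
        finally have Su: "R n (Suc k) w \<le> ennreal u" .
        then have "R n k w < ennreal u"
          using R_strict[OF w, of n k] R_finite_pred[OF w, of n k] by (metis ennreal_less_top le_less_trans less_le_trans)
        then have "\<not> ennreal u \<le> R n k w" by (simp only: not_le)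
        moreover have "piece n k u w = piece n k v w"
          using Su order_trans[OF Su ennreal_leI[OF uv(2)]] by (simp add: piece_early)
        ultimately show ?thesis using 1 by simp
      next
        case 2
        have "\<bar>piece n k u w\<bar> \<le> step n" "\<bar>piece n k v w\<bar> \<le> step n" using uv by (auto intro: piece_abs[OF w])
        then show ?thesis using 2 by auto
      next
        case 3
        have "ennreal u < R n (Suc ?N) w" by (rule cnt_bounds(2)[OF w]) simp
        also have "\<dots> \<le> R n k w" using 3 by (intro grid_mono) simp
        finally have "ennreal u \<le> R n k w" by simp
        then show ?thesis using 3 uv by (simp add: piece_late)
      qed
    qed
    moreover have "(\<Sum>k<K. if k = ?N then 2 * step n else 0) \<le> 2 * step n" by simp
    ultimately show ?thesis by linarith
  qed
  then show ?thesis unfolding eventually_sequentially by blast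
qed

text \<open>A step begun after \<open>u\<close> and completed by the earlier of the two times
  contributes \<open>(step n)\<^sup>2\<close>; a step begun after that time has a vanishing factor.
  The two steps that contain the endpoints account for the error.\<close>

lemma pieces_product:
  assumes w: "w \<in> W" and uv: "0 \<le> u" "u \<le> a" "u \<le> b"
  shows "\<forall>\<^sub>F K in sequentially.
    \<bar>(\<Sum>k<K. if ennreal u \<le> R n k w then piece n k a w * piece n k b w else 0)
      - (Q n (ennreal (min a b)) w - Q n (ennreal u) w)\<bar> \<le> 2 * (step n)\<^sup>2"
proof -
  let ?m = "min a b"
  let ?N = "cnt n (ennreal u) w" and ?M = "cnt n (ennreal ?m) w"
  have NM: "?N \<le> ?M" using uv by (intro cnt_mono w ennreal_leI) auto
  have "\<bar>(\<Sum>k<K. if ennreal u \<le> R n k w then piece n k a w * piece n k b w else 0)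
      - (Q n (ennreal (min a b)) w - Q n (ennreal u) w)\<bar> \<le> 2 * (step n)\<^sup>2" if K: "K \<ge> Suc ?M" for K
  proof -
    let ?h = "\<lambda>k. if k \<in> {?N..<?M} then (step n)\<^sup>2 else 0"
    have "(\<Sum>k<K. ?h k) = (\<Sum>k\<in>{?N..<?M}. (step n)\<^sup>2)"
      using K by (intro sum.mono_neutral_cong_right) auto
    also have "\<dots> = Q n (ennreal ?m) w - Q n (ennreal u) w"
      using NM by (simp add: Q_def of_nat_diff left_diff_distrib)
    finally have h: "Q n (ennreal ?m) w - Q n (ennreal u) w = (\<Sum>k<K. ?h k)" by simp
    have pp: "\<bar>piece n k a w * piece n k b w\<bar> \<le> (step n)\<^sup>2" for k
      unfolding abs_mult power2_eq_square using uv by (intro mult_mono piece_abs[OF w]) auto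
    have "\<bar>(\<Sum>k<K. if ennreal u \<le> R n k w then piece n k a w * piece n k b w else 0) - (\<Sum>k<K. ?h k)\<bar>
      \<le> (\<Sum>k<K. (if k = ?N then (step n)\<^sup>2 else 0) + (if k = ?M then (step n)\<^sup>2 else 0))"
      unfolding sum_subtractf[symmetric]
    proof (rule order_trans[OF sum_abs sum_mono])
      fix k
      have full: "piece n k a w * piece n k b w = (step n)\<^sup>2" if "k < ?M"
      proof -
        have "R n (Suc k) w \<le> R n ?M w" using that by (intro grid_mono) simp
        also have "\<dots> \<le> ennreal ?m" by (rule cnt_bounds(1)[OF w]) simp
        finally have m: "R n (Suc k) w \<le> ennreal ?m" .
        then have "R n (Suc k) w < \<top>" by (rule le_less_trans) simp
        then have "\<bar>val n (Suc k) w - val n k w\<bar> = step n" by (rule incr_abs[OF w])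
        then have sq: "(val n (Suc k) w - val n k w)\<^sup>2 = (step n)\<^sup>2" by (metis power2_abs)
        have "R n (Suc k) w \<le> ennreal a" "R n (Suc k) w \<le> ennreal b"
          using m by (metis ennreal_leI min.cobounded1 min.cobounded2 order_trans)+
        then show ?thesis unfolding sq[symmetric] by (simp add: piece_early power2_eq_square)
      qed
      consider "k < ?N" | "k = ?N" | "?N < k" "k < ?M" | "?N < k" "k = ?M" | "?M < k" "?N < k" using NM by linarith
      then show "\<bar>(if ennreal u \<le> R n k w then piece n k a w * piece n k b w else 0) - ?h k\<bar>
        \<le> (if k = ?N then (step n)\<^sup>2 else 0) + (if k = ?M then (step n)\<^sup>2 else 0)"
      proof cases
        case 1
        have "R n (Suc k) w \<le> R n ?N w" using 1 by (intro grid_mono) simp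
        also have "\<dots> \<le> ennreal u" by (rule cnt_bounds(1)[OF w]) simp
        finally have "R n k w < ennreal u"
          using R_strict[OF w, of n k] R_finite_pred[OF w, of n k] by (metis ennreal_less_top le_less_trans less_le_trans)
        then have "\<not> ennreal u \<le> R n k w" by (simp only: not_le)
        then show ?thesis using 1 by simp
      next
        case 2
        show ?thesis
        proof (cases "?N < ?M")
          case True
          then show ?thesis using 2 full by auto
        next
          case False
          then have "?M = ?N" using NM by simp
          then show ?thesis using 2 pp[of k] by auto
        qed
      next
        case 3
        have "ennreal u < R n (Suc ?N) w" by (rule cnt_bounds(2)[OF w]) simp
        also have "\<dots> \<le> R n k w" using 3 by (intro grid_mono) simp
        finally have "ennreal u \<le> R n k w" by simp
        then show ?thesis using 3 full by simp
      next
        case 4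
        then show ?thesis using pp[of k] by auto
      next
        case 5
        have "ennreal ?m < R n (Suc ?M) w" by (rule cnt_bounds(2)[OF w]) simp
        also have "\<dots> \<le> R n k w" using 5 by (intro grid_mono) simp
        finally have "ennreal ?m \<le> R n k w" by simp
        then have "piece n k a w = 0 \<or> piece n k b w = 0"
          using uv piece_late[of ?m n k w] by (auto simp: min_def split: if_splits)
        then show ?thesis using 5 by auto
      qed
    qed
    also have "\<dots> \<le> 2 * (step n)\<^sup>2" by (simp add: sum.distrib)
    finally show ?thesis unfolding h .
  qed
  then show ?thesis unfolding eventually_sequentially by blast
qed

text \<open>Both functions agree with \<open>1 - x\<^sup>2 / 2\<close> up to an error of third
  order.\<close>

lemma cos_exp_bound:
  fixes x :: real
  assumes x: "\<bar>x\<bar> \<le> 1"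
  shows "\<bar>cos x - exp (- x\<^sup>2 / 2)\<bar> \<le> \<bar>x\<bar> ^ 3"
proof -
  have "cmod (iexp x - (\<Sum>k\<le>2. (\<i> * x) ^ k / fact k)) \<le> \<bar>x\<bar> ^ Suc 2 / fact (Suc 2)"
    by (rule iexp_approx1)
  then have "\<bar>Re (iexp x - (\<Sum>k\<le>2. (\<i> * x) ^ k / fact k))\<bar> \<le> \<bar>x\<bar> ^ 3 / 6"
    using abs_Re_le_cmod[of "iexp x - (\<Sum>k\<le>2. (\<i> * x) ^ k / fact k)"] by (simp add: fact_numeral eval_nat_numeral)
  moreover have "Re (iexp x - (\<Sum>k\<le>2. (\<i> * x) ^ k / fact k)) = cos x - (1 - x\<^sup>2 / 2)"
    by (simp add: eval_nat_numeral Re_exp algebra_simps)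
  ultimately have 1: "\<bar>cos x - (1 - x\<^sup>2 / 2)\<bar> \<le> \<bar>x\<bar> ^ 3 / 6" by simp
  define y where "y = x\<^sup>2 / 2"
  have y: "0 \<le> y" by (simp add: y_def)
  have lo: "1 - y \<le> exp (- y)" using exp_ge_add_one_self[of "- y"] by simp
  have "exp (- y) * (1 + y) \<le> exp (- y) * exp y" using exp_ge_add_one_self[of y] by (intro mult_left_mono) auto
  also have "\<dots> = 1" by (simp add: exp_minus)
  \<comment> \<open>The product on the right is \<open>1 + y ^ 3\<close>.\<close>
  also have "\<dots> \<le> (1 - y + y\<^sup>2) * (1 + y)" using y by (simp add: algebra_simps power2_eq_square)
  finally have hi: "exp (- y) \<le> 1 - y + y\<^sup>2" using y by (simp add: mult_le_cancel_right)
  have "\<bar>x\<bar> ^ 4 \<le> \<bar>x\<bar> ^ 3" using x by (intro power_decreasing) auto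
  moreover have "y\<^sup>2 = \<bar>x\<bar> ^ 4 / 4" by (simp add: y_def power_divide power_even_eq[symmetric] eval_nat_numeral)
  moreover have "0 \<le> \<bar>x\<bar> ^ 3" by simp
  moreover have "\<bar>cos x - (1 - y)\<bar> \<le> \<bar>x\<bar> ^ 3 / 6" using 1 by (simp add: y_def)
  ultimately have "\<bar>cos x - exp (- y)\<bar> \<le> \<bar>x\<bar> ^ 3" using lo hi by linarith
  then show ?thesis by (simp add: y_def)
qed

text \<open>For factors of modulus at most one, the difference of two products is bounded by the sum
  of the differences of the factors; one power of each cubic error is absorbed into
  \<open>e\<close>.\<close>

lemma prod_cos_exp_bound:
  fixes x :: "nat \<Rightarrow> real"
  assumes x: "\<And>k. \<bar>x k\<bar> \<le> e" and e: "e \<le> 1"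
  shows "\<bar>(\<Prod>k<K. cos (x k)) - exp (- (\<Sum>k<K. (x k)\<^sup>2) / 2)\<bar> \<le> e * (\<Sum>k<K. (x k)\<^sup>2)"
proof -
  have "exp (- (\<Sum>k<K. (x k)\<^sup>2) / 2) = (\<Prod>k<K. exp (- (x k)\<^sup>2 / 2))"
    by (simp add: exp_sum[symmetric] sum_negf sum_divide_distrib)
  then have "\<bar>(\<Prod>k<K. cos (x k)) - exp (- (\<Sum>k<K. (x k)\<^sup>2) / 2)\<bar> \<le> (\<Sum>k<K. \<bar>cos (x k) - exp (- (x k)\<^sup>2 / 2)\<bar>)"
    using norm_prod_diff[of "{..<K}" "\<lambda>k. cos (x k)" "\<lambda>k. exp (- (x k)\<^sup>2 / 2)"] by simp
  also have "\<dots> \<le> (\<Sum>k<K. e * (x k)\<^sup>2)"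
  proof (rule sum_mono)
    fix k
    have "\<bar>cos (x k) - exp (- (x k)\<^sup>2 / 2)\<bar> \<le> \<bar>x k\<bar> ^ 3" using x[of k] e by (intro cos_exp_bound) simp
    also have "\<dots> = \<bar>x k\<bar> * (x k)\<^sup>2" by (simp add: power3_eq_cube power2_eq_square mult.assoc)
    also have "\<dots> \<le> e * (x k)\<^sup>2" using x[of k] by (intro mult_right_mono) auto
    finally show "\<bar>cos (x k) - exp (- (x k)\<^sup>2 / 2)\<bar> \<le> e * (x k)\<^sup>2" .
  qed
  finally show ?thesis by (simp add: sum_distrib_left)
qed

definition QV :: "(real \<Rightarrow> real) \<Rightarrow> real \<Rightarrow> real" where
  "QV w = (\<lambda>t\<in>{0..}. qv t w)"

lemma QV_measurable: "QV \<in> path_space \<rightarrow>\<^sub>M path_space"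
proof (rule measurable_path_spaceI)
  fix w assume w: "w \<in> W"
  have "continuous_on {0..} (QV w)"
    using qv_continuous[OF w] by (subst continuous_on_cong[OF refl]) (auto simp: QV_def)
  then show "QV w \<in> W" by (simp add: mem_W QV_def qv_0[OF w])
qed (simp add: QV_def qv_measurable)

lemma qv_random_measurable:
  assumes "\<tau> \<in> borel_measurable path_space" "\<And>w. w \<in> W \<Longrightarrow> 0 \<le> \<tau> w"
  shows "(\<lambda>w. qv (\<tau> w) w) \<in> borel_measurable path_space"
proof -
  have "(\<lambda>w. QV w (\<tau> w)) \<in> borel_measurable path_space"
    by (rule eval_random_time[OF QV_measurable assms(1)])
  moreover have "(\<lambda>w. QV w (\<tau> w)) \<in> borel_measurable path_space \<longleftrightarrow> (\<lambda>w. qv (\<tau> w) w) \<in> borel_measurable path_space"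
    by (rule measurable_cong) (simp add: QV_def assms(2))
  ultimately show ?thesis by blast
qed

context path_law
begin

text \<open>Flipping the last sign shows that \<open>cis (S + x)\<close> and
  \<open>cis (S - x)\<close> have the same weighted mean, and their half-sum is
  \<open>cis S * cos x\<close>. The cosine is even, so it can be absorbed into the invariant weight
  \<open>Z\<close>, which is why the induction is over arbitrary \<open>Z\<close>.\<close>

lemma sign_average:
  fixes x :: "nat \<Rightarrow> (real \<Rightarrow> real) \<Rightarrow> real"
  assumes \<psi>: "\<And>k. preserving (\<psi> k)" and x: "\<And>k. x k \<in> borel_measurable path_space"
    and flip: "\<And>j k w. w \<in> W \<Longrightarrow> x j (\<psi> k w) = (if j = k then - x j w else x j w)"
  shows "Z \<in> borel_measurable path_space \<Longrightarrow> (\<And>w. w \<in> W \<Longrightarrow> \<bar>Z w\<bar> \<le> B) \<Longrightarrow>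
    (\<And>k w. w \<in> W \<Longrightarrow> Z (\<psi> k w) = Z w) \<Longrightarrow>
    (\<integral>w. cis (\<Sum>k<K. x k w) * complex_of_real (Z w) \<partial>\<mu>) = (\<integral>w. complex_of_real ((\<Prod>k<K. cos (x k w)) * Z w) \<partial>\<mu>)"
proof (induction K arbitrary: Z)
  case (Suc K)
  let ?S = "\<lambda>w. \<Sum>k<K. x k w"
  let ?Z = "\<lambda>w. cos (x K w) * Z w"
  have Sm: "?S \<in> borel_measurable path_space" by (intro borel_measurable_sum x)
  have cism: "(\<lambda>w. cis (f w)) \<in> borel_measurable path_space" if "f \<in> borel_measurable path_space" for f
    using measurable_compose[OF that, of cis borel] by (simp add: borel_measurable_continuous_onI continuous_on_cis)
  have Zm: "(\<lambda>w. complex_of_real (Z w)) \<in> borel_measurable path_space"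
    by (rule measurable_compose[OF Suc.prems(1) borel_measurable_continuous_onI]) (intro continuous_intros)
  let ?f = "\<lambda>w. cis (?S w + x K w) * complex_of_real (Z w)" and ?g = "\<lambda>w. cis (?S w - x K w) * complex_of_real (Z w)"
  have fm: "?f \<in> borel_measurable path_space" and gm: "?g \<in> borel_measurable path_space"
    by (intro borel_measurable_times cism borel_measurable_add borel_measurable_diff Sm x Zm)+
  have int: "integrable \<mu> h" if "h \<in> borel_measurable path_space" "\<And>w. w \<in> W \<Longrightarrow> norm (h w) \<le> \<bar>Z w\<bar>"
    for h :: "_ \<Rightarrow> complex"
  proof (rule integrable_const_bound[where B=B])
    show "h \<in> borel_measurable \<mu>" using that(1) measurable_cong_sets[OF sets_law refl] by blast
    show "AE w in \<mu>. norm (h w) \<le> B" using that(2) Suc.prems(2) by (intro AE_I2) (auto intro: order_trans)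
  qed
  have fi: "integrable \<mu> ?f" and gi: "integrable \<mu> ?g"
    using fm gm by (auto intro!: int simp: norm_mult)
  have "(\<integral>w. ?f w \<partial>\<mu>) = (\<integral>w. ?f (\<psi> K w) \<partial>\<mu>)" by (rule preserving_integral[OF \<psi> fm, symmetric])
  also have "\<dots> = (\<integral>w. ?g w \<partial>\<mu>)"
    by (rule Bochner_Integration.integral_cong[OF refl]) (simp add: flip Suc.prems(3))
  finally have "2 * (\<integral>w. ?f w \<partial>\<mu>) = (\<integral>w. ?f w \<partial>\<mu>) + (\<integral>w. ?g w \<partial>\<mu>)" by simp
  also have "\<dots> = (\<integral>w. ?f w + ?g w \<partial>\<mu>)" by (rule Bochner_Integration.integral_add[OF fi gi, symmetric])
  also have "\<dots> = (\<integral>w. 2 * (cis (?S w) * complex_of_real (?Z w)) \<partial>\<mu>)"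
  proof (rule Bochner_Integration.integral_cong[OF refl])
    fix w
    have "cis (?S w + x K w) + cis (?S w - x K w) = 2 * (cis (?S w) * complex_of_real (cos (x K w)))"
      by (simp add: complex_eq_iff cos_add cos_diff sin_add sin_diff)
    then show "?f w + ?g w = 2 * (cis (?S w) * complex_of_real (?Z w))"
      by (simp add: distrib_right[symmetric] mult.assoc)
  qed
  also have "\<dots> = 2 * (\<integral>w. cis (?S w) * complex_of_real (?Z w) \<partial>\<mu>)" by (rule integral_mult_right_zero)
  finally have "(\<integral>w. ?f w \<partial>\<mu>) = (\<integral>w. cis (?S w) * complex_of_real (?Z w) \<partial>\<mu>)" by simp
  also have "\<dots> = (\<integral>w. complex_of_real ((\<Prod>k<K. cos (x k w)) * ?Z w) \<partial>\<mu>)"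
  proof (rule Suc.IH)
    show "?Z \<in> borel_measurable path_space"
      by (intro borel_measurable_times Suc.prems measurable_compose[OF x] borel_measurable_continuous_onI continuous_intros)
    fix k w assume w: "w \<in> W"
    show "?Z (\<psi> k w) = ?Z w" using flip[OF w, of K k] Suc.prems(3)[OF w, of k] by auto
    have "\<bar>?Z w\<bar> \<le> 1 * \<bar>Z w\<bar>" unfolding abs_mult by (intro mult_right_mono) auto
    then show "\<bar>?Z w\<bar> \<le> B" using Suc.prems(2)[OF w] by linarith
  qed
  finally show ?case by (simp add: mult.assoc)
qed simp

end

section \<open>The path given its quadratic variation\<close>

lemma cis_measurable: "f \<in> borel_measurable N \<Longrightarrow> (\<lambda>w. cis (f w)) \<in> borel_measurable N"
  using measurable_compose[of f N borel cis borel] by (simp add: borel_measurable_continuous_onI continuous_on_cis)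

lemma complex_of_real_measurable: "f \<in> borel_measurable N \<Longrightarrow> (\<lambda>w. complex_of_real (f w)) \<in> borel_measurable N"
  by (rule measurable_compose[OF _ borel_measurable_continuous_onI]) (auto intro!: continuous_intros)

lemma step_tendsto: "step \<longlonglongrightarrow> 0"
  unfolding step_def using LIMSEQ_power_zero[of "1/2::real"] by (simp add: power_one_over)

context reflection_law
begin

lemma preserving_id: "preserving (\<lambda>w. w)"
proof (rule preservingI)
  fix B assume "B \<in> sets path_space"
  then have "(\<lambda>w. w) -` B \<inter> W = B" using sets.sets_into_space by auto
  then show "emeasure \<mu> ((\<lambda>w. w) -` B \<inter> W) = emeasure \<mu> B" by simp
qed simp

text \<open>Reflecting at two consecutive grid points after \<open>U\<close> changes the sign of one piece of the path and
  nothing else, so the exponentials may be replaced by products of cosines.\<close>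

theorem char_identity:
  fixes c :: "'i \<Rightarrow> real" and V :: "'i \<Rightarrow> (real \<Rightarrow> real) \<Rightarrow> real" and U Z :: "(real \<Rightarrow> real) \<Rightarrow> real"
  assumes I: "finite I"
    and Vm: "\<And>i. V i \<in> borel_measurable path_space" and Um: "U \<in> borel_measurable path_space"
    and Zm: "Z \<in> borel_measurable path_space"
    and U0: "\<And>w. w \<in> W \<Longrightarrow> 0 \<le> U w" and UV: "\<And>i w. w \<in> W \<Longrightarrow> U w \<le> V i w"
    and Uinv: "\<And>n k w. w \<in> W \<Longrightarrow> U (reflect (R n k) w) = U w"
    and Vinv: "\<And>i n k w. w \<in> W \<Longrightarrow> V i (reflect (R n k) w) = V i w"
    and ZB: "\<And>w. w \<in> W \<Longrightarrow> \<bar>Z w\<bar> \<le> B"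
    and Zinv: "\<And>n k w. w \<in> W \<Longrightarrow> ennreal (U w) \<le> R n k w \<Longrightarrow> Z (reflect (R n k) w) = Z w"
  shows "(\<integral>w. cis (\<Sum>i\<in>I. c i * (w (V i w) - w (U w))) * complex_of_real (Z w) \<partial>\<mu>)
    = (\<integral>w. complex_of_real (exp (- (\<Sum>i\<in>I. \<Sum>j\<in>I. c i * c j * (qv (min (V i w) (V j w)) w - qv (U w) w)) / 2) * Z w) \<partial>\<mu>)"
proof -
  have V0: "0 \<le> V i w" if "w \<in> W" for i w using U0[OF that] UV[OF that] by (rule order_trans)
  \<comment> \<open>Only steps that begin at or after \<open>U\<close> are flipped: the weight
    \<open>Z\<close> may depend on the path before \<open>U\<close> and is invariant under those
    reflections only.\<close>
  define \<psi> where "\<psi> n k w = (if ennreal (U w) \<le> R n k w then reflect (R n (Suc k)) (reflect (R n k) w) else w)" for n k w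
  define x where "x n k w = (if ennreal (U w) \<le> R n k w then \<Sum>i\<in>I. c i * piece n k (V i w) w else 0)" for n k w
  define C where "C = (\<Sum>i\<in>I. \<bar>c i\<bar>)"
  have C0: "0 \<le> C" unfolding C_def by (intro sum_nonneg) auto
  have Em: "Measurable.pred path_space (\<lambda>w. ennreal (U w) \<le> R n k w)" for n k
    unfolding pred_def by (rule borel_measurable_le[OF measurable_compose[OF Um measurable_ennreal] R_measurable])
  have inv2: "U (reflect (R n (Suc k)) (reflect (R n k) w)) = U w"
    "R n j (reflect (R n (Suc k)) (reflect (R n k) w)) = R n j w"
    "V i (reflect (R n (Suc k)) (reflect (R n k) w)) = V i w" if w: "w \<in> W" for n k j i w
    using w reflect_in_W[OF w] by (simp_all add: Uinv Vinv R_reflect_R)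
  have \<psi>p: "preserving (\<psi> n k)" for n k
    unfolding \<psi>_def
    using preserving_comp[OF reflect_preserving[OF adm_R] reflect_preserving[OF adm_R], of n "Suc k" n k]
    by (intro preserving_If preserving_id Em) (auto simp: inv2)
  have xm: "x n k \<in> borel_measurable path_space" for n k
    unfolding x_def[abs_def]
    by (rule measurable_If[OF _ _ Em[unfolded pred_def]])
      (intro borel_measurable_sum borel_measurable_times borel_measurable_const piece_measurable Vm)+
  have flip: "x n j (\<psi> n k w) = (if j = k then - x n j w else x n j w)" if w: "w \<in> W" for n j k w
  proof (cases "ennreal (U w) \<le> R n k w")
    case True
    let ?w1 = "reflect (R n k) w" let ?w2 = "reflect (R n (Suc k)) ?w1"
    have w1: "?w1 \<in> W" using w by (rule reflect_in_W)
    have p: "piece n j (V i w) ?w2 = (if j = k then - piece n j (V i w) w else piece n j (V i w) w)" for i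
      by (auto simp: piece_reflect[OF w1 V0[OF w]] piece_reflect[OF w V0[OF w]])
    have "\<psi> n k w = ?w2" using True by (simp add: \<psi>_def)
    then have "x n j (\<psi> n k w) = (if ennreal (U w) \<le> R n j w then \<Sum>i\<in>I. c i * piece n j (V i w) ?w2 else 0)"
      by (simp only: x_def inv2[OF w])
    then show ?thesis unfolding p by (cases "j = k") (simp_all add: x_def[of n j w] x_def[of n k w] sum_negf)
  next
    case False
    then show ?thesis by (auto simp: \<psi>_def x_def)
  qed
  have Z\<psi>: "Z (\<psi> n k w) = Z w" if w: "w \<in> W" for n k w
  proof (cases "ennreal (U w) \<le> R n k w")
    case True
    let ?w1 = "reflect (R n k) w"
    have w1: "?w1 \<in> W" using w by (rule reflect_in_W)
    have "ennreal (U ?w1) \<le> R n (Suc k) ?w1"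
      using order_trans[OF True grid_mono_Suc] by (simp add: Uinv[OF w] R_reflect_R[OF w])
    then show ?thesis using True by (simp add: \<psi>_def Zinv[OF w1] Zinv[OF w])
  qed (simp add: \<psi>_def)
  have level: "(\<integral>w. cis (\<Sum>k<K. x n k w) * complex_of_real (Z w) \<partial>\<mu>)
      = (\<integral>w. complex_of_real ((\<Prod>k<K. cos (x n k w)) * Z w) \<partial>\<mu>)" for n K
    using \<psi>p[of n] xm[of n] flip[of _ n] Zm ZB Z\<psi>[of _ n]
    by (intro sign_average[where \<psi>="\<psi> n" and x="x n" and B=B])
  define Y where "Y w = (\<Sum>i\<in>I. c i * (w (V i w) - w (U w)))" for w :: "real \<Rightarrow> real"
  define v where "v n w = (\<Sum>i\<in>I. \<Sum>j\<in>I. c i * c j * (Q n (ennreal (min (V i w) (V j w))) w - Q n (ennreal (U w)) w))" for n w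
  define v' where "v' w = (\<Sum>i\<in>I. \<Sum>j\<in>I. c i * c j * (qv (min (V i w) (V j w)) w - qv (U w) w))" for w
  have xb: "\<bar>x n k w\<bar> \<le> C * step n" if w: "w \<in> W" for n k w
  proof -
    have "\<bar>\<Sum>i\<in>I. c i * piece n k (V i w) w\<bar> \<le> (\<Sum>i\<in>I. \<bar>c i\<bar> * step n)"
      by (rule order_trans[OF sum_abs sum_mono]) (auto simp: abs_mult intro!: mult_left_mono piece_abs[OF w V0[OF w]])
    then show ?thesis by (simp add: x_def C_def sum_distrib_right sum_nonneg)
  qed
  have sum_x: "\<forall>\<^sub>F K in sequentially. \<bar>(\<Sum>k<K. x n k w) - Y w\<bar> \<le> 2 * C * step n" if w: "w \<in> W" for n w
  proof -
    have "\<forall>\<^sub>F K in sequentially. \<forall>i\<in>I. \<bar>(\<Sum>k<K. if ennreal (U w) \<le> R n k w then piece n k (V i w) w else 0) - (w (V i w) - w (U w))\<bar> \<le> 2 * step n"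
      using I by (intro eventually_ball_finite ballI pieces_after w U0 UV)
    then show ?thesis
    proof (rule eventually_mono)
      fix K assume *: "\<forall>i\<in>I. \<bar>(\<Sum>k<K. if ennreal (U w) \<le> R n k w then piece n k (V i w) w else 0) - (w (V i w) - w (U w))\<bar> \<le> 2 * step n"
      have "(\<Sum>k<K. x n k w) = (\<Sum>k<K. \<Sum>i\<in>I. c i * (if ennreal (U w) \<le> R n k w then piece n k (V i w) w else 0))"
        by (intro sum.cong) (auto simp: x_def)
      also have "\<dots> = (\<Sum>i\<in>I. c i * (\<Sum>k<K. if ennreal (U w) \<le> R n k w then piece n k (V i w) w else 0))"
        by (subst sum.swap) (simp only: sum_distrib_left)
      finally have "(\<Sum>k<K. x n k w) - Y w = (\<Sum>i\<in>I. c i * ((\<Sum>k<K. if ennreal (U w) \<le> R n k w then piece n k (V i w) w else 0) - (w (V i w) - w (U w))))"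
        by (simp add: Y_def sum_subtractf right_diff_distrib)
      also have "\<bar>\<dots>\<bar> \<le> (\<Sum>i\<in>I. \<bar>c i\<bar> * (2 * step n))"
        by (rule order_trans[OF sum_abs sum_mono]) (use * in \<open>auto simp: abs_mult intro!: mult_left_mono\<close>)
      also have "\<dots> = 2 * C * step n" unfolding C_def sum_distrib_right[symmetric] by simp
      finally show "\<bar>(\<Sum>k<K. x n k w) - Y w\<bar> \<le> 2 * C * step n" .
    qed
  qed
  have sum_x2: "\<forall>\<^sub>F K in sequentially. \<bar>(\<Sum>k<K. (x n k w)\<^sup>2) - v n w\<bar> \<le> 2 * C\<^sup>2 * (step n)\<^sup>2" if w: "w \<in> W" for n w
  proof -
    let ?f = "\<lambda>i j k. if ennreal (U w) \<le> R n k w then piece n k (V i w) w * piece n k (V j w) w else 0"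
    let ?q = "\<lambda>i j. Q n (ennreal (min (V i w) (V j w))) w - Q n (ennreal (U w)) w"
    have "\<forall>\<^sub>F K in sequentially. \<forall>i\<in>I. \<forall>j\<in>I. \<bar>(\<Sum>k<K. ?f i j k) - ?q i j\<bar> \<le> 2 * (step n)\<^sup>2"
      using I by (intro eventually_ball_finite ballI pieces_product w U0 UV)
    then show ?thesis
    proof (rule eventually_mono)
      fix K assume *: "\<forall>i\<in>I. \<forall>j\<in>I. \<bar>(\<Sum>k<K. ?f i j k) - ?q i j\<bar> \<le> 2 * (step n)\<^sup>2"
      have "(x n k w)\<^sup>2 = (\<Sum>i\<in>I. \<Sum>j\<in>I. c i * c j * ?f i j k)" for k
        by (simp add: x_def power2_eq_square sum_product mult_ac)
      then have "(\<Sum>k<K. (x n k w)\<^sup>2) = (\<Sum>k<K. \<Sum>i\<in>I. \<Sum>j\<in>I. c i * c j * ?f i j k)" by simp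
      also have "\<dots> = (\<Sum>i\<in>I. \<Sum>k<K. \<Sum>j\<in>I. c i * c j * ?f i j k)" by (rule sum.swap)
      also have "\<dots> = (\<Sum>i\<in>I. \<Sum>j\<in>I. \<Sum>k<K. c i * c j * ?f i j k)" by (intro sum.cong refl sum.swap)
      also have "\<dots> = (\<Sum>i\<in>I. \<Sum>j\<in>I. c i * c j * (\<Sum>k<K. ?f i j k))" by (simp only: sum_distrib_left)
      finally have e: "(\<Sum>k<K. (x n k w)\<^sup>2) - v n w = (\<Sum>i\<in>I. \<Sum>j\<in>I. c i * c j * ((\<Sum>k<K. ?f i j k) - ?q i j))"
        unfolding v_def by (simp only: right_diff_distrib[of "c _ * c _" "\<Sum>k<K. ?f _ _ k" "?q _ _"] sum_subtractf)
      have "\<bar>(\<Sum>k<K. (x n k w)\<^sup>2) - v n w\<bar> \<le> (\<Sum>i\<in>I. \<Sum>j\<in>I. \<bar>c i\<bar> * \<bar>c j\<bar> * (2 * (step n)\<^sup>2))"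
        unfolding e by (intro order_trans[OF sum_abs] sum_mono) (use * in \<open>auto simp: abs_mult intro!: mult_left_mono\<close>)
      also have "\<dots> = 2 * C\<^sup>2 * (step n)\<^sup>2"
      proof -
        have "(\<Sum>i\<in>I. \<Sum>j\<in>I. \<bar>c i\<bar> * \<bar>c j\<bar> * (2 * (step n)\<^sup>2)) = (\<Sum>i\<in>I. \<Sum>j\<in>I. \<bar>c i\<bar> * \<bar>c j\<bar>) * (2 * (step n)\<^sup>2)"
          by (simp only: sum_distrib_right)
        also have "(\<Sum>i\<in>I. \<Sum>j\<in>I. \<bar>c i\<bar> * \<bar>c j\<bar>) = C * C"
          unfolding C_def by (rule sum_product[symmetric])
        finally show ?thesis by (simp add: power2_eq_square)
      qed
      finally show "\<bar>(\<Sum>k<K. (x n k w)\<^sup>2) - v n w\<bar> \<le> 2 * C\<^sup>2 * (step n)\<^sup>2" .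
    qed
  qed
  \<comment> \<open>For a fixed level both sequences in \<open>K\<close> are eventually constant on
    every path. Taking \<open>lim\<close> gives the eventual values as measurable functions although
    the stage of stabilization depends on the path.\<close>
  define G where "G n w = lim (\<lambda>K. cis (\<Sum>k<K. x n k w))" for n w
  define H where "H n w = lim (\<lambda>K. \<Prod>k<K. cos (x n k w))" for n w
  have stable: "\<forall>\<^sub>F K in sequentially. cis (\<Sum>k<K. x n k w) = G n w \<and> (\<Prod>k<K. cos (x n k w)) = H n w"
    if w: "w \<in> W" for n w
  proof -
    obtain K0 where K0: "ennreal (Max (insert 0 ((\<lambda>i. V i w) ` I))) < R n K0 w" using R_unbounded[OF w] by blast
    have z: "x n k w = 0" if k: "k \<ge> K0" for k
    proof -
      have "piece n k (V i w) w = 0" if i: "i \<in> I" for i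
      proof (rule piece_late[OF V0[OF w]])
        have "V i w \<le> Max (insert 0 ((\<lambda>i. V i w) ` I))" using I i by (intro Max_ge) auto
        then have "ennreal (V i w) \<le> ennreal (Max (insert 0 ((\<lambda>i. V i w) ` I)))" by (rule ennreal_leI)
        also have "\<dots> \<le> R n k w" using K0 grid_mono[OF k, of "\<lambda>_. step n" w] by (auto intro: order_trans less_imp_le)
        finally show "ennreal (V i w) \<le> R n k w" .
      qed
      then show ?thesis by (simp add: x_def)
    qed
    have s: "(\<Sum>k<K. x n k w) = (\<Sum>k<K0. x n k w)" if "K \<ge> K0" for K
      using that by (intro sum.mono_neutral_right) (auto intro!: z)
    have p: "(\<Prod>k<K. cos (x n k w)) = (\<Prod>k<K0. cos (x n k w))" if "K \<ge> K0" for K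
      using that by (intro prod.mono_neutral_right) (auto simp: z)
    have ev: "\<forall>\<^sub>F K in sequentially. K \<ge> K0" by (rule eventually_ge_at_top)
    have es: "\<forall>\<^sub>F K in sequentially. cis (\<Sum>k<K. x n k w) = cis (\<Sum>k<K0. x n k w)"
      using ev by (rule eventually_mono) (rule arg_cong[where f=cis, OF s])
    have ep: "\<forall>\<^sub>F K in sequentially. (\<Prod>k<K. cos (x n k w)) = (\<Prod>k<K0. cos (x n k w))"
      using ev by (rule eventually_mono) (rule p)
    have "G n w = cis (\<Sum>k<K0. x n k w)" unfolding G_def by (rule limI[OF tendsto_eventually[OF es]])
    moreover have "H n w = (\<Prod>k<K0. cos (x n k w))" unfolding H_def by (rule limI[OF tendsto_eventually[OF ep]])
    ultimately show ?thesis using eventually_conj[OF es ep] by (simp only:)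
  qed
  \<comment> \<open>A single large \<open>K\<close> satisfies all the eventual statements;
    \<open>s\<close> is the sum of the pieces and \<open>q\<close> the sum of their squares at that
    \<open>K\<close>.\<close>
  have approx: "\<exists>s q. G n w = cis s \<and> \<bar>s - Y w\<bar> \<le> 2 * C * step n \<and> \<bar>q - v n w\<bar> \<le> 2 * C\<^sup>2 * (step n)\<^sup>2 \<and>
      (C * step n \<le> 1 \<longrightarrow> \<bar>H n w - exp (- q / 2)\<bar> \<le> C * step n * q) \<and> norm (H n w) \<le> 1" if w: "w \<in> W" for n w
  proof -
    obtain K where K: "\<bar>(\<Sum>k<K. x n k w) - Y w\<bar> \<le> 2 * C * step n" "\<bar>(\<Sum>k<K. (x n k w)\<^sup>2) - v n w\<bar> \<le> 2 * C\<^sup>2 * (step n)\<^sup>2"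
      "cis (\<Sum>k<K. x n k w) = G n w" "(\<Prod>k<K. cos (x n k w)) = H n w"
      using eventually_happens[OF eventually_conj[OF sum_x[OF w] eventually_conj[OF sum_x2[OF w] stable[OF w]]], of n n n] by auto
    have "norm (\<Prod>k<K. cos (x n k w)) \<le> 1"
      unfolding prod_norm[symmetric] by (intro prod_le_1) auto
    then have "norm (H n w) \<le> 1" using K(4) by simp
    then show ?thesis
      using K prod_cos_exp_bound[of "\<lambda>k. x n k w" "C * step n" K, OF xb[OF w]]
      by (intro exI[of _ "\<Sum>k<K. x n k w"] exI[of _ "\<Sum>k<K. (x n k w)\<^sup>2"]) auto
  qed
  have Gm: "G n \<in> borel_measurable \<mu>" for n
    unfolding G_def[abs_def]
    by (intro borel_measurable_lim_metric law_measurable cis_measurable borel_measurable_sum xm)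
  have cosm: "(\<lambda>w. cos (x n k w)) \<in> borel_measurable path_space" for n k
    by (rule measurable_compose[OF xm borel_measurable_continuous_onI]) (intro continuous_intros)
  have Hm: "H n \<in> borel_measurable \<mu>" for n
    unfolding H_def[abs_def]
    by (intro borel_measurable_lim_metric law_measurable borel_measurable_prod cosm)
  have Zm': "(\<lambda>w. complex_of_real (Z w)) \<in> borel_measurable \<mu>"
    by (intro law_measurable complex_of_real_measurable Zm)
  have B0: "AE w in \<mu>. norm (f w) \<le> B" if "\<And>w. w \<in> W \<Longrightarrow> norm (f w) \<le> \<bar>Z w\<bar>" for f :: "_ \<Rightarrow> complex"
    using that ZB by (intro AE_I2) (auto intro: order_trans)
  have eqn: "(\<integral>w. G n w * complex_of_real (Z w) \<partial>\<mu>) = (\<integral>w. complex_of_real (H n w * Z w) \<partial>\<mu>)" for n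
  proof (rule LIMSEQ_unique)
    have cm: "(\<lambda>w. cis (\<Sum>k<K. x n k w)) \<in> borel_measurable \<mu>" for K
      by (intro law_measurable cis_measurable borel_measurable_sum xm)
    show "(\<lambda>K. \<integral>w. cis (\<Sum>k<K. x n k w) * complex_of_real (Z w) \<partial>\<mu>) \<longlonglongrightarrow> (\<integral>w. G n w * complex_of_real (Z w) \<partial>\<mu>)"
    proof (rule integral_dominated_convergence[where w="\<lambda>_. B"])
      show "AE w in \<mu>. (\<lambda>K. cis (\<Sum>k<K. x n k w) * complex_of_real (Z w)) \<longlonglongrightarrow> G n w * complex_of_real (Z w)"
      proof (rule AE_I2)
        fix w assume "w \<in> space \<mu>"
        then have w: "w \<in> W" by simp
        have "\<forall>\<^sub>F K in sequentially. cis (\<Sum>k<K. x n k w) * complex_of_real (Z w) = G n w * complex_of_real (Z w)"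
          using stable[OF w, of n] by (rule eventually_mono) simp
        then show "(\<lambda>K. cis (\<Sum>k<K. x n k w) * complex_of_real (Z w)) \<longlonglongrightarrow> G n w * complex_of_real (Z w)"
          by (rule tendsto_eventually)
      qed
      show "AE w in \<mu>. norm (cis (\<Sum>k<K. x n k w) * complex_of_real (Z w)) \<le> B" for K
        by (rule B0) (simp add: norm_mult)
    qed (intro borel_measurable_times Gm cm Zm' integrable_const)+
    have "norm (\<Prod>k<K. cos (x n k w)) \<le> 1" for K w
      unfolding prod_norm[symmetric] by (intro prod_le_1) auto
    then have bd: "norm (complex_of_real ((\<Prod>k<K. cos (x n k w)) * Z w)) \<le> \<bar>Z w\<bar>" for K w
      unfolding norm_of_real abs_mult by (intro mult_left_le_one_le) simp_all
    show "(\<lambda>K. \<integral>w. cis (\<Sum>k<K. x n k w) * complex_of_real (Z w) \<partial>\<mu>) \<longlonglongrightarrow> (\<integral>w. complex_of_real (H n w * Z w) \<partial>\<mu>)"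
      unfolding level
    proof (rule integral_dominated_convergence[where w="\<lambda>_. B"])
      show "AE w in \<mu>. (\<lambda>K. complex_of_real ((\<Prod>k<K. cos (x n k w)) * Z w)) \<longlonglongrightarrow> complex_of_real (H n w * Z w)"
      proof (rule AE_I2)
        fix w assume "w \<in> space \<mu>"
        then have w: "w \<in> W" by simp
        have "\<forall>\<^sub>F K in sequentially. complex_of_real ((\<Prod>k<K. cos (x n k w)) * Z w) = complex_of_real (H n w * Z w)"
          using stable[OF w, of n] by (rule eventually_mono) simp
        then show "(\<lambda>K. complex_of_real ((\<Prod>k<K. cos (x n k w)) * Z w)) \<longlonglongrightarrow> complex_of_real (H n w * Z w)"
          by (rule tendsto_eventually)
      qed
      show "AE w in \<mu>. norm (complex_of_real ((\<Prod>k<K. cos (x n k w)) * Z w)) \<le> B" for K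
        by (rule B0) (rule bd)
    qed (intro complex_of_real_measurable borel_measurable_times borel_measurable_prod Hm law_measurable[OF cosm] law_measurable[OF Zm] integrable_const)+
  qed
  have step0: "(\<lambda>n. a * step n) \<longlonglongrightarrow> 0" for a using tendsto_mult_left[OF step_tendsto, of a] by simp
  have step20: "(\<lambda>n. a * (step n)\<^sup>2) \<longlonglongrightarrow> 0" for a
    using tendsto_mult_left[OF tendsto_power[OF step_tendsto, of 2], of a] by simp
  have GY: "(\<lambda>n. G n w) \<longlonglongrightarrow> cis (Y w)" if w: "w \<in> W" for w
  proof -
    obtain s where s: "\<And>n. G n w = cis (s n)" "\<And>n. \<bar>s n - Y w\<bar> \<le> 2 * C * step n" using approx[OF w] by metis
    have "(\<lambda>n. s n - Y w) \<longlonglongrightarrow> 0"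
      by (rule Lim_null_comparison[OF _ step0[of "2 * C"]]) (use s in auto)
    then have "s \<longlonglongrightarrow> Y w" by (rule LIM_zero_cancel)
    then show ?thesis unfolding s(1)
      by (rule tendsto_cis)
  qed
  \<comment> \<open>As the level grows, \<open>q\<close> tends to the quadratic form
    \<open>v'\<close> and the pieces become uniformly small, so the product of cosines approaches
    the exponential.\<close>
  have Hv: "(\<lambda>n. H n w) \<longlonglongrightarrow> exp (- v' w / 2)" if w: "w \<in> W" and tm: "tame w" for w
  proof -
    obtain q where q: "\<And>n. \<bar>q n - v n w\<bar> \<le> 2 * C\<^sup>2 * (step n)\<^sup>2"
      "\<And>n. C * step n \<le> 1 \<longrightarrow> \<bar>H n w - exp (- q n / 2)\<bar> \<le> C * step n * q n" using approx[OF w] by metis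
    have "(\<lambda>n. q n - v n w) \<longlonglongrightarrow> 0"
      by (rule Lim_null_comparison[OF _ step20[of "2 * C\<^sup>2"]]) (use q in auto)
    moreover have "(\<lambda>n. v n w) \<longlonglongrightarrow> v' w"
      unfolding v_def v'_def
      by (intro tendsto_sum tendsto_mult tendsto_diff tendsto_const Q_tendsto_qv w tm U0) (auto simp: V0[OF w])
    ultimately have "(\<lambda>n. (q n - v n w) + v n w) \<longlonglongrightarrow> 0 + v' w" by (rule tendsto_add)
    then have qv': "q \<longlonglongrightarrow> v' w" by simp
    have e: "(\<lambda>n. exp (- q n / 2)) \<longlonglongrightarrow> exp (- v' w / 2)" by (intro tendsto_intros qv') simp
    have "\<forall>\<^sub>F n in sequentially. C * step n < 1" using order_tendstoD(2)[OF step0[of C], of 1] by simp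
    then have ev: "\<forall>\<^sub>F n in sequentially. norm (H n w - exp (- q n / 2)) \<le> C * step n * q n"
      by (rule eventually_mono) (use q in auto)
    have "(\<lambda>n. C * step n * q n) \<longlonglongrightarrow> 0 * v' w" by (intro tendsto_mult[OF step0 qv'])
    then have z: "(\<lambda>n. C * step n * q n) \<longlonglongrightarrow> 0" by simp
    have "(\<lambda>n. H n w - exp (- q n / 2)) \<longlonglongrightarrow> 0" by (rule Lim_null_comparison[OF ev z])
    from tendsto_add[OF this e] show ?thesis by simp
  qed
  have Ym: "Y \<in> borel_measurable path_space"
    unfolding Y_def[abs_def] by (intro borel_measurable_sum borel_measurable_times borel_measurable_const borel_measurable_diff eval_self_measurable Vm Um)
  have v'm: "v' \<in> borel_measurable path_space"
    unfolding v'_def[abs_def]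
    by (intro borel_measurable_sum borel_measurable_times borel_measurable_const borel_measurable_diff qv_random_measurable borel_measurable_min Vm Um)
      (auto simp: U0 V0)
  have l1: "(\<lambda>n. \<integral>w. G n w * complex_of_real (Z w) \<partial>\<mu>) \<longlonglongrightarrow> (\<integral>w. cis (Y w) * complex_of_real (Z w) \<partial>\<mu>)"
  proof (rule integral_dominated_convergence[where w="\<lambda>_. B"])
    show "AE w in \<mu>. (\<lambda>n. G n w * complex_of_real (Z w)) \<longlonglongrightarrow> cis (Y w) * complex_of_real (Z w)"
      by (intro AE_I2 tendsto_mult GY tendsto_const) simp
    have "norm (G n w) = 1" if "w \<in> W" for n w using approx[OF that, of n] by auto
    then show "AE w in \<mu>. norm (G n w * complex_of_real (Z w)) \<le> B" for n
      by (intro B0) (simp add: norm_mult)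
  qed (intro borel_measurable_times Gm Zm' integrable_const law_measurable[OF cis_measurable[OF Ym]])+
  have expm: "(\<lambda>w. exp (- v' w / 2)) \<in> borel_measurable path_space"
    by (rule measurable_compose[OF v'm borel_measurable_continuous_onI[of "\<lambda>y. exp (- y / 2)"]]) (intro continuous_intros, simp)
  have l2: "(\<lambda>n. \<integral>w. complex_of_real (H n w * Z w) \<partial>\<mu>) \<longlonglongrightarrow> (\<integral>w. complex_of_real (exp (- v' w / 2) * Z w) \<partial>\<mu>)"
  proof (rule integral_dominated_convergence[where w="\<lambda>_. B"])
    show "AE w in \<mu>. (\<lambda>n. complex_of_real (H n w * Z w)) \<longlonglongrightarrow> complex_of_real (exp (- v' w / 2) * Z w)"
      using AE_tame by (rule AE_mp, intro AE_I2 impI) (intro tendsto_of_real tendsto_mult Hv tendsto_const, auto)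
    have "\<bar>H n w\<bar> \<le> 1" if "w \<in> W" for n w using approx[OF that, of n] by auto
    then show "AE w in \<mu>. norm (complex_of_real (H n w * Z w)) \<le> B" for n
      by (intro B0) (simp add: norm_mult abs_mult mult_left_le_one_le)
  qed (intro complex_of_real_measurable borel_measurable_times Hm law_measurable[OF Zm] integrable_const law_measurable[OF expm])+
  show ?thesis
    using LIMSEQ_unique[OF l1[unfolded eqn] l2] by (simp only: Y_def v'_def)
qed

end

section \<open>Optional stopping and divergence\<close>

definition past :: "real \<Rightarrow> (real \<Rightarrow> real) set \<Rightarrow> bool" where
  "past s D \<longleftrightarrow> D \<in> sets path_space \<and> nonant (\<lambda>_. ennreal s) (\<lambda>w. w \<in> D)"

lemma past_reflect: "past s D \<Longrightarrow> w \<in> W \<Longrightarrow> ennreal s \<le> T w \<Longrightarrow> reflect T w \<in> D \<longleftrightarrow> w \<in> D"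
  unfolding past_def
  using nonantD[of "\<lambda>_. ennreal s" "\<lambda>w. w \<in> D" w "reflect T w"] agree_mono[OF agree_reflect[of T w], of "ennreal s"]
  by (auto intro: reflect_in_W)

context reflection_law
begin

text \<open>Sums the pieces of the steps that begin between \<open>s\<close> and \<open>T\<close>.
  Only the steps containing \<open>s\<close> and \<open>T\<close> differ from the stopped path, each
  by at most three pieces.\<close>

lemma stopped_pieces:
  assumes w: "w \<in> W" and st: "0 \<le> s" "s \<le> t"
  shows "\<bar>(\<Sum>k<K. if ennreal s \<le> R n k w \<and> R n k w < T then piece n k t w else 0)
      - (w (cut (cut t T) (R n K w)) - w (cut (cut s T) (R n K w)))\<bar> \<le> 6 * step n"
proof -
  let ?b = "\<lambda>k. if ennreal s \<le> R n k w \<and> R n k w < T then piece n k t w else 0"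
  let ?d = "\<lambda>k. piece n k (cut t T) w - piece n k (cut s T) w"
  let ?N = "cnt n (ennreal s) w" and ?M = "cnt n T w"
  have t: "0 \<le> t" using st by simp
  have "w (cut (cut t T) (R n K w)) - w (cut (cut s T) (R n K w)) = (\<Sum>k<K. ?d k)"
    by (simp add: sum_subtractf sum_piece[OF w])
  then have "\<bar>(\<Sum>k<K. ?b k) - (w (cut (cut t T) (R n K w)) - w (cut (cut s T) (R n K w)))\<bar> \<le> (\<Sum>k<K. \<bar>?b k - ?d k\<bar>)"
    by (simp add: sum_subtractf[symmetric] sum_abs del: sum_subtractf)
  also have "\<dots> \<le> (\<Sum>k<K. (if k = ?N then 3 * step n else 0) + (if k = ?M then 3 * step n else 0))"
  proof (rule sum_mono)
    fix k
    have all: "\<bar>?b k - ?d k\<bar> \<le> 3 * step n"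
      using piece_abs[OF w t, of n k] piece_abs[OF w cut_nonneg[of t T], of n k] piece_abs[OF w cut_nonneg[of s T], of n k]
      by auto
    have cc: "cut (cut r T) A = cut r (min T A)" if "0 \<le> r" for r A by (rule cut_cut[OF that])
    have zero: "?b k = ?d k" if "k \<noteq> ?N" "k \<noteq> ?M"
    proof (cases "T \<le> R n k w")
      case True
      then have T: "T \<le> R n (Suc k) w" using grid_mono_Suc order_trans by blast
      have "piece n k (cut r T) w = 0" if "0 \<le> r" for r
        using that True T by (intro piece_late) (auto simp: ennreal_cut min_le_iff_disj)
      moreover have "\<not> R n k w < T" using True by (simp only: not_less)
      ultimately show ?thesis using st t by simp
    next
      case False
      have TS: "R n (Suc k) w \<le> T"
      proof (cases "T < \<top>")
        case fin: True
        have "k < ?M"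
          using le_cnt_iff[OF w fin, of k n] linear[of T "R n k w"] False \<open>k \<noteq> ?M\<close> by (metis le_neq_implies_less)
        then show ?thesis using le_cnt_iff[OF w fin, of "Suc k" n] by simp
      qed (simp add: less_top[symmetric])
      have m: "min T (R n k w) = R n k w" "min T (R n (Suc k) w) = R n (Suc k) w"
        using False TS by (auto simp: min_def)
      have p: "piece n k (cut r T) w = piece n k r w" if "0 \<le> r" for r
        unfolding piece_def cc[OF that] m ..
      show ?thesis
      proof (cases "k < ?N")
        case True
        have "R n (Suc k) w \<le> R n ?N w" using True by (intro grid_mono) simp
        also have "\<dots> \<le> ennreal s" by (rule cnt_bounds(1)[OF w]) simp
        finally have Su: "R n (Suc k) w \<le> ennreal s" .
        then have "R n k w < ennreal s"
          using R_strict[OF w, of n k] R_finite_pred[OF w, of n k] by (metis ennreal_less_top le_less_trans less_le_trans)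
        then have "\<not> ennreal s \<le> R n k w" by (simp only: not_le)
        moreover have "piece n k t w = piece n k s w"
          using Su order_trans[OF Su ennreal_leI[OF st(2)]] by (simp add: piece_early)
        ultimately show ?thesis using p st t by simp
      next
        case False
        then have "Suc ?N \<le> k" using \<open>k \<noteq> ?N\<close> by simp
        have "ennreal s < R n (Suc ?N) w" by (rule cnt_bounds(2)[OF w]) simp
        also have "\<dots> \<le> R n k w" using \<open>Suc ?N \<le> k\<close> by (rule grid_mono)
        finally have "ennreal s \<le> R n k w" by simp
        then show ?thesis using \<open>\<not> T \<le> R n k w\<close> p st t piece_late[of s n k w] by simp
      qed
    qed
    let ?e = "(if k = ?N then 3 * step n else 0) + (if k = ?M then 3 * step n else 0)"
    show "\<bar>?b k - ?d k\<bar> \<le> ?e"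
    proof (cases "k = ?N \<or> k = ?M")
      case True
      then have "3 * step n \<le> ?e" using step_pos(3)[of n] by fastforce
      then show ?thesis by (rule order_trans[OF all])
    next
      case False
      then have "?b k = ?d k" by (intro zero) blast+
      then have "\<bar>?b k - ?d k\<bar> = 0" by (simp only: diff_self abs_zero)
      moreover have "?e = 0" using False by simp
      ultimately show ?thesis by (simp only: order_refl)
    qed
  qed
  also have "\<dots> \<le> 6 * step n" by (simp add: sum.distrib)
  finally show ?thesis .
qed

text \<open>Whether a step begins after \<open>s\<close> and before \<open>T\<close>, and whether
  the path lies in \<open>D\<close>, is known when such a step begins; reflecting there flips its
  piece, so each summand has mean zero. The sum differs from the stopped increment by at most
  \<open>6 * step n\<close>, which vanishes as the grid is refined.\<close>

lemma optional_stopping: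
  assumes T: "adm T" and C: "\<And>w r. w \<in> W \<Longrightarrow> 0 \<le> r \<Longrightarrow> ennreal r \<le> T w \<Longrightarrow> \<bar>w r\<bar> \<le> C"
    and st: "0 \<le> s" "s \<le> t" and D: "past s D"
  shows "(\<integral>w. (w (cut t (T w)) - w (cut s (T w))) * indicator D w \<partial>\<mu>) = 0"
proof -
  have t: "0 \<le> t" using st by simp
  have Dm: "D \<in> sets path_space" using D by (simp add: past_def)
  have Tm: "T \<in> borel_measurable path_space" using T by (simp add: adm_def)
  define b where "b n k w = (if ennreal s \<le> R n k w \<and> R n k w < T w then piece n k t w else 0) * indicator D w" for n k w
  \<comment> \<open>Stopping additionally at the \<open>K\<close>-th grid point leaves finitely many
    pieces; on each path this has no effect once that point is beyond \<open>t\<close>.\<close>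
  define h where "h n K w = (w (cut (cut t (T w)) (R n K w)) - w (cut (cut s (T w)) (R n K w))) * indicator D w" for n K and w :: "real \<Rightarrow> real"
  let ?h = "\<lambda>w. (w (cut t (T w)) - w (cut s (T w))) * indicator D w"
  have bm: "b n k \<in> borel_measurable path_space" for n k
  proof -
    have "Measurable.pred path_space (\<lambda>w. ennreal s \<le> R n k w \<and> R n k w < T w)"
      by (intro pred_intros_logic(3)) (simp_all add: pred_def borel_measurable_le borel_measurable_less Tm R_measurable)
    then show ?thesis unfolding b_def[abs_def]
      by (intro borel_measurable_times measurable_If piece_measurable borel_measurable_const borel_measurable_indicator Dm)
        (simp_all add: pred_def)
  qed
  have hm: "h n K \<in> borel_measurable path_space" for n K
    unfolding h_def[abs_def]
    by (intro borel_measurable_times borel_measurable_diff eval_self_measurable cut_measurable borel_measurable_const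
        borel_measurable_indicator Dm Tm R_measurable)
  have hm': "?h \<in> borel_measurable path_space"
    by (intro borel_measurable_times borel_measurable_diff eval_self_measurable cut_measurable borel_measurable_const
        borel_measurable_indicator Dm Tm)
  have b0: "(\<integral>w. b n k w \<partial>\<mu>) = 0" for n k
  proof (rule integral_antisym[OF reflect_preserving[OF adm_R[of n k]] bm])
    fix w assume w: "w \<in> W"
    let ?w = "reflect (R n k) w"
    have lt: "(R n k ?w < T ?w) = (R n k w < T w)"
      by (rule nonant_reflect[OF nonant_mono[OF adm_min_nonant(2)[OF adm_R T]] w]) simp
    have "ennreal s \<le> R n k w \<Longrightarrow> indicator D ?w = (indicator D w :: real)"
      using past_reflect[OF D w] by (simp add: indicator_def)
    then show "b n k ?w = - b n k w"
      unfolding b_def lt by (simp add: piece_reflect[OF w t] R_reflect_R[OF w])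
  qed
  have bB: "\<bar>b n k w\<bar> \<le> step n" if "w \<in> W" for n k w
    using piece_abs[OF that t, of n k] by (auto simp: b_def indicator_def)
  have hB: "\<bar>h n K w\<bar> \<le> 2 * C" "\<bar>?h w\<bar> \<le> 2 * C" if w: "w \<in> W" for n K w
  proof -
    have "\<bar>w (cut r (T w))\<bar> \<le> C" "\<bar>w (cut (cut r (T w)) (R n K w))\<bar> \<le> C" if "0 \<le> r" for r
      using that by (intro C w cut_nonneg; simp add: ennreal_cut min.coboundedI1)+
    from this(1)[OF t] this(1)[OF st(1)] this(2)[OF t] this(2)[OF st(1)]
    show "\<bar>h n K w\<bar> \<le> 2 * C" "\<bar>?h w\<bar> \<le> 2 * C"
      by (auto simp: h_def indicator_def)
  qed
  have close: "\<bar>\<integral>w. h n K w \<partial>\<mu>\<bar> \<le> 6 * step n" for n K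
  proof -
    have bi: "integrable \<mu> (b n k)" for k using bm bB by (intro bounded_integrable[where B="step n"]) auto
    have hi: "integrable \<mu> (h n K)" using hm hB by (intro bounded_integrable[where B="2 * C"]) auto
    have "(\<integral>w. h n K w \<partial>\<mu>) = (\<integral>w. h n K w - (\<Sum>k<K. b n k w) \<partial>\<mu>)"
      using bi hi by (simp add: b0)
    also have "\<bar>\<dots>\<bar> \<le> 6 * step n"
    proof -
      have "\<bar>h n K w - (\<Sum>k<K. b n k w)\<bar> \<le> 6 * step n" if "w \<in> W" for w
      proof -
        have "h n K w - (\<Sum>k<K. b n k w) = - ((\<Sum>k<K. if ennreal s \<le> R n k w \<and> R n k w < T w then piece n k t w else 0)
            - (w (cut (cut t (T w)) (R n K w)) - w (cut (cut s (T w)) (R n K w)))) * indicator D w"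
          unfolding h_def b_def sum_distrib_right[symmetric] by (simp add: algebra_simps)
        then show ?thesis using stopped_pieces[where n=n and K=K and T="T w", OF that st] by (auto simp: indicator_def abs_mult)
      qed
      then have "\<bar>\<integral>w. h n K w - (\<Sum>k<K. b n k w) \<partial>\<mu>\<bar> \<le> (\<integral>w. 6 * step n \<partial>\<mu>)"
        using bi hi by (intro integral_abs_bound[THEN order_trans] integral_mono) auto
      moreover have "measure \<mu> W = 1" using prob_space by simp
      ultimately show ?thesis by simp
    qed
    finally show ?thesis .
  qed
  have le: "\<bar>\<integral>w. ?h w \<partial>\<mu>\<bar> \<le> 6 * step n" for n
  proof -
    have "(\<lambda>K. \<integral>w. h n K w \<partial>\<mu>) \<longlonglongrightarrow> (\<integral>w. ?h w \<partial>\<mu>)"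
    proof (rule integral_dominated_convergence[where w="\<lambda>_. 2 * C"])
      show "AE w in \<mu>. (\<lambda>K. h n K w) \<longlonglongrightarrow> ?h w"
      proof (rule AE_I2)
        fix w assume "w \<in> space \<mu>"
        then have w: "w \<in> W" by simp
        obtain K0 where K0: "ennreal t < R n K0 w" using R_unbounded[OF w] by blast
        have "h n K w = ?h w" if K: "K \<ge> K0" for K
        proof -
          have "ennreal t \<le> R n K w" using K0 grid_mono[OF K, of "\<lambda>_. step n" w] by simp
          then have "ennreal (cut r (T w)) \<le> R n K w" if "0 \<le> r" "r \<le> t" for r
            using that by (simp add: ennreal_cut) (meson ennreal_leI min.coboundedI1 order_trans)
          then show ?thesis using st t by (simp add: h_def cut_eq)
        qed
        then show "(\<lambda>K. h n K w) \<longlonglongrightarrow> ?h w"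
          by (intro tendsto_eventually) (auto simp: eventually_sequentially)
      qed
      show "AE w in \<mu>. norm (h n K w) \<le> 2 * C" for K using hB by (intro AE_I2) auto
    qed (intro law_measurable hm' hm integrable_const)+
    then have "(\<lambda>K. \<bar>\<integral>w. h n K w \<partial>\<mu>\<bar>) \<longlonglongrightarrow> \<bar>\<integral>w. ?h w \<partial>\<mu>\<bar>" by (rule tendsto_rabs)
    then show ?thesis by (rule LIMSEQ_le_const2) (use close in blast)
  qed
  have "(\<lambda>n. 6 * step n) \<longlonglongrightarrow> 6 * 0" by (rule tendsto_mult_left[OF step_tendsto])
  then have "\<bar>\<integral>w. ?h w \<partial>\<mu>\<bar> \<le> 6 * 0" by (rule LIMSEQ_le_const) (use le in blast)
  then show ?thesis by simp
qed

section \<open>Almost sure divergence\<close>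

text \<open>On \<open>F J\<close> the grid ends before its \<open>J\<close>-th point and its steps
  alternate up and down, so the path stays below \<open>2 * step n < a\<close> and never reaches
  \<open>a\<close>. Prescribing one more sign costs a factor of at most \<open>2\<close>, since
  reflection at that grid point exchanges the two signs and leaves the grid alone. Hence
  \<open>F 0\<close> is null as well.\<close>

lemma AE_R_finite:
  assumes a: "0 < a" "2 * step n < a" and hit: "AE w in \<mu>. hit (\<lambda>_. 0) a w < \<top>"
  shows "AE w in \<mu>. R n J w < \<top>"
proof -
  define F where "F k = {w\<in>W. R n J w = \<top> \<and> (\<forall>i\<in>{..<k}. R n (Suc i) w < \<top> \<longrightarrow> incr n i w = (if even i then step n else - step n))}" for k
  have Fm: "F k \<in> sets path_space" for k
  proof -
    have 1: "Measurable.pred path_space (\<lambda>w. R n i w < \<top>)" for i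
      unfolding pred_def by (rule borel_measurable_less[OF R_measurable]) simp
    have 2: "Measurable.pred path_space (\<lambda>w. R n i w = \<top>)" for i
      using pred_intros_logic(2)[OF 1] by (simp add: less_top[symmetric])
    have 3: "Measurable.pred path_space (\<lambda>w. incr n i w = c)" for i c
      unfolding pred_def by (rule borel_measurable_eq[OF incr_measurable]) simp
    have "Measurable.pred path_space (\<lambda>w. R n J w = \<top> \<and> (\<forall>i\<in>{..<k}. R n (Suc i) w < \<top> \<longrightarrow> incr n i w = (if even i then step n else - step n)))"
      by (intro pred_intros_logic(3) pred_intros_finite(3) pred_intros_logic(4) 1 2 3) simp
    then show ?thesis by (simp add: F_def pred_def)
  qed
  have half: "measure \<mu> (F k) \<le> 2 * measure \<mu> (F (Suc k))" for k
  proof -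
    let ?\<rho> = "reflect (R n k)"
    have p: "preserving ?\<rho>" by (rule reflect_preserving[OF adm_R])
    have vm: "?\<rho> -` F (Suc k) \<inter> W \<in> sets path_space"
      using measurable_sets[OF reflect_measurable[OF R_measurable] Fm] .
    have "F k \<subseteq> F (Suc k) \<union> (?\<rho> -` F (Suc k) \<inter> W)"
    proof
      fix w assume "w \<in> F k"
      then have w: "w \<in> W" and J: "R n J w = \<top>"
        and alt: "\<And>i. i < k \<Longrightarrow> R n (Suc i) w < \<top> \<Longrightarrow> incr n i w = (if even i then step n else - step n)"
        by (auto simp: F_def)
      show "w \<in> F (Suc k) \<union> (?\<rho> -` F (Suc k) \<inter> W)"
      proof (cases "R n (Suc k) w < \<top> \<longrightarrow> incr n k w = (if even k then step n else - step n)")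
        case True
        then have "w \<in> F (Suc k)" using w J alt by (auto simp: F_def less_Suc_eq)
        then show ?thesis ..
      next
        case False
        then have fin: "R n (Suc k) w < \<top>" by simp
        have "\<bar>incr n k w\<bar> = step n" using incr_abs[OF w fin] fin by (simp add: incr_def)
        then have "- incr n k w = (if even k then step n else - step n)" using False by (auto split: if_splits)
        then have "?\<rho> w \<in> F (Suc k)"
          using alt J reflect_in_W[OF w]
          by (auto simp: F_def less_Suc_eq R_reflect_R[OF w] incr_reflect[OF w])
        then show ?thesis using w by simp
      qed
    qed
    then have "measure \<mu> (F k) \<le> measure \<mu> (F (Suc k) \<union> (?\<rho> -` F (Suc k) \<inter> W))"
      using Fm vm by (intro finite_measure_mono) auto
    also have "\<dots> \<le> measure \<mu> (F (Suc k)) + measure \<mu> (?\<rho> -` F (Suc k) \<inter> W)"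
      using Fm vm by (intro measure_Un_le) auto
    also have "measure \<mu> (?\<rho> -` F (Suc k) \<inter> W) = measure \<mu> (F (Suc k))"
      by (simp only: measure_def preserving_emeasure[OF p Fm])
    finally show ?thesis by simp
  qed
  have iter: "measure \<mu> (F 0) \<le> 2 ^ k * measure \<mu> (F k)" for k
  proof (induction k)
    case (Suc k)
    have "2 ^ k * measure \<mu> (F k) \<le> 2 ^ k * (2 * measure \<mu> (F (Suc k)))" by (intro mult_left_mono half) simp
    then have "measure \<mu> (F 0) \<le> 2 ^ k * (2 * measure \<mu> (F (Suc k)))" using Suc by (rule order_trans[rotated])
    then show ?case by (simp only: power_Suc mult_ac)
  qed simp
  have low: "hit (\<lambda>_. 0) a w = \<top>" if "w \<in> F J" for w
  proof -
    from that have w: "w \<in> W" and J: "R n J w = \<top>"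
      and alt: "\<And>i. i < J \<Longrightarrow> R n (Suc i) w < \<top> \<Longrightarrow> incr n i w = (if even i then step n else - step n)"
      by (auto simp: F_def)
    have v: "R n i w < \<top> \<Longrightarrow> i \<le> J \<Longrightarrow> val n i w = (if even i then 0 else step n)" for i
    proof (induction i)
      case 0
      then show ?case using val_0[OF w] by simp
    next
      case (Suc i)
      have "val n (Suc i) w = val n i w + incr n i w" using Suc.prems by (simp add: incr_def)
      then show ?case using Suc alt[of i] R_finite_pred[OF w Suc.prems(1)] by auto
    qed
    have wlt: "w t < a" if t: "0 \<le> t" for t
    proof -
      let ?i = "cnt n (ennreal t) w"
      have i: "R n ?i w \<le> ennreal t" "ennreal t < R n (Suc ?i) w" using cnt_bounds[OF w, of "ennreal t" n] by auto
      have fin: "R n ?i w < \<top>" using i(1) by (rule le_less_trans) simp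
      then have "R n ?i w < R n J w" using J by simp
      then have "?i < J" by (rule R_less_imp)
      then have "val n ?i w \<le> step n" using v[OF fin] by simp
      moreover have "\<bar>w t - val n ?i w\<bar> < step n" using R_before[OF w t i] by (simp add: val_def)
      ultimately show ?thesis using a by linarith
    qed
    show ?thesis
    proof (rule hit_cases[OF w, of "\<lambda>_. 0" a])
      fix t assume "0 \<le> t" "w t - w (enn2real 0) = a"
      then show ?thesis using wlt[of t] W_zero[OF w] by simp
    qed
  qed
  have "AE w in \<mu>. w \<notin> F J" using hit by (rule AE_mp) (auto intro!: AE_I2 simp: low)
  then have "emeasure \<mu> (F J) = 0"
    using AE_iff_measurable[of "F J" \<mu> "\<lambda>w. w \<notin> F J"] Fm sets.sets_into_space[OF Fm] by auto
  then have "measure \<mu> (F J) = 0" by (simp add: measure_def)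
  then have "measure \<mu> (F 0) = 0" using iter[of J] measure_nonneg[of \<mu> "F 0"] by simp
  then have "emeasure \<mu> (F 0) = 0" by (simp add: emeasure_eq_measure)
  moreover have "F 0 = {w \<in> space \<mu>. \<not> R n J w < \<top>}" by (auto simp: F_def less_top[symmetric])
  ultimately show ?thesis using Fm by (subst AE_iff_measurable[of "F 0"]) auto
qed

text \<open>If the whole grid is finite, its points go to infinity while consecutive values differ
  by a fixed amount, which no convergent path allows.\<close>

theorem AE_divergent:
  assumes a: "0 < a" and hit: "AE w in \<mu>. hit (\<lambda>_. 0) a w < \<top>"
  shows "AE w in \<mu>. \<not> (\<exists>l. (w \<longlongrightarrow> l) at_top)"
proof -
  have "\<forall>\<^sub>F n in sequentially. 2 * step n < a"
    using order_tendstoD(2)[OF tendsto_mult_left[OF step_tendsto, of 2], of a] a by simp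
  then obtain n where n: "2 * step n < a" by (auto simp: eventually_sequentially)
  have "AE w in \<mu>. \<forall>J. R n J w < \<top>" using AE_R_finite[OF a n hit] by (simp add: AE_all_countable)
  then show ?thesis
  proof (rule AE_mp, intro AE_I2 impI notI)
    fix w assume "w \<in> space \<mu>" and fin: "\<forall>J. R n J w < \<top>" and ex: "\<exists>l. (w \<longlongrightarrow> l) at_top"
    then have w: "w \<in> W" by simp
    obtain l where l: "(w \<longlongrightarrow> l) at_top" using ex by blast
    have "\<forall>\<^sub>F t in at_top. dist (w t) l < step n / 2" using tendstoD[OF l, of "step n / 2"] by simp
    then obtain t0 where t0: "\<And>t. t \<ge> t0 \<Longrightarrow> dist (w t) l < step n / 2" by (auto simp: eventually_at_top_linorder)
    obtain J where J: "ennreal (max t0 0) < R n J w" using R_unbounded[OF w] by blast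
    have "t0 \<le> enn2real (R n i w)" if "J \<le> i" for i
    proof -
      obtain r where r: "0 \<le> r" "R n i w = ennreal r" using fin[rule_format, of i] by (cases "R n i w") auto
      have "ennreal (max t0 0) < ennreal r" using J grid_mono[OF that, of "\<lambda>_. step n" w] r by simp
      then have "\<not> r \<le> max t0 0" using ennreal_leI[of r "max t0 0"] by (metis leD)
      then show ?thesis using r by simp
    qed
    then have "dist (val n J w) l < step n / 2" "dist (val n (Suc J) w) l < step n / 2"
      unfolding val_def by (intro t0; simp)+
    then have "\<bar>val n (Suc J) w - val n J w\<bar> < step n" by (simp add: dist_real_def abs_less_iff) argo
    then show False using incr_abs[OF w, of n J] fin by simp
  qed
qed

end

section \<open>Moments from characteristic functions\<close>

lemma derivative_along:
  fixes f :: "real \<Rightarrow> real"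
  assumes f: "(f has_real_derivative D) (at 0)" "f 0 = 0"
    and h: "h \<longlonglongrightarrow> 0" "\<And>n. h n \<noteq> 0"
  shows "(\<lambda>n. f (h n) / h n) \<longlonglongrightarrow> D"
proof -
  have "((\<lambda>y. f y / y) \<longlongrightarrow> D) (at 0)"
    using f by (simp add: has_field_derivative_iff)
  moreover have "filterlim h (at 0) sequentially"
    using h by (intro filterlim_atI) auto
  ultimately show ?thesis by (rule filterlim_compose)
qed

lemma inverse_Suc_tendsto: "(\<lambda>n. 1 / real (Suc n)) \<longlonglongrightarrow> 0"
  using LIMSEQ_inverse_real_of_nat by (simp add: inverse_eq_divide)

lemma cut_mono: "s \<le> t \<Longrightarrow> cut s T \<le> cut t T"
  unfolding cut_def by (intro enn2real_mono min.mono ennreal_leI) (auto simp: min_less_iff_disj)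

lemma QV_reflect: "w \<in> W \<Longrightarrow> QV (reflect (R n k) w) = QV w"
  by (simp add: QV_def qv_reflect)

lemma QV_in_W: "w \<in> W \<Longrightarrow> QV w \<in> W"
  by (rule measurable_space[OF QV_measurable])

text \<open>A localizing time that is a function of the quadratic variation alone. Reflections at
  grid points therefore leave it unchanged, so it may serve as a time in
  \<open>char_identity\<close>.\<close>

definition tau :: "real \<Rightarrow> (real \<Rightarrow> real) \<Rightarrow> ennreal" where
  "tau m w = hit (\<lambda>_. 0) m (QV w)"

lemma tau_measurable: "m \<noteq> 0 \<Longrightarrow> tau m \<in> borel_measurable path_space"
  unfolding tau_def[abs_def] by (rule measurable_compose[OF QV_measurable hit_measurable]) auto

lemma tau_reflect: "w \<in> W \<Longrightarrow> tau m (reflect (R n k) w) = tau m w"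
  by (simp add: tau_def QV_reflect)

lemma tau_le_iff:
  assumes w: "w \<in> W" and m: "0 < m" and r: "0 \<le> r"
  shows "tau m w \<le> ennreal r \<longleftrightarrow> m \<le> qv r w"
proof
  assume le: "tau m w \<le> ennreal r"
  then obtain t where t: "0 \<le> t" "tau m w = ennreal t" by (cases "tau m w") (auto simp: top_unique)
  have "QV w t - QV w (enn2real 0) = m"
    using hit_finite(2)[OF QV_in_W[OF w] t(2)[unfolded tau_def] t(1)] by simp
  then have "qv t w = m" using t by (simp add: QV_def qv_0[OF w])
  moreover have "t \<le> r" using le t r by (simp add: ennreal_le_iff)
  ultimately show "m \<le> qv r w" using qv_mono[OF w t(1), of r] by simp
next
  assume mr: "m \<le> qv r w"
  have "hit (\<lambda>_. 0) m (QV w) \<le> ennreal r \<or> hit (\<lambda>_. 0) (- m) (QV w) \<le> ennreal r"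
    using mr r m qv_0[OF w] by (intro hit_IVT QV_in_W w) (auto simp: QV_def)
  moreover have "\<not> hit (\<lambda>_. 0) (- m) (QV w) \<le> ennreal r"
  proof
    assume "hit (\<lambda>_. 0) (- m) (QV w) \<le> ennreal r"
    then obtain t where t: "0 \<le> t" "hit (\<lambda>_. 0) (- m) (QV w) = ennreal t"
      by (cases "hit (\<lambda>_. 0) (- m) (QV w)") (auto simp: top_unique)
    then have "QV w t - QV w (enn2real 0) = - m" using hit_finite(2)[OF QV_in_W[OF w] t(2,1)] by simp
    then show False using qv_nonneg[OF w t(1)] m t by (simp add: QV_def qv_0[OF w])
  qed
  ultimately show "tau m w \<le> ennreal r" by (simp add: tau_def)
qed

lemma qv_le_tau:
  assumes w: "w \<in> W" and m: "0 < m" and r: "0 \<le> r" "ennreal r \<le> tau m w"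
  shows "qv r w \<le> m"
proof (rule ccontr)
  assume "\<not> ?thesis"
  then have "m \<le> qv r w" "qv r w \<noteq> m" by auto
  then have "tau m w \<le> ennreal r" using tau_le_iff[OF w m r(1)] by simp
  then have "tau m w = ennreal r" using r by simp
  then have "QV w r - QV w (enn2real 0) = m"
    using hit_finite(2)[OF QV_in_W[OF w], of "\<lambda>_. 0" m r] r(1) unfolding tau_def by simp
  then show False using \<open>qv r w \<noteq> m\<close> r by (simp add: QV_def qv_0[OF w])
qed

context reflection_law
begin

lemma gaussian_char:
  fixes v c :: "'i \<Rightarrow> real"
  assumes I: "finite I" and v: "\<And>i. 0 \<le> v i" and B: "B \<in> sets path_space"
  shows "(\<integral>w. cis (\<Sum>i\<in>I. c i * w (v i)) * complex_of_real (indicator B (QV w)) \<partial>\<mu>)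
    = (\<integral>w. complex_of_real (exp (- (\<Sum>i\<in>I. \<Sum>j\<in>I. c i * c j * qv (min (v i) (v j)) w) / 2) * indicator B (QV w)) \<partial>\<mu>)"
proof -
  have Zm: "(\<lambda>w. indicator B (QV w) :: real) \<in> borel_measurable path_space"
    by (rule measurable_compose[OF QV_measurable borel_measurable_indicator[OF B]])
  have "(\<integral>w. cis (\<Sum>i\<in>I. c i * (w (v i) - w 0)) * complex_of_real (indicator B (QV w)) \<partial>\<mu>)
    = (\<integral>w. complex_of_real (exp (- (\<Sum>i\<in>I. \<Sum>j\<in>I. c i * c j * (qv (min (v i) (v j)) w - qv 0 w)) / 2) * indicator B (QV w)) \<partial>\<mu>)"
    using v by (intro char_identity[where V="\<lambda>i _. v i" and U="\<lambda>_. 0" and B=1] I Zm)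
      (auto simp: QV_reflect indicator_def)
  moreover have "(\<integral>w. cis (\<Sum>i\<in>I. c i * (w (v i) - w 0)) * complex_of_real (indicator B (QV w)) \<partial>\<mu>)
    = (\<integral>w. cis (\<Sum>i\<in>I. c i * w (v i)) * complex_of_real (indicator B (QV w)) \<partial>\<mu>)"
    by (rule Bochner_Integration.integral_cong) (auto simp: W_zero)
  moreover have "(\<integral>w. complex_of_real (exp (- (\<Sum>i\<in>I. \<Sum>j\<in>I. c i * c j * (qv (min (v i) (v j)) w - qv 0 w)) / 2) * indicator B (QV w)) \<partial>\<mu>)
    = (\<integral>w. complex_of_real (exp (- (\<Sum>i\<in>I. \<Sum>j\<in>I. c i * c j * qv (min (v i) (v j)) w) / 2) * indicator B (QV w)) \<partial>\<mu>)"
    by (rule Bochner_Integration.integral_cong) (auto simp: qv_0)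
  ultimately show ?thesis by simp
qed

context
  fixes V U Z :: "(real \<Rightarrow> real) \<Rightarrow> real" and B :: real
  assumes Vm: "V \<in> borel_measurable path_space" and Um: "U \<in> borel_measurable path_space"
    and Zm: "Z \<in> borel_measurable path_space"
    and U0: "\<And>w. w \<in> W \<Longrightarrow> 0 \<le> U w" and UV: "\<And>w. w \<in> W \<Longrightarrow> U w \<le> V w"
    and Uinv: "\<And>n k w. w \<in> W \<Longrightarrow> U (reflect (R n k) w) = U w"
    and Vinv: "\<And>n k w. w \<in> W \<Longrightarrow> V (reflect (R n k) w) = V w"
    and ZB: "\<And>w. w \<in> W \<Longrightarrow> \<bar>Z w\<bar> \<le> B"
    and Zinv: "\<And>n k w. w \<in> W \<Longrightarrow> ennreal (U w) \<le> R n k w \<Longrightarrow> Z (reflect (R n k) w) = Z w"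
begin

lemma x_measurable: "(\<lambda>w. w (V w) - w (U w)) \<in> borel_measurable path_space"
  by (intro borel_measurable_diff eval_self_measurable Vm Um)

lemma cos_identity:
  "(\<integral>w. cos (\<theta> * (w (V w) - w (U w))) * Z w \<partial>\<mu>) = (\<integral>w. exp (- (\<theta>\<^sup>2 * (qv (V w) w - qv (U w) w)) / 2) * Z w \<partial>\<mu>)" (is ?cos)
  and sin_identity: "(\<integral>w. sin (\<theta> * (w (V w) - w (U w))) * Z w \<partial>\<mu>) = 0" (is ?sin)
proof -
  let ?f = "\<lambda>w. cis (\<theta> * (w (V w) - w (U w))) * complex_of_real (Z w)"
  have "(\<integral>w. cis (\<Sum>i\<in>{()}. \<theta> * (w (V w) - w (U w))) * complex_of_real (Z w) \<partial>\<mu>)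
    = (\<integral>w. complex_of_real (exp (- (\<Sum>i\<in>{()}. \<Sum>j\<in>{()}. \<theta> * \<theta> * (qv (min (V w) (V w)) w - qv (U w) w)) / 2) * Z w) \<partial>\<mu>)"
    using Vm Um Zm U0 UV Uinv Vinv ZB Zinv
    by (intro char_identity[where V="\<lambda>_. V" and c="\<lambda>_. \<theta>" and U=U and Z=Z and B=B]) auto
  then have eq: "(\<integral>w. ?f w \<partial>\<mu>) = complex_of_real (\<integral>w. exp (- (\<theta>\<^sup>2 * (qv (V w) w - qv (U w) w)) / 2) * Z w \<partial>\<mu>)"
    unfolding integral_complex_of_real by (simp add: power2_eq_square)
  have int: "integrable \<mu> ?f"
  proof (rule bounded_integrable)
    show "?f \<in> borel_measurable path_space"
      by (intro borel_measurable_times cis_measurable complex_of_real_measurable Zm x_measurable borel_measurable_const)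
    show "norm (?f w) \<le> B" if "w \<in> W" for w using ZB[OF that] by (simp add: norm_mult)
  qed
  have "(\<integral>w. Re (?f w) \<partial>\<mu>) = Re (\<integral>w. ?f w \<partial>\<mu>)" "(\<integral>w. Im (?f w) \<partial>\<mu>) = Im (\<integral>w. ?f w \<partial>\<mu>)"
    using int by (rule integral_Re, rule integral_Im)
  then show ?cos ?sin unfolding eq by simp_all
qed

text \<open>Second difference quotients at \<open>0\<close> of the two sides of
  \<open>cos_identity\<close>. The quotients of the cosine lie below \<open>x\<^sup>2\<close>, those
  of the exponential below \<open>m\<close>. Fatou first gives integrability of the weighted square,
  which then dominates the cosine side for the passage to the limit.\<close>

lemma second_moment:
  assumes Z0: "\<And>w. w \<in> W \<Longrightarrow> 0 \<le> Z w" and qm: "\<And>w. w \<in> W \<Longrightarrow> qv (V w) w \<le> m"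
  shows "integrable \<mu> (\<lambda>w. (w (V w) - w (U w))\<^sup>2 * Z w)"
    and "(\<integral>w. (w (V w) - w (U w))\<^sup>2 * Z w \<partial>\<mu>) = (\<integral>w. (qv (V w) w - qv (U w) w) * Z w \<partial>\<mu>)"
proof -
  define x where "x w = w (V w) - w (U w)" for w :: "real \<Rightarrow> real"
  define a where "a w = qv (V w) w - qv (U w) w" for w
  define h where "h n = 1 / real (Suc n)" for n
  have h: "0 < h n" "h n \<noteq> 0" for n by (simp_all add: h_def)
  have h0: "h \<longlonglongrightarrow> 0" unfolding h_def by (rule inverse_Suc_tendsto)
  define f where "f n w = 2 * (1 - cos (h n * x w)) / (h n)\<^sup>2 * Z w" for n w
  define g where "g n w = 2 * (1 - exp (- ((h n)\<^sup>2 * a w) / 2)) / (h n)\<^sup>2 * Z w" for n w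
  have V0: "0 \<le> V w" if "w \<in> W" for w using U0[OF that] UV[OF that] by (rule order_trans)
  have a0: "0 \<le> a w" if "w \<in> W" for w
    using qv_mono[OF that U0[OF that] UV[OF that]] by (simp add: a_def)
  have am: "a w \<le> m" if "w \<in> W" for w
    using qm[OF that] qv_nonneg[OF that U0[OF that]] by (simp add: a_def)
  have xm: "x \<in> borel_measurable path_space" unfolding x_def[abs_def] by (rule x_measurable)
  have amm: "a \<in> borel_measurable path_space" unfolding a_def[abs_def]
    by (intro borel_measurable_diff qv_random_measurable Vm Um U0 V0)
  have cosm: "(\<lambda>w. cos (h n * x w)) \<in> borel_measurable path_space" for n
    by (rule measurable_compose[OF xm borel_measurable_continuous_onI]) (intro continuous_intros)
  have expm: "(\<lambda>w. exp (- ((h n)\<^sup>2 * a w) / 2)) \<in> borel_measurable path_space" for n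
    by (rule measurable_compose[OF amm borel_measurable_continuous_onI]) (intro continuous_intros, simp)
  have fm: "f n \<in> borel_measurable path_space" and gm: "g n \<in> borel_measurable path_space" for n
    unfolding f_def[abs_def] g_def[abs_def]
    by (intro borel_measurable_times borel_measurable_divide borel_measurable_diff borel_measurable_const cosm expm Zm)+
  \<comment> \<open>The half-angle formula turns the quotient into a square, which makes both its
    sign and the comparison with \<open>x\<^sup>2\<close> visible.\<close>
  have f_sq: "f n w = (2 * sin (x w * h n / 2) / h n)\<^sup>2 * Z w" for n w
  proof -
    have "1 - cos (h n * x w) = 2 * (sin (x w * h n / 2))\<^sup>2"
      using cos_double_sin[of "x w * h n / 2"] by (simp add: mult.commute)
    then show ?thesis by (simp add: f_def power_divide power_mult_distrib)
  qed
  have f_le: "0 \<le> f n w \<and> f n w \<le> (x w)\<^sup>2 * Z w" if w: "w \<in> W" for n w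
  proof -
    have "\<bar>sin (x w * h n / 2)\<bar> \<le> \<bar>x w * h n / 2\<bar>" by (rule abs_sin_x_le_abs_x)
    then have "\<bar>2 * sin (x w * h n / 2) / h n\<bar> \<le> \<bar>x w\<bar>"
      using h(1)[of n] by (simp add: abs_mult pos_divide_le_eq)
    then have "(2 * sin (x w * h n / 2) / h n)\<^sup>2 \<le> (x w)\<^sup>2" by (simp only: abs_le_square_iff)
    then show ?thesis unfolding f_sq using Z0[OF w] by (auto intro: mult_right_mono)
  qed
  have f_lim: "(\<lambda>n. f n w) \<longlonglongrightarrow> (x w)\<^sup>2 * Z w" for w
  proof -
    have "((\<lambda>y. 2 * sin (x w * y / 2)) has_real_derivative x w) (at 0)"
      by (auto intro!: derivative_eq_intros)
    then have "(\<lambda>n. 2 * sin (x w * h n / 2) / h n) \<longlonglongrightarrow> x w"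
      by (rule derivative_along[OF _ _ h0 h(2)]) simp
    then show ?thesis unfolding f_sq by (intro tendsto_intros)
  qed
  have g_bd: "0 \<le> g n w \<and> g n w \<le> m * B" if w: "w \<in> W" for n w
  proof -
    let ?y = "(h n)\<^sup>2 * a w / 2"
    have y: "0 \<le> ?y" using a0[OF w] by simp
    have e: "1 - exp (- ?y) \<le> ?y" "0 \<le> 1 - exp (- ?y)" using exp_ge_add_one_self[of "- ?y"] y by auto
    define z where "z = 2 * (1 - exp (- ?y)) / (h n)\<^sup>2"
    have z: "z \<le> a w" "0 \<le> z"
      unfolding z_def using e h(1)[of n] by (simp_all add: pos_divide_le_eq mult.commute)
    have Z: "Z w \<le> B" "0 \<le> Z w" using ZB[OF w] Z0[OF w] by auto
    have "z * Z w \<le> m * B" using z Z am[OF w] by (intro mult_mono) auto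
    moreover have "g n w = z * Z w" by (simp add: g_def z_def)
    ultimately show ?thesis using z Z by simp
  qed
  have g_lim: "(\<lambda>n. g n w) \<longlonglongrightarrow> a w * Z w" for w
  proof -
    have "((\<lambda>y. 2 * (1 - exp (- (y * a w) / 2))) has_real_derivative a w) (at 0)"
      by (auto intro!: derivative_eq_intros)
    then have "(\<lambda>n. 2 * (1 - exp (- ((h n)\<^sup>2 * a w) / 2)) / (h n)\<^sup>2) \<longlonglongrightarrow> a w"
    proof (rule derivative_along)
      show "(\<lambda>n. (h n)\<^sup>2) \<longlonglongrightarrow> 0" using tendsto_power[OF h0, of 2] by simp
    qed (simp_all add: h)
    then show ?thesis unfolding g_def by (intro tendsto_intros)
  qed
  have gi: "integrable \<mu> (g n)" for n using gm g_bd by (intro bounded_integrable[where B="m * B"]) auto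
  have fi: "integrable \<mu> (f n)" for n
  proof (rule bounded_integrable[OF fm])
    fix w assume w: "w \<in> W"
    have "0 \<le> 1 - cos (h n * x w)" "1 - cos (h n * x w) \<le> 2"
      using cos_le_one[of "h n * x w"] cos_ge_minus_one[of "h n * x w"] by linarith+
    then have "2 * (1 - cos (h n * x w)) \<le> 2 * 2" by (intro mult_left_mono) auto
    then have "2 * (1 - cos (h n * x w)) / (h n)\<^sup>2 \<le> 2 * 2 / (h n)\<^sup>2" by (rule divide_right_mono) simp
    moreover have "Z w \<le> B" "0 \<le> Z w" using ZB[OF w] Z0[OF w] by auto
    ultimately have "f n w \<le> 2 * 2 / (h n)\<^sup>2 * B" unfolding f_def by (intro mult_mono) auto
    then show "norm (f n w) \<le> 2 * 2 / (h n)\<^sup>2 * B" using f_le[OF w, of n] by simp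
  qed
  have fg: "(\<integral>w. f n w \<partial>\<mu>) = (\<integral>w. g n w \<partial>\<mu>)" for n
  proof -
    have bi: "integrable \<mu> (\<lambda>w. p w * Z w)" if "p \<in> borel_measurable path_space" "\<And>w. w \<in> W \<Longrightarrow> \<bar>p w\<bar> \<le> 1" for p
    proof (rule bounded_integrable)
      show "(\<lambda>w. p w * Z w) \<in> borel_measurable path_space" by (intro borel_measurable_times that Zm)
      fix w assume w: "w \<in> W"
      have "\<bar>p w\<bar> * \<bar>Z w\<bar> \<le> 1 * B" using that(2)[OF w] ZB[OF w] by (intro mult_mono) auto
      then show "norm (p w * Z w) \<le> B" by (simp add: abs_mult)
    qed
    have ci: "integrable \<mu> (\<lambda>w. cos (h n * x w) * Z w)" by (rule bi[OF cosm]) simp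
    have ei: "integrable \<mu> (\<lambda>w. exp (- ((h n)\<^sup>2 * a w) / 2) * Z w)" by (rule bi[OF expm]) (simp add: a0)
    have Zi: "integrable \<mu> Z" using ZB by (intro bounded_integrable[OF Zm]) auto
    have "(\<integral>w. f n w \<partial>\<mu>) = (\<integral>w. 2 / (h n)\<^sup>2 * (Z w - cos (h n * x w) * Z w) \<partial>\<mu>)"
      unfolding f_def by (rule Bochner_Integration.integral_cong) (simp_all add: field_simps)
    also have "\<dots> = 2 / (h n)\<^sup>2 * ((\<integral>w. Z w \<partial>\<mu>) - (\<integral>w. cos (h n * x w) * Z w \<partial>\<mu>))"
      using Zi ci by (simp only: integral_mult_right_zero Bochner_Integration.integral_diff)
    also have "(\<integral>w. cos (h n * x w) * Z w \<partial>\<mu>) = (\<integral>w. exp (- ((h n)\<^sup>2 * a w) / 2) * Z w \<partial>\<mu>)"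
      unfolding x_def a_def by (rule cos_identity)
    also have "2 / (h n)\<^sup>2 * ((\<integral>w. Z w \<partial>\<mu>) - (\<integral>w. exp (- ((h n)\<^sup>2 * a w) / 2) * Z w \<partial>\<mu>))
      = (\<integral>w. 2 / (h n)\<^sup>2 * (Z w - exp (- ((h n)\<^sup>2 * a w) / 2) * Z w) \<partial>\<mu>)"
      using Zi ei by (simp only: integral_mult_right_zero Bochner_Integration.integral_diff)
    also have "\<dots> = (\<integral>w. g n w \<partial>\<mu>)"
      unfolding g_def by (rule Bochner_Integration.integral_cong) (simp_all add: field_simps)
    finally show ?thesis .
  qed
  have x2m: "(\<lambda>w. (x w)\<^sup>2 * Z w) \<in> borel_measurable \<mu>"
    by (intro law_measurable borel_measurable_times borel_measurable_power xm Zm)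
  have x2i: "integrable \<mu> (\<lambda>w. (x w)\<^sup>2 * Z w)"
  proof (rule integrableI_nonneg[OF x2m])
    show "AE w in \<mu>. 0 \<le> (x w)\<^sup>2 * Z w" using Z0 by (intro AE_I2) simp
    have "(\<integral>\<^sup>+w. ennreal ((x w)\<^sup>2 * Z w) \<partial>\<mu>) = (\<integral>\<^sup>+w. liminf (\<lambda>n. ennreal (f n w)) \<partial>\<mu>)"
      by (intro nn_integral_cong lim_imp_Liminf[symmetric] tendsto_ennrealI f_lim) simp
    also have "\<dots> \<le> liminf (\<lambda>n. \<integral>\<^sup>+w. ennreal (f n w) \<partial>\<mu>)"
      by (rule nn_integral_liminf) (intro measurable_compose[OF law_measurable[OF fm] measurable_ennreal])
    also have "\<dots> \<le> liminf (\<lambda>n. ennreal (m * B))"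
    proof (intro Liminf_mono always_eventually allI)
      fix n
      have "(\<integral>\<^sup>+w. ennreal (f n w) \<partial>\<mu>) = ennreal (\<integral>w. f n w \<partial>\<mu>)"
        using f_le by (intro nn_integral_eq_integral fi AE_I2) auto
      also have "\<dots> = ennreal (\<integral>w. g n w \<partial>\<mu>)" by (simp only: fg)
      also have "\<dots> \<le> ennreal (m * B)"
        using g_bd by (intro ennreal_leI integral_le_const gi AE_I2) auto
      finally show "(\<integral>\<^sup>+w. ennreal (f n w) \<partial>\<mu>) \<le> ennreal (m * B)" .
    qed
    also have "\<dots> = ennreal (m * B)" by (rule Liminf_const) simp
    finally show "(\<integral>\<^sup>+w. ennreal ((x w)\<^sup>2 * Z w) \<partial>\<mu>) < \<infinity>" by (auto simp: less_top[symmetric] top_unique)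
  qed
  then show "integrable \<mu> (\<lambda>w. (w (V w) - w (U w))\<^sup>2 * Z w)" by (simp add: x_def)
  have "(\<lambda>n. \<integral>w. f n w \<partial>\<mu>) \<longlonglongrightarrow> (\<integral>w. (x w)\<^sup>2 * Z w \<partial>\<mu>)"
  proof (rule integral_dominated_convergence[OF x2m law_measurable[OF fm] x2i])
    show "AE w in \<mu>. (\<lambda>n. f n w) \<longlonglongrightarrow> (x w)\<^sup>2 * Z w" by (intro AE_I2 f_lim)
    show "AE w in \<mu>. norm (f n w) \<le> (x w)\<^sup>2 * Z w" for n using f_le by (intro AE_I2) auto
  qed
  moreover have "(\<lambda>n. \<integral>w. g n w \<partial>\<mu>) \<longlonglongrightarrow> (\<integral>w. a w * Z w \<partial>\<mu>)"
  proof (rule integral_dominated_convergence[where w="\<lambda>_. m * B"])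
    show "AE w in \<mu>. (\<lambda>n. g n w) \<longlonglongrightarrow> a w * Z w" by (intro AE_I2 g_lim)
    show "AE w in \<mu>. norm (g n w) \<le> m * B" for n using g_bd by (intro AE_I2) auto
  qed (intro law_measurable borel_measurable_times amm Zm gm integrable_const)+
  ultimately show "(\<integral>w. (w (V w) - w (U w))\<^sup>2 * Z w \<partial>\<mu>) = (\<integral>w. (qv (V w) w - qv (U w) w) * Z w \<partial>\<mu>)"
    unfolding fg x_def a_def by (rule LIMSEQ_unique)
qed

text \<open>The quotients \<open>sin (h * x) / h\<close> tend to \<open>x\<close> and are dominated
  by its modulus, while \<open>sin_identity\<close> makes their weighted means vanish.\<close>

lemma first_moment:
  assumes xi: "integrable \<mu> (\<lambda>w. \<bar>w (V w) - w (U w)\<bar>)"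
  shows "(\<integral>w. (w (V w) - w (U w)) * Z w \<partial>\<mu>) = 0"
proof -
  define x where "x w = w (V w) - w (U w)" for w :: "real \<Rightarrow> real"
  define h where "h n = 1 / real (Suc n)" for n
  have h: "0 < h n" "h n \<noteq> 0" for n by (simp_all add: h_def)
  have h0: "h \<longlonglongrightarrow> 0" unfolding h_def by (rule inverse_Suc_tendsto)
  have xm: "x \<in> borel_measurable path_space" unfolding x_def[abs_def] by (rule x_measurable)
  have sinm: "(\<lambda>w. sin (h n * x w)) \<in> borel_measurable path_space" for n
    by (rule measurable_compose[OF xm borel_measurable_continuous_onI]) (intro continuous_intros)
  have "(\<lambda>n. \<integral>w. sin (h n * x w) / h n * Z w \<partial>\<mu>) \<longlonglongrightarrow> (\<integral>w. x w * Z w \<partial>\<mu>)"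
  proof (rule integral_dominated_convergence[where w="\<lambda>w. \<bar>x w\<bar> * B"])
    show "integrable \<mu> (\<lambda>w. \<bar>x w\<bar> * B)" using xi by (simp add: x_def)
    show "AE w in \<mu>. (\<lambda>n. sin (h n * x w) / h n * Z w) \<longlonglongrightarrow> x w * Z w"
    proof (intro AE_I2 tendsto_mult tendsto_const)
      fix w
      have "((\<lambda>y. sin (y * x w)) has_real_derivative x w) (at 0)" by (auto intro!: derivative_eq_intros)
      then show "(\<lambda>n. sin (h n * x w) / h n) \<longlonglongrightarrow> x w" by (rule derivative_along[OF _ _ h0 h(2)]) simp
    qed
    show "AE w in \<mu>. norm (sin (h n * x w) / h n * Z w) \<le> \<bar>x w\<bar> * B" for n
    proof (rule AE_I2)
      fix w assume "w \<in> space \<mu>"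
      then have w: "w \<in> W" by simp
      have "\<bar>sin (h n * x w)\<bar> \<le> \<bar>h n * x w\<bar>" by (rule abs_sin_x_le_abs_x)
      then have "\<bar>sin (h n * x w) / h n\<bar> \<le> \<bar>x w\<bar>" using h(1)[of n] by (simp add: abs_mult pos_divide_le_eq mult.commute)
      then show "norm (sin (h n * x w) / h n * Z w) \<le> \<bar>x w\<bar> * B"
        unfolding real_norm_def abs_mult[of "sin (h n * x w) / h n"] using ZB[OF w] by (intro mult_mono) auto
    qed
  qed (intro law_measurable borel_measurable_times borel_measurable_divide borel_measurable_const xm sinm Zm)+
  moreover have "(\<integral>w. sin (h n * x w) / h n * Z w \<partial>\<mu>) = 0" for n
  proof -
    have "(\<integral>w. sin (h n * x w) / h n * Z w \<partial>\<mu>) = (\<integral>w. 1 / h n * (sin (h n * x w) * Z w) \<partial>\<mu>)"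
      by (rule Bochner_Integration.integral_cong) auto
    also have "\<dots> = 1 / h n * (\<integral>w. sin (h n * x w) * Z w \<partial>\<mu>)" by (rule integral_mult_right_zero)
    also have "(\<integral>w. sin (h n * x w) * Z w \<partial>\<mu>) = 0" unfolding x_def by (rule sin_identity)
    finally show ?thesis by simp
  qed
  ultimately have "(\<lambda>n::nat. 0) \<longlonglongrightarrow> (\<integral>w. x w * Z w \<partial>\<mu>)" by (simp only:)
  then show ?thesis by (simp add: LIMSEQ_const_iff x_def)
qed

end


text \<open>Before \<open>tau m\<close>, the increment of the square is the squared increment of the
  path plus twice its product with the present value. The first has the mean of the increment of
  \<open>qv\<close> by \<open>second_moment\<close>, the second has mean zero by
  \<open>first_moment\<close>.\<close>

theorem qv_martingale:
  assumes m: "0 < m"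
  defines "Y \<equiv> \<lambda>r w. (w (cut r (tau m w)))\<^sup>2 - qv (cut r (tau m w)) w"
  shows "integrable \<mu> (Y t)"
    and "0 \<le> s \<Longrightarrow> s \<le> t \<Longrightarrow> past s D \<Longrightarrow> (\<integral>w. (Y t w - Y s w) * indicator D w \<partial>\<mu>) = 0"
proof -
  define V where "V r w = cut r (tau m w)" for r and w :: "real \<Rightarrow> real"
  have tm: "tau m \<in> borel_measurable path_space" using m by (intro tau_measurable) simp
  have Vm: "V r \<in> borel_measurable path_space" for r
    unfolding V_def[abs_def] by (intro cut_measurable tm borel_measurable_const)
  have V0: "0 \<le> V r w" for r w by (simp add: V_def)
  have Vinv: "V r (reflect (R n k) w) = V r w" if "w \<in> W" for r n k w using that by (simp add: V_def tau_reflect)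
  have qV: "qv (V r w) w \<le> m" if w: "w \<in> W" for r w
  proof (cases "0 \<le> r")
    case True
    then show ?thesis unfolding V_def by (intro qv_le_tau[OF w m]) (auto simp: ennreal_cut)
  next
    case False
    then have "V r w = 0" by (simp add: V_def cut_def ennreal_neg)
    then show ?thesis using m by (simp add: qv_0[OF w])
  qed
  have sq: "integrable \<mu> (\<lambda>w. (w (V r w))\<^sup>2)" for r
  proof -
    have "integrable \<mu> (\<lambda>w. (w (V r w) - w 0)\<^sup>2 * 1)"
      using V0 Vinv qV by (intro second_moment(1)[where V="V r" and U="\<lambda>_. 0" and Z="\<lambda>_. 1" and B=1 and m=m] Vm) auto
    moreover have "integrable \<mu> (\<lambda>w. (w (V r w) - w 0)\<^sup>2 * 1) \<longleftrightarrow> integrable \<mu> (\<lambda>w. (w (V r w))\<^sup>2)"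
      by (rule Bochner_Integration.integrable_cong) (auto simp: W_zero)
    ultimately show ?thesis by blast
  qed
  have qi: "integrable \<mu> (\<lambda>w. qv (V r w) w)" for r
    using qV V0 by (intro bounded_integrable[where B=m] qv_random_measurable Vm) (auto simp: qv_nonneg)
  show "integrable \<mu> (Y t)" unfolding Y_def V_def[symmetric] by (intro Bochner_Integration.integrable_diff sq qi)
  assume st: "0 \<le> s" "s \<le> t" and D: "past s D"
  have Dm: "D \<in> sets path_space" using D by (simp add: past_def)
  have UV: "V s w \<le> V t w" for w unfolding V_def by (rule cut_mono[OF st(2)])
  \<comment> \<open>On the event kept here \<open>V s\<close> is the fixed time \<open>s\<close>, so
    reflections after it do not affect membership in \<open>D\<close>; on the complement the stopped
    increment vanishes.\<close>
  define Z where "Z w = indicator D w * (if ennreal s < tau m w then 1 else 0 :: real)" for w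
  have Zm: "Z \<in> borel_measurable path_space"
    unfolding Z_def[abs_def]
    by (intro borel_measurable_times borel_measurable_indicator Dm measurable_If borel_measurable_const borel_measurable_less tm)
  have Z01: "0 \<le> Z w" "\<bar>Z w\<bar> \<le> 1" for w by (auto simp: Z_def indicator_def)
  have Zinv: "Z (reflect (R n k) w) = Z w" if w: "w \<in> W" and U: "ennreal (V s w) \<le> R n k w" for n k w
  proof (cases "ennreal s < tau m w")
    case True
    then have "V s w = s" using st by (simp add: V_def cut_eq)
    then have "reflect (R n k) w \<in> D \<longleftrightarrow> w \<in> D" using U by (intro past_reflect[OF D w]) simp
    then show ?thesis by (simp add: Z_def tau_reflect[OF w] indicator_def)
  qed (simp add: Z_def tau_reflect[OF w])
  define x where "x w = w (V t w) - w (V s w)" for w :: "real \<Rightarrow> real"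
  define u where "u w = w (V s w)" for w :: "real \<Rightarrow> real"
  have xm: "x \<in> borel_measurable path_space" and um: "u \<in> borel_measurable path_space"
    unfolding x_def[abs_def] u_def[abs_def] by (intro borel_measurable_diff eval_self_measurable Vm)+
  have x2: "integrable \<mu> (\<lambda>w. (x w)\<^sup>2)"
    using second_moment(1)[where V="V t" and U="V s" and Z="\<lambda>_. 1" and B=1 and m=m, OF Vm Vm _ V0 UV Vinv Vinv]
      qV by (simp add: x_def)
  have u2: "integrable \<mu> (\<lambda>w. (u w)\<^sup>2)" unfolding u_def by (rule sq)
  have x1: "integrable \<mu> (\<lambda>w. \<bar>x w\<bar>)"
  proof (rule Bochner_Integration.integrable_bound)
    show "integrable \<mu> (\<lambda>w. 1 + (x w)\<^sup>2)" by (intro Bochner_Integration.integrable_add integrable_const x2)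
    have "\<bar>y\<bar> \<le> 1 + y\<^sup>2" for y :: real
    proof -
      have "0 \<le> (\<bar>y\<bar> - 1/2)\<^sup>2" by simp
      then show ?thesis by (simp add: power2_diff) (simp add: power2_eq_square)
    qed
    then show "AE w in \<mu>. norm \<bar>x w\<bar> \<le> norm (1 + (x w)\<^sup>2)" by (intro AE_I2) simp
  qed (intro law_measurable borel_measurable_abs xm)
  have ab: "\<bar>a * b\<bar> \<le> a\<^sup>2 + b\<^sup>2" for a b :: real
  proof -
    have "2 * (\<bar>a\<bar> * \<bar>b\<bar>) \<le> a\<^sup>2 + b\<^sup>2" using sum_squares_bound[of "\<bar>a\<bar>" "\<bar>b\<bar>"] by (simp add: mult.assoc)
    moreover have "0 \<le> \<bar>a\<bar> * \<bar>b\<bar>" by simp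
    ultimately show ?thesis unfolding abs_mult by linarith
  qed
  have xu: "integrable \<mu> (\<lambda>w. \<bar>x w * u w\<bar>)"
  proof (rule Bochner_Integration.integrable_bound)
    show "integrable \<mu> (\<lambda>w. (x w)\<^sup>2 + (u w)\<^sup>2)" by (intro Bochner_Integration.integrable_add x2 u2)
    show "AE w in \<mu>. norm \<bar>x w * u w\<bar> \<le> norm ((x w)\<^sup>2 + (u w)\<^sup>2)" using ab by (intro AE_I2) simp
  qed (intro law_measurable borel_measurable_abs borel_measurable_times xm um)
  have m2i: "integrable \<mu> (\<lambda>w. (x w)\<^sup>2 * Z w)"
    and m2: "(\<integral>w. (x w)\<^sup>2 * Z w \<partial>\<mu>) = (\<integral>w. (qv (V t w) w - qv (V s w) w) * Z w \<partial>\<mu>)"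
    unfolding x_def using Zm V0 UV Vinv Z01 Zinv qV
    by (intro second_moment[where V="V t" and U="V s" and Z=Z and B=1 and m=m] Vm; simp)+
  \<comment> \<open>The present value is unbounded, but weights in \<open>first_moment\<close> must
    be bounded; truncate at \<open>j\<close> and let \<open>j\<close> grow.\<close>
  define c where "c j y = max (- real j) (min (real j) y)" for j :: nat and y
  have cm: "(\<lambda>w. c j (u w)) \<in> borel_measurable path_space" for j
    unfolding c_def by (intro borel_measurable_max borel_measurable_min borel_measurable_const um)
  have cz: "(\<integral>w. x w * (c j (u w) * Z w) \<partial>\<mu>) = 0" for j
    unfolding x_def
  proof (rule first_moment[where B="real j"])
    show "integrable \<mu> (\<lambda>w. \<bar>w (V t w) - w (V s w)\<bar>)" using x1 by (simp add: x_def)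
    fix w assume w: "w \<in> W"
    have "\<bar>c j (u w)\<bar> * \<bar>Z w\<bar> \<le> real j * 1" using Z01 by (intro mult_mono) (auto simp: c_def)
    then show "\<bar>c j (u w) * Z w\<bar> \<le> real j" by (simp add: abs_mult)
    fix n k assume U: "ennreal (V s w) \<le> R n k w"
    have "u (reflect (R n k) w) = u w"
      unfolding u_def Vinv[OF w] by (rule reflect_before[where T="R n k" and w=w, OF V0 U])
    then show "c j (u (reflect (R n k) w)) * Z (reflect (R n k) w) = c j (u w) * Z w"
      using Zinv[OF w U] by simp
  qed (use V0 UV Vinv in \<open>auto intro!: Vm borel_measurable_times cm Zm\<close>)
  have "(\<lambda>j. \<integral>w. x w * (c j (u w) * Z w) \<partial>\<mu>) \<longlonglongrightarrow> (\<integral>w. x w * (u w * Z w) \<partial>\<mu>)"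
  proof (rule integral_dominated_convergence[where w="\<lambda>w. \<bar>x w * u w\<bar>"])
    show "AE w in \<mu>. (\<lambda>j. x w * (c j (u w) * Z w)) \<longlonglongrightarrow> x w * (u w * Z w)"
    proof (intro AE_I2 tendsto_mult tendsto_const)
      fix w
      obtain j0 :: nat where "\<bar>u w\<bar> \<le> real j0" using real_arch_simple by blast
      then have "c j (u w) = u w" if "j \<ge> j0" for j using that by (auto simp: c_def)
      then show "(\<lambda>j. c j (u w)) \<longlonglongrightarrow> u w"
        by (intro tendsto_eventually) (auto simp: eventually_sequentially)
    qed
    show "AE w in \<mu>. norm (x w * (c j (u w) * Z w)) \<le> \<bar>x w * u w\<bar>" for j
    proof (rule AE_I2)
      fix w
      have "\<bar>c j (u w)\<bar> * \<bar>Z w\<bar> \<le> \<bar>u w\<bar> * 1" using Z01 by (intro mult_mono) (auto simp: c_def)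
      then have "\<bar>x w\<bar> * (\<bar>c j (u w)\<bar> * \<bar>Z w\<bar>) \<le> \<bar>x w\<bar> * (\<bar>u w\<bar> * 1)" by (rule mult_left_mono) simp
      then show "norm (x w * (c j (u w) * Z w)) \<le> \<bar>x w * u w\<bar>" by (simp add: abs_mult)
    qed
  qed (intro law_measurable borel_measurable_times xm um cm Zm xu)+
  then have "(\<lambda>j::nat. 0) \<longlonglongrightarrow> (\<integral>w. x w * (u w * Z w) \<partial>\<mu>)" by (simp only: cz)
  then have cross: "(\<integral>w. x w * (u w * Z w) \<partial>\<mu>) = 0" by (simp add: LIMSEQ_const_iff)
  have ci: "integrable \<mu> (\<lambda>w. x w * (u w * Z w))"
  proof (rule Bochner_Integration.integrable_bound[OF xu])
    have "\<bar>x w\<bar> * (\<bar>u w\<bar> * \<bar>Z w\<bar>) \<le> \<bar>x w\<bar> * (\<bar>u w\<bar> * 1)" for w using Z01 by (intro mult_left_mono) auto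
    then show "AE w in \<mu>. norm (x w * (u w * Z w)) \<le> norm \<bar>x w * u w\<bar>" by (intro AE_I2) (simp add: abs_mult)
  qed (intro law_measurable borel_measurable_times xm um Zm)
  have ai: "integrable \<mu> (\<lambda>w. (qv (V t w) w - qv (V s w) w) * Z w)"
  proof (rule bounded_integrable[where B=m])
    show "(\<lambda>w. (qv (V t w) w - qv (V s w) w) * Z w) \<in> borel_measurable path_space"
      by (intro borel_measurable_times borel_measurable_diff qv_random_measurable Vm Zm V0)
    fix w assume w: "w \<in> W"
    have "0 \<le> qv (V t w) w - qv (V s w) w" using qv_mono[OF w V0 UV] by simp
    moreover have "qv (V t w) w - qv (V s w) w \<le> m" using qV[OF w, of t] qv_nonneg[OF w V0[of s w]] by simp
    ultimately have "\<bar>qv (V t w) w - qv (V s w) w\<bar> * \<bar>Z w\<bar> \<le> m * 1" using Z01(2)[of w] by (intro mult_mono) auto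
    then show "norm ((qv (V t w) w - qv (V s w) w) * Z w) \<le> m" by (simp add: abs_mult)
  qed
  have "(\<integral>w. (Y t w - Y s w) * indicator D w \<partial>\<mu>)
    = (\<integral>w. (x w)\<^sup>2 * Z w + (2 * (x w * (u w * Z w)) - (qv (V t w) w - qv (V s w) w) * Z w) \<partial>\<mu>)"
  proof (rule Bochner_Integration.integral_cong[OF refl])
    fix w
    show "(Y t w - Y s w) * indicator D w = (x w)\<^sup>2 * Z w + (2 * (x w * (u w * Z w)) - (qv (V t w) w - qv (V s w) w) * Z w)"
    proof (cases "ennreal s < tau m w")
      case True
      then show ?thesis unfolding Y_def V_def[symmetric] x_def u_def
        by (simp add: Z_def power2_eq_square algebra_simps)
    next
      case False
      then have le: "tau m w \<le> ennreal s" by simp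
      then have "tau m w \<le> ennreal t" using ennreal_leI[OF st(2)] by (rule order_trans)
      then have "Y t w = Y s w" using le by (simp add: Y_def cut_eq2)
      then show ?thesis using False by (simp add: Z_def)
    qed
  qed
  also have "\<dots> = (\<integral>w. (x w)\<^sup>2 * Z w \<partial>\<mu>) + (2 * (\<integral>w. x w * (u w * Z w) \<partial>\<mu>) - (\<integral>w. (qv (V t w) w - qv (V s w) w) * Z w \<partial>\<mu>))"
    using m2i ci ai by (simp only: Bochner_Integration.integral_add Bochner_Integration.integral_diff Bochner_Integration.integrable_diff integrable_mult_right integral_mult_right_zero)
  also have "\<dots> = 0" by (simp add: m2 cross)
  finally show "(\<integral>w. (Y t w - Y s w) * indicator D w \<partial>\<mu>) = 0" .
qed

text \<open>The bounded sine stands in for the increment, whose integrability under the original law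
  is unknown. Weighting by a function of the quadratic variation makes the statement pass to the
  conditional laws.\<close>

lemma sin_increment:
  assumes st: "0 \<le> s" "s \<le> t" and D: "past s D" and B: "B \<in> sets path_space"
  shows "(\<integral>w. sin (\<theta> * (w t - w s)) * (indicator D w * indicator B (QV w)) \<partial>\<mu>) = 0"
proof (rule sin_identity[where V="\<lambda>_. t" and U="\<lambda>_. s" and B=1])
  show "(\<lambda>w. indicator D w * indicator B (QV w) :: real) \<in> borel_measurable path_space"
    using D by (intro borel_measurable_times borel_measurable_indicator measurable_compose[OF QV_measurable borel_measurable_indicator[OF B]])
      (simp add: past_def)
  fix n k w assume w: "w \<in> W" and "ennreal s \<le> R n k w"
  then show "indicator D (reflect (R n k) w) * indicator B (QV (reflect (R n k) w)) = (indicator D w * indicator B (QV w) :: real)"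
    using past_reflect[OF D w] by (simp add: QV_reflect indicator_def)
qed (use st in \<open>auto simp: indicator_def\<close>)

end

section \<open>Regular conditional distributions on the path space\<close>

text \<open>Conditional probabilities of \<open>Y \<le> q\<close> for rational \<open>q\<close>
  satisfy the rules of a distribution function outside one null set. Their right-continuous
  regularization defines the measure. The bounds on \<open>Y\<close> settle the behaviour at both
  infinities.\<close>

lemma (in prob_space) exists_conditional_distribution_bounded:
  fixes Y :: "'a \<Rightarrow> real"
  assumes sub: "subalgebra M G" and Y [measurable]: "Y \<in> borel_measurable M"
    and Yb: "\<And>\<omega>. \<omega> \<in> space M \<Longrightarrow> 0 \<le> Y \<omega>" "\<And>\<omega>. \<omega> \<in> space M \<Longrightarrow> Y \<omega> \<le> 2"
  obtains K where "K \<in> G \<rightarrow>\<^sub>M prob_algebra borel"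
    "\<And>A C. A \<in> sets borel \<Longrightarrow> C \<in> sets G \<Longrightarrow>
      emeasure M {\<omega>\<in>C. Y \<omega> \<in> A} = (\<integral>\<^sup>+\<omega>\<in>C. emeasure (K \<omega>) A \<partial>M)"
proof -
  interpret G: finite_measure_subalgebra M G by unfold_locales (rule sub)
  have spG: "space G = space M" and setsG: "sets G \<subseteq> sets M" using sub by (auto simp: subalgebra_def)
  let ?I = "\<lambda>q \<omega>. indicator {\<omega>\<in>space M. Y \<omega> \<le> real_of_rat q} \<omega> :: real"
  define F where "F q = real_cond_exp M G (?I q)" for q
  have I_set: "{\<omega>\<in>space M. Y \<omega> \<le> real_of_rat q} \<in> sets M" for q by measurable
  have Ii: "integrable M (?I q)" for q
    using I_set by (intro integrable_const_bound[where B=1]) (auto simp: indicator_def)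
  have Fm: "F q \<in> borel_measurable G" for q unfolding F_def by simp
  have FmM: "F q \<in> borel_measurable M" for q by (rule measurable_from_subalg[OF sub Fm])
  have Fint: "(\<integral>\<omega>\<in>C. F q \<omega> \<partial>M) = measure M {\<omega>\<in>C. Y \<omega> \<le> real_of_rat q}" if "C \<in> sets G" for q C
  proof -
    have CM: "C \<in> sets M" using that setsG by auto
    then have "C \<inter> {\<omega>\<in>space M. Y \<omega> \<le> real_of_rat q} = {\<omega>\<in>C. Y \<omega> \<le> real_of_rat q}"
      using sets.sets_into_space by blast
    then show ?thesis
      using G.real_cond_exp_intA[OF Ii that, of q, symmetric] CM I_set[of q]
      by (simp add: F_def set_lebesgue_integral_def indicator_inter_arith[symmetric] sets.Int)
  qed
  define N where "N \<omega> \<longleftrightarrow> (\<forall>q q'. q \<le> q' \<longrightarrow> F q \<omega> \<le> F q' \<omega>) \<and> (\<forall>q. 0 \<le> F q \<omega>) \<and> (\<forall>q. F q \<omega> \<le> 1)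
    \<and> (\<forall>q. q < 0 \<longrightarrow> F q \<omega> = 0) \<and> (\<forall>q. 2 \<le> q \<longrightarrow> F q \<omega> = 1)" for \<omega>
  have Nm: "Measurable.pred G N"
    unfolding N_def[abs_def] using Fm by measurable
  have const: "AE \<omega> in M. real_cond_exp M G (\<lambda>_. c) \<omega> = c" for c :: real
    by (rule G.real_cond_exp_F_meas) simp_all
  have AEN: "AE \<omega> in M. N \<omega>"
  proof -
    have mono: "AE \<omega> in M. F q \<omega> \<le> F q' \<omega>" if "q \<le> q'" for q q'
    proof -
      have "real_of_rat q \<le> real_of_rat q'" using that by (simp add: of_rat_less_eq)
      then have "?I q \<omega> \<le> ?I q' \<omega>" for \<omega> by (auto simp: indicator_def)
      then show ?thesis unfolding F_def by (intro G.real_cond_exp_mono Ii AE_I2)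
    qed
    have ge0: "AE \<omega> in M. 0 \<le> F q \<omega>" for q
      unfolding F_def by (rule G.real_cond_exp_pos) (use I_set in auto)
    have le1: "AE \<omega> in M. F q \<omega> \<le> 1" for q
    proof -
      have "AE \<omega> in M. F q \<omega> \<le> real_cond_exp M G (\<lambda>_. 1) \<omega>"
        unfolding F_def by (intro G.real_cond_exp_mono Ii AE_I2) (auto simp: indicator_def)
      then show ?thesis using const[of 1] by eventually_elim simp
    qed
    have z: "AE \<omega> in M. F q \<omega> = 0" if "q < 0" for q
    proof -
      have "real_of_rat q < 0" using that by simp
      then have "\<not> Y \<omega> \<le> real_of_rat q" if "\<omega> \<in> space M" for \<omega> using Yb(1)[OF that] by linarith
      then have "AE \<omega> in M. ?I q \<omega> = 0" by (intro AE_I2) simp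
      then have "AE \<omega> in M. F q \<omega> = real_cond_exp M G (\<lambda>_. 0) \<omega>"
        unfolding F_def using I_set by (intro G.real_cond_exp_cong) auto
      then show ?thesis using const[of 0] by eventually_elim simp
    qed
    have o: "AE \<omega> in M. F q \<omega> = 1" if "2 \<le> q" for q
    proof -
      have "2 \<le> real_of_rat q" using that by (metis of_rat_less_eq of_rat_numeral_eq)
      then have "Y \<omega> \<le> real_of_rat q" if "\<omega> \<in> space M" for \<omega> using Yb(2)[OF that] by linarith
      then have "AE \<omega> in M. ?I q \<omega> = 1" by (intro AE_I2) simp
      then have "AE \<omega> in M. F q \<omega> = real_cond_exp M G (\<lambda>_. 1) \<omega>"
        unfolding F_def using I_set by (intro G.real_cond_exp_cong) auto
      then show ?thesis using const[of 1] by eventually_elim simp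
    qed
    show ?thesis unfolding N_def
      by (intro AE_conjI AE_all_countable[THEN iffD2] allI AE_impI mono ge0 le1 z o)
  qed
  \<comment> \<open>On the exceptional set the distribution function of the unit mass at
    \<open>0\<close> is used, so that every value of the kernel is a probability measure.\<close>
  define H where "H \<omega> x = (if N \<omega> then INF q\<in>{q. x < real_of_rat q}. F q \<omega> else if 0 \<le> x then 1 else 0)" for \<omega> x
  have ne: "{q. x < real_of_rat q} \<noteq> {}" for x :: real
    using of_rat_dense[of x "x + 1"] by auto
  have bdd: "bdd_below ((\<lambda>q. F q \<omega>) ` {q. x < real_of_rat q})" if "N \<omega>" for \<omega> x
    using that by (intro bdd_belowI[of _ 0]) (auto simp: N_def)
  have H_le: "H \<omega> x \<le> F q \<omega>" if "N \<omega>" "x < real_of_rat q" for \<omega> x q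
    using that by (auto simp: H_def intro!: cINF_lower bdd)
  have H_ge: "c \<le> H \<omega> x" if "N \<omega>" "\<And>q. x < real_of_rat q \<Longrightarrow> c \<le> F q \<omega>" for \<omega> x c
    using that ne by (auto simp: H_def intro!: cINF_greatest)
  have H_mono: "H \<omega> x \<le> H \<omega> y" if xy: "x \<le> y" for \<omega> x y
  proof (cases "N \<omega>")
    case True
    then show ?thesis using xy by (intro H_ge H_le) auto
  qed (use xy in \<open>auto simp: H_def\<close>)
  have H_neg: "H \<omega> x = 0" if x: "x < 0" for \<omega> x
  proof (cases "N \<omega>")
    case True
    obtain q where q: "x < real_of_rat q" "real_of_rat q < 0" using of_rat_dense[OF x] by auto
    then have "F q \<omega> = 0" using True by (simp add: N_def)
    then have "H \<omega> x \<le> 0" using H_le[OF True q(1)] by simp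
    moreover have "0 \<le> H \<omega> x" using True by (intro H_ge) (auto simp: N_def)
    ultimately show ?thesis by simp
  qed (use that in \<open>auto simp: H_def\<close>)
  have H_big: "H \<omega> x = 1" if "2 \<le> x" for \<omega> x
  proof (cases "N \<omega>")
    case True
    have "F q \<omega> = 1" if "x < real_of_rat q" for q
    proof -
      have "real_of_rat 2 \<le> real_of_rat q" using that \<open>2 \<le> x\<close> by simp
      then have "2 \<le> q" by (metis of_rat_less_eq)
      then show ?thesis using True by (simp add: N_def)
    qed
    then have "(\<lambda>q. F q \<omega>) ` {q. x < real_of_rat q} = {1}" using ne[of x] by auto
    then show ?thesis using True by (simp add: H_def)
  qed (use that in \<open>auto simp: H_def\<close>)
  have H_right: "continuous (at_right a) (H \<omega>)" for \<omega> a
  proof (cases "N \<omega>")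
    case True
    show ?thesis
      unfolding continuous_within
    proof (rule order_tendstoI)
      fix y assume "y < H \<omega> a"
      then show "\<forall>\<^sub>F x in at_right a. y < H \<omega> x"
        unfolding eventually_at_right_field using H_mono by (intro exI[of _ "a + 1"]) (auto intro: less_le_trans)
    next
      fix y assume y: "H \<omega> a < y"
      obtain q where q: "a < real_of_rat q" "F q \<omega> < y"
        using y True cINF_less_iff[OF ne bdd[OF True]] by (auto simp: H_def)
      show "\<forall>\<^sub>F x in at_right a. H \<omega> x < y"
        unfolding eventually_at_right_field
        using q H_le[OF True] by (intro exI[of _ "real_of_rat q"]) (auto intro: le_less_trans)
    qed
  next
    case False
    have "\<forall>\<^sub>F x in at_right a. H \<omega> x = H \<omega> a"
      unfolding eventually_at_right_field using False
      by (cases "0 \<le> a") (auto simp: H_def intro: exI[of _ "a + 1"] exI[of _ 0])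
    then show ?thesis unfolding continuous_within by (rule tendsto_eventually)
  qed
  have H_bot: "(H \<omega> \<longlongrightarrow> 0) at_bot" for \<omega>
    by (rule tendsto_eventually) (auto simp: eventually_at_bot_dense intro!: exI[of _ 0] H_neg)
  have H_top: "(H \<omega> \<longlongrightarrow> 1) at_top" for \<omega>
    by (rule tendsto_eventually) (auto simp: eventually_at_top_linorder intro!: exI[of _ 2] H_big)
  define K where "K \<omega> = interval_measure (H \<omega>)" for \<omega>
  have Kd: "real_distribution (K \<omega>)" for \<omega>
    unfolding K_def by (rule real_distribution_interval_measure[OF H_mono H_right H_bot H_top])
  have Kprob: "prob_space (K \<omega>)" for \<omega> using Kd real_distribution.axioms(1) by blast
  have Kat: "emeasure (K \<omega>) {..x} = ennreal (H \<omega> x)" for \<omega> x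
  proof -
    interpret K: real_distribution "K \<omega>" by (rule Kd)
    have "cdf (K \<omega>) x = H \<omega> x"
      unfolding K_def by (simp add: cdf_interval_measure[OF H_mono H_right H_bot])
    then show ?thesis by (simp add: K.emeasure_eq_measure cdf_def)
  qed
  have Hm: "(\<lambda>\<omega>. H \<omega> x) \<in> borel_measurable G" for x
  proof -
    \<comment> \<open>Clipping to the unit interval bounds the infimum also where \<open>N\<close>
      fails, as measurability of an infimum of reals requires; where \<open>N\<close> holds it
      changes nothing.\<close>
    have "(\<lambda>\<omega>. INF q\<in>{q. x < real_of_rat q}. max 0 (min 1 (F q \<omega>))) \<in> borel_measurable G"
      using Fm by (intro borel_measurable_cINF countableI_type) (auto intro!: borel_measurable_max borel_measurable_min bdd_belowI[of _ 0])
    then have "(\<lambda>\<omega>. if N \<omega> then INF q\<in>{q. x < real_of_rat q}. max 0 (min 1 (F q \<omega>)) else if 0 \<le> x then 1 else 0) \<in> borel_measurable G"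
      using Nm by (intro measurable_If) (auto simp: pred_def)
    also have "(\<lambda>\<omega>. if N \<omega> then INF q\<in>{q. x < real_of_rat q}. max 0 (min 1 (F q \<omega>)) else if 0 \<le> x then 1 else 0) = (\<lambda>\<omega>. H \<omega> x)"
    proof
      fix \<omega>
      show "(if N \<omega> then INF q\<in>{q. x < real_of_rat q}. max 0 (min 1 (F q \<omega>)) else if 0 \<le> x then 1 else 0) = H \<omega> x"
      proof (cases "N \<omega>")
        case True
        then have "max 0 (min 1 (F q \<omega>)) = F q \<omega>" for q by (simp add: N_def)
        then show ?thesis using True by (simp add: H_def)
      qed (simp add: H_def)
    qed
    finally show ?thesis .
  qed
  have bor: "sets borel = sigma_sets UNIV (range (\<lambda>a::real. {..a}))"
    by (subst borel_eq_atMost) (simp add: sets_measure_of_conv)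
  have stab: "Int_stable (range (\<lambda>a::real. {..a}))"
  proof (rule Int_stableI)
    fix a b :: "real set" assume "a \<in> range (\<lambda>a. {..a})" "b \<in> range (\<lambda>a. {..a})"
    then obtain x y where "a = {..x}" "b = {..y}" by auto
    then have "a \<inter> b = {..min x y}" by auto
    then show "a \<inter> b \<in> range (\<lambda>a. {..a})" by (rule range_eqI)
  qed
  have Km: "K \<in> G \<rightarrow>\<^sub>M prob_algebra borel"
  proof (rule measurable_prob_algebra_generated[OF bor stab])
    show "sets (K a) = sets borel" for a by (simp add: K_def)
    show "(\<lambda>a. emeasure (K a) A) \<in> borel_measurable G" if "A \<in> range (\<lambda>a::real. {..a})" for A
      using that Hm by (auto simp: Kat intro!: measurable_compose[OF Hm measurable_ennreal])
  qed (auto simp: Kprob)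
  have Km': "(\<lambda>\<omega>. emeasure (K \<omega>) A) \<in> borel_measurable M" if "A \<in> sets borel" for A
    by (rule measurable_from_subalg[OF sub])
      (rule measurable_compose[OF measurable_prob_algebraD[OF Km] measurable_emeasure_subprob_algebra[OF that]])
  have main: "emeasure M {\<omega>\<in>C. Y \<omega> \<in> A} = (\<integral>\<^sup>+\<omega>\<in>C. emeasure (K \<omega>) A \<partial>M)"
    if A: "A \<in> sets borel" and C: "C \<in> sets G" for A C
  proof -
    have CM: "C \<in> sets M" using C setsG by auto
    have CYm: "{\<omega>\<in>C. Y \<omega> \<in> A} \<in> sets M" if "A \<in> sets borel" for A
    proof -
      have "{\<omega>\<in>C. Y \<omega> \<in> A} = C \<inter> (Y -` A \<inter> space M)" using sets.sets_into_space[OF CM] by auto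
      then show ?thesis using CM measurable_sets[OF Y that] by simp
    qed
    have nnm: "(\<lambda>\<omega>. emeasure (K \<omega>) A * indicator C \<omega>) \<in> borel_measurable M" if "A \<in> sets borel" for A
      using Km'[OF that] CM by simp
    have "A \<in> sigma_sets UNIV (range (\<lambda>a::real. {..a}))" using A bor by simp
    with stab subset_UNIV[of "range (\<lambda>a::real. {..a})", folded Pow_UNIV] show ?thesis
    proof (induction rule: sigma_sets_induct_disjoint)
      case (basic A)
      then obtain x where x: "A = {..x}" by auto
      \<comment> \<open>Rationals strictly decreasing bounds towards \<open>x\<close> from above:
        along them both the conditional values and the events converge to those at
        \<open>x\<close>.\<close>
      define q where "q n = (SOME q. x < real_of_rat q \<and> real_of_rat q < x + 1 / real (Suc n))" for n
      have q: "x < real_of_rat (q n)" "real_of_rat (q n) < x + 1 / real (Suc n)" for n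
        using someI_ex[of "\<lambda>q. x < real_of_rat q \<and> real_of_rat q < x + 1 / real (Suc n)"] of_rat_dense[of x "x + 1 / real (Suc n)"]
        by (auto simp: q_def)
      have qx: "(\<lambda>n. real_of_rat (q n)) \<longlonglongrightarrow> x"
      proof (rule tendsto_sandwich)
        show "\<forall>\<^sub>F n in sequentially. x \<le> real_of_rat (q n)" by (intro always_eventually allI less_imp_le q(1))
        show "\<forall>\<^sub>F n in sequentially. real_of_rat (q n) \<le> x + 1 / real (Suc n)" by (intro always_eventually allI less_imp_le q(2))
        have "(\<lambda>n. x + 1 / real (Suc n)) \<longlonglongrightarrow> x + 0"
          by (rule tendsto_add[OF tendsto_const inverse_Suc_tendsto])
        then show "(\<lambda>n. x + 1 / real (Suc n)) \<longlonglongrightarrow> x" by simp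
      qed (rule tendsto_const)
      have l1: "(\<lambda>n. \<integral>\<omega>\<in>C. F (q n) \<omega> \<partial>M) \<longlonglongrightarrow> (\<integral>\<omega>\<in>C. H \<omega> x \<partial>M)"
        unfolding set_lebesgue_integral_def
      proof (rule integral_dominated_convergence[where w="\<lambda>_. 1"])
        show "AE \<omega> in M. (\<lambda>n. indicat_real C \<omega> *\<^sub>R F (q n) \<omega>) \<longlonglongrightarrow> indicat_real C \<omega> *\<^sub>R H \<omega> x"
          using AEN
        proof eventually_elim
          case (elim \<omega>)
          have "(\<lambda>n. F (q n) \<omega>) \<longlonglongrightarrow> H \<omega> x"
          proof (rule order_tendstoI)
            fix y assume "y < H \<omega> x"
            then show "\<forall>\<^sub>F n in sequentially. y < F (q n) \<omega>"
              using H_le[OF elim q(1)] by (auto intro!: always_eventually intro: less_le_trans)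
          next
            fix y assume y: "H \<omega> x < y"
            obtain r where r: "x < real_of_rat r" "F r \<omega> < y"
              using y elim cINF_less_iff[OF ne bdd[OF elim]] by (auto simp: H_def)
            have "\<forall>\<^sub>F n in sequentially. real_of_rat (q n) < real_of_rat r" using order_tendstoD(2)[OF qx r(1)] .
            then show "\<forall>\<^sub>F n in sequentially. F (q n) \<omega> < y"
            proof eventually_elim
              case (elim n)
              then have "F (q n) \<omega> \<le> F r \<omega>" using \<open>N \<omega>\<close> by (simp add: N_def of_rat_less)
              then show ?case using r(2) by simp
            qed
          qed
          then show ?case by (intro tendsto_intros)
        qed
        show "AE \<omega> in M. norm (indicat_real C \<omega> *\<^sub>R F (q n) \<omega>) \<le> 1" for n
          using AEN by eventually_elim (auto simp: N_def indicator_def)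
        show "(\<lambda>\<omega>. indicat_real C \<omega> *\<^sub>R H \<omega> x) \<in> borel_measurable M"
          using measurable_from_subalg[OF sub Hm] CM by simp
        show "(\<lambda>\<omega>. indicat_real C \<omega> *\<^sub>R F (q n) \<omega>) \<in> borel_measurable M" for n
          using FmM CM by simp
      qed simp
      have l2: "(\<lambda>n. measure M {\<omega>\<in>C. Y \<omega> \<le> real_of_rat (q n)}) \<longlonglongrightarrow> measure M {\<omega>\<in>C. Y \<omega> \<le> x}"
      proof -
        have "(\<lambda>n. \<integral>\<omega>. indicator {\<omega>\<in>C. Y \<omega> \<le> real_of_rat (q n)} \<omega> \<partial>M) \<longlonglongrightarrow> (\<integral>\<omega>. indicator {\<omega>\<in>C. Y \<omega> \<le> x} \<omega> \<partial>M :: real)"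
        proof (rule integral_dominated_convergence[where w="\<lambda>_. 1"])
          show "AE \<omega> in M. (\<lambda>n. indicat_real {\<omega>\<in>C. Y \<omega> \<le> real_of_rat (q n)} \<omega>) \<longlonglongrightarrow> indicat_real {\<omega>\<in>C. Y \<omega> \<le> x} \<omega>"
          proof (rule AE_I2, rule tendsto_eventually)
            fix \<omega>
            show "\<forall>\<^sub>F n in sequentially. indicat_real {\<omega>\<in>C. Y \<omega> \<le> real_of_rat (q n)} \<omega> = indicat_real {\<omega>\<in>C. Y \<omega> \<le> x} \<omega>"
            proof (cases "Y \<omega> \<le> x")
              case True
              then have "Y \<omega> \<le> real_of_rat (q n)" for n using q(1)[of n] by linarith
              then show ?thesis using True by (simp add: indicator_def)
            next
              case False
              then have "\<forall>\<^sub>F n in sequentially. real_of_rat (q n) < Y \<omega>" using order_tendstoD(2)[OF qx, of "Y \<omega>"] by simp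
              then show ?thesis by eventually_elim (use False in \<open>auto simp: indicator_def\<close>)
            qed
          qed
          show "indicat_real {\<omega>\<in>C. Y \<omega> \<le> x} \<in> borel_measurable M" using CYm[of "{..x}"] by simp
          show "indicat_real {\<omega>\<in>C. Y \<omega> \<le> real_of_rat (q n)} \<in> borel_measurable M" for n using CYm[of "{..real_of_rat (q n)}"] by simp
        qed (auto simp: indicator_def)
        moreover have "{\<omega>\<in>C. Y \<omega> \<le> y} \<inter> space M = {\<omega>\<in>C. Y \<omega> \<le> y}" for y using sets.sets_into_space[OF CM] by auto
        ultimately show ?thesis by simp
      qed
      have eq: "measure M {\<omega>\<in>C. Y \<omega> \<le> x} = (\<integral>\<omega>\<in>C. H \<omega> x \<partial>M)"
        using l1 l2 unfolding Fint[OF C] by (rule LIMSEQ_unique[rotated])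
      have Hb: "0 \<le> H \<omega> x" "H \<omega> x \<le> 1" for \<omega>
        using H_mono[of "min x (-1)" x \<omega>] H_neg[of "min x (-1)" \<omega>] H_mono[of x "max x 2" \<omega>] H_big[of "max x 2" \<omega>] by auto
      have "(\<integral>\<^sup>+\<omega>\<in>C. emeasure (K \<omega>) A \<partial>M) = (\<integral>\<^sup>+\<omega>. ennreal (indicator C \<omega> * H \<omega> x) \<partial>M)"
        unfolding x Kat by (intro nn_integral_cong) (auto simp: indicator_def)
      also have "\<dots> = ennreal (\<integral>\<omega>. indicator C \<omega> * H \<omega> x \<partial>M)"
      proof (intro nn_integral_eq_integral AE_I2)
        show "integrable M (\<lambda>\<omega>. indicator C \<omega> * H \<omega> x)"
          using Hb CM measurable_from_subalg[OF sub Hm[of x]]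
          by (intro integrable_const_bound[where B=1]) (auto simp: indicator_def)
      qed (auto simp: Hb)
      also have "\<dots> = emeasure M {\<omega>\<in>C. Y \<omega> \<in> A}"
        using eq by (simp add: x emeasure_eq_measure set_lebesgue_integral_def)
      finally show ?case by simp
    next
      case empty
      then show ?case by simp
    next
      case (compl A)
      have A: "A \<in> sets borel" using compl bor by simp
      have "emeasure M {\<omega>\<in>C. Y \<omega> \<in> A} + emeasure M {\<omega>\<in>C. Y \<omega> \<in> UNIV - A} = emeasure M C"
        using CYm[OF A] CYm[of "UNIV - A"] A by (subst plus_emeasure) (auto intro!: arg_cong[where f="emeasure M"])
      moreover have "(\<integral>\<^sup>+\<omega>\<in>C. emeasure (K \<omega>) A \<partial>M) + (\<integral>\<^sup>+\<omega>\<in>C. emeasure (K \<omega>) (UNIV - A) \<partial>M) = emeasure M C"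
      proof -
        have "(\<integral>\<^sup>+\<omega>\<in>C. emeasure (K \<omega>) A \<partial>M) + (\<integral>\<^sup>+\<omega>\<in>C. emeasure (K \<omega>) (UNIV - A) \<partial>M)
          = (\<integral>\<^sup>+\<omega>. emeasure (K \<omega>) A * indicator C \<omega> + emeasure (K \<omega>) (UNIV - A) * indicator C \<omega> \<partial>M)"
          using A by (intro nn_integral_add[symmetric] nnm) auto
        also have "\<dots> = (\<integral>\<^sup>+\<omega>. indicator C \<omega> \<partial>M)"
        proof (rule nn_integral_cong)
          fix \<omega>
          interpret K: real_distribution "K \<omega>" by (rule Kd)
          have "emeasure (K \<omega>) A + emeasure (K \<omega>) (UNIV - A) = 1"
            using A K.emeasure_space_1 by (subst plus_emeasure) auto
          then show "emeasure (K \<omega>) A * indicator C \<omega> + emeasure (K \<omega>) (UNIV - A) * indicator C \<omega> = indicator C \<omega>"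
            by (simp add: distrib_right[symmetric])
        qed
        also have "\<dots> = emeasure M C" using CM by simp
        finally show ?thesis .
      qed
      ultimately have "emeasure M {\<omega>\<in>C. Y \<omega> \<in> A} + emeasure M {\<omega>\<in>C. Y \<omega> \<in> UNIV - A}
        = emeasure M {\<omega>\<in>C. Y \<omega> \<in> A} + (\<integral>\<^sup>+\<omega>\<in>C. emeasure (K \<omega>) (UNIV - A) \<partial>M)"
        using compl.IH by simp
      then show ?case by (simp add: ennreal_add_left_cancel emeasure_eq_measure)
    next
      case (union A)
      have A: "A i \<in> sets borel" for i using union bor by auto
      have "emeasure M {\<omega>\<in>C. Y \<omega> \<in> (\<Union>i. A i)} = emeasure M (\<Union>i. {\<omega>\<in>C. Y \<omega> \<in> A i})"
        by (intro arg_cong[where f="emeasure M"]) auto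
      also have "\<dots> = (\<Sum>i. emeasure M {\<omega>\<in>C. Y \<omega> \<in> A i})"
        using union(1) CYm[OF A] by (intro suminf_emeasure[symmetric]) (auto simp: disjoint_family_on_def)
      also have "\<dots> = (\<Sum>i. \<integral>\<^sup>+\<omega>\<in>C. emeasure (K \<omega>) (A i) \<partial>M)" using union.IH by simp
      also have "\<dots> = (\<integral>\<^sup>+\<omega>. (\<Sum>i. emeasure (K \<omega>) (A i) * indicator C \<omega>) \<partial>M)"
        by (intro nn_integral_suminf[symmetric] nnm A)
      also have "\<dots> = (\<integral>\<^sup>+\<omega>\<in>C. emeasure (K \<omega>) (\<Union>i. A i) \<partial>M)"
      proof (rule nn_integral_cong)
        fix \<omega>
        interpret K: real_distribution "K \<omega>" by (rule Kd)
        show "(\<Sum>i. emeasure (K \<omega>) (A i) * indicator C \<omega>) = emeasure (K \<omega>) (\<Union>i. A i) * indicator C \<omega>"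
          using A union(1) by (subst suminf_emeasure[symmetric]) (auto simp: ennreal_suminf_multc)
      qed
      finally show ?case .
    qed
  qed
  show thesis by (rule that[OF Km main])
qed

text \<open>The truth values of \<open>w q < r\<close> for rational \<open>q\<close> and \<open>r\<close> determine the path. Digits \<open>0\<close> and \<open>1\<close> in base
  \<open>3\<close> can be read off the sum greedily, which embeds the path space into the real line.\<close>

definition code_bit :: "nat \<Rightarrow> (real \<Rightarrow> real) \<Rightarrow> bool" where
  "code_bit i w \<longleftrightarrow> w (real_of_rat (fst (from_nat i :: rat \<times> rat))) < real_of_rat (snd (from_nat i :: rat \<times> rat))"

definition encode :: "(real \<Rightarrow> real) \<Rightarrow> real" where
  "encode w = (\<Sum>i. of_bool (code_bit i w) * (1 / 3) ^ i)"

primrec digit_tail :: "nat \<Rightarrow> real \<Rightarrow> real" where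
  "digit_tail 0 x = x"
| "digit_tail (Suc i) x = 3 * (digit_tail i x - (if 1 \<le> digit_tail i x then 1 else 0))"

lemma ternary_summable: "summable (\<lambda>j. of_bool (b j) * (1 / 3 :: real) ^ j)"
  by (rule summable_comparison_test'[where g="\<lambda>j. (1 / 3 :: real) ^ j" and N=0]) (auto intro: summable_geometric)

lemma ternary_bounds:
  "0 \<le> (\<Sum>j. of_bool (b j) * (1 / 3 :: real) ^ j)" "(\<Sum>j. of_bool (b j) * (1 / 3 :: real) ^ j) \<le> 3 / 2"
proof -
  show "0 \<le> (\<Sum>j. of_bool (b j) * (1 / 3 :: real) ^ j)" by (intro suminf_nonneg ternary_summable) auto
  have "(\<Sum>j. of_bool (b j) * (1 / 3 :: real) ^ j) \<le> (\<Sum>j. (1 / 3) ^ j)"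
    by (intro suminf_le ternary_summable summable_geometric) auto
  also have "\<dots> = 3 / 2" by (simp add: suminf_geometric)
  finally show "(\<Sum>j. of_bool (b j) * (1 / 3 :: real) ^ j) \<le> 3 / 2" .
qed

lemma ternary_split:
  "(\<Sum>j. of_bool (b (i + j)) * (1 / 3 :: real) ^ j) = of_bool (b i) + (\<Sum>j. of_bool (b (Suc i + j)) * (1 / 3) ^ j) / 3"
proof -
  have "(\<Sum>j. of_bool (b (i + Suc j)) * (1 / 3 :: real) ^ Suc j) = (\<Sum>j. of_bool (b (i + j)) * (1 / 3) ^ j) - of_bool (b i)"
    using suminf_split_head[OF ternary_summable[of "\<lambda>j. b (i + j)"]] by simp
  moreover have "(\<Sum>j. of_bool (b (i + Suc j)) * (1 / 3 :: real) ^ Suc j) = (\<Sum>j. (1 / 3) * (of_bool (b (Suc i + j)) * (1 / 3) ^ j))"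
    by (intro suminf_cong) simp
  moreover have "\<dots> = (1 / 3) * (\<Sum>j. of_bool (b (Suc i + j)) * (1 / 3 :: real) ^ j)"
    by (rule suminf_mult[OF ternary_summable])
  ultimately show ?thesis by simp
qed

text \<open>The digits after the leading one sum to at most \<open>1/2\<close>. This gap, which base
  \<open>2\<close> would not provide, makes the greedy test reliable.\<close>

lemma ternary_ge_1: "1 \<le> (\<Sum>j. of_bool (b (i + j)) * (1 / 3 :: real) ^ j) \<longleftrightarrow> b i"
proof -
  define S where "S = (\<Sum>j. of_bool (b (Suc i + j)) * (1 / 3 :: real) ^ j)"
  have S: "0 \<le> S" "S \<le> 3 / 2" unfolding S_def by (rule ternary_bounds)+
  show ?thesis unfolding ternary_split[of b i] S_def[symmetric] using S by (cases "b i") auto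
qed

lemma digit_tail_ternary:
  "digit_tail i (\<Sum>j. of_bool (b j) * (1 / 3 :: real) ^ j) = (\<Sum>j. of_bool (b (i + j)) * (1 / 3) ^ j)"
proof (induction i)
  case (Suc i)
  have "digit_tail (Suc i) (\<Sum>j. of_bool (b j) * (1 / 3 :: real) ^ j)
    = 3 * ((\<Sum>j. of_bool (b (i + j)) * (1 / 3) ^ j) - (if b i then 1 else 0))"
    by (simp only: digit_tail.simps Suc ternary_ge_1)
  then show ?case using ternary_split[of b i] by simp
qed simp

lemma digit_encode: "1 \<le> digit_tail i (encode w) \<longleftrightarrow> code_bit i w"
  unfolding encode_def digit_tail_ternary by (rule ternary_ge_1)

lemma encode_range: "0 \<le> encode w" "encode w \<le> 2"
  using ternary_bounds[of "\<lambda>i. code_bit i w"] by (auto simp: encode_def)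

lemma encode_measurable: "encode \<in> borel_measurable path_space"
proof -
  have "Measurable.pred path_space (code_bit i)" for i
    unfolding code_bit_def[abs_def] pred_def by (rule borel_measurable_less[OF eval_measurable]) simp
  then have "(\<lambda>w. of_bool (code_bit i w) :: real) \<in> borel_measurable path_space" for i
    unfolding of_bool_def by (intro measurable_If) (auto simp: pred_def)
  then show ?thesis unfolding encode_def[abs_def]
    by (intro borel_measurable_suminf borel_measurable_times borel_measurable_const)
qed

text \<open>Reads a path value off its code as the infimum of the rationals above it. The infimum is
  taken in the extended reals because an arbitrary real number need not be the code of a
  path.\<close>

definition rat_value :: "rat \<Rightarrow> real \<Rightarrow> real" where
  "rat_value q x = real_of_ereal (INF r::rat. if 1 \<le> digit_tail (to_nat (q, r)) x then ereal (real_of_rat r) else \<infinity>)"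

lemma digit_tail_measurable [measurable]: "digit_tail i \<in> borel_measurable borel"
  by (induction i) simp_all

lemma rat_value_measurable: "rat_value q \<in> borel_measurable borel"
  unfolding rat_value_def[abs_def]
  by (intro borel_measurable_real_of_ereal borel_measurable_INF measurable_If countableI_type borel_measurable_const)
    (auto intro!: borel_measurable_le)

lemma rat_value_encode: "rat_value q (encode w) = w (real_of_rat q)"
proof -
  have bit: "1 \<le> digit_tail (to_nat (q, r)) (encode w) \<longleftrightarrow> w (real_of_rat q) < real_of_rat r" for r
    by (simp add: digit_encode code_bit_def)
  have "(INF r::rat. if 1 \<le> digit_tail (to_nat (q, r)) (encode w) then ereal (real_of_rat r) else \<infinity>) = ereal (w (real_of_rat q))"
    unfolding bit
  proof (rule antisym)
    show "ereal (w (real_of_rat q)) \<le> (INF r::rat. if w (real_of_rat q) < real_of_rat r then ereal (real_of_rat r) else \<infinity>)"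
      by (rule INF_greatest) auto
    show "(INF r::rat. if w (real_of_rat q) < real_of_rat r then ereal (real_of_rat r) else \<infinity>) \<le> ereal (w (real_of_rat q))"
    proof (rule ereal_le_epsilon2)
      fix e :: real assume "0 < e"
      then obtain r where r: "w (real_of_rat q) < real_of_rat r" "real_of_rat r < w (real_of_rat q) + e"
        using of_rat_dense[of "w (real_of_rat q)" "w (real_of_rat q) + e"] by auto
      have "(INF r::rat. if w (real_of_rat q) < real_of_rat r then ereal (real_of_rat r) else \<infinity>) \<le> (if w (real_of_rat q) < real_of_rat r then ereal (real_of_rat r) else \<infinity>)"
        by (rule INF_lower) simp
      also have "\<dots> \<le> ereal (w (real_of_rat q)) + ereal e" using r by simp
      finally show "(INF r::rat. if w (real_of_rat q) < real_of_rat r then ereal (real_of_rat r) else \<infinity>) \<le> ereal (w (real_of_rat q)) + ereal e" .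
    qed
  qed
  then show ?thesis by (simp add: rat_value_def)
qed

definition rat_above :: "nat \<Rightarrow> real \<Rightarrow> rat" where
  "rat_above n t = of_int \<lceil>real (Suc n) * t\<rceil> / of_nat (Suc n)"

lemma real_rat_above: "real_of_rat (rat_above n t) = real_of_int \<lceil>real (Suc n) * t\<rceil> / real (Suc n)"
  by (simp add: rat_above_def of_rat_divide del: of_nat_Suc)

lemma rat_above_tendsto: "(\<lambda>n. real_of_rat (rat_above n t)) \<longlonglongrightarrow> t"
  unfolding real_rat_above by (rule tendsto_rational_approx)

lemma rat_above_nonneg: "0 \<le> t \<Longrightarrow> 0 \<le> real_of_rat (rat_above n t)"
proof -
  assume "0 \<le> t"
  then have "0 \<le> real (Suc n) * t" by simp
  then have "0 \<le> \<lceil>real (Suc n) * t\<rceil>" by linarith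
  then show ?thesis unfolding real_rat_above by (intro divide_nonneg_nonneg) simp_all
qed

lemma rat_above_le: "real_of_rat (rat_above n t) \<le> t + 1"
proof -
  have "real_of_int \<lceil>real (Suc n) * t\<rceil> \<le> real (Suc n) * t + 1" by linarith
  also have "\<dots> \<le> (t + 1) * real (Suc n)" by (simp add: algebra_simps)
  finally show ?thesis unfolding real_rat_above by (simp only: pos_divide_le_eq of_nat_0_less_iff zero_less_Suc)
qed

lemma rat_above_0: "rat_above n 0 = 0"
  by (simp add: rat_above_def)

text \<open>Continuity expressed through rational times: uniform continuity on each bounded
  interval, with countable quantifiers only, so that the set of such codes is measurable.\<close>

definition decodable :: "real \<Rightarrow> bool" where
  "decodable x \<longleftrightarrow> rat_value 0 x = 0 \<and> (\<forall>N k::nat. \<exists>m::nat. \<forall>q q'.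
     0 \<le> real_of_rat q \<and> real_of_rat q \<le> real N \<and> 0 \<le> real_of_rat q' \<and> real_of_rat q' \<le> real N \<and>
     \<bar>real_of_rat q - real_of_rat q'\<bar> < 1 / real (Suc m) \<longrightarrow> \<bar>rat_value q x - rat_value q' x\<bar> \<le> 1 / real (Suc k))"

text \<open>Total on the real line: numbers that are not decodable are sent to the zero path, so the
  image of every measure on the reals is a measure on paths.\<close>

definition decode :: "real \<Rightarrow> real \<Rightarrow> real" where
  "decode x = (\<lambda>t\<in>{0..}. if decodable x then lim (\<lambda>n. rat_value (rat_above n t) x) else 0)"

lemma decode_tendsto:
  assumes x: "decodable x" and t: "0 \<le> t"
  shows "(\<lambda>n. rat_value (rat_above n t) x) \<longlonglongrightarrow> decode x t"
proof -
  let ?r = "\<lambda>n. real_of_rat (rat_above n t)"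
  obtain N :: nat where N: "t + 1 \<le> real N" using real_arch_simple by blast
  have rN: "0 \<le> ?r n \<and> ?r n \<le> real N" for n
    using rat_above_nonneg[OF t, of n] rat_above_le[of n t] N by linarith
  have "Cauchy (\<lambda>n. rat_value (rat_above n t) x)"
  proof (rule metric_CauchyI)
    fix e :: real assume "0 < e"
    then obtain k where k: "1 / real (Suc k) < e" using reals_Archimedean[of e] by (auto simp: inverse_eq_divide)
    obtain m where m: "\<And>q q'. 0 \<le> real_of_rat q \<and> real_of_rat q \<le> real N \<and> 0 \<le> real_of_rat q' \<and> real_of_rat q' \<le> real N \<and>
     \<bar>real_of_rat q - real_of_rat q'\<bar> < 1 / real (Suc m) \<Longrightarrow> \<bar>rat_value q x - rat_value q' x\<bar> \<le> 1 / real (Suc k)"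
      using x unfolding decodable_def by blast
    have "Cauchy ?r" using rat_above_tendsto by (rule LIMSEQ_imp_Cauchy)
    then obtain M where M: "\<And>i j. i \<ge> M \<Longrightarrow> j \<ge> M \<Longrightarrow> dist (?r i) (?r j) < 1 / real (Suc m)"
      unfolding Cauchy_def by (metis of_nat_0_less_iff zero_less_Suc zero_less_divide_1_iff)
    show "\<exists>M. \<forall>i\<ge>M. \<forall>j\<ge>M. dist (rat_value (rat_above i t) x) (rat_value (rat_above j t) x) < e"
    proof (intro exI[of _ M] allI impI)
      fix i j assume "i \<ge> M" "j \<ge> M"
      then have "\<bar>?r i - ?r j\<bar> < 1 / real (Suc m)" using M[of i j] by (simp only: dist_real_def)
      then have "\<bar>rat_value (rat_above i t) x - rat_value (rat_above j t) x\<bar> \<le> 1 / real (Suc k)"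
        using rN by (intro m) blast
      then show "dist (rat_value (rat_above i t) x) (rat_value (rat_above j t) x) < e"
        using k unfolding dist_real_def by linarith
    qed
  qed
  then show ?thesis using x t by (simp add: decode_def Cauchy_convergent_iff convergent_LIMSEQ_iff)
qed

lemma decode_in_W: "decode x \<in> W"
proof (cases "decodable x")
  case False
  have "continuous_on {0..} (\<lambda>t::real. 0::real)" by simp
  then have "continuous_on {0..} (decode x)"
    by (rule continuous_on_cong[THEN iffD1, rotated -1]) (use False in \<open>auto simp: decode_def\<close>)
  then show ?thesis using False by (simp add: mem_W decode_def)
next
  case x: True
  have "decode x 0 = 0"
  proof -
    have "(\<lambda>n. rat_value (rat_above n 0) x) \<longlonglongrightarrow> decode x 0" by (rule decode_tendsto[OF x]) simp
    then show ?thesis using x by (simp add: rat_above_0 decodable_def LIMSEQ_const_iff)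
  qed
  moreover have "continuous_on {0..} (decode x)"
    unfolding continuous_on_iff
  proof (intro ballI allI impI)
    fix t e :: real assume t: "t \<in> {0..}" and "0 < e"
    then obtain k where k: "1 / real (Suc k) < e" using reals_Archimedean[of e] by (auto simp: inverse_eq_divide)
    obtain N :: nat where N: "t + 2 \<le> real N" using real_arch_simple by blast
    obtain m where m: "\<And>q q'. 0 \<le> real_of_rat q \<and> real_of_rat q \<le> real N \<and> 0 \<le> real_of_rat q' \<and> real_of_rat q' \<le> real N \<and>
     \<bar>real_of_rat q - real_of_rat q'\<bar> < 1 / real (Suc m) \<Longrightarrow> \<bar>rat_value q x - rat_value q' x\<bar> \<le> 1 / real (Suc k)"
      using x unfolding decodable_def by blast
    show "\<exists>d>0. \<forall>s\<in>{0..}. dist s t < d \<longrightarrow> dist (decode x s) (decode x t) < e"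
    proof (intro exI[of _ "min 1 (1 / real (Suc m))"] conjI ballI impI)
      fix s assume s: "s \<in> {0..}" "dist s t < min 1 (1 / real (Suc m))"
      have "(\<lambda>n. \<bar>real_of_rat (rat_above n s) - real_of_rat (rat_above n t)\<bar>) \<longlonglongrightarrow> \<bar>s - t\<bar>"
        by (intro tendsto_intros rat_above_tendsto)
      then have "\<forall>\<^sub>F n in sequentially. \<bar>real_of_rat (rat_above n s) - real_of_rat (rat_above n t)\<bar> < 1 / real (Suc m)"
        by (rule order_tendstoD(2)) (use s in \<open>simp add: dist_real_def\<close>)
      then have ev: "\<forall>\<^sub>F n in sequentially. \<bar>rat_value (rat_above n s) x - rat_value (rat_above n t) x\<bar> \<le> 1 / real (Suc k)"
      proof (rule eventually_mono)
        fix n assume d: "\<bar>real_of_rat (rat_above n s) - real_of_rat (rat_above n t)\<bar> < 1 / real (Suc m)"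
        have "dist s t < 1" by (rule less_le_trans[OF s(2) min.cobounded1])
        then have "0 \<le> s" "0 \<le> t" "s \<le> t + 1" using s(1) t by (auto simp: dist_real_def)
        then show "\<bar>rat_value (rat_above n s) x - rat_value (rat_above n t) x\<bar> \<le> 1 / real (Suc k)"
          using d rat_above_nonneg[of s n] rat_above_nonneg[of t n] rat_above_le[of n s] rat_above_le[of n t] N
          by (intro m conjI) linarith+
      qed
      have "(\<lambda>n. \<bar>rat_value (rat_above n s) x - rat_value (rat_above n t) x\<bar>) \<longlonglongrightarrow> \<bar>decode x s - decode x t\<bar>"
        using s t by (intro tendsto_intros decode_tendsto[OF x]) auto
      then have "\<bar>decode x s - decode x t\<bar> \<le> 1 / real (Suc k)"
        by (rule tendsto_upperbound[OF _ ev]) simp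
      then show "dist (decode x s) (decode x t) < e" using k unfolding dist_real_def by linarith
    qed simp
  qed
  ultimately show ?thesis by (simp add: mem_W decode_def)
qed

lemma decodable_encode:
  assumes w: "w \<in> W"
  shows "decodable (encode w)"
  unfolding decodable_def rat_value_encode
proof (intro conjI allI)
  show "w (real_of_rat 0) = 0" using W_zero[OF w] by simp
  fix N k :: nat
  have "uniformly_continuous_on {0..real N} w"
    by (intro compact_uniformly_continuous continuous_on_subset[OF W_cont[OF w]]) auto
  then obtain d where d: "0 < d" "\<And>s t. s \<in> {0..real N} \<Longrightarrow> t \<in> {0..real N} \<Longrightarrow> dist t s < d \<Longrightarrow> dist (w t) (w s) < 1 / real (Suc k)"
    unfolding uniformly_continuous_on_def by (metis of_nat_0_less_iff zero_less_Suc zero_less_divide_1_iff)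
  obtain m where m: "1 / real (Suc m) < d" using reals_Archimedean[OF d(1)] by (auto simp: inverse_eq_divide)
  show "\<exists>m::nat. \<forall>q q'.
     0 \<le> real_of_rat q \<and> real_of_rat q \<le> real N \<and> 0 \<le> real_of_rat q' \<and> real_of_rat q' \<le> real N \<and>
     \<bar>real_of_rat q - real_of_rat q'\<bar> < 1 / real (Suc m) \<longrightarrow> \<bar>w (real_of_rat q) - w (real_of_rat q')\<bar> \<le> 1 / real (Suc k)"
  proof (intro exI[of _ m] allI impI)
    fix q q' assume a: "0 \<le> real_of_rat q \<and> real_of_rat q \<le> real N \<and> 0 \<le> real_of_rat q' \<and> real_of_rat q' \<le> real N \<and>
     \<bar>real_of_rat q - real_of_rat q'\<bar> < 1 / real (Suc m)"
    then have "dist (w (real_of_rat q)) (w (real_of_rat q')) < 1 / real (Suc k)"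
      using m by (intro d(2)) (auto simp: dist_real_def simp del: zero_le_of_rat_iff of_nat_Suc)
    then show "\<bar>w (real_of_rat q) - w (real_of_rat q')\<bar> \<le> 1 / real (Suc k)" unfolding dist_real_def by simp
  qed
qed

lemma decode_encode:
  assumes w: "w \<in> W"
  shows "decode (encode w) = w"
proof (rule W_eqI[OF decode_in_W w])
  fix t :: real assume t: "0 \<le> t"
  have "(\<lambda>n. rat_value (rat_above n t) (encode w)) \<longlonglongrightarrow> w t"
    unfolding rat_value_encode
    by (rule continuous_on_tendsto_compose[OF W_cont[OF w] rat_above_tendsto])
      (use t rat_above_nonneg[OF t] in \<open>auto simp del: zero_le_of_rat_iff\<close>)
  then show "decode (encode w) t = w t"
    using decode_tendsto[OF decodable_encode[OF w] t] by (rule LIMSEQ_unique[rotated])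
qed

lemma decode_measurable: "decode \<in> borel \<rightarrow>\<^sub>M path_space"
proof (rule measurable_path_spaceI)
  fix t :: real assume t: "0 \<le> t"
  have 1: "Measurable.pred borel (\<lambda>x. \<bar>rat_value q x - rat_value q' x\<bar> \<le> c)" for q q' c
    unfolding pred_def by (rule borel_measurable_le) (intro borel_measurable_abs borel_measurable_diff rat_value_measurable borel_measurable_const)+
  have 2: "Measurable.pred borel (\<lambda>x. rat_value 0 x = 0)"
    unfolding pred_def by (rule borel_measurable_eq[OF rat_value_measurable]) simp
  have "Measurable.pred borel decodable"
    unfolding decodable_def[abs_def]
    by (intro pred_intros_logic(3) pred_intros_logic(4) pred_intros_countable 1 2) simp_all
  then have "(\<lambda>x. if decodable x then lim (\<lambda>n. rat_value (rat_above n t) x) else 0) \<in> borel_measurable borel"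
    by (intro measurable_If borel_measurable_lim_metric rat_value_measurable borel_measurable_const) (simp add: pred_def)
  then show "(\<lambda>x. decode x t) \<in> borel_measurable borel" using t by (simp add: decode_def)
qed (rule decode_in_W)

text \<open>Take the conditional distribution of the real code of the path and push it forward by
  \<open>decode\<close>, a measurable left inverse of \<open>encode\<close>.\<close>

theorem (in prob_space) exists_regular_conditional_distribution:
  assumes sub: "subalgebra M G" and X: "X \<in> M \<rightarrow>\<^sub>M path_space"
  obtains K where "K \<in> G \<rightarrow>\<^sub>M prob_algebra path_space"
    "\<And>B C. B \<in> sets path_space \<Longrightarrow> C \<in> sets G \<Longrightarrow>
      emeasure M {\<omega>\<in>C. X \<omega> \<in> B} = (\<integral>\<^sup>+\<omega>\<in>C. emeasure (K \<omega>) B \<partial>M)"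
proof -
  have Ym: "(\<lambda>\<omega>. encode (X \<omega>)) \<in> borel_measurable M" by (rule measurable_compose[OF X encode_measurable])
  obtain L where L: "L \<in> G \<rightarrow>\<^sub>M prob_algebra borel"
    "\<And>A C. A \<in> sets borel \<Longrightarrow> C \<in> sets G \<Longrightarrow> emeasure M {\<omega>\<in>C. encode (X \<omega>) \<in> A} = (\<integral>\<^sup>+\<omega>\<in>C. emeasure (L \<omega>) A \<partial>M)"
    using exists_conditional_distribution_bounded[OF sub Ym encode_range] by blast
  define K where "K \<omega> = distr (L \<omega>) path_space decode" for \<omega>
  have spG: "space G = space M" and setsG: "sets G \<subseteq> sets M" using sub by (auto simp: subalgebra_def)
  show thesis
  proof (rule that)
    show "K \<in> G \<rightarrow>\<^sub>M prob_algebra path_space"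
      unfolding K_def[abs_def] by (rule measurable_compose[OF L(1) measurable_distr_prob_space[OF decode_measurable]])
    fix B C assume B: "B \<in> sets path_space" and C: "C \<in> sets G"
    have Csp: "C \<subseteq> space M" using C setsG sets.sets_into_space by blast
    have Bm: "decode -` B \<in> sets borel" using measurable_sets[OF decode_measurable B] by simp
    have "{\<omega>\<in>C. X \<omega> \<in> B} = {\<omega>\<in>C. encode (X \<omega>) \<in> decode -` B}"
      using Csp measurable_space[OF X] decode_encode by auto
    then have "emeasure M {\<omega>\<in>C. X \<omega> \<in> B} = (\<integral>\<^sup>+\<omega>\<in>C. emeasure (L \<omega>) (decode -` B) \<partial>M)"
      using L(2)[OF Bm C] by simp
    also have "\<dots> = (\<integral>\<^sup>+\<omega>\<in>C. emeasure (K \<omega>) B \<partial>M)"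
    proof (rule nn_integral_cong)
      fix \<omega> assume "\<omega> \<in> space M"
      then have "L \<omega> \<in> space (prob_algebra borel)" using L(1) spG by (auto dest: measurable_space)
      then have s: "sets (L \<omega>) = sets borel" by (simp add: space_prob_algebra)
      then have "decode \<in> L \<omega> \<rightarrow>\<^sub>M path_space" using decode_measurable measurable_cong_sets[OF s refl] by blast
      then have "emeasure (K \<omega>) B = emeasure (L \<omega>) (decode -` B)"
        using B sets_eq_imp_space_eq[OF s] by (simp add: K_def emeasure_distr)
      then show "emeasure (L \<omega>) (decode -` B) * indicator C \<omega> = emeasure (K \<omega>) B * indicator C \<omega>" by simp
    qed
    finally show "emeasure M {\<omega>\<in>C. X \<omega> \<in> B} = (\<integral>\<^sup>+\<omega>\<in>C. emeasure (K \<omega>) B \<partial>M)" .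
  qed
qed

section \<open>Integrals against a conditional law\<close>

context prob_space
begin

context
  fixes G X and K :: "'a \<Rightarrow> (real \<Rightarrow> real) measure" and f :: "(real \<Rightarrow> real) \<Rightarrow> real" and B :: real
  assumes sub: "subalgebra M G" and X: "X \<in> M \<rightarrow>\<^sub>M path_space"
    and K: "K \<in> G \<rightarrow>\<^sub>M prob_algebra path_space"
    and law: "\<And>B C. B \<in> sets path_space \<Longrightarrow> C \<in> sets G \<Longrightarrow>
      emeasure M {\<omega>\<in>C. X \<omega> \<in> B} = (\<integral>\<^sup>+\<omega>\<in>C. emeasure (K \<omega>) B \<partial>M)"
    and f: "f \<in> borel_measurable path_space" and fB: "\<And>w. w \<in> W \<Longrightarrow> \<bar>f w\<bar> \<le> B"
begin

lemma kernel_space: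
  assumes "\<omega> \<in> space M"
  shows "prob_space (K \<omega>)" "sets (K \<omega>) = sets path_space" "space (K \<omega>) = W"
proof -
  have "K \<omega> \<in> space (prob_algebra path_space)"
    using K assms sub by (auto dest: measurable_space simp: subalgebra_def)
  then show "prob_space (K \<omega>)" and s: "sets (K \<omega>) = sets path_space" by (auto simp: space_prob_algebra)
  show "space (K \<omega>) = W" using sets_eq_imp_space_eq[OF s] .
qed

lemma kernel_integral_measurable: "(\<lambda>\<omega>. \<integral>w. f w \<partial>K \<omega>) \<in> borel_measurable G"
  by (rule measurable_compose[OF measurable_prob_algebraD[OF K] integral_measurable_subprob_algebra[OF f]])

lemma kernel_integrable: "\<omega> \<in> space M \<Longrightarrow> integrable (K \<omega>) f"
proof -
  assume w: "\<omega> \<in> space M"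
  interpret K: prob_space "K \<omega>" by (rule kernel_space(1)[OF w])
  show ?thesis
    using f fB kernel_space(2,3)[OF w] measurable_cong_sets[OF kernel_space(2)[OF w] refl]
    by (intro K.integrable_const_bound[where B=B]) auto
qed

lemma kernel_integral_bound: "\<omega> \<in> space M \<Longrightarrow> \<bar>\<integral>w. f w \<partial>K \<omega>\<bar> \<le> B"
proof -
  assume w: "\<omega> \<in> space M"
  interpret K: prob_space "K \<omega>" by (rule kernel_space(1)[OF w])
  have "\<bar>\<integral>w. f w \<partial>K \<omega>\<bar> \<le> (\<integral>w. \<bar>f w\<bar> \<partial>K \<omega>)" by (rule integral_abs_bound)
  also have "\<dots> \<le> B"
    using fB kernel_integrable[OF w] kernel_space(3)[OF w] by (intro K.integral_le_const) auto
  finally show ?thesis .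
qed

text \<open>The formula for events says that, with density the indicator of \<open>C\<close>, the
  law of \<open>X\<close> is the bind of the kernel. Nonnegative integrals over these two equal
  measures agree, and adding \<open>B\<close> makes \<open>f\<close> nonnegative.\<close>

lemma kernel_set_integral:
  assumes C: "C \<in> sets G"
  shows "(\<integral>\<omega>\<in>C. f (X \<omega>) \<partial>M) = (\<integral>\<omega>\<in>C. (\<integral>w. f w \<partial>K \<omega>) \<partial>M)"
proof -
  have setsG: "sets G \<subseteq> sets M" and spG: "space G = space M" using sub by (auto simp: subalgebra_def)
  have CM: "C \<in> sets M" using C setsG by auto
  have KM: "K \<in> M \<rightarrow>\<^sub>M subprob_algebra path_space"
    by (rule measurable_from_subalg[OF sub measurable_prob_algebraD[OF K]])
  have ne: "space M \<noteq> {}" by (rule not_empty)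
  define D where "D = density M (indicator C)"
  have sD: "sets D = sets M" "space D = space M" by (simp_all add: D_def)
  have KD: "K \<in> D \<rightarrow>\<^sub>M subprob_algebra path_space" using KM measurable_cong_sets[OF sD(1) refl] by blast
  have XD: "X \<in> D \<rightarrow>\<^sub>M path_space" using X measurable_cong_sets[OF sD(1) refl] by blast
  have eq: "distr D path_space X = D \<bind> K"
  proof (rule measure_eqI)
    show s: "sets (distr D path_space X) = sets (D \<bind> K)"
      using sets_bind_measurable[OF KD] ne sD by simp
    fix A assume "A \<in> sets (distr D path_space X)"
    then have A: "A \<in> sets path_space" by simp
    have XA: "X -` A \<inter> space M \<in> sets M" using measurable_sets[OF X A] .
    have "emeasure (distr D path_space X) A = emeasure D (X -` A \<inter> space M)"
      using emeasure_distr[OF XD A] sD by simp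
    also have "\<dots> = emeasure M (C \<inter> (X -` A \<inter> space M))"
      using XA CM by (simp add: D_def emeasure_density indicator_inter_arith[symmetric] sets.Int)
    also have "C \<inter> (X -` A \<inter> space M) = {\<omega>\<in>C. X \<omega> \<in> A}" using sets.sets_into_space[OF CM] by auto
    also have "emeasure M {\<omega>\<in>C. X \<omega> \<in> A} = (\<integral>\<^sup>+\<omega>\<in>C. emeasure (K \<omega>) A \<partial>M)" by (rule law[OF A C])
    also have "\<dots> = (\<integral>\<^sup>+\<omega>. emeasure (K \<omega>) A \<partial>D)"
      using CM measurable_compose[OF KM measurable_emeasure_subprob_algebra[OF A]]
      by (simp add: D_def nn_integral_density mult.commute)
    also have "\<dots> = emeasure (D \<bind> K) A"
      by (rule emeasure_bind[symmetric, OF _ KD A]) (use ne sD in simp)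
    finally show "emeasure (distr D path_space X) A = emeasure (D \<bind> K) A" .
  qed
  define g where "g w = f w + B" for w
  have gm: "g \<in> borel_measurable path_space" unfolding g_def[abs_def] using f by simp
  have g0: "0 \<le> g w" "g w \<le> 2 * B" if "w \<in> W" for w using fB[OF that] by (auto simp: g_def)
  have XW: "X \<omega> \<in> W" if "\<omega> \<in> space M" for \<omega> using measurable_space[OF X that] .
  have gint: "(\<integral>w. g w \<partial>K \<omega>) = (\<integral>w. f w \<partial>K \<omega>) + B" if w: "\<omega> \<in> space M" for \<omega>
  proof -
    interpret K: prob_space "K \<omega>" by (rule kernel_space(1)[OF w])
    show ?thesis unfolding g_def using kernel_integrable[OF w] K.prob_space by simp
  qed
  have "(\<integral>\<^sup>+w. ennreal (g w) \<partial>distr D path_space X) = (\<integral>\<^sup>+\<omega>. ennreal (g (X \<omega>)) \<partial>D)"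
    using gm by (intro nn_integral_distr XD) simp
  also have "\<dots> = (\<integral>\<^sup>+\<omega>. ennreal (g (X \<omega>) * indicator C \<omega>) \<partial>M)"
    using CM measurable_compose[OF X gm]
    by (simp add: D_def nn_integral_density) (intro nn_integral_cong, auto simp: indicator_def)
  finally have 1: "(\<integral>\<^sup>+w. ennreal (g w) \<partial>distr D path_space X) = (\<integral>\<^sup>+\<omega>. ennreal (g (X \<omega>) * indicator C \<omega>) \<partial>M)" .
  have km: "(\<lambda>\<omega>. \<integral>\<^sup>+w. ennreal (g w) \<partial>K \<omega>) \<in> borel_measurable M"
    by (rule measurable_compose[OF KM nn_integral_measurable_subprob_algebra]) (use gm in simp)
  have "(\<integral>\<^sup>+w. ennreal (g w) \<partial>(D \<bind> K)) = (\<integral>\<^sup>+\<omega>. \<integral>\<^sup>+w. ennreal (g w) \<partial>K \<omega> \<partial>D)"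
    using gm by (intro nn_integral_bind[OF _ KD]) simp
  also have "\<dots> = (\<integral>\<^sup>+\<omega>. indicator C \<omega> * (\<integral>\<^sup>+w. ennreal (g w) \<partial>K \<omega>) \<partial>M)"
    unfolding D_def using CM km by (intro nn_integral_density) simp_all
  also have "\<dots> = (\<integral>\<^sup>+\<omega>. ennreal (((\<integral>w. f w \<partial>K \<omega>) + B) * indicator C \<omega>) \<partial>M)"
  proof (rule nn_integral_cong)
    fix \<omega> assume w: "\<omega> \<in> space M"
    interpret K: prob_space "K \<omega>" by (rule kernel_space(1)[OF w])
    have "integrable (K \<omega>) g" unfolding g_def[abs_def] using kernel_integrable[OF w] by simp
    then have "(\<integral>\<^sup>+w. ennreal (g w) \<partial>K \<omega>) = ennreal (\<integral>w. g w \<partial>K \<omega>)"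
      using g0 kernel_space(3)[OF w] by (intro nn_integral_eq_integral) auto
    then show "indicator C \<omega> * (\<integral>\<^sup>+w. ennreal (g w) \<partial>K \<omega>) = ennreal (((\<integral>w. f w \<partial>K \<omega>) + B) * indicator C \<omega>)"
      unfolding gint[OF w] by (simp add: indicator_def)
  qed
  finally have 2: "(\<integral>\<^sup>+\<omega>. ennreal (g (X \<omega>) * indicator C \<omega>) \<partial>M) = (\<integral>\<^sup>+\<omega>. ennreal (((\<integral>w. f w \<partial>K \<omega>) + B) * indicator C \<omega>) \<partial>M)"
    unfolding 1[symmetric] eq .
  obtain \<omega>0 where "\<omega>0 \<in> space M" using ne by blast
  then have B0: "0 \<le> B" using order_trans[OF abs_ge_zero fB[OF XW]] by blast
  have i1: "integrable M (\<lambda>\<omega>. f (X \<omega>) * indicator C \<omega>)"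
    using measurable_compose[OF X f] CM fB[OF XW] B0 by (intro integrable_const_bound[where B=B] AE_I2) (auto simp: indicator_def)
  have i2: "integrable M (\<lambda>\<omega>. (\<integral>w. f w \<partial>K \<omega>) * indicator C \<omega>)"
    using measurable_from_subalg[OF sub kernel_integral_measurable] CM kernel_integral_bound B0
    by (intro integrable_const_bound[where B=B] AE_I2) (auto simp: indicator_def)
  have i3: "integrable M (\<lambda>\<omega>. B * indicator C \<omega> :: real)"
    using CM by (intro integrable_const_bound[where B="\<bar>B\<bar>"]) (auto simp: indicator_def)
  have "ennreal (\<integral>\<omega>. g (X \<omega>) * indicator C \<omega> \<partial>M) = ennreal (\<integral>\<omega>. ((\<integral>w. f w \<partial>K \<omega>) + B) * indicator C \<omega> \<partial>M)"
  proof -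
    have gi: "integrable M (\<lambda>\<omega>. g (X \<omega>) * indicator C \<omega>)"
      using Bochner_Integration.integrable_add[OF i1 i3] by (simp only: g_def distrib_right)
    have ki: "integrable M (\<lambda>\<omega>. ((\<integral>w. f w \<partial>K \<omega>) + B) * indicator C \<omega>)"
      using Bochner_Integration.integrable_add[OF i2 i3] by (simp only: distrib_right)
    have "0 \<le> (\<integral>w. f w \<partial>K \<omega>) + B" if "\<omega> \<in> space M" for \<omega> using kernel_integral_bound[OF that] by linarith
    then have "AE \<omega> in M. 0 \<le> ((\<integral>w. f w \<partial>K \<omega>) + B) * indicator C \<omega>" by (intro AE_I2 mult_nonneg_nonneg) auto
    moreover have "AE \<omega> in M. 0 \<le> g (X \<omega>) * indicator C \<omega>" using g0 XW by (intro AE_I2 mult_nonneg_nonneg) auto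
    ultimately show ?thesis
      using 2 nn_integral_eq_integral[OF gi] nn_integral_eq_integral[OF ki] by (simp only:)
  qed
  then have "(\<integral>\<omega>. g (X \<omega>) * indicator C \<omega> \<partial>M) = (\<integral>\<omega>. ((\<integral>w. f w \<partial>K \<omega>) + B) * indicator C \<omega> \<partial>M)"
  proof (rule ennreal_inj[THEN iffD1, rotated 2])
    show "0 \<le> (\<integral>\<omega>. g (X \<omega>) * indicator C \<omega> \<partial>M)" using g0 XW by (intro Bochner_Integration.integral_nonneg_AE AE_I2) auto
    have "0 \<le> (\<integral>w. f w \<partial>K \<omega>) + B" if "\<omega> \<in> space M" for \<omega> using kernel_integral_bound[OF that] by linarith
    then show "0 \<le> (\<integral>\<omega>. ((\<integral>w. f w \<partial>K \<omega>) + B) * indicator C \<omega> \<partial>M)" by (intro Bochner_Integration.integral_nonneg_AE AE_I2) auto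
  qed
  then have "(\<integral>\<omega>. f (X \<omega>) * indicator C \<omega> \<partial>M) + (\<integral>\<omega>. B * indicator C \<omega> \<partial>M)
    = (\<integral>\<omega>. (\<integral>w. f w \<partial>K \<omega>) * indicator C \<omega> \<partial>M) + (\<integral>\<omega>. B * indicator C \<omega> \<partial>M)"
    unfolding g_def distrib_right Bochner_Integration.integral_add[OF i1 i3] Bochner_Integration.integral_add[OF i2 i3] .
  then show ?thesis unfolding set_lebesgue_integral_def by (simp add: mult.commute)
qed

text \<open>Both sides are versions of the conditional expectation of \<open>f (X \<omega>)\<close>
  given \<open>G\<close>, and such versions agree almost surely.\<close>

lemma AE_kernel_eq:
  assumes h: "h \<in> borel_measurable G" "integrable M h"
    and eq: "\<And>C. C \<in> sets G \<Longrightarrow> (\<integral>\<omega>\<in>C. f (X \<omega>) \<partial>M) = (\<integral>\<omega>\<in>C. h \<omega> \<partial>M)"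
  shows "AE \<omega> in M. (\<integral>w. f w \<partial>K \<omega>) = h \<omega>"
proof -
  interpret G: finite_measure_subalgebra M G by unfold_locales (rule sub)
  have fi: "integrable M (\<lambda>\<omega>. f (X \<omega>))"
    using measurable_compose[OF X f] fB measurable_space[OF X] by (intro integrable_const_bound[where B=B]) auto
  have ki: "integrable M (\<lambda>\<omega>. \<integral>w. f w \<partial>K \<omega>)"
    using measurable_from_subalg[OF sub kernel_integral_measurable] kernel_integral_bound
    by (intro integrable_const_bound[where B=B]) auto
  have "AE \<omega> in M. real_cond_exp M G (\<lambda>\<omega>. f (X \<omega>)) \<omega> = (\<integral>w. f w \<partial>K \<omega>)"
    by (rule G.real_cond_exp_charact[OF kernel_set_integral fi ki kernel_integral_measurable])
  moreover have "AE \<omega> in M. real_cond_exp M G (\<lambda>\<omega>. f (X \<omega>)) \<omega> = h \<omega>"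
    by (rule G.real_cond_exp_charact[OF eq fi h(2,1)])
  ultimately show ?thesis by eventually_elim simp
qed

end

end

section \<open>Gaussian martingales\<close>

lemma space_natural_filtration [simp]: "space (natural_filtration P X s) = space P"
  by (simp add: natural_filtration_def)

lemma natural_filtration_component:
  assumes "0 \<le> r" "r \<le> s"
  shows "X r \<in> borel_measurable (natural_filtration P X s)"
proof -
  have "(\<lambda>\<omega>. \<lambda>u\<in>{0..s}. X u \<omega>) \<in> natural_filtration P X s \<rightarrow>\<^sub>M Pi\<^sub>M {0..s} (\<lambda>_. borel)"
    unfolding natural_filtration_def by (rule measurable_vimage_algebra1) (auto simp: space_PiM)
  from measurable_compose[OF this measurable_component_singleton[of r]] show ?thesis using assms by simp
qed

lemma natural_filtration_sets:
  "A \<in> sets (natural_filtration P X s) \<Longrightarrow>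
    \<exists>B\<in>sets (Pi\<^sub>M {0..s} (\<lambda>_. borel)). A = {\<omega>\<in>space P. (\<lambda>u\<in>{0..s}. X u \<omega>) \<in> B}"
proof -
  assume "A \<in> sets (natural_filtration P X s)"
  then obtain B where "B \<in> sets (Pi\<^sub>M {0..s} (\<lambda>_. borel))" "A = (\<lambda>\<omega>. \<lambda>u\<in>{0..s}. X u \<omega>) -` B \<inter> space P"
    unfolding natural_filtration_def by (subst (asm) sets_vimage_algebra2) (auto simp: space_PiM)
  then show ?thesis by blast
qed

lemma natural_filtration_le:
  assumes "space N = space P" "\<And>u. 0 \<le> u \<Longrightarrow> u \<le> s \<Longrightarrow> X u \<in> borel_measurable N"
  shows "sets (natural_filtration P X s) \<subseteq> sets N"
proof
  fix A assume A: "A \<in> sets (natural_filtration P X s)"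
  obtain B where B: "B \<in> sets (Pi\<^sub>M {0..s} (\<lambda>_. borel))" "A = {\<omega>\<in>space P. (\<lambda>u\<in>{0..s}. X u \<omega>) \<in> B}"
    using natural_filtration_sets[OF A] by blast
  have "(\<lambda>\<omega>. \<lambda>u\<in>{0..s}. X u \<omega>) \<in> N \<rightarrow>\<^sub>M Pi\<^sub>M {0..s} (\<lambda>_. borel)"
    using assms(2) by (intro measurable_restrict) auto
  from measurable_sets[OF this B(1)] show "A \<in> sets N"
    unfolding B(2) assms(1) by (simp add: vimage_def Int_def conj_commute)
qed

lemma natural_filtration_mono: "s \<le> t \<Longrightarrow> sets (natural_filtration P X s) \<subseteq> sets (natural_filtration P X t)"
  by (intro natural_filtration_le natural_filtration_component) auto

lemma natural_filtration_subalgebra: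
  "(\<And>u. 0 \<le> u \<Longrightarrow> X u \<in> borel_measurable P) \<Longrightarrow> subalgebra P (natural_filtration P X s)"
  unfolding subalgebra_def using natural_filtration_le[of P P s X] by auto

lemma filtration_natural: "filtration (space P) (natural_filtration P X)"
  by unfold_locales (auto dest: natural_filtration_mono)

lemma adapted_natural: "adapted (natural_filtration P X) X"
  unfolding adapted_def by (auto intro: natural_filtration_component)

lemma martingaleI:
  assumes P: "prob_space P" and F: "filtration (space P) F" "\<And>t. 0 \<le> t \<Longrightarrow> subalgebra P (F t)"
    and Y: "adapted F Y" "\<And>t. 0 \<le> t \<Longrightarrow> integrable P (Y t)"
    and zero: "\<And>s t A. 0 \<le> s \<Longrightarrow> s \<le> t \<Longrightarrow> A \<in> sets (F s) \<Longrightarrow> (\<integral>\<omega>. (Y t \<omega> - Y s \<omega>) * indicator A \<omega> \<partial>P) = 0"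
  shows "martingale P F Y"
  unfolding martingale_def
proof (intro conjI allI impI F Y)
  fix s t :: real assume st: "0 \<le> s \<and> s \<le> t"
  interpret prob_space P by (rule P)
  interpret G: finite_measure_subalgebra P "F s" by unfold_locales (use F st in auto)
  show "AE \<omega> in P. real_cond_exp P (F s) (Y t) \<omega> = Y s \<omega>"
  proof (rule G.real_cond_exp_charact)
    show "integrable P (Y t)" "integrable P (Y s)" "Y s \<in> borel_measurable (F s)"
      using st Y by (auto simp: adapted_def)
    fix A assume A: "A \<in> sets (F s)"
    then have AP: "A \<in> sets P" using F(2)[of s] st by (auto simp: subalgebra_def)
    have i: "integrable P (\<lambda>\<omega>. Y r \<omega> * indicator A \<omega>)" if "0 \<le> r" for r
      using Y(2)[OF that] AP by (rule integrable_real_mult_indicator[rotated])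
    have "(\<integral>\<omega>. Y t \<omega> * indicator A \<omega> \<partial>P) - (\<integral>\<omega>. Y s \<omega> * indicator A \<omega> \<partial>P) = 0"
      using zero[of s t A] st A unfolding left_diff_distrib
      by (subst (asm) Bochner_Integration.integral_diff[OF i i]) auto
    then show "(\<integral>\<omega>\<in>A. Y t \<omega> \<partial>P) = (\<integral>\<omega>\<in>A. Y s \<omega> \<partial>P)"
      by (simp add: set_lebesgue_integral_def mult.commute)
  qed
qed

text \<open>Characteristic functions determine the law. For \<open>v = 0\<close> it is the unit mass
  at \<open>0\<close>; otherwise the variable is scaled to the standard normal law.\<close>

lemma (in prob_space) gaussian_variableI:
  assumes Y: "Y \<in> borel_measurable M"
    and char: "\<And>\<theta>. (\<integral>\<omega>. cos (\<theta> * Y \<omega>) \<partial>M) = exp (- (\<theta>\<^sup>2 * v) / 2)" "\<And>\<theta>. (\<integral>\<omega>. sin (\<theta> * Y \<omega>) \<partial>M) = 0"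
  shows "gaussian_variable M Y"
proof -
  have cm: "(\<lambda>\<omega>. cos (\<theta> * Y \<omega>)) \<in> borel_measurable M" and sm: "(\<lambda>\<omega>. sin (\<theta> * Y \<omega>)) \<in> borel_measurable M" for \<theta>
    by (rule measurable_compose[OF Y borel_measurable_continuous_onI]; intro continuous_intros)+
  have ci: "integrable M (\<lambda>\<omega>. cos (\<theta> * Y \<omega>))" and si: "integrable M (\<lambda>\<omega>. sin (\<theta> * Y \<omega>))" for \<theta>
    using cm sm by (auto intro!: integrable_const_bound[where B=1])
  \<comment> \<open>Nonnegativity of the variance comes for free: this exponential is the mean of a
    cosine.\<close>
  have "exp (- v / 2) \<le> 1"
    using integral_le_const[OF ci[of 1], of 1] char(1)[of 1] by simp
  then have v0: "0 \<le> v" by simp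
  have ch: "char (distr M borel (\<lambda>\<omega>. b * Y \<omega>)) \<theta> = complex_of_real (exp (- ((\<theta> * b)\<^sup>2 * v) / 2))" for b \<theta>
  proof -
    have bm: "(\<lambda>\<omega>. b * Y \<omega>) \<in> borel_measurable M" using Y by simp
    have "char (distr M borel (\<lambda>\<omega>. b * Y \<omega>)) \<theta> = (\<integral>\<omega>. iexp (\<theta> * (b * Y \<omega>)) \<partial>M)"
      unfolding char_def by (rule integral_distr[OF bm]) simp
    also have "\<dots> = (\<integral>\<omega>. complex_of_real (cos (\<theta> * b * Y \<omega>)) + \<i> * complex_of_real (sin (\<theta> * b * Y \<omega>)) \<partial>M)"
      by (rule Bochner_Integration.integral_cong) (auto simp: exp_Euler cos_of_real sin_of_real mult.assoc simp del: of_real_mult)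
    also have "\<dots> = complex_of_real (\<integral>\<omega>. cos (\<theta> * b * Y \<omega>) \<partial>M) + \<i> * complex_of_real (\<integral>\<omega>. sin (\<theta> * b * Y \<omega>) \<partial>M)"
      using ci si by (subst Bochner_Integration.integral_add) auto
    finally show ?thesis by (simp add: char)
  qed
  show ?thesis
  proof (cases "v = 0")
    case True
    have "distr M borel Y = return borel 0"
    proof (rule Levy_uniqueness)
      show "real_distribution (distr M borel Y)" using Y by (rule real_distribution_distr)
      have "prob_space (return borel (0::real))" by (rule prob_space_return) simp
      then show "real_distribution (return borel (0::real))"
        by (simp add: real_distribution_def real_distribution_axioms_def)
      show "char (distr M borel Y) = char (return borel 0)"
        using ch[of 1] True by (auto simp: char_def integral_return)
    qed
    moreover have "AE x in return borel (0::real). x = 0" by (subst AE_return) auto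
    ultimately have "AE x in distr M borel Y. x = 0" by (simp only:)
    then have "AE \<omega> in M. Y \<omega> = 0" using Y by (simp add: AE_distr_iff)
    then show ?thesis using Y by (auto simp: gaussian_variable_def)
  next
    case False
    then have v: "0 < v" using v0 by simp
    let ?s = "sqrt v"
    have sq: "(1 / ?s)\<^sup>2 * v = 1" using v by (simp add: power_divide)
    have Ym: "(\<lambda>\<omega>. 1 / ?s * Y \<omega>) \<in> borel_measurable M" using Y by simp
    have "distr M borel (\<lambda>\<omega>. 1 / ?s * Y \<omega>) = std_normal_distribution"
    proof (rule Levy_uniqueness[OF real_distribution_distr[OF Ym] real_dist_normal_dist])
      show "char (distr M borel (\<lambda>\<omega>. 1 / ?s * Y \<omega>)) = char std_normal_distribution"
        unfolding char_std_normal_distribution ch power_mult_distrib mult.assoc sq by simp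
    qed
    then have "distributed M lborel (\<lambda>\<omega>. 1 / ?s * Y \<omega>) std_normal_density"
      using Ym by (auto simp: distributed_def cong: distr_cong)
    from normal_density_affine[OF this, of ?s 0]
    have "distributed M lborel Y (normal_density 0 ?s)" using v by simp
    then show ?thesis using Y v unfolding gaussian_variable_def by (intro conjI disjI2 exI[of _ 0] exI[of _ ?s]) auto
  qed
qed

lemma gaussian_variable_integrable:
  assumes "prob_space N" "gaussian_variable N Y"
  shows "integrable N Y"
proof -
  interpret prob_space N by fact
  have Y: "Y \<in> borel_measurable N" using assms(2) by (simp add: gaussian_variable_def)
  consider m where "AE \<omega> in N. Y \<omega> = m" | m \<sigma> where "0 < \<sigma>" "distributed N lborel Y (normal_density m \<sigma>)"
    using assms(2) by (auto simp: gaussian_variable_def)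
  then show ?thesis
  proof cases
    case 1
    then have "integrable N Y \<longleftrightarrow> integrable N (\<lambda>_. m)" using Y by (intro integrable_cong_AE) auto
    then show ?thesis by simp
  next
    case 2
    have "integrable lborel (\<lambda>x. normal_density m \<sigma> x * x)" using 2(1) by (rule integrable_normal_moment_nz_1)
    then show ?thesis using distributed_integrable[OF 2(2), of "\<lambda>x. x"] by simp
  qed
qed

section \<open>Gaussian path laws from rational data\<close>

text \<open>A list of pairs of a time and a coefficient. Lists of rational pairs form a countable
  type, so almost sure statements about all of them hold simultaneously.\<close>

definition lin :: "(real \<times> real) list \<Rightarrow> (real \<Rightarrow> real) \<Rightarrow> real" where
  "lin L w = (\<Sum>i<length L. snd (L ! i) * w (fst (L ! i)))"

text \<open>The variance that \<open>lin L\<close> has under a centered Gaussian law with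
  independent increments and variance \<open>a t\<close> at time \<open>t\<close>.\<close>

definition covar :: "(real \<Rightarrow> real) \<Rightarrow> (real \<times> real) list \<Rightarrow> real" where
  "covar a L = (\<Sum>i<length L. \<Sum>j<length L. snd (L ! i) * snd (L ! j) * a (min (fst (L ! i)) (fst (L ! j))))"

definition rat_pairs :: "(rat \<times> rat) list \<Rightarrow> (real \<times> real) list" where
  "rat_pairs ps = map (\<lambda>p. (real_of_rat (fst p), real_of_rat (snd p))) ps"

definition below :: "(rat \<times> rat) list \<Rightarrow> (real \<Rightarrow> real) set" where
  "below ps = {w\<in>W. \<forall>p\<in>set ps. w (real_of_rat (fst p)) \<le> real_of_rat (snd p)}"

lemma lin_measurable: "lin L \<in> borel_measurable path_space"
  unfolding lin_def[abs_def] by (intro borel_measurable_sum borel_measurable_times borel_measurable_const eval_measurable)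

lemma cos_lin_measurable: "(\<lambda>w. cos (lin L w)) \<in> borel_measurable path_space"
  and sin_lin_measurable: "(\<lambda>w. sin (lin L w)) \<in> borel_measurable path_space"
  by (rule measurable_compose[OF lin_measurable borel_measurable_continuous_onI]; intro continuous_intros)+

lemma sin_inc_measurable: "(\<lambda>w. sin (c * (w q - w r))) \<in> borel_measurable path_space"
proof -
  have "(\<lambda>w. w q - w r) \<in> borel_measurable path_space" by (intro borel_measurable_diff eval_measurable)
  then show ?thesis by (rule measurable_compose[OF _ borel_measurable_continuous_onI]) (intro continuous_intros)
qed

lemma below_sets: "below ps \<in> sets path_space"
proof -
  have "Measurable.pred path_space (\<lambda>w. \<forall>p\<in>set ps. w (real_of_rat (fst p)) \<le> real_of_rat (snd p))"
    by (rule pred_intros_finite(3)) (simp, unfold pred_def, rule borel_measurable_le[OF eval_measurable], simp)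
  then show ?thesis by (simp add: below_def pred_def)
qed

text \<open>The assumptions concern rational data only. They are countably many and thus hold
  together for almost every conditional law; path continuity extends them to real times.\<close>

locale gaussian_path_law = prob_space N for N :: "(real \<Rightarrow> real) measure" +
  fixes a :: "real \<Rightarrow> real"
  assumes sets_N: "sets N = sets path_space" and a_cont: "continuous_on {0..} a"
    and char_rat: "\<And>ps. (\<forall>p\<in>set ps. 0 \<le> fst p) \<Longrightarrow>
      (\<integral>w. cos (lin (rat_pairs ps) w) \<partial>N) = exp (- covar a (rat_pairs ps) / 2) \<and> (\<integral>w. sin (lin (rat_pairs ps) w) \<partial>N) = 0"
    and inc_rat: "\<And>r q m ps. 0 \<le> r \<Longrightarrow> r \<le> q \<Longrightarrow> (\<forall>p\<in>set ps. 0 \<le> fst p \<and> fst p \<le> r) \<Longrightarrow>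
      (\<integral>w. sin (1 / real (Suc m) * (w (real_of_rat q) - w (real_of_rat r))) * indicator (below ps) w \<partial>N) = 0"
begin

lemma N_measurable: "f \<in> path_space \<rightarrow>\<^sub>M L \<Longrightarrow> f \<in> N \<rightarrow>\<^sub>M L"
  using measurable_cong_sets[OF sets_N refl] by blast

lemma space_N: "space N = W"
  using sets_N by (rule sets_eq_imp_space_eq)

text \<open>Round all times and coefficients up to rationals. Paths and \<open>a\<close> are
  continuous, and the integrands are bounded by one.\<close>

lemma char_real:
  assumes L: "\<forall>p\<in>set L. 0 \<le> fst p"
  shows "(\<integral>w. cos (lin L w) \<partial>N) = exp (- covar a L / 2)" "(\<integral>w. sin (lin L w) \<partial>N) = 0"
proof -
  define ps where "ps k = map (\<lambda>p. (rat_above k (fst p), rat_above k (snd p))) L" for k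
  let ?L = "\<lambda>k. rat_pairs (ps k)"
  have len: "length (?L k) = length L" for k by (simp add: rat_pairs_def ps_def)
  have nth: "?L k ! i = (real_of_rat (rat_above k (fst (L ! i))), real_of_rat (rat_above k (snd (L ! i))))" if "i < length L" for i k
    using that by (simp add: rat_pairs_def ps_def)
  have pos: "0 \<le> fst (L ! i)" if "i < length L" for i using L that by auto
  have nn: "\<forall>p\<in>set (ps k). 0 \<le> fst p" for k
    using L rat_above_nonneg by (auto simp: ps_def)
  have lim: "(\<lambda>k. lin (?L k) w) \<longlonglongrightarrow> lin L w" if w: "w \<in> W" for w
    unfolding lin_def len
  proof (intro tendsto_sum tendsto_mult)
    fix i assume "i \<in> {..<length L}"
    then have i: "i < length L" by simp
    show "(\<lambda>k. snd (?L k ! i)) \<longlonglongrightarrow> snd (L ! i)" unfolding nth[OF i] snd_conv by (rule rat_above_tendsto)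
    show "(\<lambda>k. w (fst (?L k ! i))) \<longlonglongrightarrow> w (fst (L ! i))" unfolding nth[OF i] fst_conv
      by (rule continuous_on_tendsto_compose[OF W_cont[OF w] rat_above_tendsto])
        (use pos[OF i] rat_above_nonneg in \<open>auto simp del: zero_le_of_rat_iff\<close>)
  qed
  have cov: "(\<lambda>k. covar a (?L k)) \<longlonglongrightarrow> covar a L"
    unfolding covar_def len
  proof (intro tendsto_sum tendsto_mult)
    fix i j assume "i \<in> {..<length L}" "j \<in> {..<length L}"
    then have ij: "i < length L" "j < length L" by auto
    show "(\<lambda>k. snd (?L k ! i)) \<longlonglongrightarrow> snd (L ! i)" "(\<lambda>k. snd (?L k ! j)) \<longlonglongrightarrow> snd (L ! j)"
      unfolding nth[OF ij(1)] nth[OF ij(2)] snd_conv by (rule rat_above_tendsto)+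
    show "(\<lambda>k. a (min (fst (?L k ! i)) (fst (?L k ! j)))) \<longlonglongrightarrow> a (min (fst (L ! i)) (fst (L ! j)))"
      unfolding nth[OF ij(1)] nth[OF ij(2)] fst_conv
      by (rule continuous_on_tendsto_compose[OF a_cont tendsto_min[OF rat_above_tendsto rat_above_tendsto]])
        (use pos[OF ij(1)] pos[OF ij(2)] rat_above_nonneg in \<open>auto simp del: zero_le_of_rat_iff\<close>)
  qed
  have "(\<lambda>k. \<integral>w. cos (lin (?L k) w) \<partial>N) \<longlonglongrightarrow> (\<integral>w. cos (lin L w) \<partial>N)"
    by (rule integral_dominated_convergence[where w="\<lambda>_. 1"])
      (auto intro!: N_measurable cos_lin_measurable AE_I2 tendsto_cos lim simp: space_N)
  moreover have "(\<lambda>k. exp (- covar a (?L k) / 2)) \<longlonglongrightarrow> exp (- covar a L / 2)"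
    by (intro tendsto_intros cov) simp
  ultimately show "(\<integral>w. cos (lin L w) \<partial>N) = exp (- covar a L / 2)"
    using char_rat[OF nn] by (simp add: LIMSEQ_unique)
  have "(\<lambda>k. \<integral>w. sin (lin (?L k) w) \<partial>N) \<longlonglongrightarrow> (\<integral>w. sin (lin L w) \<partial>N)"
    by (rule integral_dominated_convergence[where w="\<lambda>_. 1"])
      (auto intro!: N_measurable sin_lin_measurable AE_I2 tendsto_sin lim simp: space_N)
  then show "(\<integral>w. sin (lin L w) \<partial>N) = 0"
    using char_rat[OF nn] by (simp add: LIMSEQ_const_iff)
qed

lemma gaussian_process_N: "gaussian_process N (\<lambda>t w. w t)"
  unfolding gaussian_process_def
proof (intro allI impI)
  fix S :: "real set" and c :: "real \<Rightarrow> real" assume S: "finite S \<and> S \<subseteq> {0..}"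
  define xs where "xs = sorted_list_of_set S"
  have xs: "distinct xs" "set xs = S" using S by (auto simp: xs_def)
  define L where "L \<theta> = map (\<lambda>t. (t, \<theta> * c t)) xs" for \<theta>
  have Ln: "length (L \<theta>) = length xs" for \<theta> by (simp add: L_def)
  have lin: "lin (L \<theta>) w = \<theta> * (\<Sum>t\<in>S. c t * w t)" for \<theta> w
  proof -
    have "lin (L \<theta>) w = (\<Sum>i<length xs. \<theta> * (c (xs ! i) * w (xs ! i)))"
      unfolding lin_def Ln by (rule sum.cong) (auto simp: L_def)
    also have "\<dots> = \<theta> * (\<Sum>i<length xs. c (xs ! i) * w (xs ! i))" by (simp only: sum_distrib_left)
    also have "(\<Sum>i<length xs. c (xs ! i) * w (xs ! i)) = sum_list (map (\<lambda>t. c t * w t) xs)"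
      by (simp add: sum_list_sum_nth atLeast0LessThan)
    also have "\<dots> = (\<Sum>t\<in>S. c t * w t)" using xs by (simp add: sum_list_distinct_conv_sum_set)
    finally show ?thesis .
  qed
  have cov: "covar a (L \<theta>) = \<theta>\<^sup>2 * covar a (L 1)" for \<theta>
  proof -
    have "covar a (L \<theta>) = (\<Sum>i<length xs. \<Sum>j<length xs. \<theta>\<^sup>2 * (snd (L 1 ! i) * snd (L 1 ! j) * a (min (fst (L 1 ! i)) (fst (L 1 ! j)))))"
      unfolding covar_def Ln by (intro sum.cong refl) (auto simp: L_def power2_eq_square)
    then show ?thesis by (simp add: covar_def Ln sum_distrib_left)
  qed
  have pos: "\<forall>p\<in>set (L \<theta>). 0 \<le> fst p" for \<theta> using S xs by (auto simp: L_def)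
  show "gaussian_variable N (\<lambda>w. \<Sum>t\<in>S. c t * w t)"
  proof (rule gaussian_variableI[where v="covar a (L 1)"])
    show "(\<lambda>w. \<Sum>t\<in>S. c t * w t) \<in> borel_measurable N"
      by (intro N_measurable borel_measurable_sum borel_measurable_times borel_measurable_const eval_measurable)
    show "(\<integral>w. cos (\<theta> * (\<Sum>t\<in>S. c t * w t)) \<partial>N) = exp (- (\<theta>\<^sup>2 * covar a (L 1)) / 2)" for \<theta>
      using char_real(1)[OF pos, of \<theta>] unfolding lin cov[of \<theta>] .
    show "(\<integral>w. sin (\<theta> * (\<Sum>t\<in>S. c t * w t)) \<partial>N) = 0" for \<theta>
      using char_real(2)[OF pos, of \<theta>] unfolding lin .
  qed
qed

lemma integrable_N: "0 \<le> t \<Longrightarrow> integrable N (\<lambda>w. w t)"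
  using gaussian_process_N[unfolded gaussian_process_def, rule_format, of "{t}" "\<lambda>_. 1"]
  by (intro gaussian_variable_integrable prob_space_axioms) simp

definition cylinders :: "rat \<Rightarrow> (real \<Rightarrow> real) set set" where
  "cylinders r = {below ps | ps. \<forall>p\<in>set ps. 0 \<le> fst p \<and> fst p \<le> r}"

lemma cylinders_sub: "cylinders r \<subseteq> Pow W"
  by (auto simp: cylinders_def below_def)

text \<open>The rational cylinders are stable under intersection, and the sets with vanishing
  integral are closed under complements and disjoint unions; the whole space is the cylinder of the
  empty list.\<close>

lemma inc_cylinder:
  assumes r: "0 \<le> r" "r \<le> q" and A: "A \<in> sigma_sets W (cylinders r)"
  shows "(\<integral>w. sin (1 / real (Suc m) * (w (real_of_rat q) - w (real_of_rat r))) * indicator A w \<partial>N) = 0"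
proof -
  let ?f = "\<lambda>w. sin (1 / real (Suc m) * (w (real_of_rat q) - w (real_of_rat r)))"
  have sm: "A \<in> sets N" if "A \<in> sigma_sets W (cylinders r)" for A
  proof -
    have "cylinders r \<subseteq> sets path_space" using below_sets by (auto simp: cylinders_def)
    then show ?thesis using that sets.sigma_sets_subset[of "cylinders r" path_space] sets_N by auto
  qed
  have fm: "?f \<in> borel_measurable N" by (rule N_measurable[OF sin_inc_measurable])
  have fi: "integrable N (\<lambda>w. ?f w * indicator A w)" if "A \<in> sets N" for A
    using fm that by (intro integrable_const_bound[where B=1]) (auto simp: abs_mult indicator_def)
  have stab: "Int_stable (cylinders r)"
  proof (rule Int_stableI)
    fix A B assume "A \<in> cylinders r" "B \<in> cylinders r"
    then obtain ps qs where "A = below ps" "B = below qs" "\<forall>p\<in>set ps. 0 \<le> fst p \<and> fst p \<le> r" "\<forall>p\<in>set qs. 0 \<le> fst p \<and> fst p \<le> r"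
      by (auto simp: cylinders_def)
    then show "A \<inter> B \<in> cylinders r" unfolding cylinders_def
      by (intro CollectI exI[of _ "ps @ qs"]) (auto simp: below_def)
  qed
  from stab cylinders_sub A show ?thesis
  proof (induction rule: sigma_sets_induct_disjoint)
    case (basic A)
    then show ?case using inc_rat[OF r] by (auto simp: cylinders_def)
  next
    case empty
    then show ?case by simp
  next
    case (compl A)
    have "(\<integral>w. ?f w * indicator W w \<partial>N) = 0" using inc_rat[OF r, of "[]" m] by (simp add: below_def)
    moreover have "W \<in> sets N" using sets.top[of N] by (simp add: space_N)
    moreover have "(\<integral>w. ?f w * indicator (W - A) w \<partial>N) = (\<integral>w. ?f w * indicator W w - ?f w * indicator A w \<partial>N)"
      using sets.sets_into_space[OF sm[OF compl(1)]]
      by (intro Bochner_Integration.integral_cong refl) (auto simp: indicator_def space_N)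
    ultimately show ?case using compl fi[OF sm] fi by simp
  next
    case (union B)
    have Bm: "B i \<in> sets N" for i using union(2) sm by auto
    have "(\<integral>w\<in>(\<Union>i. B i). ?f w \<partial>N) = (\<Sum>i. \<integral>w\<in>B i. ?f w \<partial>N)"
    proof (rule lebesgue_integral_countable_add[OF Bm])
      show "set_integrable N (\<Union>i. B i) ?f" unfolding set_integrable_def
        using fi[of "\<Union>i. B i"] Bm by (simp add: mult.commute)
    qed (use union(1) in \<open>auto simp: disjoint_family_on_def\<close>)
    then show ?case using union.IH by (simp add: set_lebesgue_integral_def mult.commute)
  qed
qed

text \<open>Every time up to \<open>s\<close> is a limit of rational times not exceeding
  \<open>r\<close>. The strict inequality between \<open>s\<close> and \<open>r\<close> leaves room
  to approximate from the right.\<close>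

lemma filtration_cylinders:
  assumes sr: "0 \<le> s" "s < real_of_rat r"
  shows "sets (natural_filtration N (\<lambda>t w. w t) s) \<subseteq> sigma_sets W (cylinders r)"
proof -
  let ?S = "sigma W (cylinders r)"
  have S: "space ?S = W" "sets ?S = sigma_sets W (cylinders r)"
    using cylinders_sub by (auto simp: space_measure_of sets_measure_of)
  have rat: "(\<lambda>w. w (real_of_rat p)) \<in> borel_measurable ?S" if p: "0 \<le> p" "p \<le> r" for p
  proof (rule borel_measurableI_le)
    fix y
    have "Measurable.pred ?S (\<lambda>w. y < real_of_rat c \<longrightarrow> w (real_of_rat p) \<le> real_of_rat c)" for c
    proof (cases "y < real_of_rat c")
      case True
      have "below [(p, c)] \<in> cylinders r" unfolding cylinders_def using p by (intro CollectI exI[of _ "[(p, c)]"]) auto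
      then have "{w\<in>W. w (real_of_rat p) \<le> real_of_rat c} \<in> sets ?S" unfolding S by (simp add: below_def)
      then show ?thesis using True by (simp add: pred_def S)
    qed simp
    then have "Measurable.pred ?S (\<lambda>w. \<forall>c. y < real_of_rat c \<longrightarrow> w (real_of_rat p) \<le> real_of_rat c)"
      by (rule pred_intros_countable)
    moreover have "(\<forall>c. y < real_of_rat c \<longrightarrow> z \<le> real_of_rat c) \<longleftrightarrow> z \<le> y" for z
      using of_rat_dense[of y z] by (meson less_imp_le less_le_not_le not_le order_trans)
    ultimately show "{w \<in> space ?S. w (real_of_rat p) \<le> y} \<in> sets ?S" by (simp add: pred_def)
  qed
  show ?thesis
    unfolding S(2)[symmetric]
  proof (rule natural_filtration_le)
    show "space ?S = space N" by (simp add: S space_N)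
    fix u assume u: "0 \<le> u" "u \<le> s"
    let ?p = "\<lambda>n. min (rat_above n u) r"
    have p: "0 \<le> ?p n" "?p n \<le> r" for n
      using rat_above_nonneg[OF u(1), of n] u sr by (auto simp: min_def) (metis less_le_trans less_imp_le order_trans zero_le_of_rat_iff)
    show "(\<lambda>w. w u) \<in> borel_measurable ?S"
    proof (rule borel_measurable_LIMSEQ_real)
      show "(\<lambda>w. w (real_of_rat (?p n))) \<in> borel_measurable ?S" for n by (rule rat[OF p])
      fix w assume "w \<in> space ?S"
      then have w: "w \<in> W" by (simp add: S)
      have eq: "real_of_rat (?p n) = min (real_of_rat (rat_above n u)) (real_of_rat r)" for n
        by (simp add: min_def of_rat_less_eq)
      have "(\<lambda>n. min (real_of_rat (rat_above n u)) (real_of_rat r)) \<longlonglongrightarrow> min u (real_of_rat r)"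
        by (intro tendsto_min rat_above_tendsto tendsto_const)
      then have "(\<lambda>n. real_of_rat (?p n)) \<longlonglongrightarrow> u" unfolding eq using u sr by (simp add: min_def)
      then show "(\<lambda>n. w (real_of_rat (?p n))) \<longlonglongrightarrow> w u"
        by (rule continuous_on_tendsto_compose[OF W_cont[OF w]]) (use u p in auto)
    qed
  qed
qed

text \<open>Let a rational time decrease to \<open>s\<close>, so that its cylinders contain the past
  of \<open>s\<close>, and then pass from sines to increments. Under the Gaussian law the increments
  are integrable and dominate the quotients.\<close>

theorem gaussian_martingale_N: "gaussian_martingale N (\<lambda>t w. w t)"
  unfolding gaussian_martingale_def
proof (intro conjI gaussian_process_N martingaleI prob_space_axioms filtration_natural adapted_natural
    natural_filtration_subalgebra N_measurable eval_measurable integrable_N)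
  fix s t :: real and A assume st: "0 \<le> s" "s \<le> t" and A: "A \<in> sets (natural_filtration N (\<lambda>t w. w t) s)"
  have Am: "A \<in> sets N"
    using A natural_filtration_subalgebra[of "\<lambda>t w. w t" N s] N_measurable[OF eval_measurable] by (auto simp: subalgebra_def)
  show "(\<integral>w. (w t - w s) * indicator A w \<partial>N) = 0"
  proof (cases "s = t")
    case False
    then have lt: "s < t" using st by simp
    have sin0: "(\<integral>w. sin (1 / real (Suc m) * (w t - w s)) * indicator A w \<partial>N) = 0" for m
    proof -
      have "\<exists>r. s < real_of_rat r \<and> real_of_rat r < min t (s + 1 / real (Suc k))" for k
        using of_rat_dense[of s "min t (s + 1 / real (Suc k))"] lt by auto
      then obtain r where r: "\<And>k. s < real_of_rat (r k)" "\<And>k. real_of_rat (r k) < min t (s + 1 / real (Suc k))" by metis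
      have "(\<lambda>k. real_of_rat (r k)) \<longlonglongrightarrow> s"
      proof (rule tendsto_sandwich)
        show "\<forall>\<^sub>F n in sequentially. s \<le> real_of_rat (r n)" by (intro always_eventually allI less_imp_le r(1))
        show "\<forall>\<^sub>F n in sequentially. real_of_rat (r n) \<le> s + 1 / real (Suc n)"
          by (intro always_eventually allI less_imp_le less_le_trans[OF r(2) min.cobounded2])
        have "(\<lambda>n. s + 1 / real (Suc n)) \<longlonglongrightarrow> s + 0" by (rule tendsto_add[OF tendsto_const inverse_Suc_tendsto])
        then show "(\<lambda>n. s + 1 / real (Suc n)) \<longlonglongrightarrow> s" by simp
      qed (rule tendsto_const)
      note rlim = this
      have rt: "real_of_rat (r k) < t" for k by (rule less_le_trans[OF r(2) min.cobounded1])
      have tq: "t \<le> real_of_rat (rat_above k t)" for k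
        unfolding real_rat_above
        by (simp only: pos_le_divide_eq of_nat_0_less_iff zero_less_Suc mult.commute[of t] le_of_int_ceiling)
      let ?g = "\<lambda>k w. sin (1 / real (Suc m) * (w (real_of_rat (rat_above k t)) - w (real_of_rat (r k)))) * indicator A w"
      have z: "(\<integral>w. ?g k w \<partial>N) = 0" for k
      proof (rule inc_cylinder)
        have "0 \<le> real_of_rat (r k)" using r(1)[of k] st by linarith
        then show "0 \<le> r k" by simp
        have "real_of_rat (r k) \<le> real_of_rat (rat_above k t)" using rt[of k] tq[of k] by linarith
        then show "r k \<le> rat_above k t" by (simp add: of_rat_less_eq)
        show "A \<in> sigma_sets W (cylinders (r k))" using filtration_cylinders[OF st(1) r(1)] A by blast
      qed
      have "(\<lambda>k. \<integral>w. ?g k w \<partial>N) \<longlonglongrightarrow> (\<integral>w. sin (1 / real (Suc m) * (w t - w s)) * indicator A w \<partial>N)"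
      proof (rule integral_dominated_convergence[where w="\<lambda>_. 1"])
        show "AE w in N. (\<lambda>k. ?g k w) \<longlonglongrightarrow> sin (1 / real (Suc m) * (w t - w s)) * indicator A w"
        proof (intro AE_I2 tendsto_mult tendsto_sin tendsto_diff tendsto_const)
          fix w assume "w \<in> space N"
          then have w: "w \<in> W" by (simp add: space_N)
          show "(\<lambda>k. w (real_of_rat (rat_above k t))) \<longlonglongrightarrow> w t"
            by (rule continuous_on_tendsto_compose[OF W_cont[OF w] rat_above_tendsto])
              (use st tq order_trans in \<open>auto simp del: zero_le_of_rat_iff intro!: always_eventually rat_above_nonneg\<close>)
          show "(\<lambda>k. w (real_of_rat (r k))) \<longlonglongrightarrow> w s"
            by (rule continuous_on_tendsto_compose[OF W_cont[OF w] rlim])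
              (use st r(1) in \<open>auto simp del: zero_le_of_rat_iff intro!: always_eventually less_imp_le le_less_trans[OF st(1)]\<close>)
        qed
        show "AE w in N. norm (?g k w) \<le> 1" for k by (intro AE_I2) (auto simp: abs_mult indicator_def)
      qed (intro borel_measurable_times N_measurable sin_inc_measurable borel_measurable_indicator Am integrable_const)+
      then show ?thesis unfolding z by (simp add: LIMSEQ_const_iff)
    qed
    define h where "h n = 1 / real (Suc n)" for n
    have h: "0 < h n" "h n \<noteq> 0" for n by (simp_all add: h_def)
    have h0: "h \<longlonglongrightarrow> 0" unfolding h_def by (rule inverse_Suc_tendsto)
    have "(\<lambda>n. \<integral>w. sin (h n * (w t - w s)) / h n * indicator A w \<partial>N) \<longlonglongrightarrow> (\<integral>w. (w t - w s) * indicator A w \<partial>N)"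
    proof (rule integral_dominated_convergence[where w="\<lambda>w. \<bar>w t - w s\<bar>"])
      show "integrable N (\<lambda>w. \<bar>w t - w s\<bar>)" using st by (intro integrable_abs Bochner_Integration.integrable_diff integrable_N) auto
      show "AE w in N. (\<lambda>n. sin (h n * (w t - w s)) / h n * indicator A w) \<longlonglongrightarrow> (w t - w s) * indicator A w"
      proof (intro AE_I2 tendsto_mult tendsto_const)
        fix w :: "real \<Rightarrow> real"
        have "((\<lambda>y. sin (y * (w t - w s))) has_real_derivative (w t - w s)) (at 0)" by (auto intro!: derivative_eq_intros)
        then show "(\<lambda>n. sin (h n * (w t - w s)) / h n) \<longlonglongrightarrow> w t - w s" by (rule derivative_along[OF _ _ h0 h(2)]) simp
      qed
      show "AE w in N. norm (sin (h n * (w t - w s)) / h n * indicator A w) \<le> \<bar>w t - w s\<bar>" for n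
      proof (rule AE_I2)
        fix w
        have "\<bar>sin (h n * (w t - w s))\<bar> \<le> \<bar>h n * (w t - w s)\<bar>" by (rule abs_sin_x_le_abs_x)
        then have "\<bar>sin (h n * (w t - w s)) / h n\<bar> \<le> \<bar>w t - w s\<bar>" using h(1)[of n] by (simp add: abs_mult pos_divide_le_eq mult.commute)
        then show "norm (sin (h n * (w t - w s)) / h n * indicator A w) \<le> \<bar>w t - w s\<bar>" by (auto simp: indicator_def)
      qed
    qed (intro borel_measurable_times borel_measurable_divide borel_measurable_const N_measurable[OF sin_inc_measurable]
        borel_measurable_diff N_measurable[OF eval_measurable] borel_measurable_indicator Am)+
    moreover have "(\<integral>w. sin (h n * (w t - w s)) / h n * indicator A w \<partial>N) = 0" for n
    proof -
      have "(\<integral>w. sin (h n * (w t - w s)) / h n * indicator A w \<partial>N) = (\<integral>w. 1 / h n * (sin (h n * (w t - w s)) * indicator A w) \<partial>N)"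
        by (rule Bochner_Integration.integral_cong) auto
      also have "\<dots> = 1 / h n * (\<integral>w. sin (h n * (w t - w s)) * indicator A w \<partial>N)" by (rule integral_mult_right_zero)
      finally show ?thesis unfolding h_def sin0 by simp
    qed
    ultimately have "(\<lambda>n::nat. 0) \<longlonglongrightarrow> (\<integral>w. (w t - w s) * indicator A w \<partial>N)" by (simp only:)
    then show ?thesis by (simp add: LIMSEQ_const_iff)
  qed simp
qed

end

text \<open>The minimum of two nonnegative numbers is the inner product of the indicators of two
  intervals starting at \<open>0\<close>, so the form is the integral of a square.\<close>

lemma sum_min_nonneg:
  fixes c x :: "nat \<Rightarrow> real"
  assumes x: "\<And>i. i < n \<Longrightarrow> 0 \<le> x i"
  shows "0 \<le> (\<Sum>i<n. \<Sum>j<n. c i * c j * min (x i) (x j))"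
proof -
  have ind: "indicator {0..min p q} t = indicator {0..p} t * (indicator {0..q} t :: real)" for p q t :: real
    by (auto simp: indicator_def)
  have m: "(\<integral>t. c i * c j * indicator {0..min (x i) (x j)} t \<partial>lborel) = c i * c j * min (x i) (x j)"
    and i: "integrable lborel (\<lambda>t. c i * c j * indicator {0..min (x i) (x j)} t)" if "i < n" "j < n" for i j
    using x[OF that(1)] x[OF that(2)] by (auto simp: integrable_indicator_iff)
  have "(\<Sum>i<n. \<Sum>j<n. c i * c j * min (x i) (x j)) = (\<Sum>i<n. \<Sum>j<n. \<integral>t. c i * c j * indicator {0..min (x i) (x j)} t \<partial>lborel)"
    by (intro sum.cong refl m[symmetric]) auto
  also have "\<dots> = (\<Sum>i<n. \<integral>t. (\<Sum>j<n. c i * c j * indicator {0..min (x i) (x j)} t) \<partial>lborel)"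
    by (intro sum.cong refl Bochner_Integration.integral_sum[symmetric] i) auto
  also have "\<dots> = (\<integral>t. (\<Sum>i<n. \<Sum>j<n. c i * c j * indicator {0..min (x i) (x j)} t) \<partial>lborel)"
    by (intro Bochner_Integration.integral_sum[symmetric] Bochner_Integration.integrable_sum i) auto
  also have "\<dots> = (\<integral>t. (\<Sum>i<n. c i * indicator {0..x i} t)\<^sup>2 \<partial>lborel)"
    by (rule Bochner_Integration.integral_cong) (simp_all only: power2_eq_square sum_product ind mult_ac)
  also have "\<dots> \<ge> 0" by simp
  finally show ?thesis .
qed

text \<open>Monotonicity turns \<open>qv\<close> at a minimum of times into a minimum of values. The
  resulting sign bounds the conditional characteristic function by one, which gives its
  integrability.\<close>

lemma covar_qv_nonneg:
  assumes w: "w \<in> W" and L: "\<forall>p\<in>set L. 0 \<le> fst p"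
  shows "0 \<le> covar (\<lambda>t. qv t w) L"
proof -
  have n: "0 \<le> fst (L ! i)" if "i < length L" for i using L nth_mem[OF that] by blast
  have "qv (min (fst (L ! i)) (fst (L ! j))) w = min (qv (fst (L ! i)) w) (qv (fst (L ! j)) w)"
    if "i < length L" "j < length L" for i j
  proof (cases "fst (L ! i) \<le> fst (L ! j)")
    case True
    then show ?thesis using qv_mono[OF w n[OF that(1)] True] by (simp add: min_def)
  next
    case False
    then show ?thesis using qv_mono[OF w n[OF that(2)], of "fst (L ! i)"] by (auto simp: min_def)
  qed
  then have "covar (\<lambda>t. qv t w) L = (\<Sum>i<length L. \<Sum>j<length L. snd (L ! i) * snd (L ! j) * min (qv (fst (L ! i)) w) (qv (fst (L ! j)) w))"
    unfolding covar_def by (intro sum.cong refl) simp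
  then show ?thesis using sum_min_nonneg[of "length L" "\<lambda>i. qv (fst (L ! i)) w" "\<lambda>i. snd (L ! i)"] n qv_nonneg[OF w] by simp
qed

section \<open>Localizing times\<close>

lemma incseq_tendsto_top:
  fixes f :: "nat \<Rightarrow> ennreal"
  assumes "incseq f" "\<And>N::nat. \<exists>n. ennreal (real N) \<le> f n"
  shows "f \<longlonglongrightarrow> \<top>"
proof -
  have "(SUP n. f n) = \<top>"
    by (rule ennreal_SUP_eq_top) (use assms(2) in \<open>auto simp: ennreal_of_nat_eq_real_of_nat\<close>)
  then show ?thesis using LIMSEQ_SUP[OF assms(1)] by (simp only:)
qed

definition exit :: "real \<Rightarrow> (real \<Rightarrow> real) \<Rightarrow> ennreal" where
  "exit c w = min (hit (\<lambda>_. 0) c w) (hit (\<lambda>_. 0) (- c) w)"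

lemma adm_exit: "0 < c \<Longrightarrow> adm (exit c)"
  unfolding exit_def[abs_def] by (intro adm_min adm_hit adm_const) auto

lemma exit_IVT: "w \<in> W \<Longrightarrow> 0 < c \<Longrightarrow> 0 \<le> t \<Longrightarrow> c \<le> \<bar>w t\<bar> \<Longrightarrow> exit c w \<le> ennreal t"
  using hit_IVT[of w t "\<lambda>_. 0" c] W_zero[of w] by (auto simp: exit_def min_le_iff_disj)

lemma exit_value:
  assumes w: "w \<in> W" and t: "exit c w = ennreal t" "0 \<le> t"
  shows "\<bar>w t\<bar> = \<bar>c\<bar>"
proof -
  have "hit (\<lambda>_. 0) c w = ennreal t \<or> hit (\<lambda>_. 0) (- c) w = ennreal t"
    using t(1) by (auto simp: exit_def min_def split: if_splits)
  then have "w t - w 0 = c \<or> w t - w 0 = - c"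
    using hit_finite(2)[OF w _ t(2), of "\<lambda>_. 0"] by auto
  then show ?thesis using W_zero[OF w] by auto
qed

lemma exit_bound:
  assumes w: "w \<in> W" and c: "0 < c" and r: "0 \<le> r" "ennreal r \<le> exit c w"
  shows "\<bar>w r\<bar> \<le> c"
proof (rule ccontr)
  assume "\<not> \<bar>w r\<bar> \<le> c"
  then have "exit c w = ennreal r" using exit_IVT[OF w c r(1)] r(2) by (intro antisym) auto
  from exit_value[OF w this r(1)] c \<open>\<not> \<bar>w r\<bar> \<le> c\<close> show False by simp
qed

lemma exit_mono:
  assumes w: "w \<in> W" and c: "0 < c" "c \<le> d"
  shows "exit c w \<le> exit d w"
proof (cases "exit d w")
  case (real t)
  then have "\<bar>w t\<bar> = d" using exit_value[OF w, of d t] c by simp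
  then show ?thesis using exit_IVT[OF w c(1), of t] real c by simp
qed simp

lemma exit_unbounded:
  assumes w: "w \<in> W"
  shows "\<exists>n. ennreal (real N) \<le> exit (real (Suc n)) w"
proof -
  have "compact ((\<lambda>t. w t) ` {0..real N})"
    by (intro compact_continuous_image continuous_on_subset[OF W_cont[OF w]]) auto
  then obtain C where C: "\<And>t. t \<in> {0..real N} \<Longrightarrow> \<bar>w t\<bar> \<le> C"
    using compact_imp_bounded bounded_iff by (metis image_eqI real_norm_def)
  obtain n where n: "C < real n" using reals_Archimedean2 by blast
  have "ennreal (real N) \<le> exit (real (Suc n)) w"
  proof (rule ccontr)
    assume a: "\<not> ennreal (real N) \<le> exit (real (Suc n)) w"
    then obtain t where t: "exit (real (Suc n)) w = ennreal t" "0 \<le> t"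
      by (cases "exit (real (Suc n)) w") auto
    then have "t \<le> real N" using a by (simp add: ennreal_le_iff2)
    then show False using exit_value[OF w t] C[of t] t(2) n by simp
  qed
  then show ?thesis ..
qed

lemma tau_unbounded:
  assumes w: "w \<in> W"
  shows "\<exists>n. ennreal (real N) \<le> tau (real (Suc n)) w"
proof -
  obtain n where n: "qv (real N) w < real n" using reals_Archimedean2 by blast
  then have "\<not> tau (real (Suc n)) w \<le> ennreal (real N)" by (subst tau_le_iff[OF w]) auto
  then have "ennreal (real N) \<le> tau (real (Suc n)) w" by (meson le_cases)
  then show ?thesis ..
qed

lemma tau_mono:
  assumes w: "w \<in> W" and c: "0 < c" "c \<le> d"
  shows "tau c w \<le> tau d w"
proof (cases "tau d w")
  case (real t)
  then have "d \<le> qv t w" using tau_le_iff[OF w, of d t] c by simp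
  then show ?thesis using tau_le_iff[OF w c(1), of t] real c by simp
qed simp

text \<open>The path stopped at \<open>s\<close> is a random element of the path space that uses
  only values up to \<open>s\<close>. Composing with it transfers nonanticipating path functions to
  the natural filtration.\<close>

lemma stopped_path_measurable:
  assumes c: "\<And>\<omega>. \<omega> \<in> space N \<Longrightarrow> continuous_on {0..} (\<lambda>t. Z t \<omega>)" and z: "\<And>\<omega>. \<omega> \<in> space N \<Longrightarrow> Z 0 \<omega> = (0::real)"
    and m: "\<And>u. 0 \<le> u \<Longrightarrow> u \<le> s \<Longrightarrow> Z u \<in> borel_measurable N" and s: "0 \<le> s"
  shows "(\<lambda>\<omega>. \<lambda>t\<in>{0..}. Z (min t s) \<omega>) \<in> N \<rightarrow>\<^sub>M path_space"
proof (rule measurable_path_spaceI)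
  fix \<omega> assume "\<omega> \<in> space N"
  then have "continuous_on {0..} (\<lambda>t. Z (min t s) \<omega>)"
    using s by (intro continuous_on_compose2[OF c] continuous_intros) auto
  then have "continuous_on {0..} (\<lambda>t\<in>{0..}. Z (min t s) \<omega>)"
    by (rule continuous_on_eq) simp
  then show "(\<lambda>t\<in>{0..}. Z (min t s) \<omega>) \<in> W"
    using z[OF \<open>\<omega> \<in> space N\<close>] s by (simp add: mem_W)
qed (use m s in simp)

lemma stopped_value_measurable:
  assumes Z: "\<And>\<omega>. \<omega> \<in> space N \<Longrightarrow> continuous_on {0..} (\<lambda>t. Z t \<omega>)" "\<And>\<omega>. \<omega> \<in> space N \<Longrightarrow> Z 0 \<omega> = (0::real)"
    "\<And>u. 0 \<le> u \<Longrightarrow> u \<le> s \<Longrightarrow> Z u \<in> borel_measurable N" and s: "0 \<le> s"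
    and T: "(\<lambda>\<omega>. cut s (T \<omega>)) \<in> borel_measurable N"
  shows "(\<lambda>\<omega>. Z (cut s (T \<omega>)) \<omega>) \<in> borel_measurable N"
  using eval_random_time[OF stopped_path_measurable[where Z=Z and s=s, OF Z s] T] cut_le[OF s]
  by (simp add: min_absorb1)

section \<open>Augmented filtrations\<close>

lemma augmented_space [simp]: "space (augmented P F t) = space P"
  by (simp add: augmented_def space_measure_of_conv)

lemma augmented_sets:
  "subalgebra P (F t) \<Longrightarrow> sets (augmented P F t) = sigma_sets (space P) (sets (F t) \<union> null_sets P)"
  unfolding augmented_def by (rule sets_measure_of) (auto simp: subalgebra_def dest!: null_setsD2 dest: sets.sets_into_space)

lemma augmented_subalgebra:
  assumes "subalgebra P (F t)" shows "subalgebra P (augmented P F t)"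
  using assms sets.sigma_sets_subset[of "sets (F t) \<union> null_sets P" P]
  unfolding subalgebra_def augmented_sets[of P F, OF assms] by auto

lemma augmented_superset:
  assumes "subalgebra P (F t)"
  shows "sets (F t) \<subseteq> sets (augmented P F t)" "null_sets P \<subseteq> sets (augmented P F t)"
  unfolding augmented_sets[of P F, OF assms] by auto

lemma augmented_measurable:
  assumes F: "subalgebra P (F t)" and f: "f \<in> borel_measurable (F t)"
  shows "f \<in> borel_measurable (augmented P F t)"
  by (rule measurable_from_subalg[OF _ f]) (use F augmented_superset(1)[of P F, OF F] in \<open>auto simp: subalgebra_def\<close>)

lemma augmented_measurable_AE:
  fixes f g :: "'a \<Rightarrow> real"
  assumes F: "subalgebra P (F t)" and f: "f \<in> borel_measurable P" and g: "g \<in> borel_measurable (augmented P F t)"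
    and eq: "AE \<omega> in P. f \<omega> = g \<omega>"
  shows "f \<in> borel_measurable (augmented P F t)"
proof (rule measurableI)
  obtain N where N: "{\<omega>\<in>space P. f \<omega> \<noteq> g \<omega>} \<subseteq> N" "N \<in> null_sets P"
    using AE_E[OF eq] by (metis (no_types, lifting) null_setsI)
  fix S :: "real set" assume S: "S \<in> sets borel"
  have 1: "f -` S \<inter> N \<in> sets (augmented P F t)"
  proof (rule subsetD[OF augmented_superset(2)[of P F, OF F]], rule null_sets_subset[OF N(2)])
    have "f -` S \<inter> N = (f -` S \<inter> space P) \<inter> N" using N(2) sets.sets_into_space by blast
    then show "f -` S \<inter> N \<in> sets P" using measurable_sets[OF f S] N(2) by auto
  qed simp
  have "N \<in> sets (augmented P F t)" using augmented_superset(2)[of P F, OF F] N(2) by blast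
  moreover have "g -` S \<inter> space P \<in> sets (augmented P F t)" using measurable_sets[OF g S] by simp
  ultimately have "(g -` S \<inter> space P) - N \<union> (f -` S \<inter> N) \<in> sets (augmented P F t)" using 1 by blast
  also have "(g -` S \<inter> space P) - N \<union> (f -` S \<inter> N) = f -` S \<inter> space P"
    using N sets.sets_into_space by fastforce
  finally show "f -` S \<inter> space (augmented P F t) \<in> sets (augmented P F t)" by simp
qed simp

text \<open>Martingale identities for the augmented filtration reduce to the natural one, because an
  almost sure change of the event does not change an integral.\<close>

lemma augmented_sets_AE:
  assumes F: "subalgebra P (F t)" and A: "A \<in> sets (augmented P F t)"
  shows "\<exists>A'\<in>sets (F t). AE \<omega> in P. \<omega> \<in> A \<longleftrightarrow> \<omega> \<in> A'"
  using A unfolding augmented_sets[of P F, OF F]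
proof (induction rule: sigma_sets.induct)
  case (Basic A)
  then show ?case
  proof
    assume "A \<in> null_sets P"
    then have "AE \<omega> in P. \<omega> \<in> A \<longleftrightarrow> \<omega> \<in> {}" using AE_not_in by fastforce
    then show ?thesis by (intro bexI[of _ "{}"]) auto
  qed (intro bexI[of _ A], auto)
next
  case Empty
  show ?case by (intro bexI[of _ "{}"]) auto
next
  case (Compl A)
  then obtain A' where A': "A' \<in> sets (F t)" "AE \<omega> in P. \<omega> \<in> A \<longleftrightarrow> \<omega> \<in> A'" by blast
  have "space P - A' \<in> sets (F t)" using A'(1) F by (metis sets.compl_sets subalgebra_def)
  then show ?case using A'(2) by (intro bexI[of _ "space P - A'"]) auto
next
  case (Union A)
  then have "\<forall>i. \<exists>A'. A' \<in> sets (F t) \<and> (AE \<omega> in P. \<omega> \<in> A i \<longleftrightarrow> \<omega> \<in> A')" by blast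
  then obtain A' where A': "\<And>i. A' i \<in> sets (F t)" "\<And>i. AE \<omega> in P. \<omega> \<in> A i \<longleftrightarrow> \<omega> \<in> A' i" by metis
  have "AE \<omega> in P. \<forall>i. \<omega> \<in> A i \<longleftrightarrow> \<omega> \<in> A' i" using A'(2) by (simp add: AE_all_countable)
  then have "AE \<omega> in P. \<omega> \<in> (\<Union>i. A i) \<longleftrightarrow> \<omega> \<in> (\<Union>i. A' i)" by eventually_elim simp
  then show ?case using A'(1) by (intro bexI[of _ "\<Union>i. A' i"]) auto
qed

lemma filtration_augmented:
  assumes F: "\<And>t. subalgebra P (F t)" "filtration (space P) F"
  shows "filtration (space P) (augmented P F)"
proof
  fix s t :: real assume "s \<le> t"
  then have "sets (F s) \<subseteq> sets (F t)" using filtration.sets_F_mono[OF F(2)] by blast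
  then show "sets (augmented P F s) \<subseteq> sets (augmented P F t)"
    unfolding augmented_sets[of P F, OF F(1)] by (intro sigma_sets_mono') auto
qed simp

lemma extended_stopping_timeI:
  assumes "\<And>r. 0 \<le> r \<Longrightarrow> Measurable.pred (F r) (\<lambda>\<omega>. \<tau> \<omega> \<le> ennreal r)"
  shows "extended_stopping_time F \<tau>"
  unfolding extended_stopping_time_def stopping_time_def
proof
  fix t :: ennreal
  show "Measurable.pred (F (enn2real t)) (\<lambda>\<omega>. \<tau> \<omega> \<le> t)"
    using assms by (cases t) auto
qed

lemma martingale_cong:
  assumes P: "prob_space P" and Y: "martingale P F Y" and eq: "\<And>t \<omega>. \<omega> \<in> space P \<Longrightarrow> Z t \<omega> = Y t \<omega>"
  shows "martingale P F Z"
proof -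
  interpret prob_space P by (rule P)
  have sF: "space (F t) = space P" if "0 \<le> t" for t using Y that by (simp add: martingale_def subalgebra_def)
  have Ym: "Y t \<in> borel_measurable P" if "0 \<le> t" for t using Y that by (auto simp: martingale_def)
  have Zm: "Z t \<in> borel_measurable P" if "0 \<le> t" for t
    using Ym[OF that] measurable_cong[of P "Z t" "Y t" borel] eq by blast
  have "adapted F Z"
    unfolding adapted_def
  proof (intro allI impI)
    fix t :: real assume t: "0 \<le> t"
    have "Y t \<in> borel_measurable (F t)" using Y t by (simp add: martingale_def adapted_def)
    then show "Z t \<in> borel_measurable (F t)"
      using measurable_cong[of "F t" "Z t" "Y t" borel] eq sF[OF t] by auto
  qed
  moreover have "integrable P (Z t)" if "0 \<le> t" for t
    using Y that Bochner_Integration.integrable_cong[of P P "Z t" "Y t"] eq by (auto simp: martingale_def)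
  moreover have "AE \<omega> in P. real_cond_exp P (F s) (Z t) \<omega> = Z s \<omega>" if st: "0 \<le> s \<and> s \<le> t" for s t
  proof -
    have "AE \<omega> in P. real_cond_exp P (F s) (Y t) \<omega> = Y s \<omega>" using Y st by (simp add: martingale_def)
    moreover have "AE \<omega> in P. real_cond_exp P (F s) (Z t) \<omega> = real_cond_exp P (F s) (Y t) \<omega>"
    proof -
      interpret G: finite_measure_subalgebra P "F s" by unfold_locales (use Y st in \<open>auto simp: martingale_def\<close>)
      show ?thesis by (rule G.real_cond_exp_cong) (use eq Ym Zm st in auto)
    qed
    moreover have "AE \<omega> in P. Z s \<omega> = Y s \<omega>" using eq by (intro AE_I2) simp
    ultimately show ?thesis by eventually_elim simp
  qed
  ultimately show ?thesis using Y by (simp add: martingale_def)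
qed

section \<open>Transfer to the underlying probability space\<close>

locale reflected_process = prob_space P for P :: "'w measure" +
  fixes M :: "real \<Rightarrow> 'w \<Rightarrow> real"
  assumes process: "continuous_process P M" and M_0: "\<And>\<omega>. \<omega> \<in> space P \<Longrightarrow> M 0 \<omega> = 0"
    and law: "reflection_law (process_law P M)"
begin

sublocale L: reflection_law "process_law P M" by (rule law)

abbreviation "F \<equiv> natural_filtration P M"
abbreviation "X \<equiv> trajectory M"

lemma M_measurable: "0 \<le> t \<Longrightarrow> M t \<in> borel_measurable P"
  and M_cont: "\<omega> \<in> space P \<Longrightarrow> continuous_on {0..} (\<lambda>t. M t \<omega>)"
  using process by (auto simp: continuous_process_def)

lemma X_in_W: "\<omega> \<in> space P \<Longrightarrow> X \<omega> \<in> W"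
  using M_cont[of \<omega>] M_0[of \<omega>] continuous_on_eq[of "{0..}" "\<lambda>t. M t \<omega>" "X \<omega>"]
  by (simp add: mem_W trajectory_def)

lemma X_measurable: "X \<in> P \<rightarrow>\<^sub>M path_space"
  by (rule measurable_path_spaceI[OF X_in_W]) (simp_all add: trajectory_def M_measurable)

lemma X_apply: "0 \<le> t \<Longrightarrow> X \<omega> t = M t \<omega>"
  by (simp add: trajectory_def)

lemma integral_law:
  fixes f :: "_ \<Rightarrow> 'b::{banach, second_countable_topology}"
  shows "f \<in> borel_measurable path_space \<Longrightarrow> (\<integral>w. f w \<partial>process_law P M) = (\<integral>\<omega>. f (X \<omega>) \<partial>P)"
  unfolding process_law_def by (rule integral_distr[OF X_measurable])

lemma AE_law: "AE w in process_law P M. H w \<Longrightarrow> AE \<omega> in P. H (X \<omega>)"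
  unfolding process_law_def by (rule AE_distrD[OF X_measurable])

lemma F_subalgebra: "subalgebra P (F t)"
  by (rule natural_filtration_subalgebra[OF M_measurable])

lemma space_F: "space (F t) = space P"
  using F_subalgebra by (simp add: subalgebra_def)

text \<open>A function that looks at the path only up to \<open>s\<close> takes the same value on
  the path stopped at \<open>s\<close>, and the latter is measurable for the \<sigma>-algebra at
  \<open>s\<close>.\<close>

lemma past_measurable:
  assumes f: "f \<in> path_space \<rightarrow>\<^sub>M N" "nonant (\<lambda>_. ennreal s) f" and s: "0 \<le> s"
  shows "(\<lambda>\<omega>. f (X \<omega>)) \<in> F s \<rightarrow>\<^sub>M N"
proof -
  let ?S = "\<lambda>\<omega>. \<lambda>t\<in>{0..}. M (min t s) \<omega>"
  have S: "?S \<in> F s \<rightarrow>\<^sub>M path_space"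
    by (rule stopped_path_measurable) (use M_cont M_0 s in \<open>auto simp: space_F intro: natural_filtration_component\<close>)
  have "f (?S \<omega>) = f (X \<omega>)" if w: "\<omega> \<in> space P" for \<omega>
  proof (rule nonantD[OF f(2) X_in_W[OF w]])
    show "?S \<omega> \<in> W" using measurable_space[OF S] w by (simp add: space_F)
    show "agree (ennreal s) (X \<omega>) (?S \<omega>)" by (auto simp: agree_def trajectory_def ennreal_le_iff2 s)
  qed
  then show ?thesis
    using measurable_compose[OF S f(1)] by (subst measurable_cong[where g="\<lambda>\<omega>. f (?S \<omega>)"]) (auto simp: space_F)
qed

lemma past_sets:
  assumes A: "A \<in> sets (F s)"
  shows "\<exists>D. past s D \<and> A = {\<omega>\<in>space P. X \<omega> \<in> D}"
proof -
  obtain B where B: "B \<in> sets (Pi\<^sub>M {0..s} (\<lambda>_. borel))" "A = {\<omega>\<in>space P. (\<lambda>u\<in>{0..s}. M u \<omega>) \<in> B}"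
    using natural_filtration_sets[OF A] by blast
  let ?r = "\<lambda>w. \<lambda>u\<in>{0..s}. w u :: real"
  have "?r \<in> path_space \<rightarrow>\<^sub>M Pi\<^sub>M {0..s} (\<lambda>_. borel)" by (intro measurable_restrict eval_measurable)
  from measurable_sets[OF this B(1)] have "?r -` B \<inter> W \<in> sets path_space" .
  moreover have "nonant (\<lambda>_. ennreal s) (\<lambda>w. w \<in> ?r -` B \<inter> W)"
  proof (rule nonantI)
    fix w w' assume "w \<in> W" "w' \<in> W" "agree (ennreal s) w w'"
    moreover from this have "?r w' = ?r w" by (auto simp: agree_def restrict_def fun_eq_iff ennreal_leI)
    ultimately show "(w' \<in> ?r -` B \<inter> W) = (w \<in> ?r -` B \<inter> W)" by simp
  qed
  moreover have "?r (X \<omega>) = (\<lambda>u\<in>{0..s}. M u \<omega>)" for \<omega> by (auto simp: trajectory_def)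
  then have "A = {\<omega>\<in>space P. X \<omega> \<in> ?r -` B \<inter> W}" unfolding B(2) using X_in_W by auto
  ultimately show ?thesis unfolding past_def by blast
qed

text \<open>Localized by the exits from growing symmetric intervals, which make the stopped path
  bounded as \<open>optional_stopping\<close> requires.\<close>

theorem local_martingale_M: "local_martingale P F M"
  unfolding local_martingale_def
proof (intro conjI adapted_natural exI[of _ "\<lambda>n \<omega>. exit (real (Suc n)) (X \<omega>)"] allI)
  fix n
  let ?T = "exit (real (Suc n))"
  have adm: "adm ?T" by (rule adm_exit) simp
  have Tm: "?T \<in> borel_measurable path_space" using adm by (simp add: adm_def)
  show "extended_stopping_time F (\<lambda>\<omega>. ?T (X \<omega>))"
  proof (rule extended_stopping_timeI)
    fix r :: real assume r: "0 \<le> r"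
    have "nonant (\<lambda>_. ennreal r) (\<lambda>w. ?T w \<le> ennreal r)"
      by (rule nonant_mono[OF adm_min_nonant(1)[OF adm adm_const]]) simp
    then show "Measurable.pred (F r) (\<lambda>\<omega>. ?T (X \<omega>) \<le> ennreal r)"
      by (rule past_measurable[rotated]) (use r Tm in simp_all)
  qed
  let ?Y = "\<lambda>t w. w (cut t (?T w)) :: real"
  have Ym: "?Y t \<in> borel_measurable path_space" for t
    by (rule eval_self_measurable[OF cut_measurable[OF _ Tm]]) simp
  have eq: "stopped M (\<lambda>\<omega>. ?T (X \<omega>)) t \<omega> - M 0 \<omega> = ?Y t (X \<omega>)" if "\<omega> \<in> space P" for t \<omega>
    using that by (simp add: stopped_def M_0 cut_def X_apply)
  have bd: "\<bar>?Y t w\<bar> \<le> real (Suc n)" if "w \<in> W" "0 \<le> t" for t w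
    by (rule exit_bound[OF that(1)]) (auto simp: ennreal_cut that)
  have m: "martingale P F (\<lambda>t \<omega>. ?Y t (X \<omega>))"
  proof (rule martingaleI[OF prob_space_axioms filtration_natural F_subalgebra])
    show "adapted F (\<lambda>t \<omega>. ?Y t (X \<omega>))"
      unfolding adapted_def
    proof (intro allI impI)
      fix t :: real assume t: "0 \<le> t"
      have "nonant (\<lambda>_. ennreal t) (\<lambda>w. min (ennreal t) (?T w))"
        using adm_min[OF adm_const adm, of "ennreal t"] by (intro nonant_mono[OF adm_nonant]) auto
      then have "nonant (\<lambda>_. ennreal t) (?Y t)" unfolding cut_def by (rule nonant_eval) simp
      then show "(\<lambda>\<omega>. ?Y t (X \<omega>)) \<in> borel_measurable (F t)" by (rule past_measurable[OF Ym _ t])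
    qed
    show "integrable P (\<lambda>\<omega>. ?Y t (X \<omega>))" if "0 \<le> t" for t
      by (rule integrable_const_bound[where B="real (Suc n)"])
        (rule AE_I2, simp only: real_norm_def bd[OF X_in_W that], rule measurable_compose[OF X_measurable Ym])
    fix s t A assume st: "0 \<le> s" "s \<le> t" and "A \<in> sets (F s)"
    then obtain D where D: "past s D" "A = {\<omega>\<in>space P. X \<omega> \<in> D}" using past_sets by blast
    have "(\<integral>\<omega>. (?Y t (X \<omega>) - ?Y s (X \<omega>)) * indicator A \<omega> \<partial>P) = (\<integral>\<omega>. (?Y t (X \<omega>) - ?Y s (X \<omega>)) * indicator D (X \<omega>) \<partial>P)"
      by (rule Bochner_Integration.integral_cong) (auto simp: D(2) indicator_def)
    also have "\<dots> = (\<integral>w. (?Y t w - ?Y s w) * indicator D w \<partial>process_law P M)"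
      by (rule integral_law[symmetric]) (use D(1) in \<open>intro borel_measurable_times borel_measurable_diff Ym borel_measurable_indicator, simp add: past_def\<close>)
    also have "\<dots> = 0"
      by (rule L.optional_stopping[OF adm _ st D(1), of "real (Suc n)"]) (auto intro: exit_bound)
    finally show "(\<integral>\<omega>. (?Y t (X \<omega>) - ?Y s (X \<omega>)) * indicator A \<omega> \<partial>P) = 0" .
  qed
  show "martingale P F (\<lambda>t \<omega>. stopped M (\<lambda>\<omega>. ?T (X \<omega>)) t \<omega> - M 0 \<omega>)"
    by (rule martingale_cong[OF prob_space_axioms m eq])
next
  show "AE \<omega> in P. incseq (\<lambda>n. exit (real (Suc n)) (X \<omega>)) \<and> (\<lambda>n. exit (real (Suc n)) (X \<omega>)) \<longlonglongrightarrow> \<top>"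
  proof (rule AE_I2)
    fix \<omega> assume w: "\<omega> \<in> space P"
    have "incseq (\<lambda>n. exit (real (Suc n)) (X \<omega>))"
      by (rule incseq_SucI) (rule exit_mono[OF X_in_W[OF w]], simp_all)
    then show "incseq (\<lambda>n. exit (real (Suc n)) (X \<omega>)) \<and> (\<lambda>n. exit (real (Suc n)) (X \<omega>)) \<longlonglongrightarrow> \<top>"
      using incseq_tendsto_top exit_unbounded[OF X_in_W[OF w]] by blast
  qed
qed

definition A :: "real \<Rightarrow> 'w \<Rightarrow> real" where
  "A t \<omega> = qv t (X \<omega>)"

abbreviation "F' \<equiv> augmented P F"

lemma A_measurable: "A t \<in> borel_measurable P"
  unfolding A_def[abs_def] by (rule measurable_compose[OF X_measurable qv_measurable])

lemma A_cont: "\<omega> \<in> space P \<Longrightarrow> continuous_on {0..} (\<lambda>t. A t \<omega>)"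
  unfolding A_def by (rule qv_continuous[OF X_in_W])

lemma A_0: "\<omega> \<in> space P \<Longrightarrow> A 0 \<omega> = 0"
  unfolding A_def by (rule qv_0[OF X_in_W])

lemma trajectory_A: "trajectory A \<omega> = QV (X \<omega>)"
  by (simp add: trajectory_def QV_def A_def)

text \<open>Whether a path is tame depends on its whole future. Almost surely, however,
  \<open>A t\<close> is the limit of counts up to \<open>t\<close>, and the null sets in the
  filtration absorb the difference.\<close>

lemma A_adapted: "0 \<le> t \<Longrightarrow> A t \<in> borel_measurable (F' t)"
proof (rule augmented_measurable_AE[of P F, OF F_subalgebra A_measurable])
  assume t: "0 \<le> t"
  have "(\<lambda>\<omega>. Q n (ennreal t) (X \<omega>)) \<in> borel_measurable (F t)" for n
    using past_measurable[OF Q_measurable Q_nonant t] by simp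
  then have "(\<lambda>\<omega>. lim (\<lambda>n. Q n (ennreal t) (X \<omega>))) \<in> borel_measurable (F t)"
    by (rule borel_measurable_lim_metric)
  then show "(\<lambda>\<omega>. lim (\<lambda>n. Q n (ennreal t) (X \<omega>))) \<in> borel_measurable (F' t)"
    by (rule augmented_measurable[of P F, OF F_subalgebra])
  show "AE \<omega> in P. A t \<omega> = lim (\<lambda>n. Q n (ennreal t) (X \<omega>))"
    using AE_law[OF L.AE_tame] AE_space
  proof eventually_elim
    case (elim \<omega>)
    show ?case unfolding A_def using limI[OF Q_tendsto_qv[OF X_in_W[OF elim(2)] elim(1) t]] by simp
  qed
qed

lemma F'_filtration: "filtration (space P) F'"
  by (rule filtration_augmented[of P F, OF F_subalgebra filtration_natural])

lemma F'_mono: "s \<le> t \<Longrightarrow> sets (F' s) \<subseteq> sets (F' t)"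
  by (rule filtration.sets_F_mono[OF F'_filtration])

lemma tau_stopping: "0 < m \<Longrightarrow> 0 \<le> r \<Longrightarrow> {\<omega>\<in>space P. tau m (X \<omega>) \<le> ennreal r} \<in> sets (F' r)"
proof -
  assume m: "0 < m" and r: "0 \<le> r"
  have "{\<omega>\<in>space (F' r). m \<le> A r \<omega>} \<in> sets (F' r)"
    using A_adapted[OF r] by (rule borel_measurable_le[OF borel_measurable_const])
  also have "{\<omega>\<in>space (F' r). m \<le> A r \<omega>} = {\<omega>\<in>space P. tau m (X \<omega>) \<le> ennreal r}"
    using tau_le_iff[OF X_in_W m r] by (auto simp: A_def)
  finally show ?thesis .
qed

lemma cut_tau_measurable:
  assumes m: "0 < m" and r: "0 \<le> r"
  shows "(\<lambda>\<omega>. cut r (tau m (X \<omega>))) \<in> borel_measurable (F' r)"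
proof (rule borel_measurableI_le)
  fix y
  consider "y < 0" | "r \<le> y" | "0 \<le> y" "y < r" by linarith
  then show "{\<omega>\<in>space (F' r). cut r (tau m (X \<omega>)) \<le> y} \<in> sets (F' r)"
  proof cases
    case 1
    have "\<not> cut r T \<le> y" for T using cut_nonneg[of r T] 1 by linarith
    then show ?thesis by simp
  next
    case 2
    have "cut r T \<le> y" for T using cut_le[OF r, of T] 2 by linarith
    then show ?thesis using sets.top[of "F' r"] by simp
  next
    case 3
    have "cut r T \<le> y \<longleftrightarrow> T \<le> ennreal y" for T
    proof -
      have "cut r T \<le> y \<longleftrightarrow> ennreal (cut r T) \<le> ennreal y" using 3 by (simp add: ennreal_le_iff)
      also have "\<dots> \<longleftrightarrow> T \<le> ennreal y"
        unfolding ennreal_cut[OF r] using 3 by (auto simp: min_le_iff_disj ennreal_le_iff2)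
      finally show ?thesis .
    qed
    then show ?thesis using tau_stopping[OF m 3(1)] F'_mono[of y r] 3(2) by auto
  qed
qed

text \<open>The localizing times \<open>tau\<close> bound the quadratic variation and not the path;
  \<open>qv_martingale\<close> shows that this is enough for integrability of the stopped
  square.\<close>

theorem quadratic_variation_A: "quadratic_variation P M A"
  unfolding quadratic_variation_def
proof (intro conjI ballI)
  show "continuous_process P A" using A_measurable A_cont by (simp add: continuous_process_def)
  show "A 0 \<omega> = 0" if "\<omega> \<in> space P" for \<omega> using that by (rule A_0)
  show "mono_on {0..} (\<lambda>t. A t \<omega>)" if "\<omega> \<in> space P" for \<omega>
    unfolding A_def by (rule mono_onI) (auto intro: qv_mono[OF X_in_W[OF that]])
  show ad: "adapted F' A" using A_adapted by (simp add: adapted_def)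
  have adM: "M t \<in> borel_measurable (F' t)" if "0 \<le> t" for t
    by (rule augmented_measurable[of P F, OF F_subalgebra natural_filtration_component]) (use that in auto)
  show "local_martingale P F' (\<lambda>t \<omega>. (M t \<omega>)\<^sup>2 - A t \<omega>)"
    unfolding local_martingale_def
  proof (intro conjI exI[of _ "\<lambda>n \<omega>. tau (real (Suc n)) (X \<omega>)"] allI)
    show "adapted F' (\<lambda>t \<omega>. (M t \<omega>)\<^sup>2 - A t \<omega>)"
      using adM A_adapted by (auto simp: adapted_def intro!: borel_measurable_diff borel_measurable_power)
    fix n
    let ?m = "real (Suc n)"
    show "extended_stopping_time F' (\<lambda>\<omega>. tau ?m (X \<omega>))"
      by (rule extended_stopping_timeI) (use tau_stopping[of ?m] in \<open>simp add: pred_def\<close>)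
    let ?Y = "\<lambda>t w. (w (cut t (tau ?m w)))\<^sup>2 - qv (cut t (tau ?m w)) w"
    have tm: "tau ?m \<in> borel_measurable path_space" by (rule tau_measurable) simp
    have Ym: "?Y t \<in> borel_measurable path_space" for t
      by (intro borel_measurable_diff borel_measurable_power eval_self_measurable qv_random_measurable cut_measurable tm) auto
    have eq: "stopped (\<lambda>t \<omega>. (M t \<omega>)\<^sup>2 - A t \<omega>) (\<lambda>\<omega>. tau ?m (X \<omega>)) t \<omega> - ((M 0 \<omega>)\<^sup>2 - A 0 \<omega>) = ?Y t (X \<omega>)"
      if "\<omega> \<in> space P" for t \<omega>
      using that by (simp add: stopped_def M_0 A_0 cut_def X_apply) (simp add: A_def)
    have m: "martingale P F' (\<lambda>t \<omega>. ?Y t (X \<omega>))"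
    proof (rule martingaleI[OF prob_space_axioms F'_filtration augmented_subalgebra[of P F, OF F_subalgebra]])
      show "adapted F' (\<lambda>t \<omega>. ?Y t (X \<omega>))"
        unfolding adapted_def
      proof (intro allI impI borel_measurable_diff borel_measurable_power)
        fix t :: real assume t: "0 \<le> t"
        have cm: "(\<lambda>\<omega>. cut t (tau ?m (X \<omega>))) \<in> borel_measurable (F' t)" by (rule cut_tau_measurable[OF _ t]) simp
        have le: "f \<in> borel_measurable (F' t)" if "f \<in> borel_measurable (F' u)" "u \<le> t" for f :: "'w \<Rightarrow> real" and u
          using that(1) by (rule measurable_from_subalg[rotated]) (use F'_mono[OF that(2)] in \<open>auto simp: subalgebra_def\<close>)
        have "(\<lambda>\<omega>. M (cut t (tau ?m (X \<omega>))) \<omega>) \<in> borel_measurable (F' t)"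
          by (rule stopped_value_measurable[OF _ _ _ t cm]) (use M_cont M_0 le[OF adM] in auto)
        then show "(\<lambda>\<omega>. X \<omega> (cut t (tau ?m (X \<omega>)))) \<in> borel_measurable (F' t)" by (simp add: X_apply)
        have "(\<lambda>\<omega>. A (cut t (tau ?m (X \<omega>))) \<omega>) \<in> borel_measurable (F' t)"
          by (rule stopped_value_measurable[OF _ _ _ t cm]) (use A_cont A_0 le[OF A_adapted] in auto)
        then show "(\<lambda>\<omega>. qv (cut t (tau ?m (X \<omega>))) (X \<omega>)) \<in> borel_measurable (F' t)" by (simp add: A_def)
      qed
      show "integrable P (\<lambda>\<omega>. ?Y t (X \<omega>))" for t
        using L.qv_martingale(1)[of ?m t] unfolding process_law_def by (intro integrable_distr[OF X_measurable]) auto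
      fix s t C assume st: "0 \<le> s" "s \<le> t" and "C \<in> sets (F' s)"
      then obtain C' where C': "C' \<in> sets (F s)" "AE \<omega> in P. \<omega> \<in> C \<longleftrightarrow> \<omega> \<in> C'" using augmented_sets_AE[of P F, OF F_subalgebra] by blast
      obtain D where D: "past s D" "C' = {\<omega>\<in>space P. X \<omega> \<in> D}" using past_sets[OF C'(1)] by blast
      have CP: "C \<in> sets P" using \<open>C \<in> sets (F' s)\<close> augmented_subalgebra[of P F, OF F_subalgebra[of s]] by (auto simp: subalgebra_def)
      have Dm: "(\<lambda>w. (?Y t w - ?Y s w) * indicator D w) \<in> borel_measurable path_space"
        using D(1) by (intro borel_measurable_times borel_measurable_diff[OF Ym Ym] borel_measurable_indicator) (simp add: past_def)
      have "(\<integral>\<omega>. (?Y t (X \<omega>) - ?Y s (X \<omega>)) * indicator C \<omega> \<partial>P) = (\<integral>\<omega>. (?Y t (X \<omega>) - ?Y s (X \<omega>)) * indicator D (X \<omega>) \<partial>P)"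
      proof (rule Bochner_Integration.integral_cong_AE)
        have "(\<lambda>\<omega>. ?Y t (X \<omega>) - ?Y s (X \<omega>)) \<in> borel_measurable P"
          by (rule measurable_compose[OF X_measurable borel_measurable_diff[OF Ym Ym]])
        then show "(\<lambda>\<omega>. (?Y t (X \<omega>) - ?Y s (X \<omega>)) * indicator C \<omega>) \<in> borel_measurable P"
          by (rule borel_measurable_times[OF _ borel_measurable_indicator[OF CP]])
        show "(\<lambda>\<omega>. (?Y t (X \<omega>) - ?Y s (X \<omega>)) * indicator D (X \<omega>)) \<in> borel_measurable P"
          by (rule measurable_compose[OF X_measurable Dm])
        show "AE \<omega> in P. (?Y t (X \<omega>) - ?Y s (X \<omega>)) * indicator C \<omega> = (?Y t (X \<omega>) - ?Y s (X \<omega>)) * indicator D (X \<omega>)"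
          using C'(2) AE_space by eventually_elim (auto simp: D(2) indicator_def)
      qed
      also have "\<dots> = (\<integral>w. (?Y t w - ?Y s w) * indicator D w \<partial>process_law P M)"
        by (rule integral_law[symmetric, OF Dm])
      also have "\<dots> = 0" by (rule L.qv_martingale(2)[OF _ st D(1)]) simp
      finally show "(\<integral>\<omega>. (?Y t (X \<omega>) - ?Y s (X \<omega>)) * indicator C \<omega> \<partial>P) = 0" .
    qed
    show "martingale P F' (\<lambda>t \<omega>. stopped (\<lambda>t \<omega>. (M t \<omega>)\<^sup>2 - A t \<omega>) (\<lambda>\<omega>. tau ?m (X \<omega>)) t \<omega> - ((M 0 \<omega>)\<^sup>2 - A 0 \<omega>))"
      by (rule martingale_cong[OF prob_space_axioms m eq])
  next
    show "AE \<omega> in P. incseq (\<lambda>n. tau (real (Suc n)) (X \<omega>)) \<and> (\<lambda>n. tau (real (Suc n)) (X \<omega>)) \<longlonglongrightarrow> \<top>"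
    proof (rule AE_I2)
      fix \<omega> assume w: "\<omega> \<in> space P"
      have "incseq (\<lambda>n. tau (real (Suc n)) (X \<omega>))"
        by (rule incseq_SucI) (rule tau_mono[OF X_in_W[OF w]], simp_all)
      then show "incseq (\<lambda>n. tau (real (Suc n)) (X \<omega>)) \<and> (\<lambda>n. tau (real (Suc n)) (X \<omega>)) \<longlonglongrightarrow> \<top>"
        using incseq_tendsto_top tau_unbounded[OF X_in_W[OF w]] by blast
    qed
  qed
qed

end

section \<open>The conditional law given the quadratic variation\<close>

lemma covar_cong: "(\<And>t. t \<in> fst ` set L \<Longrightarrow> a t = b t) \<Longrightarrow> covar a L = covar b L"
  unfolding covar_def by (intro sum.cong refl arg_cong2[where f="(*)"]) (auto simp: min_def)

context reflected_process
begin

definition G :: "'w measure" where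
  "G = vimage_algebra (space P) (trajectory A) path_space"

lemma trajectory_A_in_W: "trajectory A \<in> space P \<rightarrow> W"
  by (simp add: trajectory_A QV_in_W X_in_W)

lemma trajectory_A_measurable: "trajectory A \<in> G \<rightarrow>\<^sub>M path_space"
  unfolding G_def by (rule measurable_vimage_algebra1[OF trajectory_A_in_W])

lemma G_sets: "C \<in> sets G \<Longrightarrow> \<exists>B\<in>sets path_space. C = {\<omega>\<in>space P. QV (X \<omega>) \<in> B}"
  unfolding G_def by (auto simp: sets_vimage_algebra2[OF trajectory_A_in_W] trajectory_A)

lemma G_subalgebra: "subalgebra P G"
proof -
  have "{\<omega>\<in>space P. QV (X \<omega>) \<in> B} \<in> sets P" if "B \<in> sets path_space" for B
    using measurable_sets[OF measurable_compose[OF X_measurable QV_measurable] that] by (simp add: vimage_def Int_def conj_commute)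
  then show ?thesis using G_sets by (auto simp: subalgebra_def G_def)
qed

lemma set_integral_law:
  fixes f :: "_ \<Rightarrow> real"
  assumes f: "f \<in> borel_measurable path_space" and B: "B \<in> sets path_space" "C = {\<omega>\<in>space P. QV (X \<omega>) \<in> B}"
  shows "(\<integral>\<omega>\<in>C. f (X \<omega>) \<partial>P) = (\<integral>w. f w * indicator B (QV w) \<partial>process_law P M)"
proof -
  have "(\<lambda>w. f w * indicator B (QV w)) \<in> borel_measurable path_space"
    by (rule borel_measurable_times[OF f measurable_compose[OF QV_measurable borel_measurable_indicator[OF B(1)]]])
  from integral_law[OF this]
  have "(\<integral>w. f w * indicator B (QV w) \<partial>process_law P M) = (\<integral>\<omega>. f (X \<omega>) * indicator B (QV (X \<omega>)) \<partial>P)" .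
  also have "\<dots> = (\<integral>\<omega>\<in>C. f (X \<omega>) \<partial>P)"
    unfolding set_lebesgue_integral_def
    by (intro Bochner_Integration.integral_cong) (auto simp: B(2) indicator_def)
  finally show ?thesis ..
qed

lemma lin_char:
  assumes L: "\<forall>p\<in>set L. 0 \<le> fst p" and B: "B \<in> sets path_space"
  shows "(\<integral>w. cos (lin L w) * indicator B (QV w) \<partial>process_law P M)
      = (\<integral>w. exp (- covar (\<lambda>t. qv t w) L / 2) * indicator B (QV w) \<partial>process_law P M)"
    and "(\<integral>w. sin (lin L w) * indicator B (QV w) \<partial>process_law P M) = 0"
proof -
  let ?\<mu> = "process_law P M"
  \<comment> \<open>Indices beyond the list receive the time \<open>0\<close>, because
    \<open>gaussian_char\<close> asks for nonnegative times at all indices.\<close>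
  let ?v = "\<lambda>i. if i < length L then fst (L ! i) else 0"
  let ?e = "\<lambda>w. exp (- covar (\<lambda>t. qv t w) L / 2) * indicator B (QV w)"
  let ?z = "\<lambda>w. cis (lin L w) * complex_of_real (indicator B (QV w))"
  have v: "0 \<le> ?v i" for i using L by auto
  have l: "(\<Sum>i<length L. snd (L ! i) * w (?v i)) = lin L w" for w :: "real \<Rightarrow> real"
    unfolding lin_def by (rule sum.cong) auto
  have c: "(\<Sum>i<length L. \<Sum>j<length L. snd (L ! i) * snd (L ! j) * qv (min (?v i) (?v j)) w) = covar (\<lambda>t. qv t w) L" for w
    unfolding covar_def by (intro sum.cong refl) auto
  have eq: "(\<integral>w. ?z w \<partial>?\<mu>) = complex_of_real (\<integral>w. ?e w \<partial>?\<mu>)"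
    using L.gaussian_char[of "{..<length L}" ?v B "\<lambda>i. snd (L ! i)", OF finite_lessThan v B]
    unfolding l c integral_complex_of_real .
  have zm: "?z \<in> borel_measurable path_space"
  proof (intro borel_measurable_times)
    have "continuous_on UNIV cis" by (simp add: cis_conv_exp continuous_intros)
    then show "(\<lambda>w. cis (lin L w)) \<in> borel_measurable path_space"
      by (rule measurable_compose[OF lin_measurable borel_measurable_continuous_onI])
    show "(\<lambda>w. complex_of_real (indicator B (QV w))) \<in> borel_measurable path_space"
      by (rule measurable_compose[OF measurable_compose[OF QV_measurable borel_measurable_indicator[OF B]] borel_measurable_of_real])
  qed
  have zi: "integrable ?\<mu> ?z"
  proof (rule L.integrable_const_bound[where B=1])
    show "AE w in ?\<mu>. norm (?z w) \<le> 1" by (intro AE_I2) (simp add: norm_mult indicator_def)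
    show "?z \<in> borel_measurable ?\<mu>" using zm measurable_cong_sets[OF L.sets_law refl] by blast
  qed
  have re: "cos (lin L w) * indicator B (QV w) = Re (?z w)" and im: "sin (lin L w) * indicator B (QV w) = Im (?z w)" for w
    by (simp_all add: indicator_def)
  show "(\<integral>w. cos (lin L w) * indicator B (QV w) \<partial>?\<mu>) = (\<integral>w. ?e w \<partial>?\<mu>)"
    and "(\<integral>w. sin (lin L w) * indicator B (QV w) \<partial>?\<mu>) = 0"
    unfolding re im integral_Re[OF zi] integral_Im[OF zi] eq by simp_all
qed

text \<open>Sets of \<open>G\<close> are events about the quadratic variation. Integrating over them
  identifies the conditional characteristic functions and sine increments, first for each rational
  datum almost surely and then for all of them together.\<close>

lemma conditional_gaussian:
  assumes K: "K \<in> G \<rightarrow>\<^sub>M prob_algebra path_space"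
    and Kl: "\<And>B C. B \<in> sets path_space \<Longrightarrow> C \<in> sets G \<Longrightarrow>
      emeasure P {\<omega>\<in>C. X \<omega> \<in> B} = (\<integral>\<^sup>+\<omega>\<in>C. emeasure (K \<omega>) B \<partial>P)"
  shows "AE \<omega> in P. gaussian_martingale (K \<omega>) (\<lambda>t w. w t)"
proof -
  note kernel = AE_kernel_eq[OF G_subalgebra X_measurable K Kl]
  have cos: "AE \<omega> in P. (\<integral>w. cos (lin (rat_pairs ps) w) \<partial>K \<omega>) = exp (- covar (\<lambda>t. A t \<omega>) (rat_pairs ps) / 2)"
    if "\<forall>p\<in>set ps. 0 \<le> fst p" for ps
  proof -
    let ?L = "rat_pairs ps"
    have L: "\<forall>p\<in>set ?L. 0 \<le> fst p" using that by (auto simp: rat_pairs_def)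
    let ?h = "\<lambda>\<omega>. exp (- covar (\<lambda>t. A t \<omega>) ?L / 2)"
    have hm: "?h \<in> borel_measurable G"
    proof -
      have "(\<lambda>w. exp (- covar w ?L / 2)) \<in> borel_measurable path_space"
        unfolding covar_def by (intro borel_measurable_divide borel_measurable_uminus
            borel_measurable_sum borel_measurable_times borel_measurable_const eval_measurable measurable_compose[OF _ borel_measurable_exp])
      from measurable_compose[OF trajectory_A_measurable this]
      have "(\<lambda>\<omega>. exp (- covar (trajectory A \<omega>) ?L / 2)) \<in> borel_measurable G" .
      \<comment> \<open>The trajectory and \<open>A\<close> differ only at negative times, which do
        not occur in the list.\<close>
      also have "(\<lambda>\<omega>. exp (- covar (trajectory A \<omega>) ?L / 2)) = ?h"
        using L by (intro ext) (auto simp: trajectory_def intro!: covar_cong)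
      finally show ?thesis .
    qed
    have hb: "\<bar>?h \<omega>\<bar> \<le> 1" if "\<omega> \<in> space P" for \<omega>
      using covar_qv_nonneg[OF X_in_W[OF that] L] by (simp add: A_def)
    have hi: "integrable P ?h"
      using hb measurable_from_subalg[OF G_subalgebra hm] by (intro integrable_const_bound[where B=1]) auto
    show ?thesis
    proof (rule kernel[where B=1, OF _ _ cos_lin_measurable _ hm hi])
      fix C assume "C \<in> sets G"
      then obtain B where B: "B \<in> sets path_space" "C = {\<omega>\<in>space P. QV (X \<omega>) \<in> B}" using G_sets by blast
      have em: "(\<lambda>w. exp (- covar (\<lambda>t. qv t w) ?L / 2)) \<in> borel_measurable path_space"
        unfolding covar_def by (intro measurable_compose[OF _ borel_measurable_exp] borel_measurable_divide borel_measurable_uminus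
            borel_measurable_sum borel_measurable_times borel_measurable_const qv_measurable)
      show "(\<integral>\<omega>\<in>C. cos (lin ?L (X \<omega>)) \<partial>P) = (\<integral>\<omega>\<in>C. ?h \<omega> \<partial>P)"
        unfolding A_def set_integral_law[OF cos_lin_measurable B] set_integral_law[OF em B] by (rule lin_char(1)[OF L B(1)])
    qed auto
  qed
  have sin: "AE \<omega> in P. (\<integral>w. sin (lin (rat_pairs ps) w) \<partial>K \<omega>) = 0"
    if "\<forall>p\<in>set ps. 0 \<le> fst p" for ps
  proof (rule kernel[where B=1, OF _ _ sin_lin_measurable])
    have L: "\<forall>p\<in>set (rat_pairs ps). 0 \<le> fst p" using that by (auto simp: rat_pairs_def)
    fix C assume "C \<in> sets G"
    then obtain B where B: "B \<in> sets path_space" "C = {\<omega>\<in>space P. QV (X \<omega>) \<in> B}" using G_sets by blast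
    show "(\<integral>\<omega>\<in>C. sin (lin (rat_pairs ps) (X \<omega>)) \<partial>P) = (\<integral>\<omega>\<in>C. 0 \<partial>P)"
      unfolding set_integral_law[OF sin_lin_measurable B] lin_char(2)[OF L B(1)] by simp
  qed auto
  let ?f = "\<lambda>r q m ps w. sin (1 / real (Suc m) * (w (real_of_rat q) - w (real_of_rat r))) * indicator (below ps) w"
  have inc: "AE \<omega> in P. (\<integral>w. ?f r q m ps w \<partial>K \<omega>) = 0"
    if r: "0 \<le> r" "r \<le> q" and ps: "\<forall>p\<in>set ps. 0 \<le> fst p \<and> fst p \<le> r" for r q m ps
  proof (rule kernel[where B=1])
    show fm: "?f r q m ps \<in> borel_measurable path_space"
      by (intro borel_measurable_times sin_inc_measurable borel_measurable_indicator below_sets)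
    show "\<bar>?f r q m ps w\<bar> \<le> 1" for w by (auto simp: abs_mult indicator_def)
    fix C assume "C \<in> sets G"
    then obtain B where B: "B \<in> sets path_space" "C = {\<omega>\<in>space P. QV (X \<omega>) \<in> B}" using G_sets by blast
    have "past (real_of_rat r) (below ps)"
      unfolding past_def
    proof (intro conjI below_sets nonantI)
      fix w w' assume w: "w \<in> W" "w' \<in> W" "agree (ennreal (real_of_rat r)) w w'"
      have "w' (real_of_rat (fst p)) = w (real_of_rat (fst p))" if "p \<in> set ps" for p
        using w(3) ps that by (auto simp: agree_def of_rat_less_eq intro!: ennreal_leI)
      then show "(w' \<in> below ps) = (w \<in> below ps)" using w by (simp add: below_def)
    qed
    then have "(\<integral>w. sin (1 / real (Suc m) * (w (real_of_rat q) - w (real_of_rat r))) * (indicator (below ps) w * indicator B (QV w)) \<partial>process_law P M) = 0"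
      using r by (intro L.sin_increment B) (auto simp: of_rat_less_eq)
    then show "(\<integral>\<omega>\<in>C. ?f r q m ps (X \<omega>) \<partial>P) = (\<integral>\<omega>\<in>C. 0 \<partial>P)"
      unfolding set_integral_law[OF fm B] mult.assoc by simp
  qed auto
  have char: "AE \<omega> in P. \<forall>ps. (\<forall>p\<in>set ps. 0 \<le> fst p) \<longrightarrow> (\<integral>w. cos (lin (rat_pairs ps) w) \<partial>K \<omega>) = exp (- covar (\<lambda>t. A t \<omega>) (rat_pairs ps) / 2)
      \<and> (\<integral>w. sin (lin (rat_pairs ps) w) \<partial>K \<omega>) = 0"
    unfolding AE_all_countable
  proof
    fix ps
    show "AE \<omega> in P. (\<forall>p\<in>set ps. 0 \<le> fst p) \<longrightarrow> (\<integral>w. cos (lin (rat_pairs ps) w) \<partial>K \<omega>) = exp (- covar (\<lambda>t. A t \<omega>) (rat_pairs ps) / 2)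
      \<and> (\<integral>w. sin (lin (rat_pairs ps) w) \<partial>K \<omega>) = 0"
    proof (cases "\<forall>p\<in>set ps. 0 \<le> fst p")
      case True
      from cos[OF this] sin[OF this] show ?thesis by eventually_elim blast
    next
      case False
      then show ?thesis by (intro AE_I2) blast
    qed
  qed
  have incs: "AE \<omega> in P. \<forall>r q m ps. 0 \<le> r \<longrightarrow> r \<le> q \<longrightarrow> (\<forall>p\<in>set ps. 0 \<le> fst p \<and> fst p \<le> r) \<longrightarrow> (\<integral>w. ?f r q m ps w \<partial>K \<omega>) = 0"
    unfolding AE_all_countable
  proof (intro allI)
    fix r q m ps
    show "AE \<omega> in P. 0 \<le> r \<longrightarrow> r \<le> q \<longrightarrow> (\<forall>p\<in>set ps. 0 \<le> fst p \<and> fst p \<le> r) \<longrightarrow> (\<integral>w. ?f r q m ps w \<partial>K \<omega>) = 0"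
    proof (cases "0 \<le> r \<and> r \<le> q \<and> (\<forall>p\<in>set ps. 0 \<le> fst p \<and> fst p \<le> r)")
      case True
      with inc[of r q ps m] show ?thesis by (auto elim: eventually_mono)
    next
      case False
      then show ?thesis by (intro AE_I2) blast
    qed
  qed
  show ?thesis
    using char incs AE_space[of P]
  proof eventually_elim
    case (elim \<omega>)
    have k: "prob_space (K \<omega>)" "sets (K \<omega>) = sets path_space"
      by (rule kernel_space[where f="\<lambda>_. 0" and B=0, OF G_subalgebra X_measurable K Kl _ _ elim(3)]; simp)+
    interpret K: gaussian_path_law "K \<omega>" "\<lambda>t. A t \<omega>"
    proof (intro gaussian_path_law.intro gaussian_path_law_axioms.intro)
      show "prob_space (K \<omega>)" "sets (K \<omega>) = sets path_space" by (rule k)+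
      show "continuous_on {0..} (\<lambda>t. A t \<omega>)" by (rule A_cont[OF elim(3)])
    next
      fix ps :: "(rat \<times> rat) list" assume ps: "\<forall>p\<in>set ps. 0 \<le> fst p"
      show "(\<integral>w. cos (lin (rat_pairs ps) w) \<partial>K \<omega>) = exp (- covar (\<lambda>t. A t \<omega>) (rat_pairs ps) / 2) \<and> (\<integral>w. sin (lin (rat_pairs ps) w) \<partial>K \<omega>) = 0"
        by (rule elim(1)[THEN spec, THEN mp, OF ps])
    next
      fix r q :: rat and m and ps :: "(rat \<times> rat) list"
      assume r: "0 \<le> r" "r \<le> q" and ps: "\<forall>p\<in>set ps. 0 \<le> fst p \<and> fst p \<le> r"
      show "(\<integral>w. ?f r q m ps w \<partial>K \<omega>) = 0"
        by (rule elim(2)[THEN spec, THEN spec, THEN spec, THEN spec, THEN mp, THEN mp, THEN mp, OF r ps])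
    qed
    show ?case by (rule K.gaussian_martingale_N)
  qed
qed

theorem ocone: "ocone_local_martingale P M"
proof -
  obtain K where K: "K \<in> G \<rightarrow>\<^sub>M prob_algebra path_space"
    "\<And>B C. B \<in> sets path_space \<Longrightarrow> C \<in> sets G \<Longrightarrow>
      emeasure P {\<omega>\<in>C. X \<omega> \<in> B} = (\<integral>\<^sup>+\<omega>\<in>C. emeasure (K \<omega>) B \<partial>P)"
    using exists_regular_conditional_distribution[OF G_subalgebra X_measurable] by blast
  have "regular_conditional_law P M A K"
    using K unfolding regular_conditional_law_def G_def by (simp add: Let_def)
  then show ?thesis
    unfolding ocone_local_martingale_def
    using process M_0 local_martingale_M quadratic_variation_A conditional_gaussian[OF K] by blast
qed

lemma first_passage_eq: "w \<in> W \<Longrightarrow> first_passage c w = hit (\<lambda>_. 0) c w"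
  unfolding first_passage_def hit_def by (simp add: W_zero)

theorem AE_divergent_M:
  assumes c: "0 < c" and fin: "AE \<omega> in P. first_passage c (X \<omega>) < \<top>"
  shows "AE \<omega> in P. \<not> (\<exists>l. ((\<lambda>t. M t \<omega>) \<longlongrightarrow> l) at_top)"
proof -
  have hm: "hit (\<lambda>_. 0) c \<in> borel_measurable path_space" using adm_hit[OF adm_const, of c 0] c by (simp add: adm_def)
  have "AE \<omega> in P. hit (\<lambda>_. 0) c (X \<omega>) < \<top>"
    using fin AE_space by eventually_elim (simp add: first_passage_eq X_in_W)
  then have "AE w in process_law P M. hit (\<lambda>_. 0) c w < \<top>"
    unfolding process_law_def using borel_measurable_less[OF hm borel_measurable_const[of \<top>]]
    by (subst AE_distr_iff[OF X_measurable]) auto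
  from AE_law[OF L.AE_divergent[OF c this]] show ?thesis
  proof eventually_elim
    case (elim \<omega>)
    have "((\<lambda>t. M t \<omega>) \<longlongrightarrow> l) at_top \<longleftrightarrow> (X \<omega> \<longlongrightarrow> l) at_top" for l
      by (rule tendsto_cong[OF eventually_mono[OF eventually_ge_at_top[of 0]]]) (simp add: X_apply)
    then show ?case using elim by simp
  qed
qed

end

text \<open>Invariance under the reflections of the theorem says that the time \<open>0\<close> and
  the first passages at the \<open>a n\<close> are good for the law on path space;
  \<open>all_adm_good\<close> spreads this to every nonanticipating time.\<close>

lemma reflected_process_of_invariance:
  fixes P :: "'w measure" and M :: "real \<Rightarrow> 'w \<Rightarrow> real" and a :: "nat \<Rightarrow> real"
  assumes P: "prob_space P" and M: "continuous_process P M" "\<And>\<omega>. \<omega> \<in> space P \<Longrightarrow> M 0 \<omega> = 0"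
    and a: "\<And>n. n \<ge> 1 \<Longrightarrow> a n > 0" "a \<longlonglongrightarrow> 0"
    and inv: "\<And>n. n \<ge> 1 \<Longrightarrow> law_invariant P M (reflection 0) \<and> law_invariant P M (reflection (a n))"
  shows "reflected_process P M"
proof -
  interpret prob_space P by (rule P)
  have XW: "trajectory M \<omega> \<in> W" if "\<omega> \<in> space P" for \<omega>
  proof -
    have "continuous_on {0..} (\<lambda>t. M t \<omega>)" using M(1) that by (simp add: continuous_process_def)
    then have "continuous_on {0..} (trajectory M \<omega>)" by (rule continuous_on_eq) (simp add: trajectory_def)
    then show ?thesis using M(2)[OF that] by (simp add: mem_W trajectory_def)
  qed
  have X: "trajectory M \<in> P \<rightarrow>\<^sub>M path_space"
    by (rule measurable_path_spaceI[OF XW]) (use M(1) in \<open>simp_all add: trajectory_def continuous_process_def\<close>)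
  interpret L: path_law "process_law P M"
    unfolding process_law_def by (intro path_law.intro path_law_axioms.intro prob_space_distr X) simp
  have good: "L.good T" if T: "adm T" and inv: "law_invariant P M \<rho>" and eq: "\<And>w. w \<in> W \<Longrightarrow> \<rho> w = reflect T w" for T \<rho>
  proof -
    have Rm: "reflect T \<in> path_space \<rightarrow>\<^sub>M path_space" by (rule reflect_measurable) (use T in \<open>simp add: adm_def\<close>)
    have "distr (process_law P M) path_space (reflect T) = distr P path_space (\<lambda>\<omega>. reflect T (trajectory M \<omega>))"
      unfolding process_law_def by (subst distr_distr[OF Rm X]) (simp add: comp_def)
    also have "\<dots> = distr P path_space (\<lambda>\<omega>. \<rho> (trajectory M \<omega>))"
      by (rule distr_cong) (simp_all add: eq XW)
    also have "\<dots> = process_law P M" using inv by (simp add: law_invariant_def)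
    finally show ?thesis using T Rm by (simp add: L.good_def L.preserving_def)
  qed
  have "L.good (\<lambda>_. 0)"
    by (rule good[OF adm_const, of "reflection 0"])
      (use inv[of 1] in \<open>auto simp: reflection_eq_reflect reflect_def hit_0_0\<close>)
  moreover have "L.good (hit (\<lambda>_. 0) (a n))" if "n \<ge> 1" for n
    by (rule good[OF adm_hit[OF adm_const], of _ "reflection (a n)"])
      (use inv[OF that] a(1)[OF that] in \<open>auto simp: reflection_eq_reflect\<close>)
  ultimately have "L.good T" if "adm T" for T
    using L.all_adm_good[OF a, of T] that by blast
  then have "reflection_law (process_law P M)"
    by unfold_locales (simp add: L.good_def)
  then show ?thesis
    by (intro reflected_process.intro reflected_process_axioms.intro P M)
qed

theorem theorem2:
  fixes P :: "'w measure" and M :: "real \<Rightarrow> 'w \<Rightarrow> real" and a :: "nat \<Rightarrow> real"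
  assumes "prob_space P"
    and "continuous_process P M"
    and "\<And>\<omega>. \<omega> \<in> space P \<Longrightarrow> M 0 \<omega> = 0"
    and "\<And>n. n \<ge> 1 \<Longrightarrow> a n > 0"
    and "a \<longlonglongrightarrow> 0"
    and "\<And>n. n \<ge> 1 \<Longrightarrow>
           law_invariant P M (reflection 0) \<and> law_invariant P M (reflection (a n))"
  shows "ocone_local_martingale P M \<and>
         ((AE \<omega> in P. first_passage (a 1) (trajectory M \<omega>) < \<top>) \<longrightarrow>
          (AE \<omega> in P. \<not> (\<exists>l. ((\<lambda>t. M t \<omega>) \<longlongrightarrow> l) at_top)))"
proof -
  interpret reflected_process P M
    by (rule reflected_process_of_invariance) (use assms in auto)
  show ?thesis
    using ocone AE_divergent_M[OF assms(4)[of 1]] by simp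
qed

end
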